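(* Let $d\ge1$ and $1<p<\infty$. Let $\mathsf{L}^{\Delta}_{t,p,d}$, $\mathsf{L}^{\Delta}_{c,p,d}$ be the best constants in $$\big(\mathsf{L}^{\Delta}_{t,p,d}\big)^{-1}\|f\|_{p}\le \|S^\Delta(f)\|_{p}\le \mathsf{L}^{\Delta}_{c,p,d}\|f\|_{p},\quad f\in L_p(\mathbb{R}^d),$$ and let $\mathsf{L}^{\widetilde\Delta}_{t,p,d}$, $\mathsf{L}^{\widetilde\Delta}_{c,p,d}$ be the best constants in $$\big(\mathsf{L}^{\widetilde\Delta}_{t,p,d}\big)^{-1}\|f\|_{p}\le \|S^{\widetilde\Delta}(f)\|_{p}\le \mathsf{L}^{\widetilde\Delta}_{c,p,d}\|f\|_{p},\quad f\in L_p(\mathbb{T}^d).$$ Then $$\mathsf{L}^{\Delta}_{c,p,d}=\mathsf{L}^{\widetilde\Delta}_{c,p,d}\quad\text{and}\quad \mathsf{L}^{\Delta}_{t,p,d}=\mathsf{L}^{\widetilde\Delta}_{t,p,d}.$$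
   Context: Partition $\mathbb{R}\setminus\{0\}$ into the intervals $[2^{k-1},2^k)$ and $(-2^k,-2^{k-1}]$, $k\in\mathbb{Z}$; $\Delta$ is the family of all $d$-fold products of these intervals (a partition of $\mathbb{R}^d$ up to a null set). For $R\in\Delta$, $S_R$ is the partial sum operator $\widehat{S_R(f)}=\mathbf{1}_R\widehat f$, and $S^\Delta(f)=\big(\sum_{R\in\Delta}|S_R(f)|^2\big)^{1/2}$ for $f\in L_p(\mathbb{R}^d)$. Periodic case: $\mathbb{T}^d$ is the $d$-torus with normalized Haar measure. $\widetilde\Delta$ is the corresponding dyadic partition of $\mathbb{Z}^d$: it consists of all $d$-fold products of the sets $\{0\}$, $[2^{k-1},2^k)\cap\mathbb{Z}$ and $(-2^k,-2^{k-1}]\cap\mathbb{Z}$, $k\ge1$. For $R\in\widetilde\Delta$, $\widehat{S_R(f)}=\mathbf{1}_R\widehat f$ (Fourier coefficients on $\mathbb{Z}^d$), and $S^{\widetilde\Delta}(f)=\big(\sum_{R\in\widetilde\Delta}|S_R(f)|^2\big)^{1/2}$ for $f\in L_p(\mathbb{T}^d)$. Best constants means the smallest constants for which the inequalities hold for all $f$ in the indicated space. *)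

theory Defs
  imports "HOL-Analysis.Analysis"
begin

section \<open>\<open>L\<^sub>p\<close> norms and best constants\<close>

definition epowr :: "ennreal \<Rightarrow> real \<Rightarrow> ennreal" (infixr \<open>epowr\<close> 80) where
  "x epowr a = (if x = top then top else ennreal (enn2real x powr a))"
  \<comment> \<open>only used for exponents \<open>a > 0\<close>\<close>

text \<open>
  Norms take values in \<open>[0, \<infinity>]\<close>, and are defined for \<open>[0, \<infinity>]\<close>-valued functions, so that no
  finiteness of a square function is presupposed.
\<close>

definition Lp_enorm :: "real \<Rightarrow> 'a measure \<Rightarrow> ('a \<Rightarrow> ennreal) \<Rightarrow> ennreal" where
  "Lp_enorm p M h = (\<integral>\<^sup>+x. h x epowr p \<partial>M) epowr (1 / p)"

definition Lp_norm :: "real \<Rightarrow> 'a measure \<Rightarrow> ('a \<Rightarrow> complex) \<Rightarrow> ennreal" where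
  "Lp_norm p M f = Lp_enorm p M (\<lambda>x. ennreal (norm (f x)))"

definition Lp_space :: "real \<Rightarrow> 'a measure \<Rightarrow> ('a \<Rightarrow> complex) set" where
  "Lp_space p M = {f \<in> borel_measurable M. Lp_norm p M f < top}"

definition square_function ::
    "'b set \<Rightarrow> ('b \<Rightarrow> ('a \<Rightarrow> complex) \<Rightarrow> 'a \<Rightarrow> complex) \<Rightarrow> ('a \<Rightarrow> complex) \<Rightarrow> 'a \<Rightarrow> ennreal" where
  "square_function D S f x = (\<Sum>\<^sub>\<infinity>R\<in>D. ennreal ((norm (S R f x))\<^sup>2)) epowr (1 / 2)"

text \<open>
  The sets of admissible constants below are closed, so these infima are their least elements;
  \<open>\<infinity>\<close> is always admissible, with \<open>inverse \<infinity> = 0\<close> and \<open>\<infinity> * 0 = 0\<close>.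
\<close>

definition best_upper_const ::
    "real \<Rightarrow> 'a measure \<Rightarrow> (('a \<Rightarrow> complex) \<Rightarrow> 'a \<Rightarrow> ennreal) \<Rightarrow> ennreal" where
  "best_upper_const p M Q =
     Inf {C. \<forall>f\<in>Lp_space p M. Lp_enorm p M (Q f) \<le> C * Lp_norm p M f}"

definition best_lower_const ::
    "real \<Rightarrow> 'a measure \<Rightarrow> (('a \<Rightarrow> complex) \<Rightarrow> 'a \<Rightarrow> ennreal) \<Rightarrow> ennreal" where
  "best_lower_const p M Q =
     Inf {C. \<forall>f\<in>Lp_space p M. inverse C * Lp_norm p M f \<le> Lp_enorm p M (Q f)}"


section \<open>Partial sums and the square function on Euclidean space\<close>

definition fourier :: "(real ^ 'n \<Rightarrow> complex) \<Rightarrow> real ^ 'n \<Rightarrow> complex" where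
  "fourier f \<xi> = (\<integral>x. f x * cis (- 2 * pi * (\<xi> \<bullet> x)) \<partial>lborel)"

primrec iterated_deriv ::
    "'a::real_normed_vector list \<Rightarrow> ('a \<Rightarrow> complex) \<Rightarrow> 'a \<Rightarrow> complex" where
  "iterated_deriv [] f = f"
| "iterated_deriv (v # vs) f = (\<lambda>x. frechet_derivative (iterated_deriv vs f) (at x) v)"

definition schwartz :: "('a::euclidean_space \<Rightarrow> complex) \<Rightarrow> bool" where
  "schwartz \<psi> \<longleftrightarrow> (\<forall>vs. set vs \<subseteq> Basis \<longrightarrow>
     iterated_deriv vs \<psi> differentiable_on UNIV \<and>
     (\<forall>m. bounded (range (\<lambda>x. norm x ^ m *\<^sub>R iterated_deriv vs \<psi> x))))"

text \<open>
  For \<open>f\<close> in \<open>L\<^sub>p\<close> the transform of \<open>f\<close> is in general only a tempered distribution. The following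
  says \<open>\<F> g = 1\<^sub>R \<F> f\<close> in that sense:
  \<open>\<langle>\<F> g, \<psi>\<rangle> = \<langle>g, \<F> \<psi>\<rangle>\<close> and \<open>\<langle>1\<^sub>R \<F> f, \<psi>\<rangle> = \<langle>\<F> f, 1\<^sub>R \<psi>\<rangle> = \<langle>f, \<F> (1\<^sub>R \<psi>)\<rangle>\<close>
  for all Schwartz functions \<open>\<psi>\<close>. If \<open>R\<close> is a bounded box, \<open>\<F> (1\<^sub>R \<psi>)\<close> lies in \<open>L\<^sub>q\<close> for all
  \<open>1 < q\<close>, so the last pairing converges for every \<open>f\<close> in \<open>L\<^sub>p\<close> with \<open>1 < p < \<infinity>\<close>.
\<close>

definition fourier_restriction ::
    "(real ^ 'n) set \<Rightarrow> (real ^ 'n \<Rightarrow> complex) \<Rightarrow> (real ^ 'n \<Rightarrow> complex) \<Rightarrow> bool" where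
  "fourier_restriction R f g \<longleftrightarrow> g \<in> borel_measurable lborel \<and>
     (\<forall>\<psi>. schwartz \<psi> \<longrightarrow>
        integrable lborel (\<lambda>x. g x * fourier \<psi> x) \<and>
        (\<integral>x. g x * fourier \<psi> x \<partial>lborel) =
        (\<integral>x. f x * fourier (\<lambda>\<xi>. indicator R \<xi> * \<psi> \<xi>) x \<partial>lborel))"

text \<open>
  For \<open>f\<close> in \<open>L\<^sub>p\<close>, \<open>1 < p < \<infinity>\<close>, and a bounded box \<open>R\<close>, such a \<open>g\<close> exists (the convolution of
  \<open>f\<close> with the inverse transform of \<open>1\<^sub>R\<close>), is unique up to null sets, and is the value at \<open>f\<close> of
  the continuous extension to \<open>L\<^sub>p\<close> of the multiplier operator with symbol \<open>1\<^sub>R\<close>.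
  The choice only picks a representative.
\<close>

definition partial_sum :: "(real ^ 'n) set \<Rightarrow> (real ^ 'n \<Rightarrow> complex) \<Rightarrow> real ^ 'n \<Rightarrow> complex" where
  "partial_sum R f = (SOME g. fourier_restriction R f g)"

definition dyadic_intervals :: "real set set" where
  "dyadic_intervals =
     (\<Union>k::int. {{2 powi (k - 1)..<2 powi k}, {- (2 powi k)<..- (2 powi (k - 1))}})"

definition dyadic_boxes :: "(real ^ 'n) set set" where
  "dyadic_boxes = {{x. \<forall>i. x $ i \<in> I i} | I. \<forall>i. I i \<in> dyadic_intervals}"

definition LP_upper_Rd :: "'n::finite itself \<Rightarrow> real \<Rightarrow> ennreal" where
  "LP_upper_Rd (_ :: 'n itself) p =
     best_upper_const p (lborel :: (real ^ 'n) measure) (square_function dyadic_boxes partial_sum)"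

definition LP_lower_Rd :: "'n::finite itself \<Rightarrow> real \<Rightarrow> ennreal" where
  "LP_lower_Rd (_ :: 'n itself) p =
     best_lower_const p (lborel :: (real ^ 'n) measure) (square_function dyadic_boxes partial_sum)"


section \<open>Partial sums and the square function on the torus\<close>

text \<open>The torus is modelled as the unit cube \<open>[0, 1)\<^sup>d\<close> with Lebesgue measure.\<close>

definition torus :: "(real ^ 'n) measure" where
  "torus = restrict_space lborel {x. \<forall>i. 0 \<le> x $ i \<and> x $ i < 1}"

definition character :: "int ^ 'n \<Rightarrow> real ^ 'n \<Rightarrow> complex" where
  "character k x = cis (2 * pi * (\<Sum>i\<in>UNIV. of_int (k $ i) * x $ i))"

definition fourier_coeff :: "(real ^ 'n \<Rightarrow> complex) \<Rightarrow> int ^ 'n \<Rightarrow> complex" where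
  "fourier_coeff f k = (\<integral>x. f x * cnj (character k x) \<partial>torus)"

text \<open>
  The blocks are finite, so the function with Fourier coefficients \<open>1\<^sub>R\<close> times those of \<open>f\<close> is a
  trigonometric polynomial.
\<close>

definition torus_partial_sum ::
    "(int ^ 'n) set \<Rightarrow> (real ^ 'n \<Rightarrow> complex) \<Rightarrow> real ^ 'n \<Rightarrow> complex" where
  "torus_partial_sum R f x = (\<Sum>k\<in>R. fourier_coeff f k * character k x)"

definition int_dyadic_intervals :: "int set set" where
  "int_dyadic_intervals =
     insert {0} (\<Union>k\<in>{1::nat..}. {{2 ^ (k - 1)..<2 ^ k}, {- (2 ^ k)<..- (2 ^ (k - 1))}})"

definition int_dyadic_boxes :: "(int ^ 'n) set set" where
  "int_dyadic_boxes = {{x. \<forall>i. x $ i \<in> I i} | I. \<forall>i. I i \<in> int_dyadic_intervals}"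

definition LP_upper_torus :: "'n::finite itself \<Rightarrow> real \<Rightarrow> ennreal" where
  "LP_upper_torus (_ :: 'n itself) p =
     best_upper_const p (torus :: (real ^ 'n) measure)
       (square_function int_dyadic_boxes torus_partial_sum)"

definition LP_lower_torus :: "'n::finite itself \<Rightarrow> real \<Rightarrow> ennreal" where
  "LP_lower_torus (_ :: 'n itself) p =
     best_lower_const p (torus :: (real ^ 'n) measure)
       (square_function int_dyadic_boxes torus_partial_sum)"

end

theory Submission
  imports Defs "HOL-Probability.Probability" "HOL-Real_Asymp.Real_Asymp"
begin

text \<open>
  A trigonometric polynomial times a modulated window \<open>\<prod> fej (\<delta> x\<^sub>i)\<close>, whose spectrum is
  concentrated near the frequencies of the polynomial, is a function on Euclidean space whose dyadic
  pieces are those of the polynomial; averaging over translates makes this transfer of both sides of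
  the inequality exact, and Fejer means reduce the torus to trigonometric polynomials. Conversely, a
  function on Euclidean space is first convolved with a kernel whose spectrum avoids neighbourhoods of
  the hyperplanes \<open>\<xi>\<^sub>i = 0\<close> and \<open>\<xi>\<^sub>i = \<plusminus>2\<^sup>j\<close> (because \<open>p > 1\<close>, this costs
  little for a fixed function), and then multiplied by a window. The result decays fast and so do its
  dyadic pieces, so it can be periodized with period \<open>2\<^sup>m\<close>, and both sides converge as \<open>m\<close>
  grows. No boundedness of the square function is used.
\<close>

text \<open>The obstacle is that the symbols are discontinuous at the frequencies that matter:
  integers that are powers of 2 are end points of blocks, and the dyadic boxes accumulate where a
  coordinate vanishes. Since no constant may be lost, boundaries are avoided rather than smoothed.
  In one direction the frequencies of the polynomial are dilated by a factor slightly above 1 and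
  shifted slightly, and the torus block \<open>{0}\<close>, which has no counterpart on the line, is
  carried by a dyadic interval close to 0. In the other direction only finitely many boundary points
  remain once the spectrum is bounded and kept away from 0. The period is a power of 2 because
  dyadic intervals are invariant under dilation by powers of 2, so that \<open>k / 2 ^ m\<close> and
  \<open>l / 2 ^ m\<close> share a box exactly when \<open>k\<close> and \<open>l\<close> share a
  block. As square functions may be infinite, limits are taken only where Fatou's lemma, averaging,
  or a perturbation with vanishing \<open>p\<close>-th power integral gives the inequality; in the
  lower estimate the kernel is chosen for the function and its square function at once.\<close>

abbreviation nn_lborel :: "('a::euclidean_space => ennreal) => ennreal" (binder "NI " 10) where "nn_lborel f == nn_integral lborel f"
abbreviation bi_lborel :: "('a::euclidean_space => 'b::{banach, second_countable_topology}) => 'b" (binder "BI " 10) where "bi_lborel f == lebesgue_integral lborel f"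
abbreviation enorm :: "'a::real_normed_vector => ennreal" where "enorm x == ennreal (norm x)"
abbreviation cof :: "real => complex" where "cof == complex_of_real"
abbreviation bm :: "('a::topological_space => 'b::topological_space) set" where "bm == borel_measurable borel"

section \<open>Powers and integrals of extended nonnegative functions\<close>

lemma epowr_ennreal [simp]: "0 <= r ==> ennreal r epowr a = ennreal (r powr a)"
 by (simp add: epowr_def)

lemma epowr_top [simp]: "top epowr a = top"
 by (simp add: epowr_def)

lemma epowr_zero [simp]: "0 epowr a = 0"
 by (simp add: epowr_def)

lemma epowr_one_left [simp]: "1 epowr a = 1"
 by (simp add: epowr_def)

lemma epowr_one [simp]: "x epowr 1 = x"
 by (cases x) auto

lemma epowr_mono:
 assumes "x <= y" "0 <= a" shows "x epowr a <= y epowr a"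
 using assms by (cases x; cases y) (auto intro!: ennreal_leI powr_mono2 simp: top_unique)

lemma epowr_epowr: "(x epowr a) epowr b = x epowr (a * b)"
 by (cases x) (auto simp: powr_powr)

lemma epowr_inverse_cancel [simp]:
 assumes "a ~= 0" shows "(x epowr a) epowr (1 / a) = x" "(x epowr (1 / a)) epowr a = x"
 using assms by (simp_all add: epowr_epowr)

lemma epowr_mult:
 assumes "0 < a" shows "(x * y) epowr a = x epowr a * y epowr a"
proof (cases x; cases y)
 fix r s assume "x = ennreal r" "0 <= r" "y = ennreal s" "0 <= s"
 then show ?thesis by (simp add: ennreal_mult'[symmetric] powr_mult)
qed (auto simp: ennreal_top_mult ennreal_mult_top)

lemma epowr_add:
 assumes "0 < a" "0 < b" shows "x epowr (a + b) = x epowr a * x epowr b"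
 using assms by (cases x) (auto simp: powr_add ennreal_mult' ennreal_top_mult)

lemma epowr_two: "x epowr 2 = x * x"
 using epowr_add[of 1 1 x] by simp

lemma epowr_le_iff:
 assumes "0 < a" shows "x epowr a <= y epowr a \<longleftrightarrow> x <= y"
 using epowr_mono[of x y a] epowr_mono[of "x epowr a" "y epowr a" "1/a"] assms by auto

lemma epowr_eq_0_iff [simp]: "x epowr a = 0 \<longleftrightarrow> x = 0"
 by (cases x) auto

lemma epowr_eq_top_iff [simp]: "x epowr a = top \<longleftrightarrow> x = top"
 by (cases x) auto

lemma epowr_less_top_iff [simp]: "x epowr a < top \<longleftrightarrow> x < top"
 by (cases x) (auto simp: top.not_eq_extremum)

lemma measurable_epowr [measurable (raw)]:
 assumes [measurable]: "f \<in> borel_measurable M"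
 shows "(%x. f x epowr a) \<in> borel_measurable M"
 unfolding epowr_def by measurable

text \<open>The tangent line of the convex function \<open>v epowr p\<close> at \<open>m\<close>,
  with the negative term moved to the right because extended values do not subtract. It is Young's
  inequality for \<open>v\<close> and \<open>m epowr (p - 1)\<close>; Jensen's inequality and
  \<open>epowr_add_le\<close> both come from it.\<close>

lemma epowr_tangent:
 assumes "1 <= p" "m ~= top"
 shows "ennreal p * m epowr (p - 1) * v <= v epowr p + ennreal (p - 1) * m epowr p"
proof (cases "p = 1 \<or> v = top")
 case True
 then show ?thesis
 proof
  assume "p = 1" then show ?thesis using assms by (cases m; cases v) auto
 qed auto
next
 case False
 then obtain r s where rs: "v = ennreal r" "0 <= r" "m = ennreal s" "0 <= s"
  using assms by (metis ennreal_cases)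
 have p: "1 < p" using False assms by auto
 define q where "q = p / (p - 1)"
 have q: "1 < q" "1/p + 1/q = 1" using p unfolding q_def by (auto simp: field_simps)
 have "s powr (p - 1) * r <= r powr p / p + (s powr (p-1)) powr q / q"
  using Youngs_inequality[OF p q, of r "s powr (p-1)"] rs by (simp add: mult.commute)
 also have "(s powr (p-1)) powr q = s powr p" using p by (simp add: powr_powr q_def)
 also have "r powr p / p + s powr p / q = (r powr p + (p - 1) * s powr p) / p"
  unfolding q_def using p by (simp add: field_simps)
 finally have "p * (s powr (p - 1) * r) <= r powr p + (p - 1) * s powr p"
  using p by (simp add: field_simps)
 then show ?thesis using rs p
  by (simp add: ennreal_mult'[symmetric] ennreal_plus[symmetric] mult.assoc ennreal_leI del: ennreal_plus)
qed

text \<open>As \<open>t\<close> tends to 0 the factor of the main term tends to 1. Unlike the cruder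
  bound with \<open>2 powr p\<close>, this lets a perturbation whose \<open>p\<close>-th power
  integral vanishes disappear without damaging a constant.\<close>

lemma epowr_add_le:
 assumes "1 < p" "0 < t" "t < 1"
 shows "(x + y) epowr p <= ennreal ((1 - t) powr (1 - p)) * x epowr p + ennreal (t powr (1 - p)) * y epowr p"
proof (cases "x = top \<or> y = top")
 case True
 then show ?thesis using assms by (auto simp: ennreal_mult_top)
next
 case False
 then obtain a b where ab: "x = ennreal a" "0 <= a" "y = ennreal b" "0 <= b"
  by (metis ennreal_cases)
 have *: "p * m powr (p - 1) * v <= v powr p + (p - 1) * m powr p" if "0 <= m" "0 <= v" for m v
  using epowr_tangent[of p "ennreal m" "ennreal v"] that assms
  by (simp add: ennreal_mult'[symmetric] ennreal_plus[symmetric] del: ennreal_plus)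
 \<comment> \<open>Both tangents are taken at \<open>a + b\<close>, the mean of
   \<open>a / (1 - t)\<close> and \<open>b / t\<close> with weights \<open>1 - t\<close> and
   \<open>t\<close>; the linear terms then add up to \<open>p * m powr p\<close>.\<close>
 define m where "m = a + b"
 have m: "0 <= m" using ab by (simp add: m_def)
 have 1: "(1 - t) * (p * m powr (p - 1) * (a / (1 - t))) <= (1 - t) * ((a / (1 - t)) powr p + (p - 1) * m powr p)"
  using assms ab m by (intro mult_left_mono *) auto
 have 2: "t * (p * m powr (p - 1) * (b / t)) <= t * ((b / t) powr p + (p - 1) * m powr p)"
  using assms ab m by (intro mult_left_mono *) auto
 have e1: "(1 - t) * (a / (1 - t)) powr p = (1 - t) powr (1 - p) * a powr p"
  using assms ab by (simp add: powr_divide powr_diff)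
 have e2: "t * (b / t) powr p = t powr (1 - p) * b powr p"
  using assms ab by (simp add: powr_divide powr_diff)
 have e3: "m powr (p - 1) * a + m powr (p - 1) * b = m powr p"
 proof -
  have "m powr (p - 1) * m = m powr p"
   by (cases "m = 0") (use assms m in \<open>auto simp: powr_diff\<close>)
  then show ?thesis by (simp add: m_def distrib_left)
 qed
 have "p * (m powr (p - 1) * a + m powr (p - 1) * b) <= (1 - t) powr (1 - p) * a powr p + t powr (1 - p) * b powr p + (p - 1) * m powr p"
 proof -
  have "(1 - t) * (p * m powr (p - 1) * (a / (1 - t))) = p * (m powr (p - 1) * a)"
   "t * (p * m powr (p - 1) * (b / t)) = p * (m powr (p - 1) * b)" using assms by simp_all
  with add_mono[OF 1 2] show ?thesis unfolding distrib_left e1 e2 by (simp add: algebra_simps)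
 qed
 then have "m powr p <= (1 - t) powr (1 - p) * a powr p + t powr (1 - p) * b powr p"
  unfolding e3 by (simp add: algebra_simps)
 then show ?thesis using ab assms
  by (simp add: ennreal_mult'[symmetric] ennreal_plus[symmetric] m_def ennreal_leI del: ennreal_plus)
qed

lemma epowr_add_le2:
 assumes "1 <= p"
 shows "(x + y) epowr p <= ennreal (2 powr p) * (x epowr p + y epowr p)"
proof (cases "x <= y")
 case True
 then have "(x + y) epowr p <= (2 * y) epowr p" using assms by (intro epowr_mono) (auto simp: mult_2 add_mono)
 also have "... = ennreal (2 powr p) * y epowr p" using assms epowr_ennreal[of 2 p] by (simp add: epowr_mult)
 also have "... <= ennreal (2 powr p) * (x epowr p + y epowr p)" by (intro mult_left_mono) auto
 finally show ?thesis .
next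
 case False
 then have "(x + y) epowr p <= (2 * x) epowr p" using assms by (intro epowr_mono) (auto simp: mult_2 add_mono)
 also have "... = ennreal (2 powr p) * x epowr p" using assms epowr_ennreal[of 2 p] by (simp add: epowr_mult)
 also have "... <= ennreal (2 powr p) * (x epowr p + y epowr p)" by (intro mult_left_mono) auto
 finally show ?thesis .
qed

section \<open>Jensen's and Young's inequalities for extended functions\<close>

lemma le_one_plus_epowr: "1 <= p ==> v <= 1 + v epowr p"
proof (cases v)
 case (real r)
 assume p: "1 <= p"
 have "r <= 1 + r powr p"
 proof (cases "r <= 1")
  case False
  then have "r powr 1 <= r powr p" using p by (intro powr_mono) auto
  then show ?thesis using False by auto
 next
  case True then show ?thesis using powr_ge_zero[of r p] by linarith
 qed
 then show ?thesis using real by (simp add: ennreal_leI flip: ennreal_plus ennreal_1)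
qed auto

text \<open>Integrate the tangent inequality at the mean \<open>m\<close> against the probability
  density \<open>K\<close> and cancel \<open>(p - 1) * m epowr p\<close>. Cancellation needs
  \<open>m\<close> to be finite, which \<open>le_one_plus_epowr\<close> provides once the right-hand
  side is finite.\<close>

theorem jensen_epowr:
 assumes [measurable]: "K \<in> borel_measurable M" "V \<in> borel_measurable M"
  and K: "(\<integral>\<^sup>+y. K y \<partial>M) = 1" and p: "1 <= p"
 shows "(\<integral>\<^sup>+y. K y * V y \<partial>M) epowr p <= (\<integral>\<^sup>+y. K y * V y epowr p \<partial>M)"
proof (cases "(\<integral>\<^sup>+y. K y * V y epowr p \<partial>M) = top")
 case False
 define m where "m = (\<integral>\<^sup>+y. K y * V y \<partial>M)"
 have "m <= (\<integral>\<^sup>+y. K y * (1 + V y epowr p) \<partial>M)" unfolding m_def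
  by (intro nn_integral_mono mult_left_mono le_one_plus_epowr p) auto
 also have "... = 1 + (\<integral>\<^sup>+y. K y * V y epowr p \<partial>M)"
  by (simp add: distrib_left nn_integral_add K)
 also have "... < top" using False by (simp add: top.not_eq_extremum)
 finally have mfin: "m ~= top" by simp
 have "ennreal p * m epowr (p - 1) * m = (\<integral>\<^sup>+y. K y * (ennreal p * m epowr (p - 1) * V y) \<partial>M)"
  unfolding m_def by (subst nn_integral_cmult[symmetric]) (auto simp: mult_ac)
 also have "... <= (\<integral>\<^sup>+y. K y * (V y epowr p + ennreal (p - 1) * m epowr p) \<partial>M)"
  by (intro nn_integral_mono mult_left_mono epowr_tangent p mfin) auto
 also have "... = (\<integral>\<^sup>+y. K y * V y epowr p \<partial>M) + ennreal (p - 1) * m epowr p"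
  by (simp add: distrib_left nn_integral_add nn_integral_multc K)
 finally have le: "ennreal p * m epowr (p - 1) * m <= (\<integral>\<^sup>+y. K y * V y epowr p \<partial>M) + ennreal (p - 1) * m epowr p" .
 have "m epowr (p - 1) * m = m epowr p"
 proof (cases "p = 1")
  case False then show ?thesis using p epowr_add[of "p-1" 1 m] by simp
 qed (use mfin in \<open>cases m; auto\<close>)
 moreover have "ennreal p = 1 + ennreal (p - 1)" using p by (simp flip: ennreal_1 ennreal_plus)
 ultimately have "m epowr p + ennreal (p - 1) * m epowr p <= (\<integral>\<^sup>+y. K y * V y epowr p \<partial>M) + ennreal (p - 1) * m epowr p"
  using le by (simp add: mult.assoc distrib_right)
 then show ?thesis unfolding m_def[symmetric]
  using mfin by (simp add: add.commute ennreal_add_left_cancel_le ennreal_mult_eq_top_iff)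
qed simp

lemma jensen_epowr':
 assumes [measurable]: "K \<in> borel_measurable M" "V \<in> borel_measurable M"
  and K: "(\<integral>\<^sup>+y. K y \<partial>M) = A" "A < top" and p: "1 < p"
 shows "(\<integral>\<^sup>+y. K y * V y \<partial>M) epowr p <= A epowr (p - 1) * (\<integral>\<^sup>+y. K y * V y epowr p \<partial>M)"
proof (cases "A = 0")
 case True
 then have "AE y in M. K y = 0" using K by (simp add: nn_integral_0_iff_AE)
 then have "(\<integral>\<^sup>+y. K y * V y \<partial>M) = 0" by (subst nn_integral_0_iff_AE) auto
 then show ?thesis by simp
next
 case False
 have c: "A * (1 / A) = 1" using False K by (simp add: ennreal_times_divide divide_eq_1_ennreal)
 have "(\<integral>\<^sup>+y. K y * V y \<partial>M) = A * (\<integral>\<^sup>+y. (1 / A * K y) * V y \<partial>M)"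
  by (subst nn_integral_cmult[symmetric]) (auto simp: mult.assoc[symmetric] c)
 then have "(\<integral>\<^sup>+y. K y * V y \<partial>M) epowr p = A epowr p * (\<integral>\<^sup>+y. (1 / A * K y) * V y \<partial>M) epowr p"
  using p by (simp add: epowr_mult)
 also have "... <= A epowr p * (\<integral>\<^sup>+y. (1 / A * K y) * V y epowr p \<partial>M)"
 proof (intro mult_left_mono jensen_epowr)
  show "(\<integral>\<^sup>+y. 1 / A * K y \<partial>M) = 1" using c K by (subst nn_integral_cmult) (auto simp: mult.commute)
 qed (use p in auto)
 also have "... = A epowr (p - 1) * (A * (\<integral>\<^sup>+y. (1 / A * K y) * V y epowr p \<partial>M))"
  using epowr_add[of "p - 1" 1 A] p by (simp add: mult_ac)
 also have "A * (\<integral>\<^sup>+y. (1 / A * K y) * V y epowr p \<partial>M) = (\<integral>\<^sup>+y. K y * V y epowr p \<partial>M)"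
  by (subst nn_integral_cmult[symmetric]) (auto simp: mult.assoc[symmetric] c)
 finally show ?thesis .
qed

text \<open>With \<open>s = id\<close> this is Young's inequality \<open>L\<^sub>1 * L\<^sub>p \<subseteq> L\<^sub>p\<close>; other \<open>s\<close> give averages along lines.\<close>

lemma young_convolution:
 fixes V :: "'a::euclidean_space => ennreal" and s :: "'b => 'a"
 assumes [measurable]: "K \<in> borel_measurable N" "V \<in> bm" "s \<in> N \<rightarrow>\<^sub>M borel"
  and "sigma_finite_measure N" and K: "(\<integral>\<^sup>+y. K y \<partial>N) = A" "A < top" and p: "1 < p"
 shows "(NI x. (\<integral>\<^sup>+y. K y * V (x - s y) \<partial>N) epowr p) <= A epowr p * (NI x. V x epowr p)"
proof -
 interpret N: sigma_finite_measure N by fact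
 interpret pair_sigma_finite N lborel by standard
 have tr: "(NI x. V (x - c) epowr p) = (NI x. V x epowr p)" for c
 proof -
  have "(NI x. V x epowr p) = (\<integral>\<^sup>+x. V x epowr p \<partial>distr lborel borel ((+) (-c)))"
   by (simp add: lborel_distr_plus)
  also have "... = (NI x. V (x - c) epowr p)"
   by (subst nn_integral_distr) auto
  finally show ?thesis by simp
 qed
 have "(NI x. (\<integral>\<^sup>+y. K y * V (x - s y) \<partial>N) epowr p) <=
   (NI x. A epowr (p - 1) * (\<integral>\<^sup>+y. K y * V (x - s y) epowr p \<partial>N))"
  using K p by (intro nn_integral_mono jensen_epowr') auto
 also have "... = A epowr (p - 1) * (NI x. (\<integral>\<^sup>+y. K y * V (x - s y) epowr p \<partial>N))"
  by (intro nn_integral_cmult) measurable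
 also have "(NI x. (\<integral>\<^sup>+y. K y * V (x - s y) epowr p \<partial>N)) = (\<integral>\<^sup>+y. (NI x. K y * V (x - s y) epowr p) \<partial>N)"
  by (intro Fubini') measurable
 also have "... = (\<integral>\<^sup>+y. K y * (NI x. V x epowr p) \<partial>N)"
  by (simp add: nn_integral_cmult tr)
 also have "... = A * (NI x. V x epowr p)" by (simp add: nn_integral_multc K)
 also have "A epowr (p - 1) * (A * (NI x. V x epowr p)) = A epowr p * (NI x. V x epowr p)"
  using epowr_add[of "p - 1" 1 A] p by (simp add: mult_ac)
 finally show ?thesis .
qed

section \<open>The \<open>\<ell>\<^sub>2\<close> norm of a family\<close>

definition l2n :: "'b set => ('b => complex) => ennreal" where
 "l2n D a = (\<Sum>\<^sub>\<infinity>R\<in>D. ennreal ((norm (a R))\<^sup>2)) epowr (1 / 2)"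

lemma square_function_eq_l2n: "square_function D S f x = l2n D (%R. S R f x)"
 by (simp add: square_function_def l2n_def)

lemma epowr_half_le_iff: "x epowr (1/2) <= y \<longleftrightarrow> x <= y epowr 2"
 using epowr_le_iff[of "1/2" x "y epowr 2"] by (simp add: epowr_epowr)

lemma L2_set_sq: "ennreal (L2_set (%R. norm (a R)) F) epowr 2 = (\<Sum>R\<in>F. ennreal ((norm (a R))\<^sup>2))"
 by (simp add: L2_set_nonneg L2_set_def sum_nonneg sum_ennreal powr_half_sqrt[symmetric] powr_powr)

text \<open>A sum of nonnegative terms is the supremum of its finite partial sums, so a bound can be
  tested on finite subfamilies, where the real calculus of \<open>L2_set\<close> is
  available.\<close>

lemma l2n_le_iff:
 "l2n D a <= z \<longleftrightarrow> (\<forall>F. finite F \<longrightarrow> F \<subseteq> D \<longrightarrow> ennreal (L2_set (%R. norm (a R)) F) <= z)"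
proof -
 have "l2n D a <= z \<longleftrightarrow> (\<Sum>\<^sub>\<infinity>R\<in>D. ennreal ((norm (a R))\<^sup>2)) <= z epowr 2"
  by (simp add: l2n_def epowr_half_le_iff)
 also have "... \<longleftrightarrow> (\<forall>F. finite F \<longrightarrow> F \<subseteq> D \<longrightarrow> (\<Sum>R\<in>F. ennreal ((norm (a R))\<^sup>2)) <= z epowr 2)"
  by (subst nonneg_infsum_complete) (auto simp: SUP_le_iff)
 also have "... \<longleftrightarrow> (\<forall>F. finite F \<longrightarrow> F \<subseteq> D \<longrightarrow> ennreal (L2_set (%R. norm (a R)) F) epowr 2 <= z epowr 2)"
  by (simp only: L2_set_sq)
 also have "... \<longleftrightarrow> (\<forall>F. finite F \<longrightarrow> F \<subseteq> D \<longrightarrow> ennreal (L2_set (%R. norm (a R)) F) <= z)"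
  by (subst epowr_le_iff) auto
 finally show ?thesis .
qed

lemma L2_set_le_l2n: "finite F ==> F \<subseteq> D ==> ennreal (L2_set (%R. norm (a R)) F) <= l2n D a"
 using l2n_le_iff[of D a "l2n D a"] by auto

lemma l2n_eq_SUP: "l2n D a = (SUP F\<in>{F. finite F \<and> F \<subseteq> D}. ennreal (L2_set (%R. norm (a R)) F))"
 by (rule antisym) (auto simp: l2n_le_iff L2_set_le_l2n SUP_le_iff intro: SUP_upper)

lemma norm_le_l2n: "R \<in> D ==> enorm (a R) <= l2n D a"
 using L2_set_le_l2n[of "{R}" D a] by simp

lemma l2n_mono: "(!!R. R \<in> D ==> norm (a R) <= norm (b R)) ==> l2n D a <= l2n D b"
 unfolding l2n_le_iff
 by (auto intro!: order_trans[OF ennreal_leI[OF L2_set_mono] L2_set_le_l2n])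

lemma l2n_cong: "(!!R. R \<in> D ==> norm (a R) = norm (b R)) ==> l2n D a = l2n D b"
 by (intro antisym l2n_mono) auto

lemma l2n_triangle: "l2n D (%R. a R + b R) <= l2n D a + l2n D b"
 unfolding l2n_le_iff
proof safe
 fix F assume F: "finite F" "F \<subseteq> D"
 have "L2_set (%R. norm (a R + b R)) F <= L2_set (%R. norm (a R) + norm (b R)) F"
  by (intro L2_set_mono norm_triangle_ineq) auto
 also have "... <= L2_set (%R. norm (a R)) F + L2_set (%R. norm (b R)) F" by (rule L2_set_triangle_ineq)
 finally have "ennreal (L2_set (%R. norm (a R + b R)) F) <= ennreal (L2_set (%R. norm (a R)) F) + ennreal (L2_set (%R. norm (b R)) F)"
  by (simp add: L2_set_nonneg flip: ennreal_plus)
 also have "... <= l2n D a + l2n D b" by (intro add_mono L2_set_le_l2n F)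
 finally show "ennreal (L2_set (%R. norm (a R + b R)) F) <= l2n D a + l2n D b" .
qed

lemma l2n_mult: "l2n D (%R. a R * c) = l2n D a * enorm c"
proof -
 have "(\<Sum>\<^sub>\<infinity>R\<in>D. ennreal ((norm (a R * c))\<^sup>2)) = (\<Sum>\<^sub>\<infinity>R\<in>D. ennreal ((norm c)\<^sup>2) * ennreal ((norm (a R))\<^sup>2))"
  by (intro infsum_cong) (simp add: norm_mult power_mult_distrib ennreal_mult' mult.commute)
 also have "... = ennreal ((norm c)\<^sup>2) * (\<Sum>\<^sub>\<infinity>R\<in>D. ennreal ((norm (a R))\<^sup>2))"
  by (simp add: nonneg_infsum_complete SUP_mult_left_ennreal sum_distrib_left[symmetric])
 finally show ?thesis unfolding l2n_def
  by (simp add: epowr_mult mult.commute powr_half_sqrt)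
qed

text \<open>Each finite subfamily passes to the limit, and the supremum over finite subfamilies is
  lower semicontinuous. Convergence of every single piece is therefore enough to apply Fatou's lemma
  to a square function.\<close>

lemma l2n_liminf:
 assumes "!!R. R \<in> D ==> (%n. a n R) \<longlonglongrightarrow> b R"
 shows "l2n D b <= liminf (%n. l2n D (a n))"
 unfolding l2n_le_iff
proof safe
 fix F assume F: "finite F" "F \<subseteq> D"
 have "(%n. ennreal (L2_set (%R. norm (a n R)) F)) \<longlonglongrightarrow> ennreal (L2_set (%R. norm (b R)) F)"
  unfolding L2_set_def using F by (intro tendsto_intros assms) auto
 then have "ennreal (L2_set (%R. norm (b R)) F) = liminf (%n. ennreal (L2_set (%R. norm (a n R)) F))"
  by (intro lim_imp_Liminf[symmetric]) auto
 also have "... <= liminf (%n. l2n D (a n))"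
  by (intro Liminf_mono always_eventually allI L2_set_le_l2n F)
 finally show "ennreal (L2_set (%R. norm (b R)) F) <= liminf (%n. l2n D (a n))" .
qed

lemma measurable_l2n [measurable (raw)]:
 assumes "countable D" and "!!R. R \<in> D ==> (%x. G x R) \<in> borel_measurable M"
 shows "(%x. l2n D (G x)) \<in> borel_measurable M"
 unfolding l2n_eq_SUP L2_set_def
proof (intro borel_measurable_SUP countable_Collect_finite_subset assms)
 fix F assume F: "F \<in> {F. finite F \<and> F \<subseteq> D}"
 have "(%x. \<Sum>R\<in>F. (cmod (G x R))\<^sup>2) \<in> borel_measurable M"
 proof (rule borel_measurable_sum)
  fix R assume "R \<in> F"
  then have [measurable]: "(%x. G x R) \<in> borel_measurable M" using F assms(2) by auto
  show "(%x. (cmod (G x R))\<^sup>2) \<in> borel_measurable M" by measurable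
 qed
 then show "(%x. ennreal (sqrt (\<Sum>R\<in>F. (cmod (G x R))\<^sup>2))) \<in> borel_measurable M" by measurable
qed

text \<open>Minkowski's integral inequality by duality: pair the vector of integrals with itself,
  move the pairing under the integral and use the Cauchy-Schwarz inequality pointwise.\<close>

lemma L2_set_integral_le:
 fixes g :: "'b => 'a => complex"
 assumes "finite F" and g: "!!R. R \<in> F ==> integrable M (g R)"
 shows "ennreal (L2_set (%R. norm (\<integral>x. g R x \<partial>M)) F) <= (\<integral>\<^sup>+x. ennreal (L2_set (%R. norm (g R x)) F) \<partial>M)"
proof -
 define a where "a R = (\<integral>x. g R x \<partial>M)" for R
 define L where "L = L2_set (%R. norm (a R)) F"
 have L0: "0 <= L" by (simp add: L_def L2_set_nonneg)
 have Lint: "integrable M (%x. L2_set (%R. norm (g R x)) F)"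
 proof (rule Bochner_Integration.integrable_bound)
  show "integrable M (%x. \<Sum>R\<in>F. norm (g R x))" using g by auto
  show "(%x. L2_set (%R. norm (g R x)) F) \<in> borel_measurable M"
   unfolding L2_set_def
   using g by (intro measurable_compose[OF _ borel_measurable_sqrt] borel_measurable_sum) auto
  show "AE x in M. norm (L2_set (%R. norm (g R x)) F) <= norm (\<Sum>R\<in>F. norm (g R x))"
   by (simp add: L2_set_nonneg sum_nonneg L2_set_le_sum)
 qed
 have "cof (L\<^sup>2) = (\<Sum>R\<in>F. cnj (a R) * a R)"
  unfolding L_def L2_set_def by (simp add: sum_nonneg complex_norm_square mult.commute del: of_real_power)
 also have "... = (\<integral>x. (\<Sum>R\<in>F. cnj (a R) * g R x) \<partial>M)"
  using g by (subst Bochner_Integration.integral_sum) (auto simp: a_def)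
 finally have "L\<^sup>2 = norm (\<integral>x. (\<Sum>R\<in>F. cnj (a R) * g R x) \<partial>M)"
  by (metis norm_of_real abs_of_nonneg zero_le_power2)
 also have "... <= (\<integral>x. norm (\<Sum>R\<in>F. cnj (a R) * g R x) \<partial>M)" by (rule integral_norm_bound)
 also have "... <= (\<integral>x. L * L2_set (%R. norm (g R x)) F \<partial>M)"
 proof (rule integral_mono)
  show "integrable M (%x. norm (\<Sum>R\<in>F. cnj (a R) * g R x))" using g by auto
  show "integrable M (%x. L * L2_set (%R. norm (g R x)) F)" using Lint by auto
  fix x
  have "norm (\<Sum>R\<in>F. cnj (a R) * g R x) <= (\<Sum>R\<in>F. \<bar>norm (a R)\<bar> * \<bar>norm (g R x)\<bar>)"
   by (rule order_trans[OF norm_sum]) (simp add: norm_mult)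
  also have "... <= L * L2_set (%R. norm (g R x)) F" unfolding L_def by (rule L2_set_mult_ineq)
  finally show "norm (\<Sum>R\<in>F. cnj (a R) * g R x) <= L * L2_set (%R. norm (g R x)) F" .
 qed
 also have "... = L * (\<integral>x. L2_set (%R. norm (g R x)) F \<partial>M)" by simp
 finally have "L * L <= L * (\<integral>x. L2_set (%R. norm (g R x)) F \<partial>M)" by (simp add: power2_eq_square)
 then have "L <= (\<integral>x. L2_set (%R. norm (g R x)) F \<partial>M)"
  using L0 by (cases "L = 0") (auto simp: L2_set_nonneg)
 then show ?thesis
  by (subst nn_integral_eq_integral[OF Lint]) (auto simp: L2_set_nonneg L_def a_def intro: ennreal_leI)
qed

lemma l2n_integral_le:
 fixes g :: "'b => 'a => complex"
 assumes g: "!!R. R \<in> D ==> integrable M (g R)"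
 shows "l2n D (%R. \<integral>x. g R x \<partial>M) <= (\<integral>\<^sup>+x. l2n D (%R. g R x) \<partial>M)"
 unfolding l2n_le_iff
proof safe
 fix F assume F: "finite F" "F \<subseteq> D"
 have "ennreal (L2_set (%R. norm (\<integral>x. g R x \<partial>M)) F) <= (\<integral>\<^sup>+x. ennreal (L2_set (%R. norm (g R x)) F) \<partial>M)"
  using F g by (intro L2_set_integral_le) auto
 also have "... <= (\<integral>\<^sup>+x. l2n D (%R. g R x) \<partial>M)" by (intro nn_integral_mono L2_set_le_l2n F)
 finally show "ennreal (L2_set (%R. norm (\<integral>x. g R x \<partial>M)) F) <= (\<integral>\<^sup>+x. l2n D (%R. g R x) \<partial>M)" .
qed

section \<open>Small perturbations\<close>

lemma Limsup_add_tendsto_0: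
 fixes a s :: "nat => ennreal"
 assumes "s \<longlonglongrightarrow> 0"
 shows "limsup (%n. a n + s n) <= limsup a" "liminf (%n. a n + s n) <= liminf a"
proof -
 have ev: "eventually (%n. a n + s n <= a n + ennreal e) sequentially" if "0 < e" for e :: real
  using order_tendstoD(2)[OF assms, of "ennreal e"] that
  by (auto elim!: eventually_mono intro!: add_left_mono)
 have c: "continuous_on UNIV (%x::ennreal. x + c)" for c by (intro continuous_intros)
 have m: "mono (%x::ennreal. x + c)" for c by (auto intro: monoI add_right_mono)
 show "limsup (%n. a n + s n) <= limsup a"
 proof (rule ennreal_le_epsilon)
  fix e :: real assume "0 < e"
  have "limsup (%n. a n + s n) <= limsup (%n. a n + ennreal e)" by (rule Limsup_mono[OF ev[OF \<open>0<e\<close>]])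
  also have "... = limsup a + ennreal e"
   by (rule Limsup_compose_continuous_mono[OF c m]) simp
  finally show "limsup (%n. a n + s n) <= limsup a + ennreal e" .
 qed
 show "liminf (%n. a n + s n) <= liminf a"
 proof (rule ennreal_le_epsilon)
  fix e :: real assume "0 < e"
  have "liminf (%n. a n + s n) <= liminf (%n. a n + ennreal e)" by (rule Liminf_mono[OF ev[OF \<open>0<e\<close>]])
  also have "... = liminf a + ennreal e"
   by (rule Liminf_compose_continuous_mono[OF c m]) simp
  finally show "liminf (%n. a n + s n) <= liminf a + ennreal e" .
 qed
qed

lemma Limsup_cmult_ennreal:
 fixes a :: "nat => ennreal" and c :: real
 shows "limsup (%n. ennreal c * a n) = ennreal c * limsup a"
  and "liminf (%n. ennreal c * a n) = ennreal c * liminf a"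
proof -
 have c: "continuous_on UNIV (%x::ennreal. ennreal c * x)"
  by (intro ennreal_continuous_on_cmult continuous_on_id) auto
 have m: "mono (%x::ennreal. ennreal c * x)" by (rule monoI) (simp add: mult_left_mono)
 show "limsup (%n. ennreal c * a n) = ennreal c * limsup a"
  by (rule Limsup_compose_continuous_mono[OF c m]) simp
 show "liminf (%n. ennreal c * a n) = ennreal c * liminf a"
  by (rule Liminf_compose_continuous_mono[OF c m]) simp
qed

lemma ennreal_le_of_scaled:
 fixes x y :: ennreal
 assumes "1 < p" and le: "!!t::real. 0 < t ==> t < 1 ==> x <= ennreal ((1 - t) powr (1 - p)) * y"
 shows "x <= y"
proof -
 have "((%n. (1 - 1 / (real n + 2)) powr (1 - p)) \<longlongrightarrow> (1 - 0) powr (1 - p)) sequentially"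
  by (intro tendsto_intros) (real_asymp, auto)
 then have "(%n. ennreal ((1 - 1 / (real n + 2)) powr (1 - p)) * y) \<longlonglongrightarrow> ennreal 1 * y"
  by (intro tendsto_mult_ennreal tendsto_ennrealI tendsto_const) auto
 then show ?thesis
  by (intro LIMSEQ_le_const[of _ _ x]) (auto intro!: le)
qed

text \<open>For fixed \<open>t\<close> the factor \<open>t powr (1 - p)\<close> is a constant in
  front of a null sequence, so the limit in \<open>n\<close> leaves only the factor
  \<open>(1 - t) powr (1 - p)\<close>, which is removed last. The comparison has constant 1 and
  makes sense when the integrals of \<open>a\<close> are infinite.\<close>

lemma perturb_power_integral:
 fixes a b c :: "nat => 'a => ennreal"
 assumes p: "1 < p" and [measurable]: "!!n. a n \<in> borel_measurable M" "!!n. b n \<in> borel_measurable M"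
  and le: "!!n. AE x in M. c n x <= a n x + b n x"
  and b: "(%n. \<integral>\<^sup>+x. b n x epowr p \<partial>M) \<longlonglongrightarrow> 0"
 shows "limsup (%n. \<integral>\<^sup>+x. c n x epowr p \<partial>M) <= limsup (%n. \<integral>\<^sup>+x. a n x epowr p \<partial>M)"
  and "liminf (%n. \<integral>\<^sup>+x. c n x epowr p \<partial>M) <= liminf (%n. \<integral>\<^sup>+x. a n x epowr p \<partial>M)"
proof -
 define A B C where "A n = (\<integral>\<^sup>+x. a n x epowr p \<partial>M)" and "B n = (\<integral>\<^sup>+x. b n x epowr p \<partial>M)"
  and "C n = (\<integral>\<^sup>+x. c n x epowr p \<partial>M)" for n
 have key: "C n <= ennreal ((1 - t) powr (1 - p)) * A n + ennreal (t powr (1 - p)) * B n"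
  if t: "0 < t" "t < 1" for n t
 proof -
  have "C n <= (\<integral>\<^sup>+x. ennreal ((1 - t) powr (1 - p)) * a n x epowr p + ennreal (t powr (1 - p)) * b n x epowr p \<partial>M)"
   unfolding C_def
   by (intro nn_integral_mono_AE eventually_mono[OF le] order_trans[OF epowr_mono epowr_add_le]) (use p t in auto)
  also have "... = ennreal ((1 - t) powr (1 - p)) * A n + ennreal (t powr (1 - p)) * B n"
   unfolding A_def B_def by (simp add: nn_integral_add nn_integral_cmult)
  finally show ?thesis .
 qed
 have s0: "(%n. ennreal (t powr (1 - p)) * B n) \<longlonglongrightarrow> 0" for t
  using ennreal_tendsto_cmult[OF _ b, of "ennreal (t powr (1 - p))"] by (simp add: B_def)
 show "limsup (%n. \<integral>\<^sup>+x. c n x epowr p \<partial>M) <= limsup (%n. \<integral>\<^sup>+x. a n x epowr p \<partial>M)"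
  unfolding A_def[symmetric] C_def[symmetric]
 proof (rule ennreal_le_of_scaled[OF p])
  fix t :: real assume t: "0 < t" "t < 1"
  have "limsup C <= limsup (%n. ennreal ((1 - t) powr (1 - p)) * A n + ennreal (t powr (1 - p)) * B n)"
   by (intro Limsup_mono always_eventually allI key t)
  also have "... <= limsup (%n. ennreal ((1 - t) powr (1 - p)) * A n)" by (rule Limsup_add_tendsto_0[OF s0])
  finally show "limsup C <= ennreal ((1 - t) powr (1 - p)) * limsup A" by (simp add: Limsup_cmult_ennreal)
 qed
 show "liminf (%n. \<integral>\<^sup>+x. c n x epowr p \<partial>M) <= liminf (%n. \<integral>\<^sup>+x. a n x epowr p \<partial>M)"
  unfolding A_def[symmetric] C_def[symmetric]
 proof (rule ennreal_le_of_scaled[OF p])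
  fix t :: real assume t: "0 < t" "t < 1"
  have "liminf C <= liminf (%n. ennreal ((1 - t) powr (1 - p)) * A n + ennreal (t powr (1 - p)) * B n)"
   by (intro Liminf_mono always_eventually allI key t)
  also have "... <= liminf (%n. ennreal ((1 - t) powr (1 - p)) * A n)" by (rule Limsup_add_tendsto_0[OF s0])
  finally show "liminf C <= ennreal ((1 - t) powr (1 - p)) * liminf A" by (simp add: Limsup_cmult_ennreal)
 qed
qed

section \<open>Lebesgue measure on Euclidean spaces\<close>

lemma nn_integral_affine:
 fixes f :: "'a::euclidean_space => ennreal"
 assumes [measurable]: "f \<in> bm" and c: "c ~= 0"
 shows "(NI x. f x) = ennreal (\<bar>c\<bar> ^ DIM('a)) * (NI x. f (t + c *\<^sub>R x))"
 by (subst lborel_affine[OF c, of t]) (simp add: nn_integral_density nn_integral_distr nn_integral_cmult)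

lemma integrable_affine:
 fixes f :: "'a::euclidean_space => 'b :: {banach, second_countable_topology}"
 assumes f: "integrable lborel f" and c: "c ~= 0"
 shows "integrable lborel (%x. f (t + c *\<^sub>R x))"
proof -
 have "(NI x. norm (f x)) = ennreal (\<bar>c\<bar> ^ DIM('a)) * (NI x. norm (f (t + c *\<^sub>R x)))"
  using borel_measurable_integrable[OF f] by (intro nn_integral_affine c) auto
 then show ?thesis
  using f borel_measurable_integrable[OF f] c unfolding integrable_iff_bounded
  by (auto simp: ennreal_mult_less_top)
qed

lemma integral_affine:
 fixes f :: "'a::euclidean_space => 'b :: {banach, second_countable_topology}"
 assumes c: "c ~= 0"
 shows "(BI x. f x) = (\<bar>c\<bar> ^ DIM('a)) *\<^sub>R (BI x. f (t + c *\<^sub>R x))"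
proof (cases "integrable lborel f")
 case True
 then show ?thesis using c borel_measurable_integrable[OF True] integrable_affine[OF True c, of t]
  by (subst lborel_affine[OF c, of t]) (simp add: integral_density integral_distr)
next
 case False
 have "\<not> integrable lborel (%x. f (t + c *\<^sub>R x))"
 proof
  assume "integrable lborel (%x. f (t + c *\<^sub>R x))"
  from integrable_affine[OF this, of "1/c" "- (1/c) *\<^sub>R t"] c show False using False
   by (simp add: algebra_simps)
 qed
 with False show ?thesis by (simp add: not_integrable_integral_eq)
qed

lemma nn_integral_translate:
 fixes f :: "'a::euclidean_space => ennreal"
 assumes "f \<in> bm"
 shows "(NI x. f (x + a)) = (NI x. f x)" "(NI x. f (x - a)) = (NI x. f x)"
  "(NI x. f (a - x)) = (NI x. f x)"
 using nn_integral_affine[OF assms, of 1 a] nn_integral_affine[OF assms, of 1 "-a"] nn_integral_affine[OF assms, of "-1" a]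
 by (simp_all add: algebra_simps)

lemma integral_translate:
 fixes f :: "'a::euclidean_space => 'b :: {banach, second_countable_topology}"
 shows "(BI x. f (x + a)) = (BI x. f x)" "(BI x. f (x - a)) = (BI x. f x)"
  "(BI x. f (a - x)) = (BI x. f x)"
 using integral_affine[of 1 f a] integral_affine[of 1 f "-a"] integral_affine[of "-1" f a]
 by (simp_all add: algebra_simps)

lemma integrable_translate:
 fixes f :: "'a::euclidean_space => 'b :: {banach, second_countable_topology}"
 assumes "integrable lborel f"
 shows "integrable lborel (%x. f (x + a))" "integrable lborel (%x. f (x - a))"
  "integrable lborel (%x. f (a - x))"
 using integrable_affine[OF assms, of 1 a] integrable_affine[OF assms, of 1 "-a"] integrable_affine[OF assms, of "-1" a]
 by (simp_all add: algebra_simps)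

lemma lborel_prod_integral:
 fixes f :: "'a::euclidean_space => real => complex"
 assumes f: "!!b. b \<in> Basis ==> integrable lborel (f b)"
 shows "integrable lborel (%x. \<Prod>b\<in>Basis. f b (x \<bullet> b))"
  and "(BI x. (\<Prod>b\<in>Basis. f b (x \<bullet> b))) = (\<Prod>b\<in>Basis. (BI x. f b x))"
proof -
 interpret product_sigma_finite "%_::'a. lborel :: real measure" by standard
 have m [measurable]: "!!b. b \<in> Basis ==> f b \<in> bm" using f by auto
 have m2: "(%x. \<Prod>b\<in>Basis. f b (x \<bullet> b)) \<in> borel_measurable (borel :: 'a measure)"
  by (intro borel_measurable_prod) measurable
 have m3: "(%f. \<Sum>b\<in>Basis. f b *\<^sub>R b) \<in> (\<Pi>\<^sub>M b\<in>(Basis::'a set). lborel) \<rightarrow>\<^sub>M borel" by measurable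
 show "integrable lborel (%x. \<Prod>b\<in>Basis. f b (x \<bullet> b))"
  unfolding lborel_eq[where 'a='a]
  using product_integrable_prod[of Basis f] f by (subst integrable_distr_eq[OF m3 m2]) simp
 show "(BI x. (\<Prod>b\<in>Basis. f b (x \<bullet> b))) = (\<Prod>b\<in>Basis. (BI x. f b x))"
  unfolding lborel_eq[where 'a='a]
  using product_integral_prod[of Basis f] f by (subst integral_distr[OF m3 m2]) simp
qed

lemma prod_Basis_vec:
 "(\<Prod>b\<in>(Basis :: (real^'n) set). g b) = (\<Prod>i\<in>UNIV. g (axis i 1))"
proof -
 have e: "(Basis :: (real^'n) set) = (%i. axis i 1) ` UNIV" by (auto simp: Basis_vec_def)
 show ?thesis
  unfolding e by (subst prod.reindex) (auto simp: inj_on_def axis_eq_axis)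
qed

definition axis_index :: "real^'n => 'n" where
 "axis_index b = (THE i. b = axis i 1)"

lemma axis_index_axis [simp]: "axis_index (axis i 1) = i"
 unfolding axis_index_def by (auto simp: axis_eq_axis)

lemma vec_prod_integral:
 fixes f :: "'n::finite => real => complex"
 assumes f: "!!i. integrable lborel (f i)"
 shows "integrable lborel (%x::real^'n. \<Prod>i\<in>UNIV. f i (x $ i))"
  and "(BI (x::real^'n). (\<Prod>i\<in>UNIV. f i (x $ i))) = (\<Prod>i\<in>UNIV. (BI x. f i x))"
 using lborel_prod_integral[of "%b::real^'n. f (axis_index b)"] f
 by (simp_all add: prod_Basis_vec inner_axis)

lemma vec_prod_nn_integral:
 fixes f :: "'n::finite => real => ennreal"
 assumes f: "!!i. f i \<in> bm"
 shows "(NI (x::real^'n). (\<Prod>i\<in>UNIV. f i (x $ i))) = (\<Prod>i\<in>UNIV. (NI x. f i x))"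
 using nn_integral_lborel_prod[of "%b::real^'n. f (axis_index b)"] f
 by (simp add: prod_Basis_vec inner_axis)

lemma cis_sum: "cis (\<Sum>i\<in>A. f i) = (\<Prod>i\<in>A. cis (f i))"
 by (induction A rule: infinite_finite_induct) (auto simp: cis_mult[symmetric])

lemma cis_measurable [measurable (raw)]:
 "f \<in> borel_measurable M ==> (%x. cis (f x)) \<in> borel_measurable M"
 by (intro borel_measurable_continuous_on[of cis]) (auto intro!: continuous_intros)

lemma fubini_swap:
 fixes F :: "'a => 'b => 'c::{banach, second_countable_topology}"
 assumes M: "sigma_finite_measure M" "sigma_finite_measure N"
  and meas [measurable]: "(%(x, y). F x y) \<in> borel_measurable (M \<Otimes>\<^sub>M N)"
  and fin: "(\<integral>\<^sup>+x. \<integral>\<^sup>+y. enorm (F x y) \<partial>N \<partial>M) < top"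
 shows "(\<integral>x. \<integral>y. F x y \<partial>N \<partial>M) = (\<integral>y. \<integral>x. F x y \<partial>M \<partial>N)"
  and "integrable M (%x. \<integral>y. F x y \<partial>N)" "integrable N (%y. \<integral>x. F x y \<partial>M)"
  and "AE x in M. integrable N (F x)" "AE y in N. integrable M (%x. F x y)"
proof -
 interpret M: sigma_finite_measure M by fact
 interpret N: sigma_finite_measure N by fact
 interpret pair_sigma_finite M N by standard
 have i: "integrable (M \<Otimes>\<^sub>M N) (%(x, y). F x y)"
  unfolding integrable_iff_bounded
 proof
  have "(\<integral>\<^sup>+z. enorm (case z of (x, y) => F x y) \<partial>(M \<Otimes>\<^sub>M N)) = (\<integral>\<^sup>+x. \<integral>\<^sup>+y. enorm (F x y) \<partial>N \<partial>M)"
   by (subst N.nn_integral_fst[symmetric]) auto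
  then show "(\<integral>\<^sup>+z. enorm (case z of (x, y) => F x y) \<partial>(M \<Otimes>\<^sub>M N)) < \<infinity>" using fin by simp
 qed fact
 show "(\<integral>x. \<integral>y. F x y \<partial>N \<partial>M) = (\<integral>y. \<integral>x. F x y \<partial>M \<partial>N)"
  using Fubini_integral[OF i] by simp
 show "integrable M (%x. \<integral>y. F x y \<partial>N)" using integrable_fst[OF i] by simp
 show "integrable N (%y. \<integral>x. F x y \<partial>M)" using integrable_snd[OF i] by simp
 show "AE x in M. integrable N (F x)" using AE_integrable_fst[OF i] by simp
 show "AE y in N. integrable M (%x. F x y)" using AE_integrable_snd[OF i] by simp
qed

lemma nn_norm_integral_le:
 fixes f :: "'a => 'b::{banach, second_countable_topology}"
 shows "enorm (\<integral>x. f x \<partial>M) <= (\<integral>\<^sup>+x. enorm (f x) \<partial>M)"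
proof (cases "integrable M f")
 case True
 then show ?thesis by (rule integral_norm_bound_ennreal)
qed (simp add: not_integrable_integral_eq)

section \<open>Translations and approximate identities in \<open>L\<^sub>p\<close>\<close>

definition pint :: "real => 'a measure => ('a => complex) => ennreal" where
 "pint p M f = (\<integral>\<^sup>+x. enorm (f x) epowr p \<partial>M)"

lemma pint_add_le:
 assumes "1 <= p" and [measurable]: "f \<in> borel_measurable M" "g \<in> borel_measurable M"
 shows "pint p M (%x. f x + g x) <= ennreal (2 powr p) * (pint p M f + pint p M g)"
proof -
 have "pint p M (%x. f x + g x) <= (\<integral>\<^sup>+x. ennreal (2 powr p) * (enorm (f x) epowr p + enorm (g x) epowr p) \<partial>M)"
  unfolding pint_def
 proof (intro nn_integral_mono)
  fix x
  have "enorm (f x + g x) epowr p <= (enorm (f x) + enorm (g x)) epowr p"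
   using assms by (intro epowr_mono) (auto simp flip: ennreal_plus intro: ennreal_leI norm_triangle_ineq)
  also have "... <= ennreal (2 powr p) * (enorm (f x) epowr p + enorm (g x) epowr p)"
   by (rule epowr_add_le2) fact
  finally show "enorm (f x + g x) epowr p <= ennreal (2 powr p) * (enorm (f x) epowr p + enorm (g x) epowr p)" .
 qed
 also have "... = ennreal (2 powr p) * (pint p M f + pint p M g)"
  unfolding pint_def by (simp add: nn_integral_cmult nn_integral_add)
 finally show ?thesis .
qed

lemma pint_uminus [simp]: "pint p M (%x. - f x) = pint p M f"
 by (simp add: pint_def)

lemma pint_diff_commute: "pint p M (%x. f x - g x) = pint p M (%x. g x - f x)"
 by (simp add: pint_def norm_minus_commute)

lemma pint_dominated:
 assumes p: "1 <= p" and [measurable]: "!!n. f n \<in> borel_measurable M" "w \<in> borel_measurable M"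
  and le: "!!n. AE x in M. enorm (f n x) epowr p <= w x" and w: "(\<integral>\<^sup>+x. w x \<partial>M) < top"
  and lim: "AE x in M. (%n. f n x) \<longlonglongrightarrow> 0"
 shows "(%n. pint p M (f n)) \<longlonglongrightarrow> 0"
proof -
 have "(%n. \<integral>\<^sup>+x. enorm (f n x) epowr p \<partial>M) \<longlonglongrightarrow> (\<integral>\<^sup>+x. 0 \<partial>M)"
 proof (rule nn_integral_dominated_convergence[where w=w])
  show "AE x in M. (%n. enorm (f n x) epowr p) \<longlonglongrightarrow> 0"
   using lim
  proof eventually_elim
   case (elim x)
   have "(%n. ennreal (norm (f n x) powr p)) \<longlonglongrightarrow> ennreal (norm (0::complex) powr p)"
    using p elim by (intro tendsto_ennrealI tendsto_powr' tendsto_norm) auto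
   then show ?case using p by simp
  qed
 qed (use le w in auto)
 then show ?thesis by (simp add: pint_def)
qed

lemma Lp_truncation:
 fixes f :: "'a::euclidean_space => complex"
 assumes p: "1 <= p" and [measurable]: "f \<in> bm" and f: "pint p lborel f < top"
 shows "(%n. pint p lborel (%x. f x - f x * indicator {x. norm (f x) <= real n \<and> norm x <= real n} x)) \<longlonglongrightarrow> 0"
proof (rule pint_dominated[where w="%x. enorm (f x) epowr p"])
 show "AE x in lborel. (%n. f x - f x * indicator {x. norm (f x) <= real n \<and> norm x <= real n} x) \<longlonglongrightarrow> 0"
 proof (rule AE_I2)
  fix x
  obtain N :: nat where "norm (f x) + norm x <= real N" using real_arch_simple by blast
  then have "norm (f x) <= real n" "norm x <= real n" if "N <= n" for n
   using that norm_ge_zero[of x] norm_ge_zero[of "f x"] by linarith+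
  then have "eventually (%n. f x - f x * indicator {x. norm (f x) <= real n \<and> norm x <= real n} x = 0) sequentially"
   by (intro eventually_sequentiallyI[of N]) (auto simp: indicator_def)
  then show "(%n. f x - f x * indicator {x. norm (f x) <= real n \<and> norm x <= real n} x) \<longlonglongrightarrow> 0"
   by (rule tendsto_eventually)
 qed
qed (use p f in \<open>auto simp: pint_def indicator_def intro!: epowr_mono\<close>)

text \<open>A measurable function is almost everywhere a limit of continuous ones. Clipping these at
  modulus \<open>M\<close> and cutting them off outside the ball does not affect the limit, because
  both operations fix \<open>f\<close>, and it makes dominated convergence available.\<close>

lemma continuous_dense_bounded:
 fixes f :: "'a::euclidean_space => complex"
 assumes p: "1 <= p" and [measurable]: "f \<in> bm" and e: "0 < e"
  and M: "0 < M" "!!x. norm (f x) <= M" and r: "!!x. norm x > r ==> f x = 0"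
 obtains \<phi> where "continuous_on UNIV \<phi>" "!!x. norm x > r + 1 ==> \<phi> x = 0" "!!x. norm (\<phi> x) <= M"
  "pint p lborel (%x. f x - \<phi> x) < ennreal e"
proof -
 have "f measurable_on UNIV"
  by (intro lebesgue_measurable_imp_measurable_on) (auto intro: measurable_completion)
 then obtain N g where N: "negligible N" and g: "!!n. continuous_on UNIV (g n)"
  "!!x. x \<notin> N ==> (%n. g n x) \<longlonglongrightarrow> f x"
  unfolding measurable_on_def by auto
 define cut where "cut x = max 0 (min 1 (r + 1 - norm x))" for x :: 'a
 define clip where "clip z = (M / max M (norm z)) *\<^sub>R z" for z :: complex
 define \<phi> where "\<phi> n x = cut x *\<^sub>R clip (g n x)" for n x
 have clip: "norm (clip z) <= M" for z
  using M unfolding clip_def by (auto simp: max_def field_simps)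
 have clipf: "clip (f x) = f x" for x
 proof -
  have "max M (norm (f x)) = M" using M(2)[of x] by (rule max_absorb1)
  then show ?thesis using M(1) by (simp add: clip_def)
 qed
 have cc: "continuous_on UNIV clip"
  unfolding clip_def using M by (intro continuous_intros) (auto simp: max_def)
 have cont: "continuous_on UNIV (\<phi> n)" for n
  unfolding \<phi>_def cut_def by (intro continuous_intros continuous_on_compose2[OF cc g(1)]) auto
 have cut: "0 <= cut x" "cut x <= 1" for x by (auto simp: cut_def)
 have b: "norm (\<phi> n x) <= M" for n x
  using mult_mono[OF cut(2) clip] cut(1)[of x] by (simp add: \<phi>_def)
 have z: "\<phi> n x = 0" if "norm x > r + 1" for n x using that by (simp add: \<phi>_def cut_def)
 have "AE x in lborel. x \<notin> N"
  using N by (metis AE_not_in AE_completion_iff negligible_iff_null_sets)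
 then have lim: "AE x in lborel. (%n. f x - \<phi> n x) \<longlonglongrightarrow> 0"
 proof eventually_elim
  case (elim x)
  have "(%n. clip (g n x)) \<longlonglongrightarrow> clip (f x)"
   using cc g(2)[OF elim] by (rule continuous_on_tendsto_compose) auto
  then have "(%n. f x - \<phi> n x) \<longlonglongrightarrow> f x - cut x *\<^sub>R f x"
   unfolding \<phi>_def clipf by (intro tendsto_intros)
  moreover have "cut x *\<^sub>R f x = f x"
   by (cases "norm x > r") (auto simp: r cut_def)
  ultimately show ?case by simp
 qed
 have [measurable]: "\<phi> n \<in> bm" for n
  using cont by (rule borel_measurable_continuous_onI)
 have "(%n. pint p lborel (%x. f x - \<phi> n x)) \<longlonglongrightarrow> 0"
 proof (rule pint_dominated[OF p, where w="%x. ennreal ((2 * M) powr p) * indicator (cball 0 (\<bar>r\<bar> + 1)) x"])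
  show "AE x in lborel. enorm (f x - \<phi> n x) epowr p <= ennreal ((2 * M) powr p) * indicator (cball 0 (\<bar>r\<bar> + 1)) x" for n
  proof (rule AE_I2)
   fix x
   show "enorm (f x - \<phi> n x) epowr p <= ennreal ((2 * M) powr p) * indicator (cball 0 (\<bar>r\<bar> + 1)) x"
   proof (cases "norm x <= \<bar>r\<bar> + 1")
    case True
    have "norm (f x - \<phi> n x) <= 2 * M" using norm_triangle_ineq4[of "f x" "\<phi> n x"] M(2)[of x] b[of n x] by linarith
    then have "norm (f x - \<phi> n x) powr p <= (2 * M) powr p" using p by (intro powr_mono2) auto
    then show ?thesis using True by (simp add: ennreal_leI)
   next
    case False
    then have "f x = 0" "\<phi> n x = 0" by (auto intro!: r z)
    then show ?thesis by simp
   qed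
  qed
  have "emeasure lborel (cball (0::'a) (\<bar>r\<bar> + 1)) < \<infinity>" by (intro emeasure_bounded_finite) auto
  then show "(NI  (x::'a). ennreal ((2 * M) powr p) * indicator (cball 0 (\<bar>r\<bar> + 1)) x) < top"
   by (subst nn_integral_cmult_indicator) (auto simp: ennreal_mult_less_top)
  show "(%x. f x - \<phi> n x) \<in> borel_measurable lborel" for n by measurable
  show "(%x::'a. ennreal ((2 * M) powr p) * indicator (cball 0 (\<bar>r\<bar> + 1)) x) \<in> borel_measurable lborel"
   by (intro borel_measurable_times_ennreal borel_measurable_const borel_measurable_indicator) simp
 qed fact
 then have "eventually (%n. pint p lborel (%x. f x - \<phi> n x) < ennreal e) sequentially"
  using e by (intro order_tendstoD) auto
 then obtain n where "pint p lborel (%x. f x - \<phi> n x) < ennreal e"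
  by (auto simp: eventually_sequentially)
 with cont b z show ?thesis by (intro that) auto
qed

lemma continuous_dense:
 fixes f :: "'a::euclidean_space => complex"
 assumes p: "1 <= p" and [measurable]: "f \<in> bm" and f: "pint p lborel f < top"
  and e: "0 < e"
 obtains \<phi> r M where "continuous_on UNIV \<phi>" "!!x. norm x > r ==> \<phi> x = 0" "!!x. norm (\<phi> x) <= M"
  "pint p lborel (%x. f x - \<phi> x) < ennreal e"
proof -
 define e' where "e' = e / (2 powr p * 4)"
 have e': "0 < e'" using e by (simp add: e'_def)
 define t where "t n x = f x * indicator {x. norm (f x) <= real n \<and> norm x <= real n} x" for n x
 have [measurable]: "t n \<in> bm" for n unfolding t_def by measurable
 have "eventually (%n. pint p lborel (%x. f x - t n x) < ennreal e') sequentially"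
  using Lp_truncation[OF p _ f] e' unfolding t_def by (intro order_tendstoD) auto
 then obtain n where n: "pint p lborel (%x. f x - t n x) < ennreal e'"
  by (auto simp: eventually_sequentially)
 have tb: "norm (t n x) <= real n + 1" "norm x > real n ==> t n x = 0" for x
  by (auto simp: t_def indicator_def)
 obtain \<phi> where \<phi>: "continuous_on UNIV \<phi>" "!!x. norm x > real n + 1 ==> \<phi> x = 0" "!!x. norm (\<phi> x) <= real n + 1"
  "pint p lborel (%x. t n x - \<phi> x) < ennreal e'"
  by (rule continuous_dense_bounded[OF p _ e', of "t n" "real n + 1" "real n"]) (use tb in auto)
 have [measurable]: "\<phi> \<in> bm" using \<phi>(1) by (rule borel_measurable_continuous_onI)
 have "pint p lborel (%x. f x - \<phi> x) <= ennreal (2 powr p) * (pint p lborel (%x. f x - t n x) + pint p lborel (%x. t n x - \<phi> x))"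
  using pint_add_le[OF p, of "%x. f x - t n x" lborel "%x. t n x - \<phi> x"] by simp
 also have "... <= ennreal (2 powr p) * (ennreal e' + ennreal e')"
  using n \<phi>(4) by (intro mult_left_mono add_mono) auto
 also have "... = ennreal (e / 2)" using e by (simp add: e'_def ennreal_mult'[symmetric] flip: ennreal_plus)
 also have "... < ennreal e" using e by (simp add: ennreal_less_iff)
 finally show ?thesis using \<phi> by (intro that) auto
qed

lemma translation_continuous_Lp:
 fixes f :: "'a::euclidean_space => complex"
 assumes p: "1 <= p" and [measurable]: "f \<in> bm" and f: "pint p lborel f < top"
  and y: "y \<longlonglongrightarrow> 0"
 shows "(%n. pint p lborel (%x. f (x - y n) - f x)) \<longlonglongrightarrow> 0"
proof (rule order_tendstoI)
 fix l :: ennreal assume "0 < l"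
 have "\<exists>e>0. ennreal e < l"
 proof -
  obtain e' where "0 < e'" "e' < l" using dense[OF \<open>0 < l\<close>] by blast
  then show ?thesis by (cases e') auto
 qed
 then obtain e where e: "0 < e" "ennreal e < l" by blast
 \<comment> \<open>Three terms are added by two uses of \<open>pint_add_le\<close>, at a cost of at
   most \<open>C\<close> for each. With each term below \<open>e / (4 * C)\<close> the total is at
   most \<open>3 * e / 4\<close>.\<close>
 define C where "C = 2 powr p * 2 powr p"
 have p2: "1 <= 2 powr p" using p by (intro ge_one_powr_ge_zero) auto
 then have C2: "2 powr p <= C" using mult_left_mono[OF p2, of "2 powr p"] by (simp add: C_def)
 have C: "1 <= C" using p2 C2 by (rule order_trans)
 define e' where "e' = e / (C * 4)"
 have e': "0 < e'" using e C by (simp add: e'_def)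
 obtain \<phi> r M where \<phi>: "continuous_on UNIV \<phi>" "!!x. norm x > r ==> \<phi> x = 0" "!!x. norm (\<phi> x) <= M"
  "pint p lborel (%x. f x - \<phi> x) < ennreal e'"
  using continuous_dense[OF p _ f e'] by auto
 have [measurable]: "\<phi> \<in> bm" using \<phi>(1) by (rule borel_measurable_continuous_onI)
 have M0: "0 <= M" using \<phi>(3)[of 0] norm_ge_zero order_trans by blast
 obtain Y where Y: "!!n. norm (y n) <= Y" using convergent_imp_Bseq[OF convergentI[OF y]] by (auto simp: Bseq_def)
 have Y0: "0 <= Y" using Y[of 0] norm_ge_zero order_trans by blast
 have lim: "(%n. pint p lborel (%x. \<phi> (x - y n) - \<phi> x)) \<longlonglongrightarrow> 0"
 proof (rule pint_dominated[OF p, where w="%x. ennreal ((2 * M) powr p) * indicator (cball 0 (\<bar>r\<bar> + Y)) x"])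
  show "AE x in lborel. enorm (\<phi> (x - y n) - \<phi> x) epowr p <= ennreal ((2 * M) powr p) * indicator (cball 0 (\<bar>r\<bar> + Y)) x" for n
  proof (rule AE_I2)
   fix x
   show "enorm (\<phi> (x - y n) - \<phi> x) epowr p <= ennreal ((2 * M) powr p) * indicator (cball 0 (\<bar>r\<bar> + Y)) x"
   proof (cases "norm x <= \<bar>r\<bar> + Y")
    case True
    have "norm (\<phi> (x - y n) - \<phi> x) <= 2 * M"
     using norm_triangle_ineq4[of "\<phi> (x - y n)" "\<phi> x"] \<phi>(3)[of x] \<phi>(3)[of "x - y n"] by linarith
    then have "norm (\<phi> (x - y n) - \<phi> x) powr p <= (2 * M) powr p" using p by (intro powr_mono2) auto
    then show ?thesis using True by (simp add: ennreal_leI)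
   next
    case False
    have "norm x <= norm (x - y n) + norm (y n)" using norm_triangle_ineq[of "x - y n" "y n"] by simp
    then have "norm (x - y n) > r" "norm x > r" using False Y[of n] Y0 by linarith+
    then have "\<phi> (x - y n) = 0" "\<phi> x = 0" by (auto intro!: \<phi>(2))
    then show ?thesis by simp
   qed
  qed
  have "emeasure lborel (cball (0::'a) (\<bar>r\<bar> + Y)) < \<infinity>" by (intro emeasure_bounded_finite) auto
  then show "(NI  (x::'a). ennreal ((2 * M) powr p) * indicator (cball 0 (\<bar>r\<bar> + Y)) x) < top"
   by (subst nn_integral_cmult_indicator) (auto simp: ennreal_mult_less_top)
  show "AE x in lborel. (%n. \<phi> (x - y n) - \<phi> x) \<longlonglongrightarrow> 0"
  proof (rule AE_I2)
   fix x
   have "(%n. \<phi> (x - y n)) \<longlonglongrightarrow> \<phi> (x - 0)"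
    by (rule continuous_on_tendsto_compose[OF \<phi>(1)]) (intro tendsto_diff tendsto_const y, auto)
   then show "(%n. \<phi> (x - y n) - \<phi> x) \<longlonglongrightarrow> 0" by (simp add: LIM_zero)
  qed
  show "(%x. \<phi> (x - y n) - \<phi> x) \<in> borel_measurable lborel" for n by measurable
  show "(%x::'a. ennreal ((2 * M) powr p) * indicator (cball 0 (\<bar>r\<bar> + Y)) x) \<in> borel_measurable lborel"
   by (intro borel_measurable_times_ennreal borel_measurable_const borel_measurable_indicator) simp
 qed
 have "eventually (%n. pint p lborel (%x. \<phi> (x - y n) - \<phi> x) < ennreal e') sequentially"
  using lim e' by (intro order_tendstoD) auto
 then show "eventually (%n. pint p lborel (%x. f (x - y n) - f x) < l) sequentially"
 proof eventually_elim
  case (elim n)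
  have tr: "pint p lborel (%x. f (x - y n) - \<phi> (x - y n)) = pint p lborel (%x. f x - \<phi> x)"
   unfolding pint_def by (rule nn_integral_translate(2)) measurable
  have "pint p lborel (%x. f (x - y n) - f x) = pint p lborel (%x. (f (x - y n) - \<phi> (x - y n)) + ((\<phi> (x - y n) - \<phi> x) + (\<phi> x - f x)))"
   by (simp add: algebra_simps)
  also have "... <= ennreal (2 powr p) * (pint p lborel (%x. f x - \<phi> x) + ennreal (2 powr p) * (pint p lborel (%x. \<phi> (x - y n) - \<phi> x) + pint p lborel (%x. f x - \<phi> x)))"
   by (intro order_trans[OF pint_add_le[OF p]] mult_left_mono add_mono)
    (auto simp: tr pint_diff_commute[of p lborel f] intro!: pint_add_le p)
  also have "... <= ennreal (2 powr p) * (ennreal e' + ennreal (2 powr p) * (ennreal e' + ennreal e'))"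
   using elim \<phi>(4) by (intro mult_left_mono add_mono) auto
  also have "... = ennreal (2 powr p * e' + C * (e' + e'))" using e' C
   by (simp add: C_def distrib_left mult.assoc ennreal_mult'[symmetric] flip: ennreal_plus)
  also have "... <= ennreal (C * e' + C * (e' + e'))" using C2 e' by (intro ennreal_leI add_mono mult_right_mono) auto
  also have "C * e' + C * (e' + e') = 3 * e / 4" using C e by (simp add: e'_def field_simps)
  also have "ennreal (3 * e / 4) <= ennreal e" using e by (intro ennreal_leI) auto
  finally show ?case using e by simp
 qed
qed simp

lemma jensen_fubini:
 fixes H :: "'a => 'b => ennreal"
 assumes M: "sigma_finite_measure M" "sigma_finite_measure N"
  and K': "K \<in> borel_measurable N" and H: "(%(x, y). H x y) \<in> borel_measurable (M \<Otimes>\<^sub>M N)"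
  and K: "(\<integral>\<^sup>+y. K y \<partial>N) = 1" and p: "1 <= p"
 shows "(\<integral>\<^sup>+x. (\<integral>\<^sup>+y. K y * H x y \<partial>N) epowr p \<partial>M) <= (\<integral>\<^sup>+y. K y * (\<integral>\<^sup>+x. H x y epowr p \<partial>M) \<partial>N)"
proof -
 interpret M: sigma_finite_measure M by fact
 interpret N: sigma_finite_measure N by fact
 interpret pair_sigma_finite M N by standard
 have Hx: "H x \<in> borel_measurable N" if "x \<in> space M" for x
  using measurable_Pair2[OF H that] by simp
 have Hy: "(%x. H x y) \<in> borel_measurable M" if "y \<in> space N" for y
  using measurable_Pair1[OF H that] by simp
 have "(%z. K (snd z) * (case z of (x, y) => H x y) epowr p) \<in> borel_measurable (M \<Otimes>\<^sub>M N)"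
  by (intro borel_measurable_times_ennreal measurable_epowr H measurable_compose[OF measurable_snd K'])
 then have m: "(%(x, y). K y * H x y epowr p) \<in> borel_measurable (M \<Otimes>\<^sub>M N)"
  by (simp add: case_prod_beta)
 have "(\<integral>\<^sup>+x. (\<integral>\<^sup>+y. K y * H x y \<partial>N) epowr p \<partial>M) <= (\<integral>\<^sup>+x. (\<integral>\<^sup>+y. K y * H x y epowr p \<partial>N) \<partial>M)"
  by (intro nn_integral_mono jensen_epowr K K' Hx p)
 also have "... = (\<integral>\<^sup>+y. (\<integral>\<^sup>+x. K y * H x y epowr p \<partial>M) \<partial>N)"
  using Fubini'[OF m] by simp
 also have "... = (\<integral>\<^sup>+y. K y * (\<integral>\<^sup>+x. H x y epowr p \<partial>M) \<partial>N)"
  by (intro nn_integral_cong nn_integral_cmult measurable_epowr Hy)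
 finally show ?thesis .
qed

text \<open>By Jensen the error is at most the average, against \<open>\<kappa>\<close>, of the
  moduli of continuity \<open>\<tau>\<close> of \<open>f\<close> in \<open>L_p\<close> at the points
  \<open>z / (n + 1)\<close>. These are bounded and tend to 0 for each \<open>z\<close>, so
  dominated convergence concludes.\<close>

theorem approximate_identity_Lp:
 fixes f :: "'a::euclidean_space => complex" and \<kappa> :: "'a => real"
 assumes p: "1 <= p" and [measurable]: "f \<in> bm" and f: "pint p lborel f < top"
  and [measurable]: "\<kappa> \<in> bm" and \<kappa>: "!!z. 0 <= \<kappa> z" "(NI z. ennreal (\<kappa> z)) = 1"
 shows "(%n. pint p lborel (%x. (BI z. cof (\<kappa> z) * f (x - (1 / real (Suc n)) *\<^sub>R z)) - f x)) \<longlonglongrightarrow> 0"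
proof -
 define \<tau> where "\<tau> y = pint p lborel (%x. f (x - y) - f x)" for y
 have [measurable]: "\<tau> \<in> bm" unfolding \<tau>_def pint_def by measurable
 have i\<kappa>: "integrable lborel \<kappa>" using \<kappa> by (simp add: integrable_iff_bounded)
 have "(BI z. \<kappa> z) = 1" using nn_integral_eq_integral[OF i\<kappa>] \<kappa>
  by (simp add: ennreal_eq_1)
 then have int\<kappa>: "(BI z. cof (\<kappa> z)) = 1" by simp
 have bound: "pint p lborel (%x. (BI z. cof (\<kappa> z) * f (x - c *\<^sub>R z)) - f x)
   <= (NI z. ennreal (\<kappa> z) * \<tau> (c *\<^sub>R z))" for c
 proof -
  have "(NI x. (NI z. ennreal (\<kappa> z) * enorm (f (x - c *\<^sub>R z))) epowr p)
   <= (NI z. ennreal (\<kappa> z) * (NI x. enorm (f (x - c *\<^sub>R z)) epowr p))"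
   by (intro jensen_fubini) (use \<kappa> p in \<open>auto intro: sigma_finite_lborel\<close>)
  also have "... = (NI z. ennreal (\<kappa> z) * pint p lborel f)"
   unfolding pint_def by (intro nn_integral_cong arg_cong2[where f="(*)"] refl nn_integral_translate(2)[where f="%x. enorm (f x) epowr p"]) measurable
  also have "... = pint p lborel f" using \<kappa> by (simp add: nn_integral_multc)
  finally have "(NI x. (NI z. ennreal (\<kappa> z) * enorm (f (x - c *\<^sub>R z))) epowr p) ~= \<infinity>"
   using f by auto
  then have "AE x in lborel. (NI z. ennreal (\<kappa> z) * enorm (f (x - c *\<^sub>R z))) epowr p ~= \<infinity>"
   by (intro nn_integral_PInf_AE) measurable
  \<comment> \<open>A divergent Bochner integral has the value 0, so \<open>f x\<close> may be
    subtracted under the integral only where convergence is known, which is almost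
    everywhere.\<close>
  then have ae: "AE x in lborel. integrable lborel (%z. cof (\<kappa> z) * f (x - c *\<^sub>R z))"
  proof eventually_elim
   case (elim x)
   then show ?case unfolding integrable_iff_bounded
    using \<kappa> by (auto simp: norm_mult ennreal_mult' top.not_eq_extremum)
  qed
  have "pint p lborel (%x. (BI z. cof (\<kappa> z) * f (x - c *\<^sub>R z)) - f x)
   <= (NI x. (NI z. ennreal (\<kappa> z) * enorm (f (x - c *\<^sub>R z) - f x)) epowr p)"
   unfolding pint_def
  proof (intro nn_integral_mono_AE eventually_mono[OF ae] epowr_mono)
   fix x assume i: "integrable lborel (%z. cof (\<kappa> z) * f (x - c *\<^sub>R z))"
   have "(BI z. cof (\<kappa> z) * f (x - c *\<^sub>R z)) - f x =
    (BI z. cof (\<kappa> z) * f (x - c *\<^sub>R z)) - (BI z. cof (\<kappa> z) * f x)"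
    using int\<kappa> by simp
   also have "... = (BI z. cof (\<kappa> z) * (f (x - c *\<^sub>R z) - f x))"
    using i i\<kappa> by (subst Bochner_Integration.integral_diff[symmetric]) (auto simp: algebra_simps)
   finally have "enorm ((BI z. cof (\<kappa> z) * f (x - c *\<^sub>R z)) - f x)
    <= (NI z. enorm (cof (\<kappa> z) * (f (x - c *\<^sub>R z) - f x)))"
    by (simp only: nn_norm_integral_le)
   then show "enorm ((BI z. cof (\<kappa> z) * f (x - c *\<^sub>R z)) - f x)
    <= (NI z. ennreal (\<kappa> z) * enorm (f (x - c *\<^sub>R z) - f x))"
    using \<kappa> by (simp add: norm_mult ennreal_mult')
  qed (use p in auto)
  also have "... <= (NI z. ennreal (\<kappa> z) * (NI x. enorm (f (x - c *\<^sub>R z) - f x) epowr p))"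
   by (intro jensen_fubini) (use \<kappa> p in \<open>auto intro: sigma_finite_lborel\<close>)
  finally show ?thesis by (simp add: \<tau>_def pint_def)
 qed
 have \<tau>b: "\<tau> y <= ennreal (2 powr p) * (pint p lborel f + pint p lborel f)" for y
 proof -
  have tr: "pint p lborel (%x. f (x - y)) = pint p lborel f"
   unfolding pint_def by (rule nn_integral_translate(2)) measurable
  show ?thesis unfolding \<tau>_def
   using pint_add_le[OF p, of "%x. f (x - y)" lborel "%x. - f x"] by (simp add: tr)
 qed
 have "(%n. (NI z. ennreal (\<kappa> z) * \<tau> ((1 / real (Suc n)) *\<^sub>R z))) \<longlonglongrightarrow> (NI (z::'a). 0)"
 proof (rule nn_integral_dominated_convergence[where w="%z. ennreal (\<kappa> z) * (ennreal (2 powr p) * (pint p lborel f + pint p lborel f))"])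
  show "(NI z. ennreal (\<kappa> z) * (ennreal (2 powr p) * (pint p lborel f + pint p lborel f))) < \<infinity>"
   using f \<kappa> by (simp add: nn_integral_multc ennreal_mult_less_top)
  show "AE z in lborel. (%n. ennreal (\<kappa> z) * \<tau> ((1 / real (Suc n)) *\<^sub>R z)) \<longlonglongrightarrow> 0"
  proof (rule AE_I2)
   fix z :: 'a
   have "(%n. (1 / real (Suc n)) *\<^sub>R z) \<longlonglongrightarrow> 0 *\<^sub>R z"
    by (intro tendsto_intros) (rule LIMSEQ_Suc, rule lim_1_over_n)
   then have "(%n. \<tau> ((1 / real (Suc n)) *\<^sub>R z)) \<longlonglongrightarrow> 0"
    unfolding \<tau>_def by (intro translation_continuous_Lp p f) auto
   then show "(%n. ennreal (\<kappa> z) * \<tau> ((1 / real (Suc n)) *\<^sub>R z)) \<longlonglongrightarrow> 0"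
    using ennreal_tendsto_cmult[of "ennreal (\<kappa> z)"] by fastforce
  qed
 qed (auto intro!: mult_left_mono \<tau>b)
 then have lim: "(%n. (NI z. ennreal (\<kappa> z) * \<tau> ((1 / real (Suc n)) *\<^sub>R z))) \<longlonglongrightarrow> 0" by simp
 show ?thesis
  by (rule tendsto_sandwich[OF _ _ tendsto_const lim]) (auto intro!: always_eventually bound)
qed

section \<open>The Fourier transform and its inversion\<close>

text \<open>The same normalisation as \<open>fourier\<close>, but on every Euclidean space, because
  kernels on the line are transformed as well as functions of several variables.\<close>

definition ft :: "('a::euclidean_space => complex) => 'a => complex" where
 "ft f \<xi> = (BI x. f x * cis (- 2 * pi * (\<xi> \<bullet> x)))"

lemma fourier_eq_ft: "fourier = ft"
 by (intro ext) (simp add: fourier_def ft_def)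

lemma integrable_mult_cis:
 fixes f :: "'a => complex"
 assumes "integrable M f" and [measurable]: "h \<in> borel_measurable M"
 shows "integrable M (%x. f x * cis (h x))"
 by (rule Bochner_Integration.integrable_bound[OF assms(1)])
  (use borel_measurable_integrable[OF assms(1)] in \<open>auto simp: norm_mult\<close>)

lemma norm_ft_le: "norm (ft f \<xi>) <= (BI x. norm (f x))"
 unfolding ft_def by (rule order_trans[OF integral_norm_bound]) (simp add: norm_mult)

lemma measurable_ft [measurable]:
 assumes [measurable]: "f \<in> bm"
 shows "ft f \<in> bm"
 unfolding ft_def[abs_def] by measurable

lemma continuous_ft:
 assumes f: "integrable lborel f"
 shows "continuous_on UNIV (ft f)"
proof (rule continuous_on_sequentiallyI)
 fix u and \<xi> :: 'a assume u: "u \<longlonglongrightarrow> \<xi>"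
 have [measurable]: "f \<in> bm" using f by auto
 show "(%n. ft f (u n)) \<longlonglongrightarrow> ft f \<xi>"
  unfolding ft_def
 proof (rule integral_dominated_convergence[where w="%x. norm (f x)"])
  show "AE x in lborel. (%n. f x * cis (- 2 * pi * (u n \<bullet> x))) \<longlonglongrightarrow> f x * cis (- 2 * pi * (\<xi> \<bullet> x))"
   by (intro AE_I2 tendsto_intros u)
 qed (use f in \<open>auto simp: norm_mult\<close>)
qed

lemma ft_cong_AE:
 assumes [measurable]: "f \<in> bm" "g \<in> bm"
  and "AE x in lborel. f x = g x"
 shows "ft f = ft g"
 unfolding ft_def[abs_def] by (intro ext integral_cong_AE) (use assms(3) in auto)

lemma ft_translate: "ft (%x. f (x - a)) \<xi> = cis (- 2 * pi * (\<xi> \<bullet> a)) * ft f \<xi>"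
proof -
 have "ft (%x. f (x - a)) \<xi> = (BI x. cis (- 2 * pi * (\<xi> \<bullet> a)) * (f (x - a) * cis (- 2 * pi * (\<xi> \<bullet> (x - a)))))"
  unfolding ft_def by (intro Bochner_Integration.integral_cong refl) (simp add: cis_mult algebra_simps)
 also have "... = cis (- 2 * pi * (\<xi> \<bullet> a)) * ft f \<xi>"
  unfolding ft_def using integral_translate(2)[of "%x. f x * cis (- 2 * pi * (\<xi> \<bullet> x))" a] by simp
 finally show ?thesis .
qed

lemma ft_modulate: "ft (%x. f x * cis (2 * pi * (a \<bullet> x))) \<xi> = ft f (\<xi> - a)"
 unfolding ft_def by (intro Bochner_Integration.integral_cong refl) (simp add: cis_mult algebra_simps)

lemma ft_scale:
 fixes f :: "'a::euclidean_space => complex"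
 assumes "c ~= 0" shows "ft f \<xi> = \<bar>c\<bar> ^ DIM('a) *\<^sub>R ft (%x. f (c *\<^sub>R x)) (c *\<^sub>R \<xi>)"
 unfolding ft_def using integral_affine[OF assms, of "%x. f x * cis (- 2 * pi * (\<xi> \<bullet> x))" 0]
 by (simp add: mult_ac)

lemma integral_ft_swap:
 assumes f: "integrable lborel f" and g: "integrable lborel g"
 shows "(BI x. f x * ft g x) = (BI x. ft f x * g x)"
proof -
 have [measurable]: "f \<in> bm" "g \<in> bm" using f g by auto
 have "(NI x. (NI y. enorm (f x * (g y * cis (- 2 * pi * (x \<bullet> y))))))
   = (NI x. enorm (f x)) * (NI y. enorm (g y))"
  by (simp add: norm_mult ennreal_mult' nn_integral_cmult nn_integral_multc)
 also have "... < top" using f g by (simp add: integrable_iff_bounded ennreal_mult_less_top)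
 finally have fin: "(NI x. (NI y. enorm (f x * (g y * cis (- 2 * pi * (x \<bullet> y)))))) < top" .
 have "(BI x. f x * ft g x) = (BI x. (BI y. f x * (g y * cis (- 2 * pi * (x \<bullet> y)))))"
  by (simp add: ft_def)
 also have "... = (BI y. (BI x. f x * (g y * cis (- 2 * pi * (x \<bullet> y)))))"
  by (rule fubini_swap(1)[OF _ _ _ fin]) (auto intro: sigma_finite_lborel)
 also have "... = (BI y. (BI x. f x * cis (- 2 * pi * (y \<bullet> x))) * g y)"
 proof (intro Bochner_Integration.integral_cong refl)
  fix y
  have "(BI x. f x * (g y * cis (- 2 * pi * (x \<bullet> y)))) = (BI x. f x * cis (- 2 * pi * (y \<bullet> x)) * g y)"
   by (simp add: inner_commute mult_ac)
  also have "... = (BI x. f x * cis (- 2 * pi * (y \<bullet> x))) * g y"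
   by simp
  finally show "(BI x. f x * (g y * cis (- 2 * pi * (x \<bullet> y)))) = (BI x. f x * cis (- 2 * pi * (y \<bullet> x))) * g y" .
 qed
 finally show ?thesis by (simp add: ft_def)
qed

lemma ft_prod:
 fixes f :: "'n::finite => real => complex" and \<xi> :: "real^'n"
 assumes "!!i. integrable lborel (f i)"
 shows "ft (%x. \<Prod>i\<in>UNIV. f i (x $ i)) \<xi> = (\<Prod>i\<in>UNIV. ft (f i) (\<xi> $ i))"
proof -
 have "cis (- 2 * pi * (\<xi> \<bullet> x)) = (\<Prod>i\<in>UNIV. cis (- 2 * pi * (\<xi> $ i * x $ i)))" for x
  by (simp add: inner_vec_def sum_distrib_left cis_sum[symmetric])
 then have "ft (%x. \<Prod>i\<in>UNIV. f i (x $ i)) \<xi> = (BI x. (\<Prod>i\<in>UNIV. f i (x $ i) * cis (- 2 * pi * (\<xi> $ i * x $ i))))"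
  by (simp add: ft_def prod.distrib)
 also have "... = (\<Prod>i\<in>UNIV. ft (f i) (\<xi> $ i))"
  unfolding ft_def inner_real_def
  by (rule vec_prod_integral(2)[where f="%i t. f i t * cis (- 2 * pi * (\<xi> $ i * t))"])
   (intro integrable_mult_cis assms, measurable)
 finally show ?thesis .
qed

text \<open>This is the characteristic function of the standard normal distribution, rescaled by
  \<open>sqrt (2 * pi)\<close>, the factor for which the Gaussian equals its own transform.\<close>

lemma gauss_real:
 shows "integrable lborel (%x::real. cof (exp (- pi * x\<^sup>2)))"
  and "(BI x. cof (exp (- pi * x\<^sup>2)) * cis (- 2 * pi * (\<xi> * x))) = cof (exp (- pi * \<xi>\<^sup>2))"
proof -
 define s where "s = sqrt (2 * pi)"
 have s: "0 < s" "s\<^sup>2 = 2 * pi" by (auto simp: s_def)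
 have e: "std_normal_density (s * x) = exp (- pi * x\<^sup>2) / s" for x
  using s by (simp add: std_normal_density_def power_mult_distrib s_def[symmetric])
 have "integrable lborel (%x. s * std_normal_density (0 + s * x))"
  using s by (intro integrable_mult_right lborel_integrable_real_affine) auto
 then have "integrable lborel (%x. exp (- pi * x\<^sup>2))" using s by (simp add: e)
 then show "integrable lborel (%x::real. cof (exp (- pi * x\<^sup>2)))" by (rule integrable_of_real)
 define t where "t = - s * \<xi>"
 have "cof (exp (- (t^2) / 2)) = char std_normal_distribution t"
  by (simp add: char_std_normal_distribution)
 also have "... = (BI x. std_normal_density x *\<^sub>R iexp (t * x))"
  unfolding char_def by (subst integral_density) auto
 also have "... = s *\<^sub>R (BI x. std_normal_density (s * x) *\<^sub>R iexp (t * (s * x)))"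
  using s lborel_integral_real_affine[of s "%x. std_normal_density x *\<^sub>R iexp (t * x)" 0] by simp
 also have "... = (BI x. s *\<^sub>R (std_normal_density (s * x) *\<^sub>R iexp (t * (s * x))))"
  by (simp only: integral_scaleR_right)
 also have "... = (BI x. cof (exp (- pi * x\<^sup>2)) * cis (- 2 * pi * (\<xi> * x)))"
 proof (intro Bochner_Integration.integral_cong refl)
  fix x
  have "t * (s * x) = - (s\<^sup>2) * (\<xi> * x)" by (simp add: t_def power2_eq_square)
  then have "t * (s * x) = - 2 * pi * (\<xi> * x)" using s by simp
  then show "s *\<^sub>R (std_normal_density (s * x) *\<^sub>R iexp (t * (s * x))) = cof (exp (- pi * x\<^sup>2)) * cis (- 2 * pi * (\<xi> * x))"
   using s by (simp add: e cis_conv_exp scaleR_conv_of_real)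
 qed
 finally have "cof (exp (- (t^2) / 2)) = (BI x. cof (exp (- pi * x\<^sup>2)) * cis (- 2 * pi * (\<xi> * x)))" .
 moreover have "t^2 / 2 = pi * \<xi>\<^sup>2" using s by (simp add: t_def power_mult_distrib)
 ultimately show "(BI x. cof (exp (- pi * x\<^sup>2)) * cis (- 2 * pi * (\<xi> * x))) = cof (exp (- pi * \<xi>\<^sup>2))"
  by simp
qed

definition gauss :: "'a::euclidean_space => real" where
 "gauss x = exp (- pi * (norm x)\<^sup>2)"

lemma gauss_pos [simp]: "0 < gauss x"
 by (simp add: gauss_def)

lemma measurable_gauss [measurable]: "gauss \<in> bm"
 unfolding gauss_def[abs_def] by measurable

lemma gauss_prod: "gauss x = (\<Prod>b\<in>Basis. exp (- pi * (x \<bullet> b)\<^sup>2))"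
proof -
 have "(norm x)\<^sup>2 = (\<Sum>b\<in>Basis. (x \<bullet> b)\<^sup>2)"
  unfolding power2_norm_eq_inner by (subst euclidean_inner) (simp add: power2_eq_square)
 then show ?thesis by (simp add: gauss_def exp_sum[symmetric] sum_distrib_left sum_negf)
qed

lemma gauss_minus [simp]: "gauss (- x) = gauss x"
 by (simp add: gauss_def)

lemma integrable_gauss: "integrable lborel (%x::'a::euclidean_space. cof (gauss x))"
 using lborel_prod_integral(1)[of "%_ x. cof (exp (- pi * x\<^sup>2))"] gauss_real(1)
 by (simp add: gauss_prod)

lemma ft_gauss: "ft (%x::'a::euclidean_space. cof (gauss x)) \<xi> = cof (gauss \<xi>)"
proof -
 have "cis (- 2 * pi * (\<xi> \<bullet> x)) = (\<Prod>b\<in>Basis. cis (- 2 * pi * ((\<xi> \<bullet> b) * (x \<bullet> b))))" for x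
  by (subst euclidean_inner) (simp add: sum_distrib_left cis_sum[symmetric])
 then have "ft (%x. cof (gauss x)) \<xi> = (BI x. (\<Prod>b\<in>Basis. cof (exp (- pi * (x \<bullet> b)\<^sup>2)) * cis (- 2 * pi * ((\<xi> \<bullet> b) * (x \<bullet> b)))))"
  by (simp add: ft_def prod.distrib gauss_prod)
 also have "... = (\<Prod>b\<in>Basis. (BI t. cof (exp (- pi * t\<^sup>2)) * cis (- 2 * pi * ((\<xi> \<bullet> b) * t))))"
  by (rule lborel_prod_integral(2)[where f="%b t. cof (exp (- pi * t\<^sup>2)) * cis (- 2 * pi * ((\<xi> \<bullet> b) * t))"])
   (intro integrable_mult_cis gauss_real, measurable)
 also have "... = cof (gauss \<xi>)" by (simp only: gauss_real gauss_prod of_real_prod)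
 finally show ?thesis .
qed

lemma nn_integral_gauss: "(NI (x::'a::euclidean_space). ennreal (gauss x)) = 1"
proof -
 have i: "integrable lborel (gauss :: 'a => real)"
  using integrable_gauss[where 'a='a] by (simp add: complex_of_real_integrable_eq)
 have "cof (BI (x::'a). gauss x) = 1"
  using ft_gauss[of "0::'a"] by (simp add: ft_def gauss_def[of "0::'a"])
 then have "(BI (x::'a). gauss x) = 1" using of_real_eq_1_iff by blast
 then show ?thesis using i by (subst nn_integral_eq_integral) (auto intro!: AE_I2 less_imp_le)
qed

text \<open>The Gaussian means \<open>G n\<close> converge to \<open>f\<close> in \<open>L_1\<close>
  as an approximate identity. By the multiplication formula they are also integrals of
  \<open>ft f\<close> against a Gaussian that flattens out, which converge everywhere. An almost
  everywhere convergent subsequence identifies the limits.\<close>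

theorem fourier_inversion:
 fixes f :: "'a::euclidean_space => complex"
 assumes f: "integrable lborel f" and F: "integrable lborel (ft f)"
 shows "AE x in lborel. f x = ft (ft f) (- x)"
proof -
 have [measurable]: "f \<in> bm" using f by auto
 have [measurable]: "ft f \<in> bm" by measurable
 define G where "G n x = (BI z. cof (gauss z) * f (x - (1 / real (Suc n)) *\<^sub>R z))" for n x
 have [measurable]: "G n \<in> bm" for n unfolding G_def[abs_def] by measurable
 have pf: "pint 1 lborel f < top" using f by (simp add: pint_def integrable_iff_bounded)
 have lim0: "(%n. pint 1 lborel (%x. G n x - f x)) \<longlonglongrightarrow> 0"
  unfolding G_def by (intro approximate_identity_Lp pf) (auto intro: less_imp_le simp: nn_integral_gauss)
 have Geq: "G n x = (BI \<xi>. ft f \<xi> * cof (gauss ((1 / real (Suc n)) *\<^sub>R \<xi>)) * cis (2 * pi * (x \<bullet> \<xi>)))" for n x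
 proof -
  define c where "c = 1 / real (Suc n)"
  have c: "c ~= 0" by (simp add: c_def)
  define m where "m \<xi> = cof (gauss (c *\<^sub>R \<xi>)) * cis (2 * pi * (x \<bullet> \<xi>))" for \<xi> :: 'a
  have mi: "integrable lborel m"
   unfolding m_def using integrable_affine[OF integrable_gauss c, of 0] by (intro integrable_mult_cis) auto
  have "(BI \<xi>. ft f \<xi> * cof (gauss (c *\<^sub>R \<xi>)) * cis (2 * pi * (x \<bullet> \<xi>))) = (BI \<xi>. ft f \<xi> * m \<xi>)"
   by (simp add: m_def mult_ac)
  also have "... = (BI y. f y * ft m y)" by (rule integral_ft_swap[OF f mi, symmetric])
  also have "... = (\<bar>c\<bar> ^ DIM('a)) *\<^sub>R (BI z. f (x + (-c) *\<^sub>R z) * ft m (x + (-c) *\<^sub>R z))"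
   using integral_affine[of "-c" "%y. f y * ft m y" x] c by simp
  also have "... = (BI z. (\<bar>c\<bar> ^ DIM('a)) *\<^sub>R (f (x + (-c) *\<^sub>R z) * ft m (x + (-c) *\<^sub>R z)))" by simp
  also have "... = (BI z. cof (gauss z) * f (x - c *\<^sub>R z))"
  proof (intro Bochner_Integration.integral_cong refl)
   fix z
   have "ft m (x + (-c) *\<^sub>R z) = ft (%\<xi>. cof (gauss (c *\<^sub>R \<xi>))) (c *\<^sub>R (- z))"
    unfolding m_def by (subst ft_modulate) simp
   then have "\<bar>c\<bar> ^ DIM('a) *\<^sub>R ft m (x + (-c) *\<^sub>R z) = cof (gauss z)"
    using ft_scale[OF c, of "%x. cof (gauss x)" "- z"] by (simp add: ft_gauss)
   then show "(\<bar>c\<bar> ^ DIM('a)) *\<^sub>R (f (x + (-c) *\<^sub>R z) * ft m (x + (-c) *\<^sub>R z)) = cof (gauss z) * f (x - c *\<^sub>R z)"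
    by (metis mult_scaleR_right mult.commute add_uminus_conv_diff scaleR_minus_left)
  qed
  finally show ?thesis unfolding G_def c_def by simp
 qed
 have Glim: "(%n. G n x) \<longlonglongrightarrow> ft (ft f) (- x)" for x
  unfolding Geq unfolding ft_def[of "ft f"]
 proof (rule integral_dominated_convergence[where w="%\<xi>. norm (ft f \<xi>)"])
  show "AE \<xi> in lborel. (%n. ft f \<xi> * cof (gauss ((1 / real (Suc n)) *\<^sub>R \<xi>)) * cis (2 * pi * (x \<bullet> \<xi>))) \<longlonglongrightarrow> ft f \<xi> * cis (- 2 * pi * (- x \<bullet> \<xi>))"
  proof (rule AE_I2)
   fix \<xi> :: 'a
   have "(%n. 1 / real (Suc n)) \<longlonglongrightarrow> 0" by (rule LIMSEQ_Suc, rule lim_1_over_n)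
   then have "(%n. (1 / real (Suc n)) *\<^sub>R \<xi>) \<longlonglongrightarrow> 0 *\<^sub>R \<xi>" by (intro tendsto_intros)
   then have "(%n. cof (gauss ((1 / real (Suc n)) *\<^sub>R \<xi>))) \<longlonglongrightarrow> cof (exp (- pi * (norm (0 *\<^sub>R \<xi>))\<^sup>2))"
    unfolding gauss_def by (intro tendsto_of_real tendsto_exp tendsto_mult tendsto_const tendsto_power tendsto_norm)
   then have "(%n. ft f \<xi> * cof (gauss ((1 / real (Suc n)) *\<^sub>R \<xi>)) * cis (2 * pi * (x \<bullet> \<xi>))) \<longlonglongrightarrow> ft f \<xi> * cof (exp (- pi * (norm (0 *\<^sub>R \<xi>))\<^sup>2)) * cis (2 * pi * (x \<bullet> \<xi>))"
    by (intro tendsto_mult tendsto_const)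
   then show "(%n. ft f \<xi> * cof (gauss ((1 / real (Suc n)) *\<^sub>R \<xi>)) * cis (2 * pi * (x \<bullet> \<xi>))) \<longlonglongrightarrow> ft f \<xi> * cis (- 2 * pi * (- x \<bullet> \<xi>))"
    by simp
  qed
  show "AE \<xi> in lborel. norm (ft f \<xi> * cof (gauss ((1 / real (Suc n)) *\<^sub>R \<xi>)) * cis (2 * pi * (x \<bullet> \<xi>))) <= norm (ft f \<xi>)" for n
   by (rule AE_I2) (auto simp: norm_mult gauss_def mult_left_le)
  show "integrable lborel (%\<xi>. norm (ft f \<xi>))" using F by simp
 qed measurable
 \<comment> \<open>Since the extended integrals tend to 0 they are finite from some
   \<open>n0\<close> on; only from there is the difference known to be integrable.\<close>
 obtain n0 where n0: "!!n. n \<ge> n0 ==> pint 1 lborel (%x. G n x - f x) < top"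
  using order_tendstoD(2)[OF lim0, of top] by (auto simp: eventually_sequentially)
 define u where "u n x = G (n + n0) x - f x" for n x
 have ui: "integrable lborel (u n)" for n
  using n0[of "n + n0"] unfolding u_def by (simp add: integrable_iff_bounded pint_def)
 have "(%n. ennreal (BI x. norm (u n x))) \<longlonglongrightarrow> ennreal 0"
 proof -
  have "ennreal (BI x. norm (u n x)) = pint 1 lborel (%x. G (n + n0) x - f x)" for n
  proof -
   have "pint 1 lborel (%x. G (n + n0) x - f x) = (NI x. enorm (u n x))"
    by (simp add: pint_def u_def)
   also have "... = ennreal (BI x. norm (u n x))"
    using ui[of n] by (intro nn_integral_eq_integral) auto
   finally show ?thesis by simp
  qed
  then show ?thesis using LIMSEQ_ignore_initial_segment[OF lim0, of n0] by simp
 qed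
 then have "(%n. (BI x. norm (u n x))) \<longlonglongrightarrow> 0"
  by (subst (asm) tendsto_ennreal_iff) auto
 from tendsto_L1_AE_subseq[OF ui this] obtain r where r: "strict_mono r" "AE x in lborel. (%n. u (r n) x) \<longlonglongrightarrow> 0" by auto
 from r(2) show ?thesis
 proof eventually_elim
  case (elim x)
  have "(%n. u (r n) x + f x) \<longlonglongrightarrow> 0 + f x" by (intro tendsto_intros elim)
  then have "(%n. G (r n + n0) x) \<longlonglongrightarrow> f x" by (simp add: u_def)
  moreover have "(%n. G (r n + n0) x) \<longlonglongrightarrow> ft (ft f) (- x)"
   using LIMSEQ_subseq_LIMSEQ[OF LIMSEQ_ignore_initial_segment[OF Glim, of n0] r(1)] by (simp add: comp_def)
  ultimately show ?case by (rule LIMSEQ_unique)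
 qed
qed

corollary ft_zero_imp_AE_zero:
 fixes f :: "'a::euclidean_space => complex"
 assumes f: "integrable lborel f" and "!!\<xi>. ft f \<xi> = 0"
 shows "AE x in lborel. f x = 0"
proof -
 have "ft f = (%_. 0)" using assms by auto
 then show ?thesis using fourier_inversion[OF f] by (simp add: ft_def)
qed

lemma AE_eq_continuous_imp_eq:
 fixes f g :: "'a::euclidean_space => complex"
 assumes "continuous_on UNIV f" "continuous_on UNIV g" "AE x in lborel. f x = g x"
 shows "f x = g x"
proof (rule ccontr)
 assume "f x ~= g x"
 have o: "open {x. f x ~= g x}" using assms by (intro open_Collect_neq)
 have "emeasure lborel {x. f x ~= g x} = 0"
  using assms(3) o by (subst (asm) AE_iff_measurable[of "{x. f x ~= g x}"]) (auto intro: borel_open)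
 then have "{x. f x ~= g x} \<in> null_sets lborel" using o by (auto simp: null_sets_def intro: borel_open)
 then have "negligible {x. f x ~= g x}"
  by (simp add: negligible_iff_null_sets null_sets_completionI)
 with open_not_negligible[OF o] \<open>f x \<noteq> g x\<close> show False by auto
qed

section \<open>Schwartz functions\<close>

text \<open>A product, hence integrable in every dimension by reduction to the line, and well
  matched to product kernels and lattice sums. It is the common majorant for Schwartz functions,
  their transforms, windows and windowed functions.\<close>

definition wt :: "'a::euclidean_space => real" where
 "wt x = (\<Prod>b\<in>Basis. 1 / (1 + (x \<bullet> b)\<^sup>2))"

lemma wt_pos: "0 < wt x"
 unfolding wt_def by (intro prod_pos) (auto simp: add_pos_nonneg)

lemma abs_wt [simp]: "\<bar>wt x\<bar> = wt x"
 using wt_pos[of x] by simp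

lemma integrable_inverse_square_1: "integrable lborel (%t::real. 1 / (1 + t\<^sup>2))"
 using integrable_I0i_1_div_plus_square integrable_inverse_1_plus_square
 by (simp add: divide_inverse set_integrable_def einterval_eq)

lemma measurable_wt [measurable]: "wt \<in> bm"
 unfolding wt_def[abs_def] by measurable

lemma integrable_wt: "integrable lborel (wt :: 'a::euclidean_space => real)"
proof -
 have "integrable lborel (%t::real. cof (1 / (1 + t\<^sup>2)))"
  by (rule integrable_of_real) (rule integrable_inverse_square_1)
 then have "integrable lborel (%x::'a. cof (wt x))"
  using lborel_prod_integral(1)[of "%(_::'a) t. cof (1 / (1 + t\<^sup>2))"] by (simp add: wt_def)
 then show ?thesis by (simp add: complex_of_real_integrable_eq)
qed

lemma norm_pow_le_wt:
 fixes x :: "'a::euclidean_space"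
 shows "1 <= (1 + norm x) ^ (2 * DIM('a)) * wt x"
proof -
 have "(\<Prod>b\<in>Basis. 1 + (x \<bullet> b)\<^sup>2) <= (\<Prod>b\<in>(Basis::'a set). (1 + norm x)\<^sup>2)"
 proof (intro prod_mono conjI)
  fix b :: 'a assume "b \<in> Basis"
  then have "(x \<bullet> b)\<^sup>2 <= (norm x)\<^sup>2"
   by (metis Basis_le_norm power2_abs power_mono abs_ge_zero)
  then show "1 + (x \<bullet> b)\<^sup>2 <= (1 + norm x)\<^sup>2" by (simp add: power2_sum add_increasing2)
 qed auto
 also have "... = (1 + norm x) ^ (2 * DIM('a))" by (simp add: power_mult)
 finally have "(\<Prod>b\<in>Basis. 1 + (x \<bullet> b)\<^sup>2) <= (1 + norm x) ^ (2 * DIM('a))" .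
 moreover have "0 < (\<Prod>b\<in>Basis. 1 + (x \<bullet> b)\<^sup>2)" by (intro prod_pos) (auto simp: add_pos_nonneg)
 ultimately show ?thesis
  unfolding wt_def prod_dividef by (simp add: field_simps)
qed

lemma one_plus_power_le: "0 <= t ==> (1 + t) ^ m <= 2 ^ m * (1 + t ^ m)" for t :: real
proof (cases "t <= 1")
 case True
 assume "0 <= t"
 then have "(1 + t) ^ m <= 2 ^ m" using True by (intro power_mono) auto
 also have "... <= 2 ^ m * (1 + t ^ m)" using \<open>0 \<le> t\<close> by simp
 finally show ?thesis .
next
 case False
 then have "(1 + t) ^ m <= (2 * t) ^ m" by (intro power_mono) auto
 also have "... <= 2 ^ m * (1 + t ^ m)" by (simp add: power_mult_distrib)
 finally show ?thesis .
qed

lemma schwartz_deriv_bound: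
 fixes \<psi> :: "'a::euclidean_space => complex"
 assumes "schwartz \<psi>" "set vs \<subseteq> Basis"
 obtains C where "0 <= C" "!!x. norm (iterated_deriv vs \<psi> x) <= C * wt x"
proof -
 let ?D = "iterated_deriv vs \<psi>" and ?m = "2 * DIM('a)"
 have b: "bounded (range (%x. norm x ^ m *\<^sub>R ?D x))" for m
  using assms by (auto simp: schwartz_def)
 obtain A where A: "!!x. norm (?D x) <= A" using b[of 0] by (auto simp: bounded_iff)
 obtain B where B: "!!x. norm x ^ ?m * norm (?D x) <= B" using b[of ?m] by (auto simp: bounded_iff)
 show thesis
 proof (rule that)
  show "0 <= 2 ^ ?m * (\<bar>A\<bar> + \<bar>B\<bar>)" by simp
  fix x
  have "norm (?D x) <= (1 + norm x) ^ ?m * wt x * norm (?D x)"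
   using mult_right_mono[OF norm_pow_le_wt[of x], of "norm (?D x)"] by simp
  also have "... <= (2 ^ ?m * (1 + norm x ^ ?m)) * wt x * norm (?D x)"
   using wt_pos[of x] by (intro mult_right_mono one_plus_power_le) auto
  also have "... = 2 ^ ?m * (norm (?D x) + norm x ^ ?m * norm (?D x)) * wt x" by (simp add: algebra_simps)
  also have "... <= 2 ^ ?m * (\<bar>A\<bar> + \<bar>B\<bar>) * wt x"
   using A[of x] B[of x] wt_pos[of x] by (intro mult_right_mono mult_left_mono add_mono) auto
  finally show "norm (?D x) <= 2 ^ ?m * (\<bar>A\<bar> + \<bar>B\<bar>) * wt x" .
 qed
qed

lemma schwartz_deriv_differentiable:
 assumes "schwartz \<psi>" "set vs \<subseteq> Basis"
 shows "(iterated_deriv vs \<psi> has_derivative frechet_derivative (iterated_deriv vs \<psi>) (at x)) (at x)"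
 using assms by (auto simp: schwartz_def differentiable_on_def frechet_derivative_works[symmetric])

lemma schwartz_deriv_integrable:
 fixes \<psi> :: "'a::euclidean_space => complex"
 assumes "schwartz \<psi>" "set vs \<subseteq> Basis"
 shows "integrable lborel (iterated_deriv vs \<psi>)"
proof -
 obtain C where C: "0 <= C" "!!x. norm (iterated_deriv vs \<psi> x) <= C * wt x"
  using schwartz_deriv_bound[OF assms] by blast
 have "continuous_on UNIV (iterated_deriv vs \<psi>)"
  using assms by (auto simp: schwartz_def intro: differentiable_imp_continuous_on)
 then have [measurable]: "iterated_deriv vs \<psi> \<in> bm" by (rule borel_measurable_continuous_onI)
 show ?thesis
  by (rule Bochner_Integration.integrable_bound[OF integrable_mult_right[OF integrable_wt, of C]])
   (use C wt_pos in \<open>auto simp: abs_mult less_imp_le intro!: AE_I2\<close>)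
qed

text \<open>A shift of length at most 1 costs only a constant factor, so the difference quotients of
  a function whose derivative is dominated by \<open>wt\<close> are dominated by \<open>wt\<close>
  too.\<close>

lemma wt_shift:
 fixes x b :: "'a::euclidean_space"
 assumes b: "b \<in> Basis" and t: "0 <= t" "t <= 1"
 shows "wt (x + t *\<^sub>R b) <= 3 * wt x"
proof -
 have *: "1 / (1 + (s + t)\<^sup>2) <= 3 * (1 / (1 + s\<^sup>2))" for s :: real
 proof -
  have "s\<^sup>2 = ((s + t) + (- t))\<^sup>2" by simp
  also have "... <= 2 * (s + t)\<^sup>2 + 2 * (- t)\<^sup>2"
   using zero_le_power2[of "s + t + t"] by (simp add: power2_eq_square algebra_simps)
  also have "... <= 2 * (s + t)\<^sup>2 + 2" using t by (simp add: power_le_one)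
  finally have "1 + s\<^sup>2 <= 3 + 2 * (s + t)\<^sup>2" by simp
  also have "... <= 3 * (1 + (s + t)\<^sup>2)" unfolding distrib_left by (intro add_mono mult_right_mono) auto
  finally have "1 + s\<^sup>2 <= 3 * (1 + (s + t)\<^sup>2)" .
  moreover have "0 < 1 + s\<^sup>2" "0 < 1 + (s + t)\<^sup>2" by (simp_all add: add_pos_nonneg)
  ultimately show ?thesis by (simp add: field_simps)
 qed
 have e: "(\<Prod>c\<in>Basis. g c (y \<bullet> c)) = g b (y \<bullet> b) * (\<Prod>c\<in>Basis - {b}. g c (y \<bullet> c))" for g :: "'a => real => real" and y
  using b by (intro prod.remove) auto
 have "wt (x + t *\<^sub>R b) = 1 / (1 + (x \<bullet> b + t)\<^sup>2) * (\<Prod>c\<in>Basis - {b}. 1 / (1 + (x \<bullet> c)\<^sup>2))"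
  unfolding wt_def e[of "%c s. 1 / (1 + s\<^sup>2)"]
  using b by (intro arg_cong2[where f="(*)"] prod.cong) (auto simp: inner_add_left inner_Basis)
 also have "... <= 3 * (1 / (1 + (x \<bullet> b)\<^sup>2)) * (\<Prod>c\<in>Basis - {b}. 1 / (1 + (x \<bullet> c)\<^sup>2))"
  by (intro mult_right_mono * prod_nonneg) auto
 also have "... = 3 * wt x"
  unfolding wt_def e[of "%c s. 1 / (1 + s\<^sup>2)"] by simp
 finally show ?thesis .
qed

text \<open>Integration by parts in one direction; by translation invariance no iterated integrals are needed.\<close>

lemma ft_directional_derivative:
 fixes \<phi> :: "'a::euclidean_space => complex"
 assumes b: "b \<in> Basis" and d: "!!x. (\<phi> has_derivative \<phi>' x) (at x)"
  and bd: "!!x. norm (\<phi> x) <= C * wt x" "!!x. norm (\<phi>' x b) <= C * wt x"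
  and int: "integrable lborel \<phi>" "integrable lborel (%x. \<phi>' x b)"
 shows "ft (%x. \<phi>' x b) \<xi> = 2 * pi * \<i> * (\<xi> \<bullet> b) * ft \<phi> \<xi>"
proof -
 define e where "e x = cis (- 2 * pi * (\<xi> \<bullet> x))" for x
 define \<Phi> where "\<Phi> x = \<phi> x * e x" for x
 define D where "D x = \<phi>' x b * e x - 2 * pi * \<i> * (\<xi> \<bullet> b) * (\<phi> x * e x)" for x
 have "continuous_on UNIV \<phi>" using d by (meson continuous_at_imp_continuous_on has_derivative_continuous)
 then have [measurable]: "\<phi> \<in> bm" by (rule borel_measurable_continuous_onI)
 have [measurable]: "(%x. \<phi>' x b) \<in> bm" using int by auto
 have [measurable]: "e \<in> bm" "\<Phi> \<in> bm" "D \<in> bm"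
  unfolding e_def[abs_def] \<Phi>_def[abs_def] D_def[abs_def] by measurable
 have C0: "0 <= C"
  using order_trans[OF norm_ge_zero bd(1)[of 0]] wt_pos[of "0::'a"] by (simp add: zero_le_mult_iff)
 define K where "K = C + 2 * pi * \<bar>\<xi> \<bullet> b\<bar> * C"
 have K0: "0 <= K" using C0 by (simp add: K_def)
 have ne: "norm (e x) = 1" for x by (simp add: e_def)
 have Db: "norm (D x) <= K * wt x" for x
 proof -
  have "norm (D x) <= norm (\<phi>' x b) + 2 * pi * \<bar>\<xi> \<bullet> b\<bar> * norm (\<phi> x)"
   unfolding D_def by (rule order_trans[OF norm_triangle_ineq4]) (simp add: norm_mult ne)
  also have "... <= C * wt x + 2 * pi * \<bar>\<xi> \<bullet> b\<bar> * (C * wt x)"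
   by (intro add_mono mult_left_mono bd) auto
  finally show ?thesis by (simp add: K_def algebra_simps)
 qed
 have vd: "((%t. \<Phi> (x + t *\<^sub>R b)) has_vector_derivative D (x + t *\<^sub>R b)) (at t)" for x t
 proof -
  have 1: "((%t. \<phi> (x + t *\<^sub>R b)) has_vector_derivative \<phi>' (x + t *\<^sub>R b) b) (at t)"
  proof -
   have "((%t. \<phi> (x + t *\<^sub>R b)) has_derivative (%h. \<phi>' (x + t *\<^sub>R b) (h *\<^sub>R b))) (at t)"
    by (rule has_derivative_compose[OF _ d]) (auto intro!: derivative_eq_intros)
   moreover have "\<phi>' (x + t *\<^sub>R b) (h *\<^sub>R b) = h *\<^sub>R \<phi>' (x + t *\<^sub>R b) b" for h
    using d by (intro linear_scale has_derivative_linear)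
   ultimately show ?thesis by (simp add: has_vector_derivative_def)
  qed
  have 2: "((%t. e (x + t *\<^sub>R b)) has_vector_derivative (- (2 * pi * \<i> * (\<xi> \<bullet> b)) * e (x + t *\<^sub>R b))) (at t)"
   unfolding e_def cis_conv_exp
   by (rule has_vector_derivative_real_field derivative_eq_intros refl | simp add: inner_add_right algebra_simps)+
  show ?thesis
   unfolding \<Phi>_def D_def
   by (rule has_vector_derivative_eq_rhs[OF has_vector_derivative_mult[OF 1 2]]) (simp add: algebra_simps)
 qed
 \<comment> \<open>The difference quotients of \<open>\<Phi>\<close> in direction \<open>b\<close>
   have integral 0, since \<open>\<Phi>\<close> and its translates have the same integral. They
   converge to \<open>D\<close> under a common majorant, so the integral of \<open>D\<close> is 0,
   and this is the claim.\<close>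
 define q where "q n x = real (Suc n) *\<^sub>R (\<Phi> (x + (1 / real (Suc n)) *\<^sub>R b) - \<Phi> x)" for n x
 have qb: "norm (q n x) <= 3 * K * wt x" for n x
 proof -
  let ?h = "1 / real (Suc n)"
  have "norm (\<Phi> (x + ?h *\<^sub>R b) - \<Phi> (x + 0 *\<^sub>R b)) <= 3 * K * wt x * norm (?h - 0)"
  proof (rule differentiable_bound[where S="{0..1}" and f'="%t h. h *\<^sub>R D (x + t *\<^sub>R b)"])
   fix t :: real assume t: "t \<in> {0..1}"
   show "((%t. \<Phi> (x + t *\<^sub>R b)) has_derivative (%h. h *\<^sub>R D (x + t *\<^sub>R b))) (at t within {0..1})"
    using vd[of x t] by (simp add: has_vector_derivative_def has_derivative_at_withinI)
   have "norm (D (x + t *\<^sub>R b)) <= K * wt (x + t *\<^sub>R b)" by (rule Db)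
   also have "... <= K * (3 * wt x)" using wt_shift[OF b, of t x] t K0 by (intro mult_left_mono) auto
   finally have Dle: "norm (D (x + t *\<^sub>R b)) <= K * (3 * wt x)" .
   show "onorm (%h. h *\<^sub>R D (x + t *\<^sub>R b)) <= 3 * K * wt x"
   proof (rule onorm_le)
    fix h :: real
    show "norm (h *\<^sub>R D (x + t *\<^sub>R b)) <= 3 * K * wt x * norm h"
     using mult_right_mono[OF Dle, of "\<bar>h\<bar>"] by (simp add: mult_ac)
   qed
  qed auto
  then have "real (Suc n) * norm (\<Phi> (x + ?h *\<^sub>R b) - \<Phi> x) <= real (Suc n) * (3 * K * wt x * ?h)"
   by (intro mult_left_mono) auto
  then show ?thesis by (simp add: q_def)
 qed
 have qlim: "(%n. q n x) \<longlonglongrightarrow> D x" for x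
 proof -
  have "(%h. norm (\<Phi> (x + (0 + h) *\<^sub>R b) - \<Phi> (x + 0 *\<^sub>R b) - h *\<^sub>R D (x + 0 *\<^sub>R b)) / norm h) \<midarrow>0\<rightarrow> 0"
   using vd[of x 0] unfolding has_vector_derivative_def has_derivative_at by simp
  moreover have "filterlim (%n. 1 / real (Suc n)) (at 0) sequentially"
   unfolding filterlim_at by (intro conjI LIMSEQ_Suc lim_1_over_n) (auto intro!: always_eventually)
  ultimately have "(%n. norm (\<Phi> (x + (0 + 1 / real (Suc n)) *\<^sub>R b) - \<Phi> (x + 0 *\<^sub>R b) - (1 / real (Suc n)) *\<^sub>R D (x + 0 *\<^sub>R b)) / norm (1 / real (Suc n))) \<longlonglongrightarrow> 0"
   by (rule filterlim_compose)
  moreover have "norm (\<Phi> (x + (0 + 1 / real (Suc n)) *\<^sub>R b) - \<Phi> (x + 0 *\<^sub>R b) - (1 / real (Suc n)) *\<^sub>R D (x + 0 *\<^sub>R b)) / norm (1 / real (Suc n)) = norm (q n x - D x)" for n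
  proof -
   have "q n x - D x = real (Suc n) *\<^sub>R (\<Phi> (x + (1 / real (Suc n)) *\<^sub>R b) - \<Phi> x - (1 / real (Suc n)) *\<^sub>R D x)"
    unfolding q_def scaleR_diff_right by simp
   then show ?thesis by (simp only: norm_scaleR) simp
  qed
  ultimately have "(%n. norm (q n x - D x)) \<longlonglongrightarrow> 0" by (simp only:)
  then show ?thesis by (simp add: tendsto_norm_zero_iff LIM_zero_iff)
 qed
 have i\<Phi>: "integrable lborel \<Phi>" unfolding \<Phi>_def e_def using int by (intro integrable_mult_cis) auto
 have "(%n. (BI x. q n x)) \<longlonglongrightarrow> (BI x. D x)"
 proof (rule integral_dominated_convergence[where w="%x. 3 * K * wt x"])
  show "integrable lborel (%x::'a. 3 * K * wt x)" by (intro integrable_mult_right integrable_wt)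
  show "q n \<in> borel_measurable lborel" for n unfolding q_def[abs_def] by measurable
 qed (use qb qlim in auto)
 moreover have "(BI x. q n x) = 0" for n
  unfolding q_def using i\<Phi> integrable_translate(1)[OF i\<Phi>] by (simp add: integral_translate)
 ultimately have "(BI x. D x) = 0" by (simp add: LIMSEQ_const_iff)
 moreover have "(BI x. D x) = ft (%x. \<phi>' x b) \<xi> - 2 * pi * \<i> * (\<xi> \<bullet> b) * ft \<phi> \<xi>"
  unfolding D_def e_def ft_def using int
  by (subst Bochner_Integration.integral_diff) (auto intro!: integrable_mult_cis integrable_mult_right)
 ultimately show ?thesis by simp
qed

lemma ft_iterated_deriv:
 fixes \<psi> :: "'a::euclidean_space => complex"
 assumes s: "schwartz \<psi>" and b: "b \<in> Basis"
 shows "ft (iterated_deriv (replicate m b) \<psi>) \<xi> = (2 * pi * \<i> * (\<xi> \<bullet> b)) ^ m * ft \<psi> \<xi>"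
proof (induction m)
 case (Suc m)
 let ?vs = "replicate m b"
 have vs: "set ?vs \<subseteq> Basis" "set (b # ?vs) \<subseteq> Basis" using b by auto
 obtain C where C: "0 <= C" "!!x. norm (iterated_deriv ?vs \<psi> x) <= C * wt x"
  using schwartz_deriv_bound[OF s vs(1)] by blast
 obtain C' where C': "0 <= C'" "!!x. norm (iterated_deriv (b # ?vs) \<psi> x) <= C' * wt x"
  using schwartz_deriv_bound[OF s vs(2)] by blast
 have "ft (%x. frechet_derivative (iterated_deriv ?vs \<psi>) (at x) b) \<xi> = 2 * pi * \<i> * (\<xi> \<bullet> b) * ft (iterated_deriv ?vs \<psi>) \<xi>"
 proof (rule ft_directional_derivative[OF b, where C="C + C'" and \<phi>'="%x. frechet_derivative (iterated_deriv ?vs \<psi>) (at x)"])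
  fix x
  show "norm (iterated_deriv ?vs \<psi> x) <= (C + C') * wt x"
   using C(2)[of x] C'(1) wt_pos[of x] by (simp add: distrib_right add_increasing2 less_imp_le)
  show "norm (frechet_derivative (iterated_deriv ?vs \<psi>) (at x) b) <= (C + C') * wt x"
   using C'(2)[of x] C(1) wt_pos[of x] by (simp add: distrib_right add_increasing less_imp_le)
 qed (use schwartz_deriv_differentiable[OF s vs(1)] schwartz_deriv_integrable[OF s vs(1)] schwartz_deriv_integrable[OF s vs(2)] in auto)
 then show ?case using Suc by simp
qed simp

lemma schwartz_integrable: "schwartz \<psi> ==> integrable lborel \<psi>"
 using schwartz_deriv_integrable[of \<psi> "[]"] by simp

text \<open>The transform is bounded by a multiple of \<open>wt\<close>. Taking
  \<open>2 * DIM('a)\<close> derivatives in the direction of the largest frequency coordinate, of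
  modulus \<open>M\<close>, gains \<open>M ^ (2 * DIM('a))\<close>, which pays for all factors
  \<open>1 + (\<xi> \<bullet> b)^2\<close> together.\<close>

lemma schwartz_ft_integrable:
 fixes \<psi> :: "'a::euclidean_space => complex"
 assumes s: "schwartz \<psi>"
 shows "integrable lborel (ft \<psi>)"
proof -
 let ?m = "2 * DIM('a)"
 define A where "A v = (BI x. norm (iterated_deriv v \<psi> x))" for v
 define B where "B = A [] + (\<Sum>b\<in>Basis. A (replicate ?m b))"
 have A0: "0 <= A v" for v unfolding A_def by simp
 have e: "norm (ft \<psi> \<xi>) <= A []" for \<xi> unfolding A_def using norm_ft_le[of \<psi> \<xi>] by simp
 have eb: "\<bar>\<xi> \<bullet> b\<bar> ^ ?m * norm (ft \<psi> \<xi>) <= A (replicate ?m b)" if b: "b \<in> Basis" for b \<xi>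
 proof -
  have "\<bar>\<xi> \<bullet> b\<bar> ^ ?m * norm (ft \<psi> \<xi>) <= (2 * pi * \<bar>\<xi> \<bullet> b\<bar>) ^ ?m * norm (ft \<psi> \<xi>)"
   using pi_gt3 by (intro mult_right_mono power_mono mult_left_le_one_le) (auto simp: mult_le_cancel_right1)
  also have "... = norm (ft (iterated_deriv (replicate ?m b) \<psi>) \<xi>)"
   by (simp add: ft_iterated_deriv[OF s b] norm_mult norm_power)
  also have "... <= A (replicate ?m b)" unfolding A_def by (rule norm_ft_le)
  finally show ?thesis .
 qed
 have bound: "norm (ft \<psi> \<xi>) <= 2 ^ DIM('a) * B * wt \<xi>" for \<xi>
 proof -
  define M where "M = Max ((%b. \<bar>\<xi> \<bullet> b\<bar>) ` Basis)"
  have Mb: "\<bar>\<xi> \<bullet> b\<bar> <= M" if "b \<in> Basis" for b unfolding M_def using that by (intro Max_ge) auto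
  have "M \<in> (%b. \<bar>\<xi> \<bullet> b\<bar>) ` Basis" unfolding M_def by (intro Max_in) auto
  then obtain b where b: "b \<in> Basis" "M = \<bar>\<xi> \<bullet> b\<bar>" by auto
  have M0: "0 <= M" using b by simp
  have p0: "0 < (\<Prod>b\<in>Basis. 1 + (\<xi> \<bullet> b)\<^sup>2)" by (intro prod_pos) (auto simp: add_pos_nonneg)
  have "(\<Prod>b\<in>Basis. 1 + (\<xi> \<bullet> b)\<^sup>2) <= (\<Prod>b\<in>(Basis::'a set). 1 + M\<^sup>2)"
   using Mb by (intro prod_mono) (auto intro: abs_le_square_iff[THEN iffD1] simp: abs_le_square_iff[symmetric] M0)
  also have "... = (1 + M\<^sup>2) ^ DIM('a)" by simp
  also have "... <= 2 ^ DIM('a) * (1 + M ^ ?m)" using one_plus_power_le[of "M\<^sup>2" "DIM('a)"] by (simp add: power_mult)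
  finally have "(\<Prod>b\<in>Basis. 1 + (\<xi> \<bullet> b)\<^sup>2) * norm (ft \<psi> \<xi>) <= 2 ^ DIM('a) * (1 + M ^ ?m) * norm (ft \<psi> \<xi>)"
   by (intro mult_right_mono) auto
  also have "... = 2 ^ DIM('a) * (norm (ft \<psi> \<xi>) + M ^ ?m * norm (ft \<psi> \<xi>))" by (simp add: algebra_simps)
  also have "... <= 2 ^ DIM('a) * (A [] + A (replicate ?m b))"
   using e eb[OF b(1)] b(2) by (intro mult_left_mono add_mono) auto
  also have "... <= 2 ^ DIM('a) * B"
   unfolding B_def using A0 b(1) member_le_sum[of b Basis "%b. A (replicate ?m b)"] by (intro mult_left_mono add_mono) auto
  finally have "norm (ft \<psi> \<xi>) <= 2 ^ DIM('a) * B / (\<Prod>b\<in>Basis. 1 + (\<xi> \<bullet> b)\<^sup>2)"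
   using p0 by (simp add: field_simps)
  then show ?thesis unfolding wt_def prod_dividef by simp
 qed
 have B0: "0 <= B" unfolding B_def using A0 by (intro add_nonneg_nonneg sum_nonneg) auto
 have [measurable]: "\<psi> \<in> bm" using schwartz_integrable[OF s] by auto
 show ?thesis
  by (rule Bochner_Integration.integrable_bound[OF integrable_mult_right[OF integrable_wt, of "2 ^ DIM('a) * B"]])
   (use bound wt_pos B0 in \<open>auto simp: abs_mult less_imp_le intro!: AE_I2\<close>)
qed

section \<open>Translated Gaussians as Schwartz functions\<close>

inductive_set polyf :: "('a::euclidean_space => complex) set" where
 const: "(%x. c) \<in> polyf"
| lin: "(%x. cof (x \<bullet> v)) \<in> polyf"
| add: "P \<in> polyf ==> Q \<in> polyf ==> (%x. P x + Q x) \<in> polyf"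
| mult: "P \<in> polyf ==> Q \<in> polyf ==> (%x. P x * Q x) \<in> polyf"

lemma polyf_deriv:
 assumes "Q \<in> polyf"
 shows "\<exists>Q'. (\<forall>v. Q' v \<in> polyf) \<and> (\<forall>x. (Q has_derivative (%v. Q' v x)) (at x))"
 using assms
proof induction
 case (const c)
 show ?case by (rule exI[of _ "%v x. 0"]) (auto intro: polyf.const)
next
 case (lin w)
 show ?case
  by (rule exI[of _ "%v x. cof (v \<bullet> w)"]) (auto intro!: polyf.const derivative_eq_intros)
next
 case (add P Q)
 then obtain P' Q' where "\<forall>v. P' v \<in> polyf" "\<forall>v. Q' v \<in> polyf" "!!x. (P has_derivative (%v. P' v x)) (at x)"
  "!!x. (Q has_derivative (%v. Q' v x)) (at x)" by blast
 then show ?case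
  by (intro exI[of _ "%v x. P' v x + Q' v x"]) (auto intro!: polyf.add has_derivative_add)
next
 case (mult P Q)
 then obtain P' Q' where "\<forall>v. P' v \<in> polyf" "\<forall>v. Q' v \<in> polyf" "!!x. (P has_derivative (%v. P' v x)) (at x)"
  "!!x. (Q has_derivative (%v. Q' v x)) (at x)" by blast
 then show ?case using mult
  by (intro exI[of _ "%v x. P x * Q' v x + P' v x * Q x"]) (auto intro!: polyf.add polyf.mult has_derivative_mult)
qed

lemma polyf_bound:
 assumes "Q \<in> polyf"
 shows "\<exists>C m. 0 <= C \<and> (\<forall>x. norm (Q x) <= C * (1 + norm x) ^ m)"
 using assms
proof induction
 case (const c)
 show ?case by (rule exI[of _ "norm c"], rule exI[of _ 0]) auto
next
 case (lin w)
 have "norm (cof (x \<bullet> w)) <= norm w * (1 + norm x) ^ 1" for x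
  using Cauchy_Schwarz_ineq2[of x w] mult_left_mono[of "norm x" "1 + norm x" "norm w"] by (simp add: mult.commute)
 then show ?case by (intro exI[of _ "norm w"] exI[of _ 1]) auto
next
 case (add P Q)
 then obtain C m D n where b: "0 <= C" "0 <= D" "!!x. norm (P x) <= C * (1 + norm x) ^ m" "!!x. norm (Q x) <= D * (1 + norm x) ^ n"
  by blast
 have "norm (P x + Q x) <= (C + D) * (1 + norm x) ^ (m + n)" for x
 proof -
  have "norm (P x + Q x) <= C * (1 + norm x) ^ m + D * (1 + norm x) ^ n"
   using norm_triangle_ineq[of "P x" "Q x"] b(3,4)[of x] by linarith
  also have "... <= C * (1 + norm x) ^ (m + n) + D * (1 + norm x) ^ (m + n)"
   using b by (intro add_mono mult_left_mono power_increasing) auto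
  finally show ?thesis by (simp add: algebra_simps)
 qed
 then show ?case using b by (intro exI[of _ "C + D"] exI[of _ "m + n"]) auto
next
 case (mult P Q)
 then obtain C m D n where b: "0 <= C" "0 <= D" "!!x. norm (P x) <= C * (1 + norm x) ^ m" "!!x. norm (Q x) <= D * (1 + norm x) ^ n"
  by blast
 have "norm (P x * Q x) <= (C * D) * (1 + norm x) ^ (m + n)" for x
 proof -
  have "norm (P x * Q x) <= (C * (1 + norm x) ^ m) * (D * (1 + norm x) ^ n)"
   unfolding norm_mult using b by (intro mult_mono) auto
  then show ?thesis by (simp add: power_add mult_ac)
 qed
 then show ?case using b by (intro exI[of _ "C * D"] exI[of _ "m + n"]) auto
qed

lemma gauss_shift_deriv:
 fixes a :: "'a::euclidean_space"
 shows "((%x. cof (gauss (x - a))) has_derivative (%v. cof (- 2 * pi * ((x - a) \<bullet> v)) * cof (gauss (x - a)))) (at x)"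
proof -
 have "((%x. exp (- pi * ((x - a) \<bullet> (x - a)))) has_derivative (%v. exp (- pi * ((x - a) \<bullet> (x - a))) * (- pi * ((x - a) \<bullet> v + v \<bullet> (x - a))))) (at x)"
  by (auto intro!: derivative_eq_intros)
 then have "((%x. cof (exp (- pi * ((x - a) \<bullet> (x - a))))) has_derivative (%v. cof (exp (- pi * ((x - a) \<bullet> (x - a))) * (- pi * ((x - a) \<bullet> v + v \<bullet> (x - a)))))) (at x)"
  by (rule has_derivative_of_real)
 then show ?thesis
  by (rule has_derivative_eq_rhs[unfolded gauss_def[symmetric], rotated] | simp add: gauss_def power2_norm_eq_inner inner_commute algebra_simps)+
qed

text \<open>Polynomials times a Gaussian are stable under directional derivatives; with the decay of
  \<open>poly_gauss_bounded\<close> this gives every condition in \<open>schwartz\<close>.\<close>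

lemma iterated_deriv_gauss:
 fixes a :: "'a::euclidean_space"
 shows "\<exists>Q\<in>polyf. iterated_deriv vs (%x. cof (gauss (x - a))) = (%x. Q x * cof (gauss (x - a)))"
proof (induction vs)
 case Nil
 show ?case by (rule bexI[of _ "%x. 1"]) (auto intro: polyf.const)
next
 case (Cons v vs)
 let ?E = "%x. cof (gauss (x - a))"
 obtain Q where Q: "Q \<in> polyf" "iterated_deriv vs ?E = (%x. Q x * ?E x)" using Cons by blast
 obtain Q' where Q': "!!v. Q' v \<in> polyf" "!!x. (Q has_derivative (%v. Q' v x)) (at x)" using polyf_deriv[OF Q(1)] by blast
 define P where "P x = Q x * (cof (- 2 * pi) * (cof (x \<bullet> v) + cof (- (a \<bullet> v)))) + Q' v x" for x
 have P: "P \<in> polyf" unfolding P_def[abs_def] by (intro polyf.intros Q Q')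
 have "frechet_derivative (%x. Q x * ?E x) (at x) v = P x * ?E x" for x
 proof -
  have "((%x. Q x * ?E x) has_derivative (%v. Q x * (cof (- 2 * pi * ((x - a) \<bullet> v)) * ?E x) + Q' v x * ?E x)) (at x)"
   by (intro has_derivative_mult Q' gauss_shift_deriv)
  then have "frechet_derivative (%x. Q x * ?E x) (at x) = (%v. Q x * (cof (- 2 * pi * ((x - a) \<bullet> v)) * ?E x) + Q' v x * ?E x)"
   by (rule frechet_derivative_at[symmetric])
  then show ?thesis by (simp add: P_def algebra_simps)
 qed
 then show ?case using P Q by auto
qed

lemma poly_gauss_bounded:
 fixes a :: "'a::euclidean_space"
 shows "\<exists>B. \<forall>x. (1 + norm x) ^ k * gauss (x - a) <= B"
proof (intro exI allI)
 fix x :: 'a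
 define u where "u = 1 + norm a + norm (x - a)"
 \<comment> \<open>The successor keeps the divisor \<open>n\<close> positive when
   \<open>k = 0\<close>; the inequality \<open>(1 + u / n) ^ n \<le> exp u\<close> then bounds
   powers of \<open>u\<close>.\<close>
 define n where "n = Suc k"
 have u1: "1 <= u" by (simp add: u_def)
 have "(1 + norm x) <= u" unfolding u_def using norm_triangle_ineq[of "x - a" a] by simp
 then have "(1 + norm x) ^ k <= u ^ k" by (intro power_mono) auto
 also have "... <= u ^ n" unfolding n_def using u1 by (intro power_increasing) auto
 also have "... = real n ^ n * (u / real n) ^ n" by (simp add: power_mult_distrib[symmetric] n_def)
 also have "... <= real n ^ n * (1 + u / real n) ^ n" using u1 by (intro mult_left_mono power_mono) (auto simp: n_def)
 also have "... <= real n ^ n * exp u"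
  using u1 by (intro mult_left_mono exp_ge_one_plus_x_over_n_power_n) (auto simp: n_def)
 finally have "(1 + norm x) ^ k * gauss (x - a) <= real n ^ n * exp u * gauss (x - a)"
  by (intro mult_right_mono) (auto intro: less_imp_le)
 also have "... = real n ^ n * exp (u - pi * (norm (x - a))\<^sup>2)"
  by (simp add: gauss_def mult_exp_exp)
 also have "... <= real n ^ n * exp (2 + norm a)"
 proof -
  have "0 <= (norm (x - a) - 1)\<^sup>2" by simp
  then have "norm (x - a) <= 1 + (norm (x - a))\<^sup>2" unfolding power2_diff using norm_ge_zero[of "x - a"] zero_le_power2[of "norm (x - a)"]
   by (simp; linarith)
  also have "(norm (x - a))\<^sup>2 <= pi * (norm (x - a))\<^sup>2" using pi_gt3 by (simp add: mult_le_cancel_right1)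
  finally show ?thesis by (intro mult_left_mono) (auto simp: u_def)
 qed
 finally show "(1 + norm x) ^ k * gauss (x - a) <= real (Suc k) ^ Suc k * exp (2 + norm a)" by (simp add: n_def)
qed

lemma schwartz_gauss:
 fixes a :: "'a::euclidean_space"
 shows "schwartz (%x. cof (gauss (x - a)))"
 unfolding schwartz_def
proof (intro allI impI conjI)
 fix vs :: "'a list" and m :: nat
 let ?E = "%x. cof (gauss (x - a))"
 obtain Q where Q: "Q \<in> polyf" "iterated_deriv vs ?E = (%x. Q x * ?E x)" using iterated_deriv_gauss by blast
 obtain Q' where Q': "!!v. Q' v \<in> polyf" "!!x. (Q has_derivative (%v. Q' v x)) (at x)" using polyf_deriv[OF Q(1)] by blast
 have "(%x. Q x * ?E x) differentiable (at x)" for x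
  using has_derivative_mult[OF Q'(2) gauss_shift_deriv] unfolding differentiable_def by blast
 then show "iterated_deriv vs ?E differentiable_on UNIV"
  unfolding Q(2) differentiable_on_def by (auto intro: differentiable_at_withinI)
 obtain C k where C: "0 <= C" "!!x. norm (Q x) <= C * (1 + norm x) ^ k" using polyf_bound[OF Q(1)] by blast
 obtain B where B: "!!x. (1 + norm x) ^ (m + k) * gauss (x - a) <= B" using poly_gauss_bounded by blast
 have "norm (norm x ^ m *\<^sub>R (Q x * ?E x)) <= C * B" for x
 proof -
  have "norm (norm x ^ m *\<^sub>R (Q x * ?E x)) = norm x ^ m * norm (Q x) * gauss (x - a)"
   by (simp add: norm_mult less_imp_le abs_of_pos)
  also have "... <= (1 + norm x) ^ m * (C * (1 + norm x) ^ k) * gauss (x - a)"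
   using C by (intro mult_right_mono mult_mono power_mono) (auto intro: less_imp_le)
  also have "... = C * ((1 + norm x) ^ (m + k) * gauss (x - a))" by (simp add: power_add mult_ac)
  also have "... <= C * B" using B C by (intro mult_left_mono) auto
  finally show ?thesis .
 qed
 then show "bounded (range (%x. norm x ^ m *\<^sub>R iterated_deriv vs ?E x))"
  unfolding Q(2) bounded_iff by auto
qed

section \<open>Partial sum operators on Euclidean space\<close>

text \<open>Translates of one Gaussian are enough test functions: their transforms are
  \<open>gauss\<close> times all the exponentials. Hence the difference of two candidates, damped by
  \<open>gauss\<close>, is integrable with vanishing Fourier transform.\<close>

lemma fourier_restriction_unique:
 assumes "fourier_restriction R f g" "fourier_restriction R f h"
 shows "AE x in lborel. g x = h x"
proof -
 have [measurable]: "g \<in> bm" "h \<in> bm"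
  using assms by (auto simp: fourier_restriction_def)
 have E: "ft (%x. cof (gauss (x - a))) x = cof (gauss x) * cis (- 2 * pi * (a \<bullet> x))" for a x :: "real^'a"
  using ft_translate[of "%x. cof (gauss x)" a x] by (simp add: ft_gauss inner_commute)
 have r: "integrable lborel (%x. u x * (cof (gauss x) * cis (- 2 * pi * (a \<bullet> x)))) \<and>
   (BI x. u x * (cof (gauss x) * cis (- 2 * pi * (a \<bullet> x)))) =
   (BI x. f x * ft (%\<xi>. indicator R \<xi> * cof (gauss (\<xi> - a))) x)"
  if "fourier_restriction R f u" for u a
 proof -
  have "integrable lborel (%x. u x * ft (%x. cof (gauss (x - a))) x) \<and>
   (BI x. u x * ft (%x. cof (gauss (x - a))) x) =
   (BI x. f x * ft (%\<xi>. indicator R \<xi> * cof (gauss (\<xi> - a))) x)"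
   using that schwartz_gauss[of a] unfolding fourier_restriction_def fourier_eq_ft by blast
  then show ?thesis unfolding E .
 qed
 have s: "integrable lborel (%x. g x * (cof (gauss x) * cis (- 2 * pi * (a \<bullet> x))))"
  "integrable lborel (%x. h x * (cof (gauss x) * cis (- 2 * pi * (a \<bullet> x))))"
  "(BI x. g x * (cof (gauss x) * cis (- 2 * pi * (a \<bullet> x)))) =
  (BI x. h x * (cof (gauss x) * cis (- 2 * pi * (a \<bullet> x))))" for a
  using r[OF assms(1)] r[OF assms(2)] by metis+
 define d where "d x = (g x - h x) * cof (gauss x)" for x
 have "integrable lborel d"
  using Bochner_Integration.integrable_diff[OF s(1)[of 0] s(2)[of 0]] unfolding d_def by (simp add: algebra_simps)
 moreover have "ft d a = 0" for a
  using Bochner_Integration.integral_diff[OF s(1)[of a] s(2)[of a]] s(3)[of a]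
  unfolding d_def ft_def by (simp add: algebra_simps)
 ultimately have "AE x in lborel. d x = 0" by (rule ft_zero_imp_AE_zero)
 then show ?thesis
 proof eventually_elim
  case (elim x)
  then show ?case using gauss_pos[of x] by (auto simp: d_def)
 qed
qed

text \<open>The representative picked by choice is never inspected; this lets any explicit function
  satisfying the defining identity take its place.\<close>

lemma partial_sum_AE:
 assumes "fourier_restriction R f g"
 shows "AE x in lborel. partial_sum R f x = g x"
 using fourier_restriction_unique[OF someI[of "fourier_restriction R f", OF assms] assms]
 by (simp add: partial_sum_def)

lemma integrable_indicator_mult:
 fixes f :: "'a => complex"
 assumes "integrable M f" "R \<in> sets M"
 shows "integrable M (%x. indicator R x * f x)"
proof -
 have "(%x. indicat_real R x *\<^sub>R f x) = (%x. indicator R x * f x)" by (auto simp: indicator_def)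
 then show ?thesis using integrable_mult_indicator[OF assms(2,1)] by simp
qed

lemma integrable_indicator_complex:
 assumes "R \<in> sets M" "emeasure M R < top"
 shows "integrable M (indicator R :: 'a => complex)"
proof -
 have "(%x. cof (indicator R x)) = indicator R" by (auto simp: indicator_def)
 moreover have "integrable M (%x. cof (indicator R x))"
  using assms by (intro integrable_of_real integrable_real_indicator) auto
 ultimately show ?thesis by simp
qed

lemma integrable_mult_bounded:
 fixes f g :: "'a => complex"
 assumes "integrable M f" and [measurable]: "g \<in> borel_measurable M" and b: "!!x. norm (g x) <= B"
 shows "integrable M (%x. g x * f x)"
proof (rule Bochner_Integration.integrable_bound[OF integrable_mult_right[OF assms(1), of "cof B"]])
 show "AE x in M. norm (g x * f x) <= norm (cof B * f x)"
  using order_trans[OF b abs_ge_self[of B]] by (auto simp: norm_mult mult_right_mono)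
qed (use assms(1) in measurable)

text \<open>For integrable functions the distributional identity follows from the pointwise one by
  the multiplication formula. This case serves the polynomials times windows, whose transforms are
  known at every point.\<close>

lemma fourier_restriction_L1:
 assumes R [measurable]: "R \<in> sets borel" and f: "integrable lborel f" and h: "integrable lborel h"
  and e: "!!\<xi>. ft h \<xi> = indicator R \<xi> * ft f \<xi>"
 shows "fourier_restriction R f h"
 unfolding fourier_restriction_def fourier_eq_ft
proof (intro conjI allI impI)
 fix \<psi> :: "real^'a => complex" assume s: "schwartz \<psi>"
 note \<psi> = schwartz_integrable[OF s]
 have "integrable lborel (%x. ft \<psi> x * h x)"
  using norm_ft_le[of \<psi>] \<psi> by (intro integrable_mult_bounded h) auto
 then show "integrable lborel (%x. h x * ft \<psi> x)" by (simp add: mult.commute)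
 have "(BI x. h x * ft \<psi> x) = (BI x. ft h x * \<psi> x)" by (rule integral_ft_swap[OF h \<psi>])
 also have "... = (BI x. ft f x * (indicator R x * \<psi> x))" by (simp add: e mult_ac)
 also have "... = (BI x. f x * ft (%\<xi>. indicator R \<xi> * \<psi> \<xi>) x)"
  by (rule integral_ft_swap[symmetric, OF f]) (intro integrable_indicator_mult \<psi>, simp)
 finally show "(BI x. h x * ft \<psi> x) = (BI x. f x * ft (%\<xi>. indicator R \<xi> * \<psi> \<xi>) x)" .
qed (use h in auto)

definition conv :: "('a::euclidean_space => complex) => ('a => complex) => 'a => complex" where
 "conv k f x = (BI z. k z * f (x - z))"

lemma measurable_conv [measurable]:
 assumes [measurable]: "k \<in> bm" "f \<in> bm"
 shows "conv k f \<in> bm"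
 unfolding conv_def[abs_def] by measurable

text \<open>The inverse transform of the indicator. For a nondegenerate box it lies in
  \<open>L_q\<close> for all \<open>q > 1\<close> but not in \<open>L_1\<close>, so convolution with
  it is not covered by Young's inequality for integrable kernels.\<close>

definition ker :: "'a::euclidean_space set => 'a => complex" where
 "ker R x = ft (indicator R) (- x)"

lemma measurable_ker [measurable]: "R \<in> sets borel ==> ker R \<in> bm"
 unfolding ker_def[abs_def]
 by (intro measurable_compose[OF borel_measurable_uminus[OF measurable_ident_sets] measurable_ft] borel_measurable_indicator) auto

text \<open>Absolute convergence of the convolution, uniformly in the point. This one condition
  covers \<open>L_q\<close> kernels acting on \<open>L_p\<close> and integrable kernels acting on
  bounded functions, so the Fubini arguments below serve for both.\<close>

definition conv_bounded :: "('a::euclidean_space => complex) => ('a => complex) => real => bool" where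
 "conv_bounded k f M \<longleftrightarrow> (\<forall>x. (NI z. ennreal (norm (k z) * norm (f (x - z)))) <= ennreal M)"

lemma conv_boundedD:
 assumes "conv_bounded k f M" "0 <= M"
 shows "norm (conv k f x) <= M"
proof -
 have "enorm (conv k f x) <= (NI z. enorm (k z * f (x - z)))"
  unfolding conv_def by (rule nn_norm_integral_le)
 also have "... <= ennreal M" using assms by (simp add: conv_bounded_def norm_mult)
 finally show ?thesis using assms by (simp add: ennreal_le_iff)
qed

text \<open>The defining identity of \<^const>\<open>fourier_restriction\<close>, extended to all test functions of the form
 \<open>\<psi>(\<xi>) = \<F> \<theta> (- \<xi>)\<close> with \<open>\<theta>\<close> in \<open>L\<^sub>1\<close>, for which \<open>\<F> \<psi> = \<theta>\<close> whenever \<open>\<psi>\<close> is integrable.\<close>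

lemma conv_ker_pairing:
 fixes f \<theta> :: "'a::euclidean_space => complex"
 assumes R [measurable]: "R \<in> sets borel" "emeasure lborel R < top" and [measurable]: "f \<in> bm"
  and M: "conv_bounded (ker R) f M" and \<theta>: "integrable lborel \<theta>"
 shows "(BI x. conv (ker R) f x * \<theta> x) = (BI t. f t * ft (%\<xi>. indicator R \<xi> * ft \<theta> (- \<xi>)) t)"
proof -
 have [measurable]: "\<theta> \<in> bm" using \<theta> by auto
 have iR: "integrable lborel (indicator R :: 'a => complex)" using R by (intro integrable_indicator_complex) auto
 have fin: "(NI s. (NI t. enorm (ker R (s - t) * f t * \<theta> s))) < top"
 proof -
  have "(NI t. enorm (ker R (s - t) * f t * \<theta> s)) <= ennreal M * enorm (\<theta> s)" for s
  proof -
   have "(NI t. enorm (ker R (s - t) * f t * \<theta> s)) = (NI t. ennreal (norm (ker R (s - t)) * norm (f (s - (s - t))))) * enorm (\<theta> s)"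
    by (subst nn_integral_multc[symmetric]) (auto simp: norm_mult ennreal_mult')
   also have "(NI t. ennreal (norm (ker R (s - t)) * norm (f (s - (s - t))))) = (NI z. ennreal (norm (ker R z) * norm (f (s - z))))"
    by (rule nn_integral_translate(3)[where f="%z. ennreal (norm (ker R z) * norm (f (s - z)))"]) measurable
   also have "... <= ennreal M" using M by (simp add: conv_bounded_def)
   finally show ?thesis by (simp add: mult_right_mono)
  qed
  then have "(NI s. (NI t. enorm (ker R (s - t) * f t * \<theta> s))) <= (NI s. ennreal M * enorm (\<theta> s))"
   by (intro nn_integral_mono)
  also have "... < top" using \<theta> by (simp add: nn_integral_cmult ennreal_mult_less_top integrable_iff_bounded)
  finally show ?thesis .
 qed
 have "(BI x. conv (ker R) f x * \<theta> x) = (BI s. (BI t. ker R (s - t) * f t * \<theta> s))"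
 proof (intro Bochner_Integration.integral_cong refl)
  fix s
  have "conv (ker R) f s = (BI t. ker R (s - t) * f t)"
   unfolding conv_def using integral_translate(3)[of "%z. ker R z * f (s - z)" s] by simp
  then show "conv (ker R) f s * \<theta> s = (BI t. ker R (s - t) * f t * \<theta> s)" by simp
 qed
 also have "... = (BI t. (BI s. ker R (s - t) * f t * \<theta> s))"
  by (rule fubini_swap(1)[OF sigma_finite_lborel sigma_finite_lborel _ fin]) measurable
 also have "... = (BI t. f t * ft (%\<xi>. indicator R \<xi> * ft \<theta> (- \<xi>)) t)"
 proof (intro Bochner_Integration.integral_cong refl)
  fix t
  \<comment> \<open>Reflecting and translating \<open>\<theta>\<close> brings the inner integral
    into the shape of the multiplication formula, which exchanges the transform of the indicator for
    the indicator itself.\<close>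
  have \<theta>': "integrable lborel (%u. \<theta> (t - u))" by (rule integrable_translate[OF \<theta>])
  have ft\<theta>': "ft (%u. \<theta> (t - u)) \<xi> = ft \<theta> (- \<xi>) * cis (- 2 * pi * (t \<bullet> \<xi>))" for \<xi>
  proof -
   have "ft (%u. \<theta> (t - u)) \<xi> = (BI s. \<theta> (t - (t - s)) * cis (- 2 * pi * (\<xi> \<bullet> (t - s))))"
    unfolding ft_def using integral_translate(3)[of "%u. \<theta> (t - u) * cis (- 2 * pi * (\<xi> \<bullet> u))" t] by simp
   also have "... = (BI s. \<theta> s * cis (- 2 * pi * (- \<xi> \<bullet> s)) * cis (- 2 * pi * (t \<bullet> \<xi>)))"
    by (intro Bochner_Integration.integral_cong refl) (simp add: mult.assoc cis_mult inner_diff_right inner_commute algebra_simps)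
   finally show ?thesis by (simp add: ft_def)
  qed
  have "(BI s. ker R (s - t) * f t * \<theta> s) = f t * (BI s. \<theta> s * ft (indicator R) (t - s))"
   by (subst integral_mult_right_zero[symmetric]) (intro Bochner_Integration.integral_cong refl, simp add: ker_def mult_ac)
  also have "(BI s. \<theta> s * ft (indicator R) (t - s)) = (BI u. \<theta> (t - u) * ft (indicator R) u)"
   using integral_translate(3)[of "%s. \<theta> s * ft (indicator R) (t - s)" t] by simp
  also have "... = (BI \<xi>. ft (%u. \<theta> (t - u)) \<xi> * indicator R \<xi>)" by (rule integral_ft_swap[OF \<theta>' iR])
  also have "... = ft (%\<xi>. indicator R \<xi> * ft \<theta> (- \<xi>)) t"
   unfolding ft\<theta>' by (simp add: ft_def[of "%\<xi>. indicator R \<xi> * ft \<theta> (- \<xi>)"] mult_ac)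
  finally show "(BI s. ker R (s - t) * f t * \<theta> s) = f t * ft (%\<xi>. indicator R \<xi> * ft \<theta> (- \<xi>)) t" .
 qed
 finally show ?thesis .
qed

text \<open>Use the pairing with \<open>\<theta> = ft \<psi>\<close>: by inversion
  \<open>ft (ft \<psi>) (- \<xi>)\<close> is \<open>\<psi> \<xi>\<close> almost everywhere, which is
  enough under the outer transform.\<close>

lemma fourier_restriction_conv_ker:
 fixes f :: "real^'n::finite => complex"
 assumes R [measurable]: "R \<in> sets borel" "emeasure lborel R < top" and [measurable]: "f \<in> bm"
  and M: "conv_bounded (ker R) f M" "0 <= M"
 shows "fourier_restriction R f (conv (ker R) f)"
 unfolding fourier_restriction_def fourier_eq_ft
proof (intro conjI allI impI)
 show "conv (ker R) f \<in> borel_measurable lborel" by measurable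
 fix \<psi> :: "real^'n => complex" assume s: "schwartz \<psi>"
 note \<psi> = schwartz_integrable[OF s] and F = schwartz_ft_integrable[OF s]
 have [measurable]: "\<psi> \<in> bm" using \<psi> by auto
 show "integrable lborel (%x. conv (ker R) f x * ft \<psi> x)"
  using conv_boundedD[OF M] by (intro integrable_mult_bounded F) auto
 have "ft (%\<xi>. indicator R \<xi> * ft (ft \<psi>) (- \<xi>)) = ft (%\<xi>. indicator R \<xi> * \<psi> \<xi>)"
  using fourier_inversion[OF \<psi> F] by (intro ft_cong_AE) auto
 then show "(BI x. conv (ker R) f x * ft \<psi> x) = (BI x. f x * ft (%\<xi>. indicator R \<xi> * \<psi> \<xi>) x)"
  using conv_ker_pairing[OF R _ M(1) F] by simp
qed

lemma ft_indicator_Icc_le: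
 fixes a b t :: real
 assumes ab: "a <= b"
 shows "norm (ft (indicator {a..b}) t) <= b - a" "norm (ft (indicator {a..b}) t) * \<bar>t\<bar> <= 1"
proof -
 have m: "(BI x. norm (indicator {a..b} x :: complex)) = b - a"
 proof -
  have "(%x. norm (indicator {a..b} x :: complex)) = indicat_real {a..b}" by (auto simp: indicator_def)
  then show ?thesis using ab by simp
 qed
 then show "norm (ft (indicator {a..b}) t) <= b - a"
  using norm_ft_le[of "indicator {a..b}" t] by simp
 show "norm (ft (indicator {a..b}) t) * \<bar>t\<bar> <= 1"
 proof (cases "t = 0")
  case False
  define F where "F x = (\<i> / (2 * pi * t)) * cis (- 2 * pi * (t * x))" for x
  have d: "(F has_vector_derivative cis (- 2 * pi * (t * x))) (at x within {a..b})" for x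
   unfolding F_def cis_conv_exp
   by (rule has_vector_derivative_real_field derivative_eq_intros refl | simp add: False field_simps)+
  have "ft (indicator {a..b}) t = (BI x. indicat_real {a..b} x *\<^sub>R cis (- 2 * pi * (t * x)))"
   unfolding ft_def by (intro Bochner_Integration.integral_cong refl) (auto simp: indicator_def)
  also have "... = F b - F a"
   by (rule integral_FTC_atLeastAtMost[OF ab d]) (auto intro!: continuous_intros)
  finally have "norm (ft (indicator {a..b}) t) <= norm (F b) + norm (F a)" using norm_triangle_ineq4 by simp
  also have "... = 1 / (pi * \<bar>t\<bar>)" by (simp add: F_def norm_mult norm_divide)
  finally have "norm (ft (indicator {a..b}) t) * \<bar>t\<bar> <= 1 / (pi * \<bar>t\<bar>) * \<bar>t\<bar>" by (rule mult_right_mono) auto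
  also have "... = 1 / pi" using False by simp
  also have "... <= 1" using pi_gt3 by simp
  finally show ?thesis .
 qed simp
qed

section \<open>The Fejer kernel\<close>

text \<open>This is \<open>(sin (pi * t) / (pi * t)) ^ 2\<close>. As the squared modulus of a
  transform it is visibly nonnegative, and its relation to \<open>tent\<close> becomes an
  autocorrelation.\<close>

definition fej :: "real => real" where
 "fej t = (norm (ft (indicator {0..1}) t))\<^sup>2"

definition tent :: "real => real" where
 "tent \<xi> = max 0 (1 - \<bar>\<xi>\<bar>)"

lemma integrable_unit_indicator: "integrable lborel (indicator {0..1::real} :: real => complex)"
 by (intro integrable_indicator_complex) auto

lemma fej_nonneg [simp]: "0 <= fej t"
 by (simp add: fej_def)

lemma continuous_fej: "continuous_on UNIV fej"
 unfolding fej_def[abs_def] by (intro continuous_intros continuous_ft integrable_unit_indicator)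

lemma measurable_fej [measurable]: "fej \<in> bm"
 by (rule borel_measurable_continuous_onI[OF continuous_fej])

lemma fej_le_1: "fej t <= 1"
 using ft_indicator_Icc_le(1)[of 0 1 t] unfolding fej_def by (intro power_le_one) auto

lemma fej_0: "fej 0 = 1"
proof -
 have "ft (indicator {0..1::real}) 0 = (BI (x::real). cof (indicator {0..1} x))"
  unfolding ft_def by (intro Bochner_Integration.integral_cong refl) (auto simp: indicator_def)
 then show ?thesis unfolding fej_def by simp
qed

lemma fej_le: "fej t <= 2 / (1 + t\<^sup>2)"
proof -
 have "fej t * t\<^sup>2 = (norm (ft (indicator {0..1}) t) * \<bar>t\<bar>)\<^sup>2" by (simp add: fej_def power_mult_distrib)
 also have "... <= 1" using ft_indicator_Icc_le(2)[of 0 1 t] by (intro power_le_one) auto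
 finally have "fej t * (1 + t\<^sup>2) <= 2" using fej_le_1[of t] by (simp add: algebra_simps)
 then show ?thesis by (simp add: pos_le_divide_eq add_pos_nonneg)
qed

lemma integrable_fej: "integrable lborel fej"
proof -
 have "integrable lborel (%t::real. 2 * (1 / (1 + t\<^sup>2)))" by (intro integrable_mult_right integrable_inverse_square_1)
 then show ?thesis by (rule Bochner_Integration.integrable_bound) (use fej_le in \<open>auto intro!: AE_I2\<close>)
qed

lemma continuous_tent: "continuous_on UNIV tent"
 unfolding tent_def[abs_def] by (intro continuous_intros)

lemma tent_eq_0: "1 <= \<bar>\<xi>\<bar> ==> tent \<xi> = 0"
 by (simp add: tent_def)

lemma measurable_tent [measurable]: "tent \<in> bm"
 by (rule borel_measurable_continuous_onI[OF continuous_tent])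

lemma integrable_tent: "integrable lborel (%\<xi>. cof (tent \<xi>))"
proof -
 have i: "integrable lborel (indicat_real {-1..1::real})" by (intro integrable_real_indicator) auto
 show ?thesis
  by (rule Bochner_Integration.integrable_bound[OF i]) (auto simp: tent_def indicator_def intro!: AE_I2)
qed

text \<open>The tent is the autocorrelation of the unit interval, so its transform is the squared
  modulus of the transform of that interval.\<close>

lemma ft_tent: "ft (%\<xi>. cof (tent \<xi>)) x = cof (fej x)"
proof -
 let ?J = "indicator {0..1} :: real => complex"
 have tent: "cof (tent \<xi>) = (BI \<eta>. ?J \<eta> * ?J (\<eta> - \<xi>))" for \<xi>
 proof -
  have "(BI \<eta>. ?J \<eta> * ?J (\<eta> - \<xi>)) = (BI \<eta>. cof (indicator {max 0 \<xi>..min 1 (1 + \<xi>)} \<eta>))"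
   by (intro Bochner_Integration.integral_cong refl) (auto simp: indicator_def)
  also have "... = cof (tent \<xi>)"
   by (cases "max 0 \<xi> <= min 1 (1 + \<xi>)") (auto simp: tent_def max_def min_def split: if_splits)
  finally show ?thesis by simp
 qed
 have fin: "(NI \<xi>. (NI \<eta>. enorm (?J \<eta> * ?J (\<eta> - \<xi>) * cis (- 2 * pi * (x * \<xi>))))) < top"
 proof -
  have "(NI \<xi>. (NI \<eta>. enorm (?J \<eta> * ?J (\<eta> - \<xi>) * cis (- 2 * pi * (x * \<xi>)))))
   <= (NI (\<xi>::real). indicator {-1..1} \<xi>)"
  proof (rule nn_integral_mono)
   fix \<xi> :: real
   have "(NI \<eta>. enorm (?J \<eta> * ?J (\<eta> - \<xi>) * cis (- 2 * pi * (x * \<xi>)))) <= (NI (\<eta>::real). indicator {-1..1} \<xi> * indicator {0..1} \<eta>)"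
    by (intro nn_integral_mono) (auto simp: indicator_def norm_mult)
   then show "(NI \<eta>. enorm (?J \<eta> * ?J (\<eta> - \<xi>) * cis (- 2 * pi * (x * \<xi>)))) <= indicator {-1..1} \<xi>"
    by (simp add: nn_integral_cmult)
  qed
  also have "... < top" by simp
  finally show ?thesis .
 qed
 have "ft (%\<xi>. cof (tent \<xi>)) x = (BI \<xi>. (BI \<eta>. ?J \<eta> * ?J (\<eta> - \<xi>) * cis (- 2 * pi * (x * \<xi>))))"
  unfolding ft_def tent by simp
 also have "... = (BI \<eta>. (BI \<xi>. ?J \<eta> * ?J (\<eta> - \<xi>) * cis (- 2 * pi * (x * \<xi>))))"
  by (rule fubini_swap(1)[OF sigma_finite_lborel sigma_finite_lborel _ fin]) measurable
 also have "... = (BI \<eta>. ?J \<eta> * cis (- 2 * pi * (x * \<eta>)) * cnj (ft ?J x))"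
 proof (intro Bochner_Integration.integral_cong refl)
  fix \<eta> :: real
  have "(BI \<xi>. ?J \<eta> * ?J (\<eta> - \<xi>) * cis (- 2 * pi * (x * \<xi>))) = (BI \<zeta>. ?J \<eta> * ?J \<zeta> * cis (- 2 * pi * (x * (\<eta> - \<zeta>))))"
   using integral_translate(3)[of "%\<xi>. ?J \<eta> * ?J (\<eta> - \<xi>) * cis (- 2 * pi * (x * \<xi>))" \<eta>] by simp
  also have "... = (BI \<zeta>. (?J \<eta> * cis (- 2 * pi * (x * \<eta>))) * (?J \<zeta> * cis (2 * pi * (x * \<zeta>))))"
   by (intro Bochner_Integration.integral_cong refl) (simp add: cis_mult algebra_simps)
  also have "... = ?J \<eta> * cis (- 2 * pi * (x * \<eta>)) * (BI \<zeta>. ?J \<zeta> * cis (2 * pi * (x * \<zeta>)))" by simp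
  also have "(BI \<zeta>. ?J \<zeta> * cis (2 * pi * (x * \<zeta>))) = cnj (ft ?J x)"
  proof -
   have "cnj (ft ?J x) = (BI \<zeta>. cnj (?J \<zeta> * cis (- 2 * pi * (x * \<zeta>))))"
    unfolding ft_def inner_real_def by (rule Bochner_Integration.integral_cnj[symmetric])
   also have "... = (BI \<zeta>. ?J \<zeta> * cis (2 * pi * (x * \<zeta>)))"
    by (intro Bochner_Integration.integral_cong refl) (auto simp: cis_cnj indicator_def)
   finally show ?thesis by simp
  qed
  finally show "(BI \<xi>. ?J \<eta> * ?J (\<eta> - \<xi>) * cis (- 2 * pi * (x * \<xi>))) = ?J \<eta> * cis (- 2 * pi * (x * \<eta>)) * cnj (ft ?J x)" .
 qed
 also have "... = ft ?J x * cnj (ft ?J x)" by (simp add: ft_def)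
 also have "... = cof (fej x)" unfolding fej_def by (simp only: complex_norm_square)
 finally show ?thesis .
qed

lemma integrable_fej_complex: "integrable lborel (%x. cof (fej x))"
 by (intro integrable_of_real integrable_fej)

text \<open>Inversion of \<open>ft_tent\<close> yields this almost everywhere and continuity yields
  it at every point. The pointwise form is wanted because supports of spectra are read off from
  it.\<close>

lemma ft_fej: "ft (%x. cof (fej x)) \<xi> = cof (tent \<xi>)"
proof -
 have e: "ft (%\<xi>. cof (tent \<xi>)) = (%x. cof (fej x))" using ft_tent by auto
 have "AE x in lborel. cof (tent x) = ft (%x. cof (fej x)) (- x)"
  using fourier_inversion[OF integrable_tent] integrable_fej_complex unfolding e by simp
 then have "cof (tent (- \<xi>)) = ft (%x. cof (fej x)) (- (- \<xi>))"
  by (intro AE_eq_continuous_imp_eq[of "%x. cof (tent x)" "%x. ft (%x. cof (fej x)) (- x)"])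
   (auto intro!: continuous_intros continuous_on_compose2[OF continuous_tent] continuous_on_compose2[OF continuous_ft[OF integrable_fej_complex]])
 then show ?thesis by (simp add: tent_def)
qed

lemma integral_fej: "(NI x. ennreal (fej x)) = 1"
proof -
 have "cof (BI x. fej x) = 1"
  using ft_fej[of 0] by (simp add: ft_def tent_def)
 then have "(BI x. fej x) = 1" using of_real_eq_1_iff by blast
 then show ?thesis using integrable_fej by (subst nn_integral_eq_integral) auto
qed

lemma ft_fej_scaled:
 assumes "0 < s"
 shows "ft (%x. cof (s * fej (s * x))) \<xi> = cof (tent (\<xi> / s))"
proof -
 have "cof (tent (\<xi> / s)) = s *\<^sub>R ft (%x. cof (fej (s *\<^sub>R x))) (s *\<^sub>R (\<xi> / s))"
  using ft_scale[of s "%x. cof (fej x)" "\<xi> / s"] assms by (simp add: ft_fej)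
 also have "... = ft (%x. cof (s * fej (s * x))) \<xi>"
  using assms unfolding ft_def by (simp add: scaleR_conv_of_real mult.assoc)
 finally show ?thesis by simp
qed

lemma integrable_fej_scaled:
 assumes "0 < s" shows "integrable lborel (%x. cof (s * fej (s * x)))"
 using integrable_affine[OF integrable_fej_complex, of s 0] assms by simp

lemma nn_integral_fej_scaled:
 assumes "0 < s" shows "(NI x. ennreal (s * fej (s * x))) = 1"
 using nn_integral_affine[of "%x. ennreal (fej x)" s 0] assms
 by (simp add: integral_fej ennreal_mult' nn_integral_cmult)

text \<open>The shape serves four purposes: values in \<open>[0, 1]\<close>, pointwise convergence
  to 1 as \<open>\<delta>\<close> tends to 0, decay like \<open>wt\<close> for fixed
  \<open>\<delta>\<close>, and a transform that vanishes as soon as one frequency coordinate reaches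
  \<open>\<delta>\<close> in modulus.\<close>

definition window :: "real => real^'n::finite => real" where
 "window \<delta> x = (\<Prod>i\<in>UNIV. fej (\<delta> * x $ i))"

lemma wt_vec: "wt (x::real^'n::finite) = (\<Prod>i\<in>UNIV. 1 / (1 + (x $ i)\<^sup>2))"
 unfolding wt_def by (simp add: prod_Basis_vec inner_axis)

lemma window_nonneg [simp]: "0 <= window \<delta> x"
 by (auto simp: window_def intro: prod_nonneg)

lemma window_le_1: "window \<delta> x <= 1"
 unfolding window_def by (intro prod_le_1) (auto simp: fej_le_1)

lemma continuous_window: "continuous_on UNIV (window \<delta>)"
 unfolding window_def[abs_def] by (intro continuous_intros continuous_on_compose2[OF continuous_fej]) auto

lemma measurable_window [measurable]: "window \<delta> \<in> bm"
 by (rule borel_measurable_continuous_onI[OF continuous_window])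

lemma window_tendsto_1: "\<delta> \<longlonglongrightarrow> 0 ==> (%n. window (\<delta> n) x) \<longlonglongrightarrow> 1"
proof -
 assume d: "\<delta> \<longlonglongrightarrow> 0"
 have "(%n. fej (\<delta> n * x $ i)) \<longlonglongrightarrow> fej (0 * x $ i)" for i
  by (rule continuous_on_tendsto_compose[OF continuous_fej]) (intro tendsto_mult tendsto_const d, auto)
 then have "(%n. window (\<delta> n) x) \<longlonglongrightarrow> (\<Prod>i\<in>(UNIV::'a set). 1)"
  unfolding window_def by (intro tendsto_prod) (simp add: fej_0)
 then show ?thesis by simp
qed

lemma window_le_wt:
 fixes x :: "real^'n::finite"
 assumes "0 < \<delta>" "\<delta> <= 1"
 shows "window \<delta> x <= (2 / \<delta>\<^sup>2) ^ CARD('n) * wt x"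
proof -
 have "window \<delta> x <= (\<Prod>i\<in>(UNIV::'n set). (2 / \<delta>\<^sup>2) * (1 / (1 + (x $ i)\<^sup>2)))"
  unfolding window_def
 proof (intro prod_mono conjI fej_nonneg)
  fix i
  have "\<delta>\<^sup>2 * (1 + (x $ i)\<^sup>2) <= 1 + (\<delta> * x $ i)\<^sup>2"
   using assms by (simp add: power_mult_distrib distrib_left power_le_one)
  then have "2 / (1 + (\<delta> * x $ i)\<^sup>2) <= 2 / (\<delta>\<^sup>2 * (1 + (x $ i)\<^sup>2))"
   using assms by (intro divide_left_mono) (auto simp: add_pos_nonneg)
  then show "fej (\<delta> * x $ i) <= (2 / \<delta>\<^sup>2) * (1 / (1 + (x $ i)\<^sup>2))"
   using fej_le[of "\<delta> * x $ i"] by simp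
 qed
 also have "... = (2 / \<delta>\<^sup>2) ^ CARD('n) * wt x" unfolding wt_vec by (simp only: prod.distrib prod_constant)
 finally show ?thesis .
qed

lemma integrable_window:
 assumes "0 < \<delta>" "\<delta> <= 1"
 shows "integrable lborel (%x::real^'n::finite. cof (window \<delta> x))"
 by (rule Bochner_Integration.integrable_bound[OF integrable_mult_right[OF integrable_wt, of "(2 / \<delta>\<^sup>2) ^ CARD('n)"]])
  (use window_le_wt[OF assms] wt_pos in \<open>auto simp: abs_mult intro!: AE_I2\<close>)

lemma ft_window:
 assumes "0 < \<delta>"
 shows "ft (%x. cof (window \<delta> x)) \<xi> = (\<Prod>i\<in>UNIV. cof (tent (\<xi> $ i / \<delta>) / \<delta>))"
proof -
 have i: "integrable lborel (%x. cof (fej (\<delta> * x)))"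
  using integrable_affine[OF integrable_fej_complex, of \<delta> 0] assms by simp
 have "ft (%x. cof (fej (\<delta> * x))) t = cof (tent (t / \<delta>) / \<delta>)" for t
 proof -
  have "cof \<delta> * ft (%x. cof (fej (\<delta> * x))) t = ft (%x. cof (\<delta> * fej (\<delta> * x))) t"
   unfolding ft_def by (simp add: mult.assoc)
  then show ?thesis using ft_fej_scaled[OF assms, of t] assms by (simp add: field_simps)
 qed
 then show ?thesis
  unfolding window_def using ft_prod[OF i, of \<xi>] by simp
qed

lemma ft_window_eq_0:
 assumes "0 < \<delta>" "\<bar>\<xi> $ i\<bar> \<ge> \<delta>"
 shows "ft (%x. cof (window \<delta> x)) \<xi> = 0"
proof -
 have "tent (\<xi> $ i / \<delta>) = 0" using assms by (intro tent_eq_0) (simp add: field_simps)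
 then show ?thesis unfolding ft_window[OF assms(1)] by (intro prod_zero) auto
qed

section \<open>Kernels of boxes\<close>

definition cbx :: "('n => real set) => (real^'n) set" where
 "cbx I = {x. \<forall>i. x $ i \<in> I i}"

lemma indicator_cbx: "indicator (cbx I) x = (\<Prod>i\<in>(UNIV::'n::finite set). indicator (I i) (x $ i) :: 'b::{comm_semiring_1})"
proof (cases "x \<in> cbx I")
 case False
 then obtain i where "x $ i \<notin> I i" by (auto simp: cbx_def)
 then have "(\<Prod>i\<in>(UNIV::'n set). indicator (I i) (x $ i) :: 'b) = 0"
  by (intro prod_zero bexI[of _ i]) (auto simp: indicator_def)
 then show ?thesis using False by simp
qed (simp add: cbx_def)

lemma measurable_cbx:
 assumes "!!i. I i \<in> sets borel"
 shows "cbx (I :: 'n::finite => real set) \<in> sets borel"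
proof -
 have "cbx I = (\<Inter>i\<in>UNIV. (%x. x $ i) -` I i \<inter> space borel)" by (auto simp: cbx_def)
 also have "... \<in> sets borel"
  using assms by (intro sets.finite_INT measurable_sets[of _ borel borel]) auto
 finally show ?thesis .
qed

lemma emeasure_cbx_less_top:
 assumes "!!i. I i \<in> sets borel" "!!i. emeasure lborel (I i) < top"
 shows "emeasure lborel (cbx (I :: 'n::finite => real set)) < top"
proof -
 have "emeasure lborel (cbx I) = (NI x. indicator (cbx I) x)"
  using measurable_cbx[of I, OF assms(1)] by simp
 also have "... = (\<Prod>i\<in>UNIV. (NI x. indicator (I i) x))"
  unfolding indicator_cbx using assms by (intro vec_prod_nn_integral) auto
 also have "... < top" using assms by (auto simp: less_top[symmetric] ennreal_prod_eq_top)
 finally show ?thesis .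
qed

lemma ker_cbx:
 assumes I: "!!i. I i \<in> sets borel" "!!i. emeasure lborel (I i) < top"
 shows "ker (cbx I) x = (\<Prod>i\<in>(UNIV::'n::finite set). ft (indicator (I i)) (- (x $ i)))"
proof -
 have "ker (cbx I) x = ft (%x. \<Prod>i\<in>(UNIV::'n set). indicator (I i) (x $ i)) (- x)"
  unfolding ker_def indicator_cbx[abs_def] ..
 also have "... = (\<Prod>i\<in>UNIV. ft (indicator (I i)) ((- x) $ i))"
  using I by (intro ft_prod integrable_indicator_complex) auto
 finally show ?thesis by simp
qed

lemma nn_integral_inverse_power_finite:
 assumes q: "1 < q"
 shows "(NI (t::real). ennreal ((1 + \<bar>t\<bar>) powr - q)) < top"
proof -
 have A: "(NI (t::real). ennreal ((1 + t) powr - q) * indicator {0..} t) = ennreal (0 - (1 + 0) powr (1 - q) / (1 - q))"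
 proof (rule nn_integral_FTC_atLeast)
  show "((%t. (1 + t) powr (1 - q) / (1 - q)) has_real_derivative (1 + x) powr - q) (at x)" if "0 <= x" for x
  proof -
   have "((%t. 1 + t) has_real_derivative 1) (at x)" by (auto intro!: derivative_eq_intros)
   from DERIV_cdivide[OF DERIV_fun_powr[OF this, of "1 - q"], of "1 - q"] show ?thesis
    using that q by simp
  qed
  show "((%t. (1 + t) powr (1 - q) / (1 - q)) \<longlongrightarrow> 0) at_top"
   using q by real_asymp
 qed auto
 have B: "(NI (t::real). ennreal ((1 - t) powr - q) * indicator {..0} t) = (NI (t::real). ennreal ((1 + t) powr - q) * indicator {0..} t)"
  by (subst nn_integral_translate(3)[symmetric, of _ 0]) (auto intro!: nn_integral_cong simp: indicator_def)
 have "(NI (t::real). ennreal ((1 + \<bar>t\<bar>) powr - q)) <= (NI (t::real). ennreal ((1 + t) powr - q) * indicator {0..} t + ennreal ((1 - t) powr - q) * indicator {..0} t)"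
  by (intro nn_integral_mono) (auto simp: indicator_def abs_if)
 also have "... = (NI (t::real). ennreal ((1 + t) powr - q) * indicator {0..} t) + (NI (t::real). ennreal ((1 - t) powr - q) * indicator {..0} t)"
  by (rule nn_integral_add) auto
 also have "... < top" unfolding A B by simp
 finally show ?thesis .
qed

text \<open>The end points are left open on purpose: dyadic intervals contain one end and not the
  other, and for Fourier transforms only the closed interval matters.\<close>

definition short_interval :: "real set => bool" where
 "short_interval I \<longleftrightarrow> I \<in> sets borel \<and> (\<exists>a b. a <= b \<and> {a<..<b} \<subseteq> I \<and> I \<subseteq> {a..b})"

lemma short_interval_ft:
 assumes "short_interval I"
 obtains a b where "a <= b" "ft (indicator I) = ft (indicator {a..b})" "emeasure lborel I < top"
proof -
 from assms obtain a b where ab: "I \<in> sets borel" "a <= b" "{a<..<b} \<subseteq> I" "I \<subseteq> {a..b}"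
  unfolding short_interval_def by auto
 have "AE x in lborel. x ~= a \<and> x ~= b"
  using AE_lborel_singleton[of a] AE_lborel_singleton[of b] by eventually_elim auto
 then have "AE x in lborel. (indicator I x :: complex) = indicator {a..b} x"
  by eventually_elim (use ab in \<open>fastforce simp: indicator_def\<close>)
 then have "ft (indicator I) = ft (indicator {a..b})" using ab by (intro ft_cong_AE) auto
 moreover have "emeasure lborel I <= emeasure lborel {a..b}" using ab by (intro emeasure_mono) auto
 then have "emeasure lborel I < top" using ab by (auto intro: order_le_less_trans)
 ultimately show ?thesis using that ab by auto
qed

text \<open>The transform is bounded by a multiple of \<open>1 / (1 + |t|)\<close>, whose
  \<open>q\<close>-th power is integrable precisely for \<open>q > 1\<close>. As \<open>q\<close>
  will be the exponent conjugate to \<open>p\<close>, this is where the finiteness of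
  \<open>p\<close> enters.\<close>

lemma ft_short_interval_Lq:
 assumes I: "short_interval I" and q: "1 < q"
 shows "(NI t. enorm (ft (indicator I) (- t)) epowr q) < top"
proof -
 obtain a b where ab: "a <= b" "ft (indicator I) = ft (indicator {a..b})" using short_interval_ft[OF I] by blast
 have le: "norm (ft (indicator I) (- t)) <= (b - a + 1) * (1 / (1 + \<bar>t\<bar>))" for t
  using ft_indicator_Icc_le[OF ab(1), of "- t"] ab by (simp add: field_simps)
 have "(NI t. enorm (ft (indicator I) (- t)) epowr q) <= (NI t. ennreal ((b - a + 1) powr q) * ennreal ((1 + \<bar>t\<bar>) powr - q))"
 proof (rule nn_integral_mono)
  fix t :: real
  have "enorm (ft (indicator I) (- t)) epowr q <= ennreal ((b - a + 1) * (1 / (1 + \<bar>t\<bar>))) epowr q"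
   using q le[of t] by (intro epowr_mono ennreal_leI) auto
  also have "... = ennreal ((b - a + 1) powr q * (1 + \<bar>t\<bar>) powr - q)"
   using ab q by (simp add: powr_mult powr_divide powr_minus divide_inverse inverse_powr)
  finally show "enorm (ft (indicator I) (- t)) epowr q <= ennreal ((b - a + 1) powr q) * ennreal ((1 + \<bar>t\<bar>) powr - q)"
   by (simp add: ennreal_mult')
 qed
 also have "... < top" using nn_integral_inverse_power_finite[OF q] by (simp add: nn_integral_cmult ennreal_mult_less_top)
 finally show ?thesis .
qed

lemma epowr_prod: "0 < q ==> (\<Prod>i\<in>A. f i) epowr q = (\<Prod>i\<in>A. f i epowr q)"
 by (induction A rule: infinite_finite_induct) (auto simp: epowr_mult)

lemma ker_cbx_Lq:
 assumes I: "!!i. short_interval (I i)" and q: "1 < q"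
 shows "(NI (z::real^'n::finite). enorm (ker (cbx I) z) epowr q) < top"
proof -
 have I': "I i \<in> sets borel" "emeasure lborel (I i) < top" for i
  using I[of i] short_interval_ft[OF I[of i]] by (auto simp: short_interval_def)
 have [measurable]: "ft (indicator (I i)) \<in> bm" for i using I' by (intro measurable_ft) auto
 have "(NI (z::real^'n). enorm (ker (cbx I) z) epowr q) = (NI (z::real^'n). (\<Prod>i\<in>UNIV. enorm (ft (indicator (I i)) (- (z $ i))) epowr q))"
  using q by (simp add: ker_cbx[OF I'] prod_norm[symmetric] prod_ennreal[symmetric] epowr_prod)
 also have "... = (\<Prod>i\<in>UNIV. (NI t. enorm (ft (indicator (I i)) (- t)) epowr q))"
  by (rule vec_prod_nn_integral) measurable
 also have "... < top" using ft_short_interval_Lq[OF I q] by (simp add: less_top[symmetric] ennreal_prod_eq_top)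
 finally show ?thesis .
qed

text \<open>Young's inequality in the form \<open>ab \<le> s\<^sup>q a\<^sup>q + s\<^sup>-\<^sup>p b\<^sup>p\<close> replaces Hoelder's inequality.\<close>

lemma young_product:
 fixes a b s :: real
 assumes p: "1 < p" and s: "0 < s" and ab: "0 <= a" "0 <= b" and q: "q = p / (p - 1)"
 shows "ennreal (a * b) <= ennreal (s powr q) * ennreal a epowr q + ennreal (s powr - p) * ennreal b epowr p"
proof -
 have q1: "1 < q" "1/p + 1/q = 1" unfolding q using p by (simp_all add: field_simps)
 have "a * b = (b / s) * (s * a)" using s by simp
 also have "... <= (b / s) powr p / p + (s * a) powr q / q"
  using p q1 ab s by (intro Youngs_inequality) auto
 also have "... <= (b / s) powr p + (s * a) powr q"
  using p q1 by (intro add_mono divide_left_mono[of 1 p "(b / s) powr p", simplified] divide_left_mono[of 1 q "(s * a) powr q", simplified]) auto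
 also have "... = s powr q * a powr q + s powr - p * b powr p"
  using s ab by (simp add: powr_mult powr_divide powr_minus divide_inverse inverse_powr)
 finally show ?thesis using ab by (simp add: ennreal_mult'[symmetric] ennreal_leI flip: ennreal_plus)
qed

lemma conv_young:
 fixes k f :: "'a::euclidean_space => complex"
 assumes p: "1 < p" and s: "0 < s" and q: "q = p / (p - 1)"
  and [measurable]: "k \<in> bm" "f \<in> bm"
 shows "(NI z. ennreal (norm (k z) * norm (f (x - z)))) <=
  ennreal (s powr q) * pint q lborel k + ennreal (s powr - p) * pint p lborel f"
proof -
 have "(NI z. ennreal (norm (k z) * norm (f (x - z)))) <=
  (NI z. ennreal (s powr q) * enorm (k z) epowr q + ennreal (s powr - p) * enorm (f (x - z)) epowr p)"
  by (intro nn_integral_mono young_product p s q) auto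
 also have "... = ennreal (s powr q) * pint q lborel k + ennreal (s powr - p) * (NI z. enorm (f (x - z)) epowr p)"
  unfolding pint_def by (simp add: nn_integral_add nn_integral_cmult)
 also have "(NI z. enorm (f (x - z)) epowr p) = pint p lborel f"
  unfolding pint_def by (rule nn_integral_translate(3)[where f="%z. enorm (f z) epowr p"]) measurable
 finally show ?thesis .
qed

lemma conv_bounded_ker_cbx:
 fixes f :: "real^'n::finite => complex"
 assumes p: "1 < p" and [measurable]: "f \<in> bm" and f: "pint p lborel f < top"
  and I: "!!i. short_interval (I i)"
 obtains M where "0 <= M" "conv_bounded (ker (cbx I)) f M"
proof -
 have Im: "I i \<in> sets borel" for i using I[of i] by (simp add: short_interval_def)
 have [measurable]: "cbx I \<in> sets borel" by (rule measurable_cbx[OF Im])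
 define q where "q = p / (p - 1)"
 have q: "1 < q" using p by (simp add: q_def)
 define X where "X = pint q lborel (ker (cbx I)) + pint p lborel f"
 have X: "X < top" using f ker_cbx_Lq[OF I q] by (simp add: X_def pint_def)
 have "(NI z. ennreal (norm (ker (cbx I) z) * norm (f (x - z)))) <= ennreal (enn2real X)" for x
  using conv_young[OF p zero_less_one q_def, of "ker (cbx I)" f x] X by (simp add: X_def[symmetric])
 then show ?thesis by (intro that[of "enn2real X"]) (auto simp: conv_bounded_def)
qed

lemma conv_bounded_integrable:
 assumes "conv_bounded k f M" and [measurable]: "k \<in> bm" "f \<in> bm"
 shows "integrable lborel (%z. k z * f (x - z))"
 unfolding integrable_iff_bounded
 using assms(1) by (auto simp: conv_bounded_def norm_mult intro: order_le_less_trans)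

text \<open>Young's inequality with a scale \<open>s\<close> bounds the difference by
  \<open>s powr q\<close> times a quantity of the kernel plus \<open>s powr - p\<close> times a null
  sequence. Fixing a small \<open>s\<close> first and then taking \<open>n\<close> large gives
  convergence at every point \<open>x\<close>.\<close>

lemma conv_ker_tendsto:
 fixes f :: "real^'n::finite => complex"
 assumes p: "1 < p" and [measurable]: "f \<in> bm" "!!n. h n \<in> bm"
  and f: "pint p lborel f < top" and h: "!!n. pint p lborel (h n) < top"
  and I: "!!i. short_interval (I i)" and lim: "(%n. pint p lborel (%x. h n x - f x)) \<longlonglongrightarrow> 0"
 shows "(%n. conv (ker (cbx I)) (h n) x) \<longlonglongrightarrow> conv (ker (cbx I)) f x"
proof -
 have Im: "I i \<in> sets borel" for i using I[of i] by (simp add: short_interval_def)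
 have [measurable]: "cbx I \<in> sets borel" by (rule measurable_cbx[OF Im])
 let ?K = "ker (cbx I)"
 define q where "q = p / (p - 1)"
 have q: "1 < q" using p by (simp add: q_def)
 have Kq: "pint q lborel ?K < top" using ker_cbx_Lq[OF I q] by (simp add: pint_def)
 then obtain A where A: "0 <= A" "pint q lborel ?K = ennreal A" by (cases "pint q lborel ?K") auto
 have int: "integrable lborel (%z. ?K z * u (x - z))" if u [measurable]: "u \<in> bm" and fu: "pint p lborel u < top" for u
 proof -
  obtain M where "conv_bounded ?K u M" using conv_bounded_ker_cbx[of p u I, OF p u fu I] by auto
  then show ?thesis by (rule conv_bounded_integrable) measurable
 qed
 have le: "enorm (conv ?K (h n) x - conv ?K f x) <= ennreal (s powr q) * pint q lborel ?K + ennreal (s powr - p) * pint p lborel (%x. h n x - f x)"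
  if "0 < s" for s n
 proof -
  have "conv ?K (h n) x - conv ?K f x = (BI z. ?K z * (h n (x - z) - f (x - z)))"
   unfolding conv_def by (subst Bochner_Integration.integral_diff[symmetric]) (auto intro!: int f h simp: algebra_simps)
  then have "enorm (conv ?K (h n) x - conv ?K f x) <= (NI z. enorm (?K z * (h n (x - z) - f (x - z))))"
   by (simp only: nn_norm_integral_le)
  also have "... <= ennreal (s powr q) * pint q lborel ?K + ennreal (s powr - p) * pint p lborel (%x. h n x - f x)"
   unfolding norm_mult using conv_young[OF p that q_def, of ?K "%x. h n x - f x" x] by simp
  finally show ?thesis .
 qed
 show ?thesis
 proof (rule LIMSEQ_I)
  fix r :: real assume r: "0 < r"
  \<comment> \<open>Chosen so that the kernel part \<open>s powr q * A\<close> is below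
    \<open>r / 2\<close>; the summand 1 in \<open>A + 1\<close> also covers
    \<open>A = 0\<close>.\<close>
  define s where "s = (r / (2 * (A + 1))) powr (1 / q)"
  have s: "0 < s" "s powr q = r / (2 * (A + 1))" using r A q by (auto simp: s_def powr_powr)
  have sA: "s powr q * A < r / 2" unfolding s using A r by (simp add: field_simps)
  have "(%n. ennreal (s powr - p) * pint p lborel (%x. h n x - f x)) \<longlonglongrightarrow> ennreal (s powr - p) * 0"
   by (intro ennreal_tendsto_cmult lim) auto
  then have "eventually (%n. ennreal (s powr - p) * pint p lborel (%x. h n x - f x) < ennreal (r / 2)) sequentially"
   using r by (intro order_tendstoD) auto
  then obtain N where N: "!!n. n \<ge> N ==> ennreal (s powr - p) * pint p lborel (%x. h n x - f x) < ennreal (r / 2)"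
   by (auto simp: eventually_sequentially)
  show "\<exists>N. \<forall>n\<ge>N. norm (conv ?K (h n) x - conv ?K f x) < r"
  proof (intro exI allI impI)
   fix n assume n: "n \<ge> N"
   have "enorm (conv ?K (h n) x - conv ?K f x) <= ennreal (s powr q * A) + ennreal (s powr - p) * pint p lborel (%x. h n x - f x)"
    using le[OF s(1), of n] A by (simp add: ennreal_mult')
   also have "... < ennreal (r / 2 + r / 2)"
    by (rule add_mono_ennreal[OF ennreal_lessI[OF _ sA] N[OF n]]) (use r in simp)
   finally show "norm (conv ?K (h n) x - conv ?K f x) < r" by (simp add: ennreal_less_iff)
  qed
 qed
qed

section \<open>Dyadic boxes as equivalence classes\<close>

text \<open>Dyadic intervals as classes of the relation "same sign and same binary order of
  magnitude". Since \<open>dint 0 = {0}\<close>, the same definition restricted to integers also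
  yields the block \<open>{0}\<close> of the torus, and membership in a box becomes an equality of
  classes.\<close>

definition dint :: "real => real set" where
 "dint t = {s. sgn s = sgn t \<and> \<lfloor>log 2 \<bar>s\<bar>\<rfloor> = \<lfloor>log 2 \<bar>t\<bar>\<rfloor>}"

lemma dint_refl [simp]: "t \<in> dint t"
 by (simp add: dint_def)

lemma dint_eq_iff: "dint s = dint t \<longleftrightarrow> s \<in> dint t"
 by (auto simp: dint_def)

lemma dint_sym: "s \<in> dint t \<longleftrightarrow> t \<in> dint s"
 by (auto simp: dint_def)

lemma dint_nonzero: "s \<in> dint t ==> s = 0 \<longleftrightarrow> t = 0"
 by (auto simp: dint_def sgn_zero_iff)

lemma dint_uminus: "- s \<in> dint (- t) \<longleftrightarrow> s \<in> dint t"
 by (auto simp: dint_def sgn_minus)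

lemma powi_eq_powr: "2 powi k = (2::real) powr real_of_int k"
 by (simp add: powr_real_of_int')

lemma dint_pos:
 assumes "0 < t"
 shows "dint t = {2 powi \<lfloor>log 2 t\<rfloor>..<2 powi (\<lfloor>log 2 t\<rfloor> + 1)}"
proof (intro set_eqI iffI)
 fix s :: real
 { assume s: "s \<in> dint t"
  then have "sgn s = 1" using assms by (simp add: dint_def)
  then have s0: "0 < s" by (simp add: sgn_1_pos)
  then have "\<lfloor>log 2 s\<rfloor> = \<lfloor>log 2 t\<rfloor>" using s assms by (simp add: dint_def)
  then show "s \<in> {2 powi \<lfloor>log 2 t\<rfloor>..<2 powi (\<lfloor>log 2 t\<rfloor> + 1)}"
   using s0 by (subst (asm) floor_log_eq_powr_iff) (auto simp: powi_eq_powr) }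
 { assume s: "s \<in> {2 powi \<lfloor>log 2 t\<rfloor>..<2 powi (\<lfloor>log 2 t\<rfloor> + 1)}"
  then have s0: "0 < s" by (auto intro: less_le_trans[of 0 "2 powi \<lfloor>log 2 t\<rfloor>"])
  then have "\<lfloor>log 2 s\<rfloor> = \<lfloor>log 2 t\<rfloor>"
   using s by (subst floor_log_eq_powr_iff) (auto simp: powi_eq_powr)
  then show "s \<in> dint t" using s0 assms by (simp add: dint_def) }
qed

lemma dint_neg:
 assumes "t < 0"
 shows "dint t = {- (2 powi (\<lfloor>log 2 (- t)\<rfloor> + 1))<..- (2 powi \<lfloor>log 2 (- t)\<rfloor>)}"
proof -
 have "s \<in> dint t \<longleftrightarrow> - s \<in> dint (- t)" for s using dint_uminus[of s t] by simp
 moreover have "dint (- t) = {2 powi \<lfloor>log 2 (- t)\<rfloor>..<2 powi (\<lfloor>log 2 (- t)\<rfloor> + 1)}"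
  using assms by (intro dint_pos) auto
 ultimately show ?thesis by (intro set_eqI) (metis atLeastLessThan_iff greaterThanAtMost_iff le_minus_iff minus_less_iff)
qed

lemma floor_log_powi [simp]: "\<lfloor>log 2 (2 powi k)\<rfloor> = k"
 by (simp add: powi_eq_powr)

lemma dyadic_intervals_eq: "dyadic_intervals = dint ` (- {0})"
proof (intro set_eqI iffI)
 fix I assume "I \<in> dyadic_intervals"
 then obtain k :: int where k: "I = {2 powi (k - 1)..<2 powi k} \<or> I = {- (2 powi k)<..- (2 powi (k - 1))}"
  unfolding dyadic_intervals_def by blast
 have p: "0 < (2::real) powi (k - 1)" by (rule zero_less_power_int) simp
 have "dint (2 powi (k - 1)) = {2 powi (k - 1)..<2 powi k}"
  using dint_pos[OF p] by (simp only: floor_log_powi diff_add_cancel)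
 moreover have "dint (- (2 powi (k - 1))) = {- (2 powi k)<..- (2 powi (k - 1))}"
  using dint_neg[of "- (2 powi (k - 1))"] p by (simp only: floor_log_powi diff_add_cancel minus_minus neg_less_0_iff_less simp_thms)
 ultimately have "I = dint (2 powi (k - 1)) \<or> I = dint (- (2 powi (k - 1)))" using k by (simp only:)
 moreover have "2 powi (k - 1) ~= (0::real)" using p by (rule less_imp_neq[symmetric])
 then have "2 powi (k - 1) \<in> - {0::real}" "- (2 powi (k - 1)) \<in> - {0::real}"
  by (simp_all only: Compl_iff singleton_iff neg_equal_0_iff_equal simp_thms)
 ultimately show "I \<in> dint ` (- {0})" by blast
next
 fix I assume "I \<in> dint ` (- {0})"
 then obtain t :: real where t: "t ~= 0" "I = dint t" by auto
 define k where "k = \<lfloor>log 2 \<bar>t\<bar>\<rfloor> + 1"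
 have "I = {2 powi (k - 1)..<2 powi k} \<or> I = {- (2 powi k)<..- (2 powi (k - 1))}"
  using t dint_pos[of t] dint_neg[of t] by (cases "0 < t") (auto simp: k_def)
 then show "I \<in> dyadic_intervals" unfolding dyadic_intervals_def by blast
qed

lemma short_interval_dint:
 assumes "t ~= 0" shows "short_interval (dint t)"
proof -
 let ?k = "\<lfloor>log 2 \<bar>t\<bar>\<rfloor>"
 have le: "2 powi ?k <= (2::real) powi (?k + 1)" by (intro power_int_increasing) auto
 show ?thesis
 proof (cases "0 < t")
  case True
  have e: "dint t = {2 powi ?k..<2 powi (?k + 1)}" using dint_pos[OF True] True by simp
  show ?thesis unfolding short_interval_def e
   by (intro conjI exI[of _ "2 powi ?k"] exI[of _ "2 powi (?k + 1)"] le) auto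
 next
  case False
  then have "t < 0" using assms by simp
  then have e: "dint t = {- (2 powi (?k + 1))<..- (2 powi ?k)}" using dint_neg[of t] by simp
  show ?thesis unfolding short_interval_def e
   by (intro conjI exI[of _ "- (2 powi (?k + 1))"] exI[of _ "- (2 powi ?k)"]) (use le in auto)
 qed
qed

lemma dint_abs_le:
 assumes "s \<in> dint t" shows "\<bar>s\<bar> <= 2 * \<bar>t\<bar>"
proof (cases "t = 0")
 case True then show ?thesis using dint_nonzero[OF assms] by simp
next
 case False
 have *: "s <= 2 * t" if "s \<in> dint t" "0 < t" for s t
 proof -
  have "s < 2 powi (\<lfloor>log 2 t\<rfloor> + 1)" "2 powi \<lfloor>log 2 t\<rfloor> <= t"
   using that dint_pos[OF that(2)] dint_refl[of t] by auto
  moreover have "2 powi (\<lfloor>log 2 t\<rfloor> + 1) = 2 * (2::real) powi \<lfloor>log 2 t\<rfloor>" by (simp add: power_int_add)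
  ultimately show ?thesis by linarith
 qed
 show ?thesis
 proof (cases "0 < t")
  case True
  then have "0 < s" using assms dint_pos[OF True] by (auto intro: less_le_trans[of 0 "2 powi \<lfloor>log 2 t\<rfloor>"])
  then show ?thesis using *[OF assms True] True by simp
 next
  case F: False
  then have t: "0 < - t" using False by simp
  have s: "- s \<in> dint (- t)" using assms by (simp add: dint_uminus)
  have "0 < (2::real) powi \<lfloor>log 2 (- t)\<rfloor>" by simp
  also have "... <= - s" using s unfolding dint_pos[OF t] by simp
  finally have "0 < - s" .
  then show ?thesis using *[OF s t] t by simp
 qed
qed

text \<open>Multiplication by \<open>2 ^ m\<close> adds the integer \<open>m\<close> to the binary
  logarithm, hence also to its floor. The comparison of spectra under periodization rests on
  this.\<close>

lemma dint_scale: "2 ^ m * s \<in> dint (2 ^ m * t) \<longleftrightarrow> s \<in> dint t"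
proof (cases "s = 0 \<or> t = 0")
 case True
 then show ?thesis using dint_nonzero[of s t] dint_nonzero[of "2 ^ m * s" "2 ^ m * t"] by auto
next
 case False
 have L: "log 2 \<bar>2 ^ m * u\<bar> = real m + log 2 \<bar>u\<bar>" if "u ~= 0" for u :: real
  using that by (simp add: abs_mult log_mult log_nat_power)
 have "\<lfloor>log 2 \<bar>2 ^ m * u\<bar>\<rfloor> = int m + \<lfloor>log 2 \<bar>u\<bar>\<rfloor>" if "u ~= 0" for u :: real
  unfolding int_add_floor L[OF that] by simp
 then show ?thesis using False by (simp add: dint_def sgn_mult)
qed

definition bx :: "real^'n => (real^'n) set" where
 "bx x = cbx (%i. dint (x $ i))"

lemma mem_bx: "y \<in> bx x \<longleftrightarrow> (\<forall>i. y $ i \<in> dint (x $ i))"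
 by (simp add: bx_def cbx_def)

lemma bx_refl [simp]: "x \<in> bx x"
 by (simp add: mem_bx)

lemma bx_eq_iff: "bx x = bx y \<longleftrightarrow> x \<in> bx y"
proof
 assume "x \<in> bx y"
 then have "dint (x $ i) = dint (y $ i)" for i by (simp add: mem_bx dint_eq_iff)
 then show "bx x = bx y" by (simp add: bx_def)
qed (use bx_refl in blast)

lemma dyadic_boxes_eq: "dyadic_boxes = bx ` {x. \<forall>i. x $ i ~= 0}"
proof (intro set_eqI iffI)
 fix R :: "(real^'n) set" assume "R \<in> dyadic_boxes"
 then obtain I where I: "R = {x. \<forall>i. x $ i \<in> I i}" "!!i. I i \<in> dint ` (- {0})"
  unfolding dyadic_boxes_def dyadic_intervals_eq by auto
 then have "\<forall>i. \<exists>t. t ~= 0 \<and> I i = dint t" by blast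
 then obtain t where t: "!!i. t i ~= 0" "!!i. I i = dint (t i)" by metis
 then have "R = bx (\<chi> i. t i)" by (simp add: I bx_def cbx_def)
 then show "R \<in> bx ` {x. \<forall>i. x $ i ~= 0}" using t by (intro image_eqI) auto
next
 fix R :: "(real^'n) set" assume "R \<in> bx ` {x. \<forall>i. x $ i ~= 0}"
 then obtain x where "R = {y. \<forall>i. y $ i \<in> dint (x $ i)}" "!!i. dint (x $ i) \<in> dint ` (- {0})"
  by (auto simp: bx_def cbx_def)
 then show "R \<in> dyadic_boxes"
  unfolding dyadic_boxes_def dyadic_intervals_eq by (intro CollectI exI[of _ "%i. dint (x $ i)"]) simp
qed

lemma countable_dyadic_boxes: "countable (dyadic_boxes :: (real^'n::finite) set set)"
proof -
 have "countable dyadic_intervals" unfolding dyadic_intervals_def by (rule countable_UN) (simp_all only: countable_empty countable_insert countableI_type)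
 then have "countable (PiE (UNIV :: 'n set) (%_. dyadic_intervals))" by (intro countable_PiE) auto
 then have "countable (cbx ` (PiE (UNIV :: 'n set) (%_. dyadic_intervals)))" by (rule countable_image)
 moreover have "dyadic_boxes \<subseteq> cbx ` (PiE (UNIV :: 'n set) (%_. dyadic_intervals))"
  unfolding dyadic_boxes_def cbx_def by (auto simp: PiE_UNIV_domain)
 ultimately show ?thesis by (rule countable_subset[rotated])
qed

section \<open>Dyadic blocks of integers\<close>

definition iint :: "int => int set" where
 "iint k = {l. real_of_int l \<in> dint (real_of_int k)}"

lemma iint_0 [simp]: "iint 0 = {0}"
 using dint_nonzero[of _ 0] dint_nonzero by (fastforce simp: iint_def)

text \<open>Positive blocks are the classes of the powers \<open>2 ^ j\<close>, negative ones are
  their reflections, and every nonzero integer shares its class with some \<open>2 ^ j\<close> or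
  \<open>- (2 ^ j)\<close>, where \<open>j\<close> is its binary order.\<close>

lemma int_dyadic_intervals_eq: "int_dyadic_intervals = range iint"
proof -
 have p: "iint (2 ^ j) = {2 ^ j..<2 ^ Suc j}" for j
 proof -
  have p0: "0 < (2::real) ^ j" by simp
  have f: "\<lfloor>log 2 ((2::real) ^ j)\<rfloor> = int j" by (simp add: log_nat_power)
  have e: "int j + 1 = int (Suc j)" by simp
  have "dint (2 ^ j) = {2 ^ j..<2 ^ Suc j}"
   using dint_pos[OF p0] by (simp only: f e power_int_of_nat)
  then have d: "dint (real_of_int (2 ^ j)) = {real_of_int (2 ^ j)..<real_of_int (2 ^ Suc j)}"
   by (simp only: of_int_power of_int_numeral)
  show ?thesis unfolding iint_def d
   by (intro set_eqI) (simp only: mem_Collect_eq atLeastLessThan_iff of_int_le_iff of_int_less_iff)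
 qed
 have n: "iint (- k) = uminus ` iint k" for k
 proof (intro set_eqI iffI)
  fix l assume "l \<in> iint (- k)"
  then have "- l \<in> iint k" using dint_uminus[of "real_of_int (- l)" "real_of_int k"] by (simp add: iint_def)
  then show "l \<in> uminus ` iint k" by (intro image_eqI[of _ _ "- l"]) simp
 next
  fix l assume "l \<in> uminus ` iint k"
  then show "l \<in> iint (- k)" using dint_uminus by (auto simp: iint_def)
 qed
 have "uminus ` {a..<b} = {- b<..- (a::int)}" for a b by simp
 then have m: "iint (- (2 ^ j)) = {- (2 ^ Suc j)<..- (2 ^ j)}" for j by (simp add: n p)
 have i: "iint k \<in> {iint (2 ^ j), iint (- (2 ^ j))}" if k: "k ~= 0" "j = nat \<lfloor>log 2 \<bar>real_of_int k\<bar>\<rfloor>" for k j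
 proof -
  have "0 <= log 2 \<bar>real_of_int k\<bar>" using k by simp
  then have "\<lfloor>log 2 \<bar>real_of_int k\<bar>\<rfloor> = int j" using k by simp
  then have "\<lfloor>log 2 \<bar>real_of_int k\<bar>\<rfloor> = \<lfloor>log 2 (2 ^ j)\<rfloor>" by (simp add: log_nat_power)
  then have "dint (real_of_int k) = dint (2 ^ j) \<or> dint (real_of_int k) = dint (- (2 ^ j))"
   using k by (cases "0 < k") (auto simp: dint_eq_iff dint_def sgn_if)
  then show ?thesis by (auto simp: iint_def)
 qed
 show ?thesis
 proof (intro set_eqI iffI)
  fix I assume "I \<in> int_dyadic_intervals"
  then consider "I = {0}" | k where "1 <= k" "I = {2 ^ (k - 1)..<2 ^ k}" | k where "1 <= k" "I = {- (2 ^ k)<..- (2 ^ (k - 1))}"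
   unfolding int_dyadic_intervals_def by auto
  then show "I \<in> range iint"
  proof cases
   case 1 then show ?thesis by (intro image_eqI[of _ _ 0]) auto
  next
   case (2 k) then show ?thesis using p[of "k - 1"] by (intro image_eqI[of _ _ "2 ^ (k - 1)"]) auto
  next
   case (3 k) then show ?thesis using m[of "k - 1"] by (intro image_eqI[of _ _ "- (2 ^ (k - 1))"]) auto
  qed
 next
  fix I assume "I \<in> range iint"
  then obtain k where k: "I = iint k" by auto
  show "I \<in> int_dyadic_intervals"
  proof (cases "k = 0")
   case True then show ?thesis by (simp add: k int_dyadic_intervals_def)
  next
   case False
   then obtain j where "I = {2 ^ j..<2 ^ Suc j} \<or> I = {- (2 ^ Suc j)<..- (2 ^ j)}" using i[OF False refl] unfolding k p m by blast
   then have "I \<in> {{2 ^ (Suc j - 1)..<2 ^ Suc j}, {- (2 ^ Suc j)<..- (2 ^ (Suc j - 1))}}"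
    by (simp only: diff_Suc_1 insert_iff empty_iff simp_thms)
   then show ?thesis unfolding int_dyadic_intervals_def by (rule insertI2[OF UN_I[rotated]]) simp
  qed
 qed
qed

definition ibx :: "int^'n => (int^'n) set" where
 "ibx k = {l. \<forall>i. l $ i \<in> iint (k $ i)}"

definition iv :: "int^'n => real^'n" where
 "iv k = (\<chi> i. real_of_int (k $ i))"

lemma iv_nth [simp]: "iv k $ i = real_of_int (k $ i)"
 by (simp add: iv_def)

lemma mem_ibx: "l \<in> ibx k \<longleftrightarrow> iv l \<in> bx (iv k)"
 by (simp add: ibx_def mem_bx iint_def)

lemma ibx_refl [simp]: "k \<in> ibx k"
 by (simp add: mem_ibx)

lemma ibx_eq_iff: "ibx k = ibx l \<longleftrightarrow> bx (iv k) = bx (iv l)"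
proof
 assume "ibx k = ibx l"
 then have "k \<in> ibx l" using ibx_refl by blast
 then show "bx (iv k) = bx (iv l)" by (simp add: bx_eq_iff mem_ibx)
next
 assume "bx (iv k) = bx (iv l)"
 then show "ibx k = ibx l" by (intro set_eqI) (simp only: mem_ibx)
qed

lemma int_dyadic_boxes_eq: "int_dyadic_boxes = range ibx"
proof (intro set_eqI iffI)
 fix R :: "(int^'n) set" assume "R \<in> int_dyadic_boxes"
 then obtain I where I: "R = {x. \<forall>i. x $ i \<in> I i}" "\<forall>i. I i \<in> range iint"
  unfolding int_dyadic_boxes_def int_dyadic_intervals_eq by blast
 then have "\<forall>i. \<exists>k. I i = iint k" by blast
 then obtain k where "!!i. I i = iint (k i)" by metis
 then have "R = ibx (\<chi> i. k i)" by (simp add: I ibx_def)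
 then show "R \<in> range ibx" by auto
next
 fix R :: "(int^'n) set" assume "R \<in> range ibx"
 then obtain k where "R = {y. \<forall>i. y $ i \<in> iint (k $ i)}" by (auto simp: ibx_def)
 then show "R \<in> int_dyadic_boxes"
  unfolding int_dyadic_boxes_def int_dyadic_intervals_eq by (intro CollectI exI[of _ "%i. iint (k $ i)"]) simp
qed

lemma countable_int_dyadic_boxes: "countable (int_dyadic_boxes :: (int^'n::finite) set set)"
 unfolding int_dyadic_boxes_eq by simp

lemma finite_vec:
 assumes "!!i. finite (A i)"
 shows "finite {x :: 'a^'n::finite. \<forall>i. x $ i \<in> A i}"
proof -
 have "finite (PiE UNIV A)" using assms by (intro finite_PiE) auto
 then have "finite (vec_lambda ` PiE UNIV A)" by (rule finite_imageI)
 moreover have "x \<in> vec_lambda ` PiE UNIV A" if "\<forall>i. x $ i \<in> A i" for x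
  using that by (intro image_eqI[of _ _ "vec_nth x"]) auto
 ultimately show ?thesis by (elim finite_subset[rotated]) auto
qed

lemma finite_ibx: "finite (ibx (k :: int^'n::finite))"
proof -
 have "iint m \<subseteq> {- (2 * \<bar>m\<bar>)..2 * \<bar>m\<bar>}" for m
 proof
  fix l assume "l \<in> iint m"
  then have "\<bar>real_of_int l\<bar> <= 2 * \<bar>real_of_int m\<bar>" unfolding iint_def by (intro dint_abs_le) simp
  then have "\<bar>l\<bar> <= 2 * \<bar>m\<bar>" by linarith
  then show "l \<in> {- (2 * \<bar>m\<bar>)..2 * \<bar>m\<bar>}" by auto
 qed
 then have "finite (iint m)" for m by (rule finite_subset) simp
 then show ?thesis unfolding ibx_def by (intro finite_vec)
qed

section \<open>Square functions of finite sums\<close>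

lemma l2n_finite_support:
 assumes "finite F" "F \<subseteq> D" "!!R. R \<in> D - F ==> a R = 0"
 shows "l2n D a = ennreal (L2_set (%R. norm (a R)) F)"
proof -
 have "(\<Sum>\<^sub>\<infinity>R\<in>D. ennreal ((norm (a R))\<^sup>2)) = (\<Sum>\<^sub>\<infinity>R\<in>F. ennreal ((norm (a R))\<^sup>2))"
  using assms by (intro infsum_cong_neutral) auto
 also have "... = (\<Sum>R\<in>F. ennreal ((norm (a R))\<^sup>2))" using assms by simp
 also have "... = ennreal (L2_set (%R. norm (a R)) F) epowr 2" by (rule L2_set_sq[symmetric])
 finally show ?thesis unfolding l2n_def by (simp add: epowr_epowr del: epowr_ennreal)
qed

text \<open>The right-hand side mentions only the classes into which \<open>\<rho>\<close> divides
  \<open>K\<close>, and no longer the labels; two labellings can be compared through it.\<close>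

lemma l2n_classes:
 assumes K: "finite K" "\<rho> ` K \<subseteq> D"
 shows "l2n D (%R. \<Sum>k\<in>{k\<in>K. \<rho> k = R}. a k) = ennreal (L2_set (%C. norm (\<Sum>k\<in>C. a k)) ((%k. {l\<in>K. \<rho> l = \<rho> k}) ` K))"
proof -
 have "l2n D (%R. \<Sum>k\<in>{k\<in>K. \<rho> k = R}. a k) = ennreal (L2_set (%R. norm (\<Sum>k\<in>{k\<in>K. \<rho> k = R}. a k)) (\<rho> ` K))"
 proof (rule l2n_finite_support)
  show "(\<Sum>k\<in>{k\<in>K. \<rho> k = R}. a k) = 0" if "R \<in> D - \<rho> ` K" for R
   using that by (intro sum.neutral) auto
 qed (use K in auto)
 moreover have "L2_set (%C. norm (\<Sum>k\<in>C. a k)) ((%R. {l\<in>K. \<rho> l = R}) ` \<rho> ` K) = L2_set (%R. norm (\<Sum>k\<in>{k\<in>K. \<rho> k = R}. a k)) (\<rho> ` K)"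
  unfolding L2_set_def by (subst sum.reindex) (auto simp: inj_on_def)
 ultimately show ?thesis by (simp add: image_image)
qed

text \<open>The mechanism of the transfer in both directions: the square function of a finite sum
  depends only on which frequencies share a box. Two families of boxes that partition
  \<open>K\<close> in the same way give the same value, however the boxes themselves are
  indexed.\<close>

lemma l2n_partition_eq:
 assumes "finite K" "\<rho> ` K \<subseteq> D" "\<rho>' ` K \<subseteq> D'"
  and "!!k l. k \<in> K ==> l \<in> K ==> \<rho> k = \<rho> l \<longleftrightarrow> \<rho>' k = \<rho>' l"
 shows "l2n D (%R. \<Sum>k\<in>{k\<in>K. \<rho> k = R}. a k) = l2n D' (%R. \<Sum>k\<in>{k\<in>K. \<rho>' k = R}. a k)"
proof -
 have "(%k. {l\<in>K. \<rho> l = \<rho> k}) ` K = (%k. {l\<in>K. \<rho>' l = \<rho>' k}) ` K"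
  using assms(4) by (intro image_cong refl) auto
 then show ?thesis using l2n_classes[OF assms(1,2), of a] l2n_classes[OF assms(1,3), of a] by simp
qed

lemma torus_square_function:
 fixes f :: "real^'n::finite => complex"
 assumes "finite K" "!!k. k \<notin> K ==> fourier_coeff f k = 0"
 shows "square_function int_dyadic_boxes torus_partial_sum f x =
  l2n int_dyadic_boxes (%R. \<Sum>k\<in>{k\<in>K. ibx k = R}. fourier_coeff f k * character k x)"
 unfolding square_function_eq_l2n torus_partial_sum_def
proof (rule l2n_cong)
 fix R :: "(int^'n) set" assume "R \<in> int_dyadic_boxes"
 then obtain m where R: "R = ibx m" by (auto simp: int_dyadic_boxes_eq)
 have "{k \<in> K. ibx k = R} = K \<inter> R" unfolding R by (auto simp: ibx_eq_iff mem_ibx bx_eq_iff)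
 then have "(\<Sum>k\<in>R. fourier_coeff f k * character k x) = (\<Sum>k\<in>{k\<in>K. ibx k = R}. fourier_coeff f k * character k x)"
  using finite_ibx[of m] assms(2) unfolding R by (intro sum.mono_neutral_right) auto
 then show "norm (\<Sum>k\<in>R. fourier_coeff f k * character k x) = norm (\<Sum>k\<in>{k\<in>K. ibx k = R}. fourier_coeff f k * character k x)"
  by simp
qed

section \<open>The torus\<close>

definition ucube :: "(real^'n) set" where
 "ucube = cbx (%_. {0..<1})"

lemma mem_ucube: "x \<in> ucube \<longleftrightarrow> (\<forall>i. 0 <= x $ i \<and> x $ i < 1)"
 by (simp add: ucube_def cbx_def)

lemma measurable_ucube [measurable]: "(ucube :: (real^'n::finite) set) \<in> sets borel"
 unfolding ucube_def by (intro measurable_cbx) auto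

lemma torus_eq: "torus = restrict_space lborel ucube"
 unfolding torus_def by (intro arg_cong[where f="restrict_space lborel"]) (auto simp: mem_ucube)

lemma space_torus: "space torus = (ucube :: (real^'n::finite) set)"
 by (simp add: torus_eq space_restrict_space)

lemma emeasure_ucube: "emeasure lborel (ucube :: (real^'n::finite) set) = 1"
proof -
 have "emeasure lborel (ucube :: (real^'n) set) = (NI (x::real^'n). indicator ucube x)" by simp
 also have "... = (\<Prod>i\<in>(UNIV::'n set). (NI t. indicator {0..<1::real} t))"
  unfolding ucube_def indicator_cbx by (rule vec_prod_nn_integral) auto
 finally show ?thesis by simp
qed

text \<open>On Borel functions \<^const>\<open>torus\<close> and the following measure on all of \<open>\<real>\<^sup>d\<close> integrate alike.\<close>

definition utor :: "(real^'n::finite) measure" where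
 "utor = density lborel (%x. ennreal (indicator ucube x))"

lemma sets_utor [simp, measurable_cong]: "sets utor = sets borel"
 and space_utor [simp]: "space utor = UNIV"
 by (simp_all add: utor_def)

abbreviation nn_utor :: "(real^'n::finite => ennreal) => ennreal" (binder "NU " 10) where "nn_utor f == nn_integral utor f"
abbreviation bi_utor :: "(real^'n::finite => 'b::{banach, second_countable_topology}) => 'b" (binder "BU " 10) where "bi_utor f == lebesgue_integral utor f"

lemma nn_integral_utor:
 "f \<in> bm ==> (NU x. f x) = (NI x. f x * indicator ucube x)"
 unfolding utor_def by (subst nn_integral_density) (auto simp: mult.commute indicator_def intro!: nn_integral_cong)

lemma nn_integral_torus:
 assumes "!!x. x \<in> ucube ==> f x = g x" "g \<in> bm"
 shows "(\<integral>\<^sup>+x. f x \<partial>torus) = (NU x. g x)"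
proof -
 have "(\<integral>\<^sup>+x. f x \<partial>torus) = (NI x. f x * indicator ucube x)"
  unfolding torus_eq by (rule nn_integral_restrict_space) auto
 also have "... = (NI x. g x * indicator ucube x)"
  by (intro nn_integral_cong) (auto simp: indicator_def assms)
 finally show ?thesis using nn_integral_utor[OF assms(2)] by simp
qed

lemma integral_torus:
 fixes f g :: "real^'n::finite => complex"
 assumes "!!x. x \<in> ucube ==> f x = g x" "g \<in> bm"
 shows "(\<integral>x. f x \<partial>torus) = (BU x. g x)"
proof -
 have "(\<integral>x. f x \<partial>torus) = (BI x. indicator ucube x *\<^sub>R f x)"
  unfolding torus_eq by (rule integral_restrict_space) auto
 also have "... = (BI x. indicator ucube x *\<^sub>R g x)"
  by (intro Bochner_Integration.integral_cong refl) (auto simp: indicator_def assms)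
 also have "... = (BU x. g x)" unfolding utor_def using assms(2) by (subst integral_density) auto
 finally show ?thesis .
qed

lemma prob_space_utor: "prob_space (utor :: (real^'n::finite) measure)"
 by (rule prob_spaceI) (use nn_integral_utor[of "%_::real^'n. 1"] emeasure_ucube[where 'n='n] in simp)

lemma sigma_finite_utor: "sigma_finite_measure (utor :: (real^'n::finite) measure)"
 by (rule prob_space_imp_sigma_finite[OF prob_space_utor])

lemma integrable_utor_bounded:
 fixes f :: "real^'n::finite => complex"
 assumes "f \<in> bm" "!!x. norm (f x) <= B"
 shows "integrable utor f"
proof -
 interpret prob_space "utor :: (real^'n) measure" by (rule prob_space_utor)
 show ?thesis using assms by (intro integrable_const_bound[of _ B]) auto
qed

text \<open>Functions on the torus have arbitrary values off the unit cube, which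
  \<open>torus\<close> does not see. Their periodic extension makes translation and convolution on
  the whole space meaningful.\<close>

definition pex :: "(real^'n => 'a) => real^'n => 'a" where
 "pex F x = F (\<chi> i. frac (x $ i))"

lemma pex_ucube: "x \<in> ucube ==> pex F x = F x"
 unfolding pex_def by (rule arg_cong[where f=F]) (simp add: vec_eq_iff mem_ucube frac_eq)

lemma pex_periodic: "pex F (x + iv j) = pex F x"
 unfolding pex_def by (simp only: vector_add_component iv_nth frac_add_of_int_right)

lemma measurable_pex:
 fixes F :: "real^'n::finite => 'a::topological_space"
 assumes "F \<in> borel_measurable torus"
 shows "pex F \<in> bm"
proof -
 have "(%x::real^'n. (\<chi> i. frac (x $ i))) \<in> bm"
 proof (rule borel_measurable_euclidean_space[THEN iffD2], rule ballI)
  fix b :: "real^'n" assume "b \<in> Basis"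
  moreover have "(Basis :: (real^'n) set) = range (%i. axis i 1)" by (auto simp: Basis_vec_def)
  ultimately obtain i where b: "b = axis i 1" by blast
  have "(%x::real^'n. x $ i - real_of_int \<lfloor>x $ i\<rfloor>) \<in> bm" by measurable
  then show "(%x::real^'n. (\<chi> i. frac (x $ i)) \<bullet> b) \<in> bm"
   unfolding b by (simp only: inner_axis inner_real_def mult_1_right vec_lambda_beta frac_def)
 qed
 then have "(%x::real^'n. (\<chi> i. frac (x $ i))) \<in> borel \<rightarrow>\<^sub>M torus"
  unfolding torus_eq by (intro measurable_restrict_space2) (auto simp: mem_ucube frac_lt_1)
 from measurable_compose[OF this assms] show ?thesis unfolding pex_def[abs_def] .
qed

lemma borel_imp_torus: "F \<in> bm ==> F \<in> borel_measurable torus"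
 unfolding torus_eq by (rule measurable_restrict_space1) simp

section \<open>Unfolding over the integer lattice\<close>

lemma ex1_cell:
 fixes x :: "real^'n::finite"
 shows "x - iv j \<in> ucube \<longleftrightarrow> j = (\<chi> i. \<lfloor>x $ i\<rfloor>)"
proof -
 have "x - iv j \<in> ucube \<longleftrightarrow> (\<forall>i. \<lfloor>x $ i\<rfloor> = j $ i)"
  unfolding mem_ucube floor_eq_iff by (simp add: algebra_simps)
 then show ?thesis by (auto simp: vec_eq_iff)
qed

lemma nn_integral_cell:
 fixes x :: "real^'n::finite"
 shows "(\<integral>\<^sup>+j. indicator ucube (x - iv j) \<partial>count_space UNIV) = (1::ennreal)"
proof -
 have "(\<integral>\<^sup>+j. indicator ucube (x - iv j) \<partial>count_space UNIV) = (\<Sum>j\<in>{\<chi> i. \<lfloor>x $ i\<rfloor>}. indicator ucube (x - iv j) :: ennreal)"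
  by (rule nn_integral_count_space') (auto simp: indicator_def ex1_cell)
 then show ?thesis by (simp add: indicator_def ex1_cell)
qed

text \<open>The integer translates of the unit cube tile the space: insert their indicators, whose
  sum is 1, exchange sum and integral, and translate every cell back to the unit cube.\<close>

theorem nn_integral_unfold:
 fixes g :: "real^'n::finite => ennreal"
 assumes [measurable]: "g \<in> bm"
 shows "(NI x. g x) = (NU x. (\<integral>\<^sup>+j. g (x + iv j) \<partial>count_space UNIV))"
proof -
 have m: "(%x. \<integral>\<^sup>+j. g (x + iv j) \<partial>count_space UNIV) \<in> bm"
  by (intro sigma_finite_measure.borel_measurable_nn_integral[OF sigma_finite_measure_count_space]) measurable
 have "(NI x. g x) = (NI x. \<integral>\<^sup>+j. g x * indicator ucube (x - iv j) \<partial>count_space UNIV)"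
  by (simp add: nn_integral_cmult nn_integral_cell)
 also have "... = (\<integral>\<^sup>+j. (NI x. g x * indicator ucube (x - iv j)) \<partial>count_space UNIV)"
  by (rule nn_integral_count_space_nn_integral) auto
 also have "... = (\<integral>\<^sup>+j. (NI x. g (x + iv j) * indicator ucube x) \<partial>count_space UNIV)"
 proof (rule nn_integral_cong)
  fix j :: "int^'n"
  show "(NI x. g x * indicator ucube (x - iv j)) = (NI x. g (x + iv j) * indicator ucube x)"
   using nn_integral_translate(1)[of "%x. g x * indicator ucube (x - iv j)" "iv j"] by simp
 qed
 also have "... = (NI x. \<integral>\<^sup>+j. g (x + iv j) * indicator ucube x \<partial>count_space UNIV)"
  by (rule nn_integral_count_space_nn_integral[symmetric]) auto
 also have "... = (NI x. (\<integral>\<^sup>+j. g (x + iv j) \<partial>count_space UNIV) * indicator ucube x)"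
  by (simp add: nn_integral_multc)
 also have "... = (NU x. (\<integral>\<^sup>+j. g (x + iv j) \<partial>count_space UNIV))"
  by (rule nn_integral_utor[OF m, symmetric])
 finally show ?thesis .
qed

lemma iv_uminus: "iv (- j) = - iv j"
 by (simp add: vec_eq_iff)

text \<open>Move the cube instead of the function and then fold. The translates of the moved cube
  tile as well, so every class of points modulo the lattice is met exactly once.\<close>

lemma nn_integral_periodic_shift:
 fixes h :: "real^'n::finite => ennreal"
 assumes [measurable]: "h \<in> bm" and per: "!!x j. h (x + iv j) = h x"
 shows "(NU x. h (x + y)) = (NU x. h x)"
proof -
 have c: "(\<integral>\<^sup>+j. indicator ucube (x + iv j - y) \<partial>count_space UNIV) = (1::ennreal)" for x
 proof -
  have "(\<integral>\<^sup>+j. indicator ucube (x + iv j - y) \<partial>count_space UNIV) = (\<integral>\<^sup>+j. indicator ucube ((x - y) - iv (- j)) \<partial>count_space UNIV)"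
   by (simp add: iv_uminus algebra_simps)
  also have "... = (\<integral>\<^sup>+j. indicator ucube ((x - y) - iv j) \<partial>count_space UNIV)"
   by (rule nn_integral_bij_count_space[where g=uminus]) (rule bij_uminus)
  finally show ?thesis by (simp add: nn_integral_cell)
 qed
 have "(NU x. h (x + y)) = (NI x. h (x + y) * indicator ucube x)" by (rule nn_integral_utor) measurable
 also have "... = (NI x. h x * indicator ucube (x - y))"
  using nn_integral_translate(1)[of "%x. h x * indicator ucube (x - y)" y] by simp
 also have "... = (NU x. (\<integral>\<^sup>+j. h (x + iv j) * indicator ucube (x + iv j - y) \<partial>count_space UNIV))"
  by (rule nn_integral_unfold) measurable
 also have "... = (NU x. h x)" by (simp add: per nn_integral_cmult c)
 finally show ?thesis .
qed

section \<open>Characters and Fejer means\<close>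

lemma norm_character [simp]: "norm (character k x) = 1"
 by (simp add: character_def)

lemma measurable_character [measurable]: "character k \<in> bm"
 unfolding character_def[abs_def] by measurable

lemma character_add: "character k (x + y) = character k x * character k y"
 by (simp add: character_def cis_mult distrib_left sum.distrib)

lemma character_iv [simp]: "character k (iv j) = 1"
proof -
 have "(\<Sum>i\<in>UNIV. real_of_int (k $ i) * iv j $ i) = real_of_int (\<Sum>i\<in>UNIV. k $ i * j $ i)" by simp
 then show ?thesis unfolding character_def by (simp only:) (rule cis_multiple_2pi, rule Ints_of_int)
qed

lemma character_mult: "character k x * character l x = character (k + l) x"
 by (simp add: character_def cis_mult distrib_right distrib_left sum.distrib)

lemma cnj_character: "cnj (character k x) = character (- k) x"
 by (simp add: character_def cis_cnj sum_negf)

lemma character_uminus: "character k (- x) = character (- k) x"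
 by (simp add: character_def sum_negf)

lemma character_inner: "character k x = cis (2 * pi * (iv k \<bullet> x))"
 by (simp add: character_def inner_vec_def)

lemma character_prod: "character k x = (\<Prod>i\<in>UNIV. cis (2 * pi * (real_of_int (k $ i) * x $ i)))"
 by (simp add: character_def sum_distrib_left cis_sum)

text \<open>The period starts at an arbitrary \<open>a\<close> because the Fejer kernel will be
  integrated over a period centred at its peak.\<close>

lemma integral_cis_period:
 fixes a :: real and k :: int
 shows "(BI t. indicator {a..<a + 1} t * cis (2 * pi * (real_of_int k * t))) = (if k = 0 then 1 else 0)"
proof -
 have "(BI t. indicator {a..<a + 1} t * cis (2 * pi * (real_of_int k * t))) = (BI t. indicat_real {a..a + 1} t *\<^sub>R cis (2 * pi * (real_of_int k * t)))"
 proof (rule integral_cong_AE)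
  show "AE t in lborel. indicator {a..<a + 1} t * cis (2 * pi * (real_of_int k * t)) = indicat_real {a..a + 1} t *\<^sub>R cis (2 * pi * (real_of_int k * t))"
   using AE_lborel_singleton[of "a + 1"] by eventually_elim (auto simp: indicator_def)
 qed measurable
 also have "... = (if k = 0 then 1 else 0)"
 proof (cases "k = 0")
  case False
  define F where "F x = (1 / (\<i> * (2 * pi * k))) * cis (2 * pi * (real_of_int k * x))" for x
  have d: "(F has_vector_derivative cis (2 * pi * (real_of_int k * x))) (at x within {a..a + 1})" for x
   unfolding F_def cis_conv_exp
   by (rule has_vector_derivative_real_field derivative_eq_intros refl | simp add: False field_simps)+
  have "(BI t. indicat_real {a..a + 1} t *\<^sub>R cis (2 * pi * (real_of_int k * t))) = F (a + 1) - F a"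
   by (rule integral_FTC_atLeastAtMost[OF _ d]) (auto intro!: continuous_intros)
  also have "cis (2 * pi * (real_of_int k * (a + 1))) = cis (2 * pi * (real_of_int k * a))"
  proof -
   have "cis (2 * pi * (real_of_int k * (a + 1))) = cis (2 * pi * (real_of_int k * a)) * cis (2 * pi * real_of_int k)"
    unfolding cis_mult by (rule arg_cong[where f=cis]) (simp add: algebra_simps)
   then show ?thesis by (simp only: cis_multiple_2pi[OF Ints_of_int] mult_1_right)
  qed
  then have "F (a + 1) - F a = 0" by (simp add: F_def)
  finally show ?thesis using False by simp
 qed (simp add: scaleR_conv_of_real)
 finally show ?thesis .
qed

lemma integral_character:
 fixes k :: "int^'n::finite"
 shows "(BU x. character k x) = (if k = 0 then 1 else 0)"
proof -
 have i: "integrable lborel (%t. indicator {0..<1} t * cis (2 * pi * (real_of_int m * t)))" for m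
  using integrable_mult_cis[OF integrable_indicator_complex[of "{0..<1::real}" lborel], of "%t. 2 * pi * (real_of_int m * t)"] by simp
 have "(BU x. character k x) = (BI x. indicator ucube x *\<^sub>R character k x)"
  unfolding utor_def by (subst integral_density) auto
 also have "... = (BI x. (\<Prod>i\<in>UNIV. indicator {0..<1} (x $ i) * cis (2 * pi * (real_of_int (k $ i) * x $ i))))"
 proof (intro Bochner_Integration.integral_cong refl)
  fix x :: "real^'n"
  have "indicat_real ucube x *\<^sub>R character k x = indicator ucube x * character k x" by (simp add: indicator_def)
  also have "... = (\<Prod>i\<in>UNIV. indicator {0..<1} (x $ i) * cis (2 * pi * (real_of_int (k $ i) * x $ i)))"
   unfolding ucube_def indicator_cbx character_prod by (simp add: prod.distrib)
  finally show "indicat_real ucube x *\<^sub>R character k x = (\<Prod>i\<in>UNIV. indicator {0..<1} (x $ i) * cis (2 * pi * (real_of_int (k $ i) * x $ i)))" .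
 qed
 also have "... = (\<Prod>i\<in>UNIV. (BI t. indicator {0..<1} t * cis (2 * pi * (real_of_int (k $ i) * t))))"
  using i by (rule vec_prod_integral(2))
 also have "... = (\<Prod>i\<in>UNIV. if k $ i = 0 then 1 else 0)"
  using integral_cis_period[of 0] by simp
 also have "... = (if k = 0 then 1 else 0)"
  by (cases "k = 0") (auto simp: vec_eq_iff intro!: prod_zero)
 finally show ?thesis .
qed

lemma fourier_coeff_utor:
 fixes F :: "real^'n::finite => complex"
 assumes [measurable]: "F \<in> borel_measurable torus"
 shows "fourier_coeff F k = (BU x. pex F x * cnj (character k x))"
proof -
 have [measurable]: "pex F \<in> bm" by (rule measurable_pex) fact
 show ?thesis unfolding fourier_coeff_def cnj_character
  by (rule integral_torus) (simp add: pex_ucube, measurable)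
qed

definition trigp :: "(int^'n) set => (int^'n => complex) => real^'n => complex" where
 "trigp K a x = (\<Sum>k\<in>K. a k * character k x)"

lemma measurable_trigp [measurable]: "trigp K a \<in> bm"
 unfolding trigp_def[abs_def] by measurable

lemma trigp_bound: "norm (trigp K a x) <= (\<Sum>k\<in>K. norm (a k))"
 unfolding trigp_def by (rule order_trans[OF norm_sum]) (simp add: norm_mult)

lemma trigp_periodic: "trigp K a (x + iv j) = trigp K a x"
 by (simp add: trigp_def character_add)

lemma fourier_coeff_trigp:
 fixes a :: "int^'n::finite => complex"
 assumes K: "finite K"
 shows "fourier_coeff (trigp K a) l = (if l \<in> K then a l else 0)"
proof -
 have i: "integrable utor (%x::real^'n. c * character k x)" for k c
  by (rule integrable_utor_bounded[of _ "norm c"]) (auto simp: norm_mult)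
 have "fourier_coeff (trigp K a) l = (BU x. (\<Sum>k\<in>K. a k * character (k - l) x))"
  unfolding fourier_coeff_def
 proof (rule integral_torus)
  fix x :: "real^'n"
  show "trigp K a x * cnj (character l x) = (\<Sum>k\<in>K. a k * character (k - l) x)"
   unfolding trigp_def sum_distrib_right by (intro sum.cong refl) (simp add: cnj_character mult.assoc character_mult)
 qed measurable
 also have "... = (\<Sum>k\<in>K. a k * (if k - l = 0 then 1 else 0))"
  using i by (subst Bochner_Integration.integral_sum) (auto simp: integral_character)
 also have "... = (\<Sum>k\<in>K. if k = l then a k else 0)" by (intro sum.cong refl) auto
 also have "... = (if l \<in> K then a l else 0)" using K by simp
 finally show ?thesis .
qed

section \<open>The periodic Fejer kernel\<close>

definition fm :: "nat => int => real" where
 "fm n k = max 0 (1 - \<bar>real_of_int k\<bar> / real n)"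

text \<open>The form as a squared modulus shows positivity, while \<open>fk_eq\<close> recovers the
  multipliers \<open>fm\<close>. For \<open>n = 0\<close> the division yields 0, and the kernel has
  mass 1 only for positive \<open>n\<close>.\<close>

definition fk :: "nat => real => real" where
 "fk n t = (norm (\<Sum>j<n. cis (2 * pi * (real j * t))))\<^sup>2 / real n"

lemma fk_nonneg [simp]: "0 <= fk n t"
 by (simp add: fk_def)

lemma measurable_fk [measurable]: "fk n \<in> bm"
 unfolding fk_def[abs_def] by measurable

lemma fk_eq:
 assumes n: "0 < n"
 shows "cof (fk n t) = (\<Sum>k\<in>{- int n<..<int n}. cof (fm n k) * cis (2 * pi * (real_of_int k * t)))"
proof -
 let ?e = "%k::int. cis (2 * pi * (real_of_int k * t))"
 let ?P = "{..<n} \<times> {..<n}" and ?K = "{- int n<..<int n}"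
 let ?d = "%p::nat \<times> nat. int (fst p) - int (snd p)"
 \<comment> \<open>Expanding the square gives one term for each pair of indices below
   \<open>n\<close>. The pairs with difference \<open>k\<close> are parametrised by their minimum,
   which runs through \<open>n - |k|\<close> values.\<close>
 have card: "card {p \<in> ?P. ?d p = k} = nat (int n - \<bar>k\<bar>)" if k: "k \<in> ?K" for k
 proof -
  define m where "m = nat (int n - \<bar>k\<bar>)"
  have "{p \<in> ?P. ?d p = k} = (%b. (b + nat k, b + nat (- k))) ` {..<m}"
  proof (intro set_eqI iffI)
   fix p assume p: "p \<in> {p \<in> ?P. ?d p = k}"
   obtain a b where ab: "p = (a, b)" by (cases p)
   show "p \<in> (%b. (b + nat k, b + nat (- k))) ` {..<m}"
    using p k unfolding ab m_def by (intro image_eqI[of _ _ "min a b"]) auto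
  qed (use k in \<open>auto simp: m_def\<close>)
  moreover have "inj_on (%b. (b + nat k, b + nat (- k))) {..<m}" by (auto simp: inj_on_def)
  ultimately show ?thesis by (simp add: card_image m_def)
 qed
 have "cof ((norm (\<Sum>j<n. cis (2 * pi * (real j * t))))\<^sup>2) = (\<Sum>a<n. cis (2 * pi * (real a * t))) * (\<Sum>b<n. cis (- (2 * pi * (real b * t))))"
  unfolding complex_norm_square by (simp add: cis_cnj)
 also have "... = (\<Sum>a<n. \<Sum>b<n. ?e (int a - int b))"
  unfolding sum_product by (intro sum.cong refl) (simp add: cis_mult algebra_simps)
 also have "... = (\<Sum>p\<in>?P. ?e (?d p))" by (simp add: sum.cartesian_product case_prod_beta)
 also have "... = (\<Sum>k\<in>?K. \<Sum>p\<in>{p \<in> ?P. ?d p = k}. ?e (?d p))"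
  by (rule sum.group[symmetric]) auto
 also have "... = (\<Sum>k\<in>?K. real n * fm n k * ?e k)"
 proof (intro sum.cong refl)
  fix k assume k: "k \<in> ?K"
  have k': "\<bar>k\<bar> < int n" using k by auto
  then have "real_of_int \<bar>k\<bar> <= real n" by linarith
  then have "fm n k = 1 - real_of_int \<bar>k\<bar> / real n" using n by (simp add: fm_def)
  moreover have "real (nat (int n - \<bar>k\<bar>)) = real n - real_of_int \<bar>k\<bar>" using k' by simp
  ultimately have c: "real (card {p \<in> ?P. ?d p = k}) = real n * fm n k"
   unfolding card[OF k] using n by (simp add: right_diff_distrib)
  have "(\<Sum>p\<in>{p \<in> ?P. ?d p = k}. ?e (?d p)) = (\<Sum>p\<in>{p \<in> ?P. ?d p = k}. ?e k)"
   by (intro sum.cong refl) auto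
  also have "... = cof (real (card {p \<in> ?P. ?d p = k})) * ?e k"
   by (simp only: sum_constant of_real_of_nat_eq)
  also have "... = real n * fm n k * ?e k" unfolding c by simp
  finally show "(\<Sum>p\<in>{p \<in> ?P. ?d p = k}. ?e (?d p)) = real n * fm n k * ?e k" .
 qed
 also have "... = real n * (\<Sum>k\<in>?K. fm n k * ?e k)" by (simp add: sum_distrib_left mult.assoc)
 finally show ?thesis using n unfolding fk_def by (simp add: field_simps)
qed

definition FM :: "nat => int^'n => real" where
 "FM n k = (\<Prod>i\<in>UNIV. fm n (k $ i))"

definition FK :: "nat => real^'n => real" where
 "FK n x = (\<Prod>i\<in>UNIV. fk n (x $ i))"

definition KN :: "nat => (int^'n) set" where
 "KN n = {k. \<forall>i. k $ i \<in> {- int n<..<int n}}"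

lemma finite_KN: "finite (KN n :: (int^'n::finite) set)"
 unfolding KN_def by (intro finite_vec) auto

lemma FM_eq_0: "0 < n ==> k \<notin> KN n ==> FM n (k::int^'n::finite) = 0"
proof -
 assume n: "0 < n" and "k \<notin> KN n"
 then obtain i where "k $ i \<notin> {- int n<..<int n}" unfolding KN_def by blast
 then have "\<bar>k $ i\<bar> \<ge> int n" by auto
 then have "fm n (k $ i) = 0" using n by (auto simp: fm_def field_simps)
 then show ?thesis unfolding FM_def by (intro prod_zero) auto
qed

lemma FM_0 [simp]: "FM n 0 = 1"
 by (simp add: FM_def fm_def)

lemma FM_tendsto: "(%n. FM n k) \<longlonglongrightarrow> 1"
proof -
 have "(%n. fm n (k $ i)) \<longlonglongrightarrow> max 0 (1 - 0)" for i
  unfolding fm_def by (intro tendsto_intros lim_const_over_n)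
 then have "(%n. FM n k) \<longlonglongrightarrow> (\<Prod>i\<in>(UNIV::'a set). 1)" unfolding FM_def by (intro tendsto_prod) simp
 then show ?thesis by simp
qed

lemma FK_nonneg [simp]: "0 <= FK n x"
 unfolding FK_def by (intro prod_nonneg) auto

lemma measurable_FK [measurable]: "FK n \<in> borel_measurable (borel :: (real^'n::finite) measure)"
 unfolding FK_def[abs_def] by measurable

lemma FK_eq:
 assumes n: "0 < n"
 shows "cof (FK n x) = trigp (KN n) (%k. cof (FM n k)) (x::real^'n::finite)"
proof -
 let ?K = "{- int n<..<int n}"
 have "cof (FK n x) = (\<Prod>i\<in>UNIV. \<Sum>k\<in>?K. cof (fm n k) * cis (2 * pi * (real_of_int k * x $ i)))"
  by (simp add: FK_def fk_eq[OF n])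
 also have "... = (\<Sum>g\<in>PiE (UNIV::'n set) (%_. ?K). \<Prod>i\<in>UNIV. cof (fm n (g i)) * cis (2 * pi * (real_of_int (g i) * x $ i)))"
  by (rule prod_sum_PiE) auto
 also have "... = (\<Sum>k\<in>KN n. cof (FM n k) * character k x)"
  by (rule sum.reindex_bij_witness[of _ vec_nth vec_lambda])
   (auto simp: KN_def FM_def character_prod prod.distrib PiE_UNIV_domain)
 finally show ?thesis by (simp add: trigp_def)
qed

lemma FK_periodic: "FK n (x + iv j) = FK n (x :: real^'n::finite)"
proof (cases "0 < n")
 case True
 then have "cof (FK n (x + iv j)) = cof (FK n x)" by (simp add: FK_eq trigp_periodic)
 then show ?thesis by simp
qed (simp add: FK_def fk_def)

lemma fk_uminus: "fk n (- t) = fk n t"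
proof -
 have "(\<Sum>j<n. cis (2 * pi * (real j * (- t)))) = cnj (\<Sum>j<n. cis (2 * pi * (real j * t)))"
  by (simp add: cis_cnj)
 then show ?thesis by (simp only: fk_def complex_mod_cnj)
qed

lemma FK_diff_commute: "FK n (x - y) = FK n (y - x)"
proof -
 have "fk n (x $ i - y $ i) = fk n (y $ i - x $ i)" for i using fk_uminus[of n "y $ i - x $ i"] by simp
 then show ?thesis by (simp add: FK_def)
qed

lemma integral_FK_character:
 assumes n: "0 < n"
 shows "(BU y. cof (FK n (x - y)) * character k y) = FM n k * character k (x :: real^'n::finite)"
proof -
 have i: "integrable utor (%y::real^'n. c * character l y)" for l c
  by (rule integrable_utor_bounded[of _ "norm c"]) (auto simp: norm_mult)
 have "cof (FK n (x - y)) * character k y = (\<Sum>l\<in>KN n. (FM n l * character l x) * character (k - l) y)" for y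
 proof -
  have c: "character l (x - y) = character l x * character (- l) y" for l
   using character_add[of l x "- y"] by (simp add: character_uminus)
  show ?thesis unfolding FK_eq[OF n] trigp_def sum_distrib_right c
  proof (intro sum.cong refl)
   fix l
   have "character (- l) y * character k y = character (k - l) y" by (simp add: character_mult)
   then show "cof (FM n l) * (character l x * character (- l) y) * character k y = cof (FM n l) * character l x * character (k - l) y"
    by (metis mult.assoc)
  qed
 qed
 then have "(BU y. cof (FK n (x - y)) * character k y) = (\<Sum>l\<in>KN n. (FM n l * character l x) * (if k - l = 0 then 1 else 0))"
  using i by (subst Bochner_Integration.integral_cong[OF refl, of _ _ "%y. \<Sum>l\<in>KN n. (FM n l * character l x) * character (k - l) y"], simp)
   (subst Bochner_Integration.integral_sum, auto simp: integral_character)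
 also have "... = (\<Sum>l\<in>KN n. if l = k then FM n l * character l x else 0)" by (intro sum.cong refl) auto
 also have "... = FM n k * character k x" by (simp add: finite_KN FM_eq_0[OF n])
 finally show ?thesis .
qed

lemma nn_integral_FK:
 fixes x y :: "real^'n::finite"
 assumes n: "0 < n"
 shows "(NU y. ennreal (FK n (x - y))) = 1" "(NU x. ennreal (FK n (x - y))) = 1"
proof -
 have A: "(NU y. ennreal (FK n (x - y))) = 1" for x :: "real^'n"
 proof -
  have "character 0 y = 1" for y :: "real^'n" by (simp add: character_def)
  then have c: "(BU y. cof (FK n (x - y))) = 1" using integral_FK_character[OF n, of x 0] by simp
  then have "integrable utor (%y. cof (FK n (x - y)))" using not_integrable_integral_eq by force
  then have i: "integrable utor (%y. FK n (x - y))" by (simp add: complex_of_real_integrable_eq)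
  have "cof (BU y. FK n (x - y)) = 1" using c by simp
  then have "(BU y. FK n (x - y)) = 1" using of_real_eq_1_iff by blast
  then show ?thesis using i by (subst nn_integral_eq_integral) auto
 qed
 show "(NU y. ennreal (FK n (x - y))) = 1" by (rule A)
 show "(NU x. ennreal (FK n (x - y))) = 1" using A[of y] by (simp add: FK_diff_commute[of n _ y])
qed

text \<open>Jensen for the probability density \<open>FK n (x - y)\<close> in \<open>y\<close>, then
  Fubini, where the mass of the kernel in the other variable is 1 as well. No finiteness of the
  right-hand side enters.\<close>

lemma fejer_contract:
 fixes U :: "real^'n::finite => ennreal"
 assumes n: "0 < n" and p: "1 <= p" and [measurable]: "U \<in> bm"
 shows "(NU x. (NU y. ennreal (FK n (x - y)) * U y) epowr p) <= (NU y. U y epowr p)"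
proof -
 interpret utor: sigma_finite_measure "utor :: (real^'n) measure" by (rule sigma_finite_utor)
 interpret pair_sigma_finite "utor :: (real^'n) measure" "utor :: (real^'n) measure" by standard
 have "(NU x. (NU y. ennreal (FK n (x - y)) * U y) epowr p) <= (NU x. (NU y. ennreal (FK n (x - y)) * U y epowr p))"
  by (intro nn_integral_mono jensen_epowr nn_integral_FK n p) measurable
 also have "... = (NU y. (NU x. ennreal (FK n (x - y)) * U y epowr p))"
  by (rule Fubini') measurable
 also have "... = (NU y. U y epowr p)" using n by (simp add: nn_integral_multc nn_integral_FK)
 finally show ?thesis .
qed

lemma integrable_pex:
 fixes F :: "real^'n::finite => complex"
 assumes F: "F \<in> borel_measurable torus" and p: "1 <= p" and f: "pint p torus F < top"
 shows "pint p torus F = pint p utor (pex F)" "integrable utor (pex F)"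
proof -
 have [measurable]: "pex F \<in> bm" by (rule measurable_pex[OF F])
 interpret prob_space "utor :: (real^'n) measure" by (rule prob_space_utor)
 show e: "pint p torus F = pint p utor (pex F)"
  unfolding pint_def by (rule nn_integral_torus) (simp_all add: pex_ucube)
 have "(NU x. enorm (pex F x)) <= (NU x. 1 + enorm (pex F x) epowr p)"
  by (intro nn_integral_mono le_one_plus_epowr p)
 also have "... = 1 + pint p utor (pex F)" using emeasure_space_1 by (simp add: nn_integral_add pint_def)
 also have "... < top" using f e by simp
 finally show "integrable utor (pex F)" by (simp add: integrable_iff_bounded)
qed

section \<open>Fejer means and the square function\<close>

definition fmean :: "nat => (real^'n => complex) => real^'n => complex" where
 "fmean n F = trigp (KN n) (%k. cof (FM n k) * fourier_coeff F k)"

lemma measurable_fmean [measurable]: "fmean n F \<in> bm"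
 by (simp add: fmean_def)

lemma fourier_coeff_fmean:
 assumes "0 < n" shows "fourier_coeff (fmean n F) k = FM n k * fourier_coeff F (k :: int^'n::finite)"
 unfolding fmean_def fourier_coeff_trigp[OF finite_KN] using FM_eq_0[OF assms, of k] by auto

lemma fmean_eq_integral:
 fixes F :: "real^'n::finite => complex"
 assumes n: "0 < n" and F: "F \<in> borel_measurable torus" and i: "integrable utor (pex F)"
 shows "fmean n F x = (BU y. cof (FK n (x - y)) * pex F y)"
proof -
 have int: "integrable utor (%y. c * (pex F y * cnj (character k y)))" for k c
 proof -
  have "integrable utor (%y. character (- k) y * pex F y)" by (rule integrable_mult_bounded[OF i]) auto
  then show ?thesis unfolding cnj_character by (simp add: mult.commute)
 qed
 have "(BU y. cof (FK n (x - y)) * pex F y) = (BU y. (\<Sum>k\<in>KN n. (FM n k * character k x) * (pex F y * cnj (character k y))))"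
 proof (intro Bochner_Integration.integral_cong refl)
  fix y
  have c: "character k (x - y) = character k x * cnj (character k y)" for k
   using character_add[of k x "- y"] by (simp add: character_uminus cnj_character)
  show "cof (FK n (x - y)) * pex F y = (\<Sum>k\<in>KN n. (FM n k * character k x) * (pex F y * cnj (character k y)))"
   unfolding FK_eq[OF n] trigp_def sum_distrib_right c by (intro sum.cong refl) (simp add: mult_ac)
 qed
 also have "... = (\<Sum>k\<in>KN n. (BU y. (FM n k * character k x) * (pex F y * cnj (character k y))))"
  by (rule Bochner_Integration.integral_sum) (rule int)
 also have "... = (\<Sum>k\<in>KN n. (FM n k * character k x) * fourier_coeff F k)"
  unfolding fourier_coeff_utor[OF F] by simp
 finally show ?thesis unfolding fmean_def trigp_def by (simp add: mult_ac)
qed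

lemma pint_fmean_le:
 fixes F :: "real^'n::finite => complex"
 assumes n: "0 < n" and F: "F \<in> borel_measurable torus" and p: "1 <= p" and f: "pint p torus F < top"
 shows "pint p utor (fmean n F) <= pint p torus F"
proof -
 have [measurable]: "pex F \<in> bm" by (rule measurable_pex[OF F])
 have "pint p utor (fmean n F) <= (NU x. (NU y. ennreal (FK n (x - y)) * enorm (pex F y)) epowr p)"
  unfolding pint_def
 proof (intro nn_integral_mono epowr_mono)
  fix x
  show "enorm (fmean n F x) <= (NU y. ennreal (FK n (x - y)) * enorm (pex F y))"
   unfolding fmean_eq_integral[OF n F integrable_pex(2)[OF F p f]]
   by (rule order_trans[OF nn_norm_integral_le]) (simp add: norm_mult ennreal_mult')
 qed (use p in simp)
 also have "... <= pint p utor (pex F)" unfolding pint_def by (rule fejer_contract[OF n p]) measurable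
 finally show ?thesis using integrable_pex(1)[OF F p f] by simp
qed

definition sqT :: "real => (real^'n::finite => complex) => ennreal" where
 "sqT p F = (\<integral>\<^sup>+x. square_function int_dyadic_boxes torus_partial_sum F x epowr p \<partial>torus)"

lemma torus_square_function_eq: "square_function int_dyadic_boxes torus_partial_sum F x = l2n int_dyadic_boxes (%R. trigp R (fourier_coeff F) x)"
 by (simp add: square_function_eq_l2n torus_partial_sum_def trigp_def)

lemma measurable_torus_square [measurable]:
 "(%x. l2n int_dyadic_boxes (%R. trigp R c x)) \<in> borel_measurable (borel :: (real^'n::finite) measure)"
 by (rule measurable_l2n[OF countable_int_dyadic_boxes]) measurable

lemma sqT_eq: "sqT p F = (NU x. l2n int_dyadic_boxes (%R. trigp R (fourier_coeff F) x) epowr p)"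
 unfolding sqT_def torus_square_function_eq by (rule nn_integral_torus) auto

text \<open>Averaging with the Fejer kernel commutes with the block sums, so by Minkowski's
  inequality the square function of the mean is at most the mean of the square function, and
  \<open>fejer_contract\<close> applies.\<close>

lemma sqT_fmean_le:
 fixes F :: "real^'n::finite => complex"
 assumes n: "0 < n" and p: "1 <= p"
 shows "sqT p (fmean n F) <= sqT p F"
proof -
 have "sqT p (fmean n F) <= (NU x. (NU y. ennreal (FK n (x - y)) * l2n int_dyadic_boxes (%R. trigp R (fourier_coeff F) y)) epowr p)"
  unfolding sqT_eq
 proof (intro nn_integral_mono epowr_mono)
  fix x :: "real^'n"
  have i: "integrable utor (%y. cof (FK n (x - y)) * trigp R c y)" for R c
  proof (rule integrable_utor_bounded)
   fix y
   have "norm (cof (FK n (x - y))) <= (\<Sum>k\<in>(KN n :: (int^'n) set). norm (cof (FM n k)))"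
    unfolding FK_eq[OF n] by (rule order_trans[OF trigp_bound]) simp
   then show "norm (cof (FK n (x - y)) * trigp R c y) <= (\<Sum>k\<in>(KN n :: (int^'n) set). norm (cof (FM n k))) * (\<Sum>k\<in>R. norm (c k))"
    unfolding norm_mult by (intro mult_mono trigp_bound sum_nonneg) auto
  qed measurable
  have ic: "integrable utor (%y. a * (cof (FK n (x - y)) * character k y))" for a k
   using i[of "{k}" "%_. a"] by (simp add: trigp_def mult_ac)
  have e: "trigp R (fourier_coeff (fmean n F)) x = (BU y. cof (FK n (x - y)) * trigp R (fourier_coeff F) y)" for R
  proof -
   have "(BU y. cof (FK n (x - y)) * trigp R (fourier_coeff F) y) = (BU y. (\<Sum>k\<in>R. fourier_coeff F k * (cof (FK n (x - y)) * character k y)))"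
    by (simp add: trigp_def sum_distrib_left mult_ac)
   also have "... = (\<Sum>k\<in>R. (BU y. fourier_coeff F k * (cof (FK n (x - y)) * character k y)))"
    by (rule Bochner_Integration.integral_sum) (rule ic)
   also have "... = (\<Sum>k\<in>R. fourier_coeff F k * (FM n k * character k x))" by (simp add: integral_FK_character[OF n])
   finally show ?thesis by (simp add: trigp_def fourier_coeff_fmean[OF n] mult_ac)
  qed
  have "l2n int_dyadic_boxes (%R. trigp R (fourier_coeff (fmean n F)) x) <= (NU y. l2n int_dyadic_boxes (%R. cof (FK n (x - y)) * trigp R (fourier_coeff F) y))"
   unfolding e by (rule l2n_integral_le) (rule i)
  also have "... = (NU y. ennreal (FK n (x - y)) * l2n int_dyadic_boxes (%R. trigp R (fourier_coeff F) y))"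
   by (subst mult.commute) (simp add: l2n_mult mult.commute)
  finally show "l2n int_dyadic_boxes (%R. trigp R (fourier_coeff (fmean n F)) x) <= (NU y. ennreal (FK n (x - y)) * l2n int_dyadic_boxes (%R. trigp R (fourier_coeff F) y))" .
 qed (use p in simp)
 also have "... <= sqT p F" unfolding sqT_eq by (rule fejer_contract[OF n p]) measurable
 finally show ?thesis .
qed

section \<open>Convergence of Fejer means in the mean\<close>

lemma fk_tail:
 assumes \<delta>: "0 < \<delta>" and s: "\<delta> <= \<bar>s\<bar>" "\<bar>s\<bar> <= 1 / 2"
 shows "fk n s <= (4 / (2 - 2 * cos (2 * pi * \<delta>))) / real n" "0 < 2 - 2 * cos (2 * pi * \<delta>)"
proof -
 define w where "w = cis (2 * pi * s)"
 have "cos (2 * pi * \<delta>) < cos 0" using \<delta> s by (intro cos_monotone_0_pi) auto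
 then show pos: "0 < 2 - 2 * cos (2 * pi * \<delta>)" by simp
 have "cos (2 * pi * s) = cos (2 * pi * \<bar>s\<bar>)" by (simp add: abs_if)
 also have "... <= cos (2 * pi * \<delta>)" using \<delta> s by (intro cos_monotone_0_pi_le) auto
 finally have c: "cos (2 * pi * s) <= cos (2 * pi * \<delta>)" .
 have "(norm (w - 1))\<^sup>2 = (cos (2 * pi * s) - 1)\<^sup>2 + (sin (2 * pi * s))\<^sup>2" by (simp add: w_def cmod_power2)
 also have "... = 2 - 2 * cos (2 * pi * s)" using sin_cos_squared_add[of "2 * pi * s"] by (simp add: power2_diff)
 finally have w: "(norm (w - 1))\<^sup>2 \<ge> 2 - 2 * cos (2 * pi * \<delta>)" using c by linarith
 then have w1: "w ~= 1" using pos by auto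
 have "cis (2 * pi * (real j * s)) = w ^ j" for j
  unfolding w_def by (induction j) (simp_all add: cis_mult[symmetric] distrib_left distrib_right)
 then have "(\<Sum>j<n. cis (2 * pi * (real j * s))) = (\<Sum>j<n. w ^ j)" by (simp only:)
 \<comment> \<open>The numerator has modulus at most 2, while the denominator is bounded below away
   from the integers; the normalisation by \<open>n\<close> therefore makes the tail of order
   \<open>1 / n\<close>.\<close>
 also have "... = (w ^ n - 1) / (w - 1)" by (rule geometric_sum[OF w1])
 finally have "(norm (\<Sum>j<n. cis (2 * pi * (real j * s))))\<^sup>2 = (norm (w ^ n - 1))\<^sup>2 / (norm (w - 1))\<^sup>2"
  by (simp add: norm_divide power_divide)
 also have "... <= 2\<^sup>2 / (2 - 2 * cos (2 * pi * \<delta>))"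
 proof (rule frac_le)
  have "norm (w ^ n - 1) <= norm (w ^ n) + norm (1::complex)" by (rule norm_triangle_ineq4)
  also have "... = 2" by (simp add: w_def norm_power)
  finally show "(norm (w ^ n - 1))\<^sup>2 <= 2\<^sup>2" by (intro power_mono) auto
 qed (use w pos in auto)
 finally show "fk n s <= (4 / (2 - 2 * cos (2 * pi * \<delta>))) / real n"
  unfolding fk_def by (intro divide_right_mono) auto
qed

lemma nn_integral_fk:
 assumes n: "0 < n"
 shows "(NI t. ennreal (indicator {0..<1} t * fk n (t - 1/2))) = 1"
proof -
 let ?I = "indicator {- (1/2)..<- (1/2) + 1} :: real => complex"
 have ii: "integrable lborel (%t. c * (?I t * cis (2 * pi * (real_of_int m * t))))" for m c
  by (intro integrable_mult_right integrable_mult_cis integrable_indicator_complex) auto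
 have e: "cof (indicator {- (1/2)..<1/2} t * fk n t) = (\<Sum>k\<in>{- int n<..<int n}. cof (fm n k) * (?I t * cis (2 * pi * (real_of_int k * t))))" for t
  by (simp add: fk_eq[OF n] sum_distrib_left indicator_def)
 have "integrable lborel (%t. cof (indicator {- (1/2)..<1/2} t * fk n t))"
  unfolding e by (intro Bochner_Integration.integrable_sum ii)
 then have i: "integrable lborel (%t. indicator {- (1/2)..<1/2} t * fk n t)" by (simp only: complex_of_real_integrable_eq)
 have "cof (BI t. indicator {- (1/2)..<1/2} t * fk n t) = (BI t. cof (indicator {- (1/2)..<1/2} t * fk n t))"
  by (rule integral_complex_of_real[symmetric])
 also have "... = (\<Sum>k\<in>{- int n<..<int n}. cof (fm n k) * (if k = 0 then 1 else 0))"
  unfolding e Bochner_Integration.integral_sum[OF ii] integral_mult_right_zero integral_cis_period ..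
 also have "... = (\<Sum>k\<in>{0}. cof (fm n k) * (if k = 0 then 1 else 0))"
  using n by (intro sum.mono_neutral_right) auto
 also have "... = 1" by (simp add: fm_def)
 finally have "(BI t. indicator {- (1/2)..<1/2} t * fk n t) = 1" using of_real_eq_1_iff by blast
 then have "(NI t. ennreal (indicator {- (1/2)..<1/2} t * fk n t)) = 1"
  using i by (subst nn_integral_eq_integral) auto
 moreover have "(NI t. ennreal (indicator {0..<1} t * fk n (t - 1/2))) = (NI t. ennreal (indicator {- (1/2)..<1/2} (t - 1/2) * fk n (t - 1/2)))"
  by (intro nn_integral_cong) (simp add: indicator_def)
 ultimately show ?thesis
  using nn_integral_translate(2)[of "%t. ennreal (indicator {- (1/2)..<1/2} t * fk n t)" "1/2"] by simp
qed

text \<open>The centre of the unit cube. Shifting by it moves the peak of the Fejer kernel from the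
  corners into the interior, so that being far from the peak is a single condition in each
  coordinate.\<close>

definition halfv :: "real^'n" where "halfv = (\<chi> i. 1/2)"

lemma FK_tail:
 assumes n: "0 < n" and \<delta>: "0 < \<delta>" "\<delta> <= 1/2"
 shows "(NU (z::real^'n::finite). ennreal (FK n (z - halfv)) * indicator {z. \<delta> <= \<bar>z $ i - 1/2\<bar>} z) <= ennreal ((4 / (2 - 2 * cos (2 * pi * \<delta>))) / real n)"
proof -
 let ?C = "(4 / (2 - 2 * cos (2 * pi * \<delta>))) / real n"
 define S where "S = {t::real. \<delta> <= \<bar>t - 1/2\<bar>}"
 have [measurable]: "S \<in> sets borel" unfolding S_def by measurable
 define f where "f j t = ennreal (indicator {0..<1} t * fk n (t - 1/2)) * (if j = i then indicator S t else 1)" for j :: 'n and t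
 have [measurable]: "f j \<in> bm" for j unfolding f_def[abs_def] by measurable
 have m: "(%z::real^'n. ennreal (FK n (z - halfv)) * indicator {z. \<delta> <= \<bar>z $ i - 1/2\<bar>} z) \<in> bm"
  by measurable
 have "(NU (z::real^'n). ennreal (FK n (z - halfv)) * indicator {z. \<delta> <= \<bar>z $ i - 1/2\<bar>} z) = (NI (z::real^'n). (\<Prod>j\<in>UNIV. f j (z $ j)))"
  unfolding nn_integral_utor[OF m]
 proof (rule nn_integral_cong)
  fix z :: "real^'n"
  have "(\<Prod>j\<in>UNIV. f j (z $ j)) = (\<Prod>j\<in>UNIV. ennreal (indicator {0..<1} (z $ j) * fk n (z $ j - 1/2))) * indicator S (z $ i)"
   unfolding f_def by (simp add: prod.distrib)
  also have "(\<Prod>j\<in>UNIV. ennreal (indicator {0..<1} (z $ j) * fk n (z $ j - 1/2))) = ennreal (indicator ucube z * FK n (z - halfv))"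
   by (subst prod_ennreal) (auto simp: ucube_def indicator_cbx FK_def halfv_def prod.distrib)
  finally show "ennreal (FK n (z - halfv)) * indicator {z. \<delta> <= \<bar>z $ i - 1/2\<bar>} z * indicator ucube z = (\<Prod>j\<in>UNIV. f j (z $ j))"
   by (auto simp: indicator_def S_def)
 qed
 also have "... = (\<Prod>j\<in>UNIV. (NI t. f j t))" by (rule vec_prod_nn_integral) measurable
 also have "... = (NI t. f i t) * (\<Prod>j\<in>UNIV - {i}. (NI t. f j t))"
  by (rule prod.remove) auto
 also have "(\<Prod>j\<in>UNIV - {i}. (NI t. f j t)) = 1"
  by (intro prod.neutral) (auto simp: f_def nn_integral_fk[OF n])
 also have "(NI t. f i t) <= (NI (t::real). ennreal ?C * indicator {0..<1} t)"
 proof (rule nn_integral_mono)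
  fix t :: real
  show "f i t <= ennreal ?C * indicator {0..<1} t"
  proof (cases "t \<in> {0..<1} \<and> t \<in> S")
   case True
   then have "fk n (t - 1/2) <= ?C" by (intro fk_tail[OF \<delta>(1)]) (auto simp: S_def abs_if)
   then show ?thesis using True by (simp add: f_def ennreal_leI)
  qed (auto simp: f_def)
 qed
 also have "... = ennreal ?C" by (simp add: nn_integral_cmult_indicator)
 finally show ?thesis by simp
qed

text \<open>Otherwise some null sequence of translations violates continuity in \<open>L_1\<close>
  on Euclidean space for the periodic function cut off to \<open>[-1, 2]^d\<close>. This larger cube
  contains \<open>y\<close> and \<open>y + z\<close> for \<open>y\<close> in the unit cube and small
  \<open>z\<close>, and it meets only finitely many cells, so the cut-off function is
  integrable.\<close>

lemma utor_translation_small: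
 fixes G :: "real^'n::finite => complex"
 assumes [measurable]: "G \<in> bm" and per: "!!x j. G (x + iv j) = G x"
  and G: "(NU x. enorm (G x)) < top" and e: "0 < e"
 shows "\<exists>\<delta>>0. \<forall>z. (\<forall>i. \<bar>z $ i\<bar> < \<delta>) \<longrightarrow> (NU y. enorm (G y - G (y + z))) <= ennreal e"
proof (rule ccontr)
 assume neg: "\<not> ?thesis"
 have "\<exists>z. (\<forall>i. \<bar>z $ i\<bar> < 1 / real (Suc n)) \<and> ennreal e < (NU y. enorm (G y - G (y + z)))" for n
 proof -
  have "0 < 1 / real (Suc n)" by simp
  with neg show ?thesis by (meson not_le)
 qed
 then obtain z where z: "!!n i. \<bar>z n $ i\<bar> < 1 / real (Suc n)" "!!n. ennreal e < (NU y. enorm (G y - G (y + z n)))"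
  by metis
 have z0: "(%n. - z n) \<longlonglongrightarrow> 0"
 proof (rule vec_tendstoI)
  fix i
  have "(%n. 1 / real (Suc n)) \<longlonglongrightarrow> 0" by (rule LIMSEQ_Suc, rule lim_1_over_n)
  moreover have "eventually (%n. norm ((- z n) $ i) <= 1 / real (Suc n)) sequentially"
   using z(1) by (intro always_eventually allI) (simp add: less_imp_le del: of_nat_Suc)
  ultimately show "(%n. (- z n) $ i) \<longlonglongrightarrow> 0 $ i" unfolding zero_index by (rule Lim_null_comparison[rotated])
 qed
 define B where "B = cbx (%_::'n. {-1..2::real})"
 have [measurable]: "B \<in> sets borel" unfolding B_def by (intro measurable_cbx) auto
 define f where "f x = G x * indicator B x" for x
 have [measurable]: "f \<in> bm" unfolding f_def[abs_def] by measurable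
 define J where "J = {j::int^'n. \<forall>i. j $ i \<in> {-2..2}}"
 have J: "finite J" unfolding J_def by (intro finite_vec) auto
 have "pint 1 lborel f = (NI x. enorm (f x))" by (simp add: pint_def)
 also have "... = (NU x. (\<integral>\<^sup>+j. enorm (f (x + iv j)) \<partial>count_space UNIV))" by (rule nn_integral_unfold) measurable
 also have "... = (NU x. enorm (G x) * (\<integral>\<^sup>+j. indicator B (x + iv j) \<partial>count_space UNIV))"
  by (subst nn_integral_cmult[symmetric]) (auto simp: f_def per norm_mult indicator_def intro!: nn_integral_cong)
 also have "... = (NI x. enorm (G x) * (\<integral>\<^sup>+j. indicator B (x + iv j) \<partial>count_space UNIV) * indicator ucube x)"
  by (intro nn_integral_utor borel_measurable_times_ennreal sigma_finite_measure.borel_measurable_nn_integral[OF sigma_finite_measure_count_space]) measurable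
 also have "... <= (NI x. (enorm (G x) * of_nat (card J)) * indicator ucube x)"
 proof (rule nn_integral_mono)
  fix x :: "real^'n"
  show "enorm (G x) * (\<integral>\<^sup>+j. indicator B (x + iv j) \<partial>count_space UNIV) * indicator ucube x <= enorm (G x) * of_nat (card J) * indicator ucube x"
  proof (cases "x \<in> ucube")
   case True
   have "(\<integral>\<^sup>+j. indicator B (x + iv j) \<partial>count_space UNIV) <= (\<integral>\<^sup>+j. indicator J j \<partial>count_space UNIV)"
   proof (rule nn_integral_mono)
    fix j
    have "j \<in> J" if "x + iv j \<in> B"
     unfolding J_def
    proof (intro CollectI allI)
     fix i
     have "-1 <= x $ i + real_of_int (j $ i)" "x $ i + real_of_int (j $ i) <= 2" "0 <= x $ i" "x $ i < 1"
      using that True by (auto simp: B_def cbx_def mem_ucube)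
     then have "real_of_int (-2) < real_of_int (j $ i)" "real_of_int (j $ i) <= real_of_int 2" by simp_all
     then show "j $ i \<in> {-2..2}" by (simp only: of_int_less_iff of_int_le_iff) auto
    qed
    then show "indicator B (x + iv j) <= (indicator J j :: ennreal)" by (auto simp: indicator_def)
   qed
   also have "... = of_nat (card J)" using J by (simp add: emeasure_count_space)
   finally show ?thesis using True by (simp add: mult_left_mono)
  qed simp
 qed
 also have "... = (NU x. enorm (G x) * of_nat (card J))" by (rule nn_integral_utor[symmetric]) measurable
 also have "... < top" using G by (simp add: nn_integral_multc ennreal_mult_less_top ennreal_of_nat_eq_real_of_nat)
 finally have pf: "pint 1 lborel f < top" .
 have lim: "(%n. pint 1 lborel (%x. f (x - (- z n)) - f x)) \<longlonglongrightarrow> 0"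
  by (rule translation_continuous_Lp[OF _ _ pf z0]) auto
 have "ennreal e <= pint 1 lborel (%x. f (x - (- z n)) - f x)" for n
 proof -
  have "(NU y. enorm (G y - G (y + z n))) = (NI y. enorm (G y - G (y + z n)) * indicator ucube y)"
   by (rule nn_integral_utor) measurable
  also have "... <= pint 1 lborel (%x. f (x - (- z n)) - f x)"
   unfolding pint_def
  proof (rule nn_integral_mono)
   fix y
   have "1 / real (Suc n) <= 1" by simp
   then have zb: "\<bar>z n $ i\<bar> < 1" for i using z(1)[of n i] by linarith
   have "y \<in> B \<and> y + z n \<in> B" if "y \<in> ucube"
    unfolding B_def cbx_def
   proof (intro conjI CollectI allI)
    fix i
    have "0 <= y $ i" "y $ i < 1" using that by (auto simp: mem_ucube)
    then show "y $ i \<in> {-1..2}" "(y + z n) $ i \<in> {-1..2}" using zb[of i] by auto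
   qed
   then show "enorm (G y - G (y + z n)) * indicator ucube y <= enorm (f (y - (- z n)) - f y) epowr 1"
    by (cases "y \<in> ucube") (auto simp: f_def norm_minus_commute)
  qed
  finally show ?thesis using z(2)[of n] by simp
 qed
 then have "ennreal e <= 0" by (intro LIMSEQ_le_const[OF lim]) auto
 then show False using e by simp
qed

text \<open>Convergence in \<open>L_1\<close> is enough for every \<open>p\<close>: it yields an
  almost everywhere convergent subsequence, to which Fatou's lemma applies, and also the uniqueness
  of Fourier coefficients.\<close>

lemma fmean_L1:
 fixes F :: "real^'n::finite => complex"
 assumes F: "F \<in> borel_measurable torus" and i: "integrable utor (pex F)"
 shows "(%n. (NU x. enorm (fmean (Suc n) F x - pex F x))) \<longlonglongrightarrow> 0"
proof -
 interpret utor: prob_space "utor :: (real^'n) measure" by (rule prob_space_utor)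
 interpret P: pair_sigma_finite "utor :: (real^'n) measure" "utor :: (real^'n) measure" by standard
 define G where "G = pex F"
 have [measurable]: "G \<in> bm" unfolding G_def by (rule measurable_pex[OF F])
 have per: "G (x + iv j) = G x" for x j unfolding G_def by (rule pex_periodic)
 have Gi: "integrable utor G" using i by (simp add: G_def)
 have Gf: "(NU x. enorm (G x)) < top" using Gi by (simp add: integrable_iff_bounded)
 define \<tau> where "\<tau> z = (NU y. enorm (G y - G (y + z)))" for z
 have [measurable]: "\<tau> \<in> bm"
  unfolding \<tau>_def[abs_def] by (intro utor.borel_measurable_nn_integral) measurable
 have per2: "G (y + (z + iv j)) = G (y + z)" for y z j using per[of "y + z" j] by (simp add: add.assoc)
 define A where "A = (NU x. enorm (G x)) + (NU x. enorm (G x))"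
 have A: "A < top" using Gf by (simp add: A_def)
 have \<tau>b: "\<tau> z <= A" for z
 proof -
  have "\<tau> z <= (NU y. enorm (G y) + enorm (G (y + z)))"
   unfolding \<tau>_def by (intro nn_integral_mono) (simp add: norm_triangle_ineq4 flip: ennreal_plus)
  also have "... = (NU y. enorm (G y)) + (NU y. enorm (G (y + z)))"
   by (rule nn_integral_add) measurable
  also have "(NU y. enorm (G (y + z))) = (NU y. enorm (G y))"
   by (rule nn_integral_periodic_shift) (auto simp: per)
  finally show ?thesis by (simp add: A_def)
 qed
 have main: "(NU x. enorm (fmean n F x - G x)) <= (NU z. ennreal (FK n (z - halfv)) * \<tau> (z - halfv))" if n: "0 < n" for n
 proof -
  have FKb: "norm (cof (FK n y)) <= (\<Sum>k\<in>(KN n :: (int^'n) set). norm (cof (FM n k)))" for y :: "real^'n"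
   unfolding FK_eq[OF n] by (rule order_trans[OF trigp_bound]) simp
  have FKi: "integrable utor (%y. cof (FK n (x - y)))" for x :: "real^'n"
  proof (rule integrable_utor_bounded)
   fix y show "norm (cof (FK n (x - y))) <= (\<Sum>k\<in>(KN n :: (int^'n) set). norm (cof (FM n k)))" by (rule FKb)
  qed measurable
  have FK1: "(BU y. cof (FK n (x - y))) = 1" for x :: "real^'n"
   using integral_FK_character[OF n, of x 0] by (simp add: character_def)
  have "(NU x. enorm (fmean n F x - G x)) <= (NU x. (NU y. ennreal (FK n (x - y)) * enorm (G y - G x)))"
  proof (rule nn_integral_mono)
   fix x :: "real^'n"
   have GFi: "integrable utor (%y. cof (FK n (x - y)) * G y)"
   proof (rule integrable_mult_bounded[OF Gi])
    fix y show "norm (cof (FK n (x - y))) <= (\<Sum>k\<in>(KN n :: (int^'n) set). norm (cof (FM n k)))" by (rule FKb)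
   qed measurable
   have "fmean n F x - G x = (BU y. cof (FK n (x - y)) * G y) - (BU y. cof (FK n (x - y)) * G x)"
    by (simp only: fmean_eq_integral[OF n F i] G_def integral_mult_left_zero FK1 mult_1_left)
   also have "... = (BU y. cof (FK n (x - y)) * (G y - G x))"
    using GFi FKi by (subst Bochner_Integration.integral_diff[symmetric]) (auto simp: right_diff_distrib)
   finally have "enorm (fmean n F x - G x) <= (NU y. enorm (cof (FK n (x - y)) * (G y - G x)))"
    by (simp only: nn_norm_integral_le)
   then show "enorm (fmean n F x - G x) <= (NU y. ennreal (FK n (x - y)) * enorm (G y - G x))"
    by (simp add: norm_mult ennreal_mult')
  qed
  also have "... = (NU y. (NU x. ennreal (FK n (x - y)) * enorm (G y - G x)))"
   by (rule P.Fubini') measurable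
  \<comment> \<open>Periodicity permits the substitution \<open>x = z + y - halfv\<close>; after
    exchanging the integrals the inner one is the modulus of continuity \<open>\<tau>\<close> at
    \<open>z - halfv\<close>.\<close>
  also have "... = (NU y. (NU z. ennreal (FK n (z - halfv)) * enorm (G y - G (y + (z - halfv)))))"
  proof (rule nn_integral_cong)
   fix y :: "real^'n"
   have FKp: "FK n (x + iv j - y) = FK n (x - y)" for x j using FK_periodic[of n "x - y" j] by (simp add: algebra_simps)
   have "(NU x. ennreal (FK n (x - y)) * enorm (G y - G x)) = (NU z. ennreal (FK n (z + (y - halfv) - y)) * enorm (G y - G (z + (y - halfv))))"
    by (rule nn_integral_periodic_shift[symmetric]) (auto simp: per FKp)
   then show "(NU x. ennreal (FK n (x - y)) * enorm (G y - G x)) = (NU z. ennreal (FK n (z - halfv)) * enorm (G y - G (y + (z - halfv))))"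
    by (simp add: algebra_simps)
  qed
  also have "... = (NU z. (NU y. ennreal (FK n (z - halfv)) * enorm (G y - G (y + (z - halfv)))))"
   by (rule P.Fubini') measurable
  also have "... = (NU z. ennreal (FK n (z - halfv)) * \<tau> (z - halfv))"
   unfolding \<tau>_def by (intro nn_integral_cong nn_integral_cmult) measurable
  finally show ?thesis .
 qed
 have mFK: "(NU (z::real^'n). ennreal (FK n (z - halfv))) = 1" if "0 < n" for n
  using nn_integral_FK(2)[OF that] .
 show ?thesis
 proof (rule order_tendstoI)
  fix l :: ennreal assume "0 < l"
  have "\<exists>e>0. ennreal e < l"
  proof -
   obtain e' where "0 < e'" "e' < l" using dense[OF \<open>0 < l\<close>] by blast
   then show ?thesis by (cases e') auto
  qed
  then obtain e where e: "0 < e" "ennreal e < l" by blast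
  have e2: "0 < e / 2" using e by simp
  from utor_translation_small[OF _ per Gf e2] obtain \<delta>0 where
   \<delta>0: "0 < \<delta>0" "!!z. (\<forall>i. \<bar>z $ i\<bar> < \<delta>0) ==> \<tau> z <= ennreal (e / 2)" unfolding \<tau>_def by auto
  \<comment> \<open>The tail estimate of the kernel requires a radius of at most
    \<open>1 / 2\<close>, half a period.\<close>
  define \<delta> where "\<delta> = min \<delta>0 (1/2)"
  have \<delta>: "0 < \<delta>" "\<delta> <= 1/2" "\<delta> <= \<delta>0" using \<delta>0 by (auto simp: \<delta>_def)
  define c where "c = 4 / (2 - 2 * cos (2 * pi * \<delta>))"
  let ?S = "%i. {z::real^'n. \<delta> <= \<bar>z $ i - 1/2\<bar>}"
  have bound: "(NU z. ennreal (FK n (z - halfv)) * \<tau> (z - halfv)) <= ennreal (e / 2) + A * (of_nat CARD('n) * ennreal (c / real n))"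
   if n: "0 < n" for n
  proof -
   have "(NU z. ennreal (FK n (z - halfv)) * \<tau> (z - halfv)) <=
    (NU z. ennreal (FK n (z - halfv)) * ennreal (e / 2) + A * (\<Sum>i\<in>UNIV. ennreal (FK n (z - halfv)) * indicator (?S i) z))"
   proof (rule nn_integral_mono)
    fix z :: "real^'n"
    show "ennreal (FK n (z - halfv)) * \<tau> (z - halfv) <= ennreal (FK n (z - halfv)) * ennreal (e / 2) + A * (\<Sum>i\<in>UNIV. ennreal (FK n (z - halfv)) * indicator (?S i) z)"
    proof (cases "\<exists>i. z \<in> ?S i")
     case True
     then obtain i where i: "z \<in> ?S i" by blast
     have "ennreal (FK n (z - halfv)) * \<tau> (z - halfv) <= ennreal (FK n (z - halfv)) * A"
      by (intro mult_left_mono \<tau>b) auto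
     also have "... = A * (ennreal (FK n (z - halfv)) * indicator (?S i) z)" using i by (simp add: mult.commute)
     also have "... <= A * (\<Sum>i\<in>UNIV. ennreal (FK n (z - halfv)) * indicator (?S i) z)"
      by (intro mult_left_mono member_le_sum) auto
     finally show ?thesis by (rule order_trans) simp
    next
     case False
     then have "\<tau> (z - halfv) <= ennreal (e / 2)" using \<delta> by (intro \<delta>0(2)) (auto simp: halfv_def not_le intro: less_le_trans)
     then have "ennreal (FK n (z - halfv)) * \<tau> (z - halfv) <= ennreal (FK n (z - halfv)) * ennreal (e / 2)" by (intro mult_left_mono) auto
     then show ?thesis by (rule order_trans) simp
    qed
   qed
   also have "... = ennreal (e / 2) + A * (\<Sum>i\<in>UNIV. (NU z. ennreal (FK n (z - halfv)) * indicator (?S i) z))"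
   proof -
    define q where "q i z = ennreal (FK n (z - halfv)) * indicator (?S i) z" for i z
    have [measurable]: "q i \<in> bm" for i unfolding q_def[abs_def] by measurable
    show ?thesis unfolding q_def[symmetric]
     using mFK[OF n] by (simp add: nn_integral_add nn_integral_multc nn_integral_cmult nn_integral_sum)
   qed
   also have "... <= ennreal (e / 2) + A * (\<Sum>i\<in>(UNIV::'n set). ennreal (c / real n))"
    unfolding c_def by (intro add_left_mono mult_left_mono sum_mono FK_tail n \<delta>) auto
   finally show ?thesis by simp
  qed
  have "(%n. ennreal (c / real n)) \<longlonglongrightarrow> ennreal 0" by (intro tendsto_ennrealI lim_const_over_n)
  then have "(%n. A * (of_nat CARD('n) * ennreal (c / real n))) \<longlonglongrightarrow> A * (of_nat CARD('n) * 0)"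
   using A by (intro ennreal_tendsto_cmult) (auto simp: ennreal_mult_less_top ennreal_of_nat_eq_real_of_nat)
  then have "eventually (%n. A * (of_nat CARD('n) * ennreal (c / real n)) < ennreal (e / 2)) sequentially"
   using e by (intro order_tendstoD) auto
  then have "eventually (%n. A * (of_nat CARD('n) * ennreal (c / real (Suc n))) < ennreal (e / 2)) sequentially"
   by (rule eventually_sequentially_Suc[THEN iffD2])
  then show "eventually (%n. (NU x. enorm (fmean (Suc n) F x - pex F x)) < l) sequentially"
  proof eventually_elim
   case (elim n)
   have "(NU x. enorm (fmean (Suc n) F x - pex F x)) <= ennreal (e / 2) + A * (of_nat CARD('n) * ennreal (c / real (Suc n)))"
    using order_trans[OF main[OF zero_less_Suc] bound[OF zero_less_Suc]] unfolding G_def .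
   also have "... <= ennreal (e / 2) + ennreal (e / 2)" using elim by (intro add_left_mono) auto
   also have "... = ennreal e" using e by (simp flip: ennreal_plus)
   finally show ?case using e by simp
  qed
 qed simp
qed

section \<open>From Euclidean space to the torus\<close>

text \<open>End points of dyadic intervals at or above 1 are integers, so none lies strictly between
  \<open>k\<close> and \<open>k + 1\<close>.\<close>

lemma dint_int_step:
 assumes k: "1 <= (k::int)" and r: "real_of_int k <= r" "r < real_of_int k + 1"
 shows "r \<in> dint (real_of_int k)"
proof -
 have k0: "0 < real_of_int k" using k by simp
 define j where "j = nat \<lfloor>log 2 (real_of_int k)\<rfloor>"
 have "0 <= log 2 (real_of_int k)" using k by simp
 then have j: "\<lfloor>log 2 (real_of_int k)\<rfloor> = int j" by (simp add: j_def)
 have e: "int j + 1 = int (Suc j)" by simp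
 have d: "dint (real_of_int k) = {2 ^ j..<2 ^ Suc j}"
  using dint_pos[OF k0] by (simp only: j e power_int_of_nat)
 have "real_of_int k \<in> {2 ^ j..<2 ^ Suc j}" using dint_refl[of "real_of_int k"] unfolding d .
 then have l: "2 ^ j <= real_of_int k" and u: "real_of_int k < 2 ^ Suc j" by (auto simp del: power_Suc numeral_power_le_of_int_cancel_iff of_int_less_numeral_power_cancel_iff)
 from u have "real_of_int k < real_of_int (2 ^ Suc j)" by simp
 then have "k + 1 <= 2 ^ Suc j" by (simp only: of_int_less_iff)
 then have "real_of_int (k + 1) <= real_of_int (2 ^ Suc j)" by (simp only: of_int_le_iff)
 then have "r < 2 ^ Suc j" using r(2) by (simp del: power_Suc of_int_le_numeral_power_cancel_iff)
 moreover have "2 ^ j <= r" using l r(1) by (rule order_trans)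
 ultimately show ?thesis unfolding d by simp
qed

text \<open>Take the midpoint \<open>3/2 * u\<close> of a dyadic interval \<open>[u, 2u)\<close>
  with \<open>u \<le> \<epsilon> / 2\<close>, and radius \<open>u / 4\<close>. This interval near 0
  will stand for the torus block \<open>{0}\<close>.\<close>

lemma dint_center:
 assumes "0 < \<epsilon>"
 obtains a \<delta> :: real where "0 < \<delta>" "a + \<delta> < \<epsilon>" "0 < a - \<delta>" "!!s. \<bar>s - a\<bar> <= \<delta> ==> s \<in> dint a"
proof -
 define u where "u = (2::real) powi \<lfloor>log 2 (\<epsilon> / 2)\<rfloor>"
 have t0: "0 < \<epsilon> / 2" using assms by simp
 have u0: "0 < u" unfolding u_def by (rule zero_less_power_int) simp
 have "(2::real) powi (\<lfloor>log 2 (\<epsilon> / 2)\<rfloor> + 1) = u * 2" unfolding u_def by (rule power_int_add_1) simp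
 then have d: "dint (\<epsilon> / 2) = {u..<u * 2}" using dint_pos[OF t0] by (simp only: u_def[symmetric])
 then have ut: "u <= \<epsilon> / 2" using dint_refl[of "\<epsilon> / 2"] by simp
 have "3/2 * u \<in> dint (\<epsilon> / 2)" unfolding d using u0 by simp
 then have "dint (3/2 * u) = dint (\<epsilon> / 2)" by (simp only: dint_eq_iff)
 then have d2: "dint (3/2 * u) = {u..<u * 2}" using d by (rule trans)
 show ?thesis
 proof (rule that[of "u / 4" "3/2 * u"])
  fix s assume "\<bar>s - 3/2 * u\<bar> <= u / 4"
  then show "s \<in> dint (3/2 * u)" unfolding d2 using u0 by (simp add: abs_le_iff del: divide_le_cancel, linarith)
 qed (use u0 ut in auto)
qed

definition sqR :: "real => (real^'n::finite => complex) => ennreal" where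
 "sqR p f = (NI x. square_function dyadic_boxes partial_sum f x epowr p)"

text \<open>The boxes are countable, so the null sets on which the chosen representatives differ
  from the given functions unite to one null set.\<close>

lemma sqR_eq:
 assumes "!!R. R \<in> dyadic_boxes ==> fourier_restriction R f (v R)"
 shows "sqR p f = (NI x. l2n dyadic_boxes (%R. v R x) epowr p)"
proof -
 have "AE x in lborel. \<forall>R\<in>dyadic_boxes. partial_sum R f x = v R x"
  using assms partial_sum_AE by (subst AE_ball_countable[OF countable_dyadic_boxes]) blast
 then have "AE x in lborel. square_function dyadic_boxes partial_sum f x epowr p = l2n dyadic_boxes (%R. v R x) epowr p"
  by eventually_elim (auto simp: square_function_eq_l2n intro!: arg_cong[where f="%x. x epowr p"] l2n_cong)
 then show ?thesis unfolding sqR_def by (rule nn_integral_cong_AE)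
qed

lemma measurable_bx:
 assumes "!!i. x $ i ~= 0"
 shows "bx (x :: real^'n::finite) \<in> sets borel"
 unfolding bx_def using short_interval_dint[OF assms] by (intro measurable_cbx) (auto simp: short_interval_def)

lemma window_power_integral:
 fixes \<delta> p :: real
 assumes "0 < \<delta>" "\<delta> <= 1" "1 <= p"
 shows "(NI (x::real^'n::finite). ennreal (window \<delta> x) epowr p) < top"
  "0 < (NI (x::real^'n::finite). ennreal (window \<delta> x) epowr p)"
proof -
 have "(NI (x::real^'n). ennreal (window \<delta> x) epowr p) <= (NI (x::real^'n). enorm (cof (window \<delta> x)))"
 proof (rule nn_integral_mono)
  fix x :: "real^'n"
  have "window \<delta> x powr p <= window \<delta> x powr 1"
   using assms window_le_1[of \<delta> x] window_nonneg[of \<delta> x] by (intro powr_mono') auto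
  then show "ennreal (window \<delta> x) epowr p <= enorm (cof (window \<delta> x))" by (simp add: ennreal_leI)
 qed
 also have "... < top" using integrable_window[OF assms(1,2), where 'n='n] by (simp add: integrable_iff_bounded)
 finally show "(NI (x::real^'n). ennreal (window \<delta> x) epowr p) < top" .
 show "0 < (NI (x::real^'n). ennreal (window \<delta> x) epowr p)"
 proof (rule ccontr)
  assume "\<not> ?thesis"
  then have "(NI (x::real^'n). ennreal (window \<delta> x) epowr p) = 0" by simp
  then have "AE x::real^'n in lborel. ennreal (window \<delta> x) epowr p = 0" by (subst (asm) nn_integral_0_iff_AE) measurable
  then have ae: "AE x::real^'n in lborel. cof (window \<delta> x) = 0"
  proof eventually_elim
   case (elim x)
   then show ?case using window_nonneg[of \<delta> x] by (simp del: epowr_ennreal add: ennreal_eq_0_iff)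
  qed
  have "cof (window \<delta> (0::real^'n)) = 0"
   by (rule AE_eq_continuous_imp_eq[OF _ _ ae]) (auto intro!: continuous_intros continuous_on_compose2[OF continuous_window])
  then show False by (simp add: window_def fej_0)
 qed
qed

text \<open>Since \<open>\<delta>\<close> below is small, the frequencies \<open>(1 + \<eta>) k + s\<close> lie in the interior of the real dyadic
 interval corresponding to that of \<open>k\<close>: the dilation moves all \<open>k \<noteq> 0\<close> outward, away from the closed
 end of their intervals. Averaging over \<open>y\<close> turns Euclidean integrals into torus integrals exactly.\<close>

lemma trig_transfer:
 fixes a :: "int^'n::finite => complex" and p :: real
 assumes K: "finite K" and p: "1 <= p"
 obtains f :: "real^'n => real^'n => complex" and c where "\<forall>y. f y \<in> bm \<and> pint p lborel (f y) < top"
  "0 < c" "c < top"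
  "(%y. pint p lborel (f y)) \<in> bm" "(%y. sqR p (f y)) \<in> bm"
  "(NU (y::real^'n). pint p lborel (f y)) = c * pint p utor (trigp K a)"
  "(NU (y::real^'n). sqR p (f y)) = c * sqT p (trigp K a)"
proof -
 define M where "M = (\<Sum>k\<in>K. \<Sum>i\<in>UNIV. \<bar>real_of_int (k $ i)\<bar>)"
 have M0: "0 <= M" unfolding M_def by (intro sum_nonneg) auto
 have M: "\<bar>real_of_int (k $ i)\<bar> <= M" if "k \<in> K" for k i
 proof -
  have "\<bar>real_of_int (k $ i)\<bar> <= (\<Sum>i\<in>UNIV. \<bar>real_of_int (k $ i)\<bar>)" by (rule member_le_sum) auto
  also have "... <= M" unfolding M_def using K that by (intro member_le_sum[of k K "%k. \<Sum>i\<in>UNIV. \<bar>real_of_int (k $ i)\<bar>"] sum_nonneg) auto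
  finally show ?thesis .
 qed
 \<comment> \<open>Dilation by \<open>1 + \<eta>\<close> displaces a coordinate by at most
   \<open>\<eta> * M\<close> and the shift adds less than \<open>\<eta>\<close>. As
   \<open>\<eta> * M + \<eta> = 1 / 2\<close>, no frequency leaves the unit interval adjacent to its
   integer.\<close>
 define \<eta> where "\<eta> = 1 / (2 * (M + 1))"
 have \<eta>: "0 < \<eta>" "\<eta> * M + \<eta> = 1 / 2" "\<eta> <= 1 / 2" using M0 by (auto simp: \<eta>_def field_simps)
 define \<nu> where "\<nu> = 1 + \<eta>"
 obtain b \<delta> where b: "0 < \<delta>" "b + \<delta> < \<eta>" "0 < b - \<delta>" "!!s. \<bar>s - b\<bar> <= \<delta> ==> s \<in> dint b"
  using dint_center[OF \<eta>(1)] by metis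
 have \<delta>1: "\<delta> <= 1" using b \<eta> by linarith
 \<comment> \<open>The representative on the line of the class of \<open>k\<close>: the integer
   itself, except that \<open>b\<close> replaces 0.\<close>
 define d where "d k = (if k = 0 then b else real_of_int k)" for k :: int
 have near: "\<nu> * real_of_int (k $ i) + s \<in> dint (d (k $ i))" if k: "k \<in> K" and s: "\<bar>s - b\<bar> <= \<delta>" for k i s
 proof -
  define m where "m = k $ i"
  have \<eta>m: "\<bar>\<eta> * real_of_int m\<bar> <= \<eta> * M" using M[OF k, of i] \<eta>(1) by (simp add: abs_mult m_def)
  have s': "0 < s" "s < \<eta>" using s b(2,3) by (auto simp: abs_le_iff)
  consider "m = 0" | "1 <= m" | "m <= -1" by linarith
  then have "\<nu> * real_of_int m + s \<in> dint (d m)"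
  proof cases
   case 1 then show ?thesis using b(4)[OF s] by (simp add: d_def)
  next
   case 2
   have "\<nu> * real_of_int m + s \<in> dint (real_of_int m)"
   proof (rule dint_int_step[OF 2])
    have "0 <= \<eta> * real_of_int m" using \<eta>(1) 2 by simp
    then show "real_of_int m <= \<nu> * real_of_int m + s" using s' by (simp add: \<nu>_def distrib_right)
    have "\<eta> * real_of_int m <= \<eta> * M" using \<eta>m by (rule order_trans[OF abs_ge_self])
    then have "\<eta> * real_of_int m + s < 1" using \<eta>(2) s' by linarith
    then show "\<nu> * real_of_int m + s < real_of_int m + 1" by (simp add: \<nu>_def distrib_right)
   qed
   then show ?thesis using 2 by (simp add: d_def)
  next
   case 3
   have "- (\<nu> * real_of_int m + s) \<in> dint (real_of_int (- m))"
   proof (rule dint_int_step)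
    \<comment> \<open>For negative frequencies the positive shift \<open>s\<close> points towards 0,
      but it is smaller than \<open>\<eta>\<close>, whereas the dilation moves outward by at least
      \<open>\<eta>\<close>.\<close>
    have "\<eta> * real_of_int m <= \<eta> * (-1)" using \<eta>(1) 3 by (intro mult_left_mono) auto
    then show "real_of_int (- m) <= - (\<nu> * real_of_int m + s)" using s' by (simp add: \<nu>_def distrib_right)
    have "- (\<eta> * real_of_int m) <= \<eta> * M" using \<eta>m by (simp add: abs_le_iff)
    then show "- (\<nu> * real_of_int m + s) < real_of_int (- m) + 1" using \<eta>(1,2) s' by (simp add: \<nu>_def distrib_right)
   qed (use 3 in simp)
   then have "\<nu> * real_of_int m + s \<in> dint (real_of_int m)" using dint_uminus[of "\<nu> * real_of_int m + s" "real_of_int m"] by simp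
   then show ?thesis using 3 by (simp add: d_def)
  qed
  then show ?thesis by (simp add: m_def)
 qed
 \<comment> \<open>The stand-in for the zero block does not merge with another block: elements of
   \<open>dint b\<close> have modulus at most \<open>2 * b < 1\<close>, so no nonzero integer is
   among them.\<close>
 have dd: "dint (d k) = dint (d l) \<longleftrightarrow> dint (real_of_int k) = dint (real_of_int l)" for k l
 proof -
  have "b < 1 / 2" "0 < b" using b \<eta> by linarith+
  have *: "real_of_int k \<notin> dint b" if "k ~= 0" for k
  proof
   assume "real_of_int k \<in> dint b"
   then have "\<bar>real_of_int k\<bar> <= 2 * \<bar>b\<bar>" by (rule dint_abs_le)
   then have "real_of_int \<bar>k\<bar> < 1" using \<open>b < 1 / 2\<close> \<open>0 < b\<close> by simp
   then show False using that by linarith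
  qed
  show ?thesis
   unfolding dint_eq_iff d_def
   using dint_nonzero[of "real_of_int k" "real_of_int l"] *[of k] *[of l] dint_sym[of b "real_of_int l"] by auto
 qed
 define ctr where "ctr k = (\<chi> i. \<nu> * real_of_int (k $ i) + b)" for k :: "int^'n"
 have ctr_d: "dint (ctr k $ i) = dint (d (k $ i))" if "k \<in> K" for k i
  using near[OF that, of b i] b(1) by (simp add: ctr_def dint_eq_iff)
 have d0: "d k ~= 0" for k using b(1,3) by (auto simp: d_def)
 have ctr0: "ctr k $ i ~= 0" if "k \<in> K" for k i
  using ctr_d[OF that, of i] d0[of "k $ i"] dint_nonzero[of "ctr k $ i" "d (k $ i)"] by (simp add: dint_eq_iff)
 define w where "w x = cof (window \<delta> x)" for x :: "real^'n"
 have wi: "integrable lborel w" unfolding w_def using b(1) \<delta>1 by (rule integrable_window)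
 define e where "e k x = w x * cis (2 * pi * (ctr k \<bullet> x))" for k x
 have ei: "integrable lborel (e k)" for k unfolding e_def by (intro integrable_mult_cis wi) measurable
 have [measurable]: "w \<in> bm" "e k \<in> bm" for k using wi ei by auto
 have fte: "\<xi> \<in> bx (ctr k)" if k: "k \<in> K" and nz: "ft (e k) \<xi> ~= 0" for k \<xi>
  unfolding mem_bx
 proof
  fix i
  have "ft (e k) \<xi> = ft w (\<xi> - ctr k)" unfolding e_def by (rule ft_modulate)
  then have "\<bar>(\<xi> - ctr k) $ i\<bar> < \<delta>"
   using ft_window_eq_0[OF b(1), of "\<xi> - ctr k" i] nz unfolding w_def by fastforce
  then have "\<nu> * real_of_int (k $ i) + (\<xi> $ i - \<nu> * real_of_int (k $ i)) \<in> dint (d (k $ i))"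
   by (intro near[OF k]) (simp add: ctr_def algebra_simps)
  then show "\<xi> $ i \<in> dint (ctr k $ i)" using ctr_d[OF k, of i] by simp
 qed
 define c where "c y k = a k * character k y" for y k
 define f where "f y x = (\<Sum>k\<in>K. c y k * e k x)" for y x
 define S where "S z = l2n int_dyadic_boxes (%R. \<Sum>k\<in>{k\<in>K. ibx k = R}. a k * character k z)" for z
 define \<rho> where "\<rho> k = bx (ctr k)" for k
 have S_eq: "S z = l2n int_dyadic_boxes (%R. trigp R (fourier_coeff (trigp K a)) z)" for z
  unfolding S_def torus_square_function_eq[symmetric]
  by (subst torus_square_function[OF K]) (auto simp: fourier_coeff_trigp[OF K] intro!: l2n_cong sum.cong arg_cong[where f=norm])
 have [measurable]: "S \<in> bm" unfolding S_eq[abs_def] by measurable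
 have per: "S (z + iv j) = S z" for z j unfolding S_def by (simp add: character_add)
 have ce: "c y k * e k x = a k * character k (y + \<nu> *\<^sub>R x) * (w x * cis (2 * pi * ((\<chi> i. b) \<bullet> x)))" for y k x
 proof -
  have "ctr k = \<nu> *\<^sub>R iv k + (\<chi> i. b)" by (simp add: vec_eq_iff ctr_def)
  then have "cis (2 * pi * (ctr k \<bullet> x)) = character k (\<nu> *\<^sub>R x) * cis (2 * pi * ((\<chi> i. b) \<bullet> x))"
   by (simp add: character_inner cis_mult inner_add_left algebra_simps)
  then show ?thesis by (simp add: c_def e_def character_add mult_ac)
 qed
 \<comment> \<open>All modulations share the factor with frequency \<open>b\<close> in each
   coordinate; what remains is the polynomial at \<open>y + \<nu> x\<close>. Hence the dilation of
   frequencies is a mere change of the argument, which averaging over \<open>y\<close>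
   removes.\<close>
 have f_eq: "f y x = trigp K a (y + \<nu> *\<^sub>R x) * (w x * cis (2 * pi * ((\<chi> i. b) \<bullet> x)))" for y x
  unfolding f_def ce trigp_def by (simp add: sum_distrib_right)
 have fr: "fourier_restriction R (f y) (%x. \<Sum>k\<in>{k\<in>K. \<rho> k = R}. c y k * e k x)" if R: "R \<in> dyadic_boxes" for R y
 proof (rule fourier_restriction_L1)
  obtain x0 where x0: "R = bx x0" "!!i. x0 $ i ~= 0" using R by (auto simp: dyadic_boxes_eq)
  show "R \<in> sets borel" unfolding x0 by (rule measurable_bx) fact
  have fts: "ft (%x. \<Sum>k\<in>A. c y k * e k x) \<xi> = (\<Sum>k\<in>A. c y k * ft (e k) \<xi>)" for A \<xi>
   unfolding ft_def sum_distrib_right mult.assoc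
   by (subst Bochner_Integration.integral_sum) (auto intro!: integrable_mult_right integrable_mult_cis ei)
  show "integrable lborel (f y)" unfolding f_def[abs_def] by (intro Bochner_Integration.integrable_sum integrable_mult_right ei)
  show "integrable lborel (%x. \<Sum>k\<in>{k\<in>K. \<rho> k = R}. c y k * e k x)"
   by (intro Bochner_Integration.integrable_sum integrable_mult_right ei)
  fix \<xi>
  have t: "c y k * ft (e k) \<xi> = 0" if "k \<in> K" "(\<xi> \<in> R) ~= (\<rho> k = R)" for k
  proof (rule ccontr)
   assume "c y k * ft (e k) \<xi> ~= 0"
   then have "\<xi> \<in> \<rho> k" unfolding \<rho>_def using fte[OF that(1)] by auto
   then have "bx \<xi> = \<rho> k" by (simp add: \<rho>_def bx_eq_iff)
   then show False using that(2) by (metis bx_eq_iff x0(1))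
  qed
  show "ft (%x. \<Sum>k\<in>{k\<in>K. \<rho> k = R}. c y k * e k x) \<xi> = indicator R \<xi> * ft (f y) \<xi>"
  proof (cases "\<xi> \<in> R")
   case True
   then show ?thesis unfolding f_def[abs_def] fts using K t by (simp, intro sum.mono_neutral_left) auto
  next
   case False
   then show ?thesis unfolding fts using t by (simp, intro sum.neutral) auto
  qed
 qed
 have \<rho>D: "\<rho> ` K \<subseteq> dyadic_boxes" using ctr0 by (auto simp: \<rho>_def dyadic_boxes_eq)
 have \<rho>ibx: "\<rho> k = \<rho> l \<longleftrightarrow> ibx k = ibx l" if "k \<in> K" "l \<in> K" for k l
 proof -
  have "\<rho> k = \<rho> l \<longleftrightarrow> (\<forall>i. dint (ctr k $ i) = dint (ctr l $ i))"
   unfolding \<rho>_def bx_eq_iff mem_bx dint_eq_iff ..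
  also have "... \<longleftrightarrow> (\<forall>i. dint (real_of_int (k $ i)) = dint (real_of_int (l $ i)))"
   using ctr_d[OF that(1)] ctr_d[OF that(2)] dd by simp
  also have "... \<longleftrightarrow> ibx k = ibx l" unfolding ibx_eq_iff bx_eq_iff mem_bx dint_eq_iff by simp
  finally show ?thesis .
 qed
 have sq: "sqR p (f y) = (NI x. S (y + \<nu> *\<^sub>R x) epowr p * ennreal (window \<delta> x) epowr p)" for y
 proof -
  have "l2n dyadic_boxes (%R. \<Sum>k\<in>{k\<in>K. \<rho> k = R}. c y k * e k x) = S (y + \<nu> *\<^sub>R x) * ennreal (window \<delta> x)" for x
  proof -
   have "l2n dyadic_boxes (%R. \<Sum>k\<in>{k\<in>K. \<rho> k = R}. c y k * e k x) = l2n int_dyadic_boxes (%R. \<Sum>k\<in>{k\<in>K. ibx k = R}. c y k * e k x)"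
    by (rule l2n_partition_eq[OF K \<rho>D _ \<rho>ibx]) (auto simp: int_dyadic_boxes_eq)
   also have "... = S (y + \<nu> *\<^sub>R x) * enorm (w x * cis (2 * pi * ((\<chi> i. b) \<bullet> x)))"
    unfolding ce S_def l2n_mult[symmetric] by (simp add: sum_distrib_right)
   finally show ?thesis by (simp add: norm_mult w_def)
  qed
  then show ?thesis using p by (simp add: sqR_eq[OF fr] epowr_mult del: epowr_ennreal)
 qed
 have pf: "pint p lborel (f y) = (NI x. enorm (trigp K a (y + \<nu> *\<^sub>R x)) epowr p * ennreal (window \<delta> x) epowr p)" for y
  unfolding pint_def f_eq using p by (simp add: norm_mult w_def ennreal_mult' epowr_mult del: epowr_ennreal)
 define C where "C = (NI (x::real^'n). ennreal (window \<delta> x) epowr p)"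
 note C = window_power_integral[OF b(1) \<delta>1 p, where 'n='n, folded C_def]
 interpret utor: sigma_finite_measure "utor :: (real^'n) measure" by (rule sigma_finite_utor)
 interpret P: pair_sigma_finite "lborel :: (real^'n) measure" "utor :: (real^'n) measure" by standard
 have avg: "(NU y. (NI x. H (y + \<nu> *\<^sub>R x) * ennreal (window \<delta> x) epowr p)) = C * (NU y. H y)"
  if [measurable]: "H \<in> bm" and Hp: "!!z j. H (z + iv j) = H z" for H :: "real^'n => ennreal"
 proof -
  have "(NU y. (NI x. H (y + \<nu> *\<^sub>R x) * ennreal (window \<delta> x) epowr p)) = (NI x. (NU y. H (y + \<nu> *\<^sub>R x) * ennreal (window \<delta> x) epowr p))"
   by (rule P.Fubini') measurable
  also have "... = (NI (x::real^'n). (NU y. H y) * ennreal (window \<delta> x) epowr p)"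
   by (simp add: nn_integral_multc nn_integral_periodic_shift[OF that] del: epowr_ennreal)
  also have "... = C * (NU y. H y)"
   unfolding C_def by (subst nn_integral_cmult) (measurable, rule mult.commute)
  finally show ?thesis .
 qed
 show ?thesis
 proof (rule that[of f C])
  have fm: "f y \<in> bm" for y unfolding f_def[abs_def] by measurable
  show "0 < C" "C < top" by (rule C)+
  define B where "B = (\<Sum>k\<in>K. norm (a k))"
  have "pint p lborel (f y) < top" for y
  proof -
   have "pint p lborel (f y) <= (NI (x::real^'n). ennreal B epowr p * ennreal (window \<delta> x) epowr p)"
    unfolding pf B_def using p by (intro nn_integral_mono mult_right_mono epowr_mono ennreal_leI trigp_bound) auto
   also have "... = ennreal B epowr p * C" unfolding C_def by (rule nn_integral_cmult) measurable
   also have "... < top" using C by (simp add: ennreal_mult_less_top del: epowr_ennreal)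
   finally show ?thesis .
  qed
  then show "\<forall>y. f y \<in> bm \<and> pint p lborel (f y) < top" using fm by blast
  show "(%y. pint p lborel (f y)) \<in> bm" unfolding pf by measurable
  show "(%y. sqR p (f y)) \<in> bm" unfolding sq by measurable
  show "(NU y. pint p lborel (f y)) = C * pint p utor (trigp K a)"
   unfolding pf pint_def[of p utor] by (rule avg) (auto simp: trigp_periodic)
  show "(NU y. sqR p (f y)) = C * sqT p (trigp K a)"
   unfolding sq sqT_eq S_eq[symmetric] by (rule avg) (auto simp: per)
 qed
qed

lemma ennreal_cancel_left:
 fixes c x y :: ennreal
 assumes "0 < c" "c < top" "c * x <= c * y" shows "x <= y"
proof -
 have "c * (1 / c) = 1" using assms by (simp add: ennreal_times_divide divide_eq_1_ennreal less_imp_neq[symmetric])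
 then have e: "(1 / c) * (c * z) = z" for z by (metis mult.assoc mult.commute mult_1)
 show ?thesis using mult_left_mono[OF assms(3), of "1 / c"] by (simp add: e)
qed

text \<open>The Euclidean inequality holds for each \<open>f y\<close>. After integration over
  \<open>y\<close> both sides carry the same factor \<open>c\<close>, the \<open>p\<close>-th power
  mass of the window, which is positive and finite and cancels.\<close>

lemma trig_upper:
 fixes a :: "int^'n::finite => complex"
 assumes K: "finite K" and p: "1 <= p"
  and R: "!!f :: real^'n => complex. f \<in> bm ==> pint p lborel f < top ==> sqR p f <= D * pint p lborel f"
 shows "sqT p (trigp K a) <= D * pint p utor (trigp K a)"
proof -
 obtain f :: "real^'n => real^'n => complex" and c where f: "\<forall>y. f y \<in> bm \<and> pint p lborel (f y) < top" and c: "0 < c" "c < top"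
  and [measurable]: "(%y. pint p lborel (f y)) \<in> bm" "(%y. sqR p (f y)) \<in> bm"
  and i: "(NU y. pint p lborel (f y)) = c * pint p utor (trigp K a)"
  "(NU y. sqR p (f y)) = c * sqT p (trigp K a)"
  by (rule trig_transfer[OF K p, where a=a], rule that, assumption+)
 have "c * sqT p (trigp K a) <= (NU y. D * pint p lborel (f y))"
  unfolding i[symmetric] by (intro nn_integral_mono R) (use f in auto)
 also have "... = c * (D * pint p utor (trigp K a))" by (simp add: nn_integral_cmult i mult_ac)
 finally show ?thesis by (rule ennreal_cancel_left[OF c])
qed

lemma trig_lower:
 fixes a :: "int^'n::finite => complex"
 assumes K: "finite K" and p: "1 <= p"
  and R: "!!f :: real^'n => complex. f \<in> bm ==> pint p lborel f < top ==> D * pint p lborel f <= sqR p f"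
 shows "D * pint p utor (trigp K a) <= sqT p (trigp K a)"
proof -
 obtain f :: "real^'n => real^'n => complex" and c where f: "\<forall>y. f y \<in> bm \<and> pint p lborel (f y) < top" and c: "0 < c" "c < top"
  and [measurable]: "(%y. pint p lborel (f y)) \<in> bm" "(%y. sqR p (f y)) \<in> bm"
  and i: "(NU y. pint p lborel (f y)) = c * pint p utor (trigp K a)"
  "(NU y. sqR p (f y)) = c * sqT p (trigp K a)"
  by (rule trig_transfer[OF K p, where a=a], rule that, assumption+)
 have "c * (D * pint p utor (trigp K a)) = (NU y. D * pint p lborel (f y))" by (simp add: nn_integral_cmult i mult_ac)
 also have "... <= c * sqT p (trigp K a)"
  unfolding i[symmetric] by (intro nn_integral_mono R) (use f in auto)
 finally show ?thesis by (rule ennreal_cancel_left[OF c])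
qed

section \<open>From trigonometric polynomials to all functions on the torus\<close>

lemma continuous_epowr: "0 < a ==> continuous_on UNIV (%x::ennreal. x epowr a)"
proof -
 assume a: "0 < a"
 \<comment> \<open>A monotone map onto \<open>[0, \<infinity>]\<close> is continuous; the inverse
   power supplies the preimages.\<close>
 have "x \<in> range (%x. x epowr a)" for x using a epowr_inverse_cancel(2)[of a x] by (intro image_eqI[of _ _ "x epowr (1/a)"]) auto
 then have "range (%x::ennreal. x epowr a) = UNIV" by auto
 then show ?thesis using a by (intro continuous_onI_mono epowr_mono) auto
qed

lemma liminf_epowr: "0 < a ==> liminf (%n. u n epowr a) = liminf u epowr a"
 by (rule Liminf_compose_continuous_mono[OF continuous_epowr]) (auto intro!: monoI epowr_mono)

lemma fatou_epowr:
 fixes u :: "nat => 'a => ennreal"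
 assumes a: "0 < a" and [measurable]: "!!n. u n \<in> borel_measurable M"
  and le: "AE x in M. v x <= liminf (%n. u n x)"
 shows "(\<integral>\<^sup>+x. v x epowr a \<partial>M) <= liminf (%n. \<integral>\<^sup>+x. u n x epowr a \<partial>M)"
proof -
 have "(\<integral>\<^sup>+x. v x epowr a \<partial>M) <= (\<integral>\<^sup>+x. liminf (%n. u n x epowr a) \<partial>M)"
  unfolding liminf_epowr[OF a] using a by (intro nn_integral_mono_AE eventually_mono[OF le] epowr_mono) auto
 also have "... <= liminf (%n. \<integral>\<^sup>+x. u n x epowr a \<partial>M)" by (rule nn_integral_liminf) measurable
 finally show ?thesis .
qed

lemma liminf_norm: "f \<longlonglongrightarrow> (l::complex) ==> liminf (%n. enorm (f n)) = enorm l"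
 by (rule lim_imp_Liminf) (auto intro!: tendsto_ennrealI tendsto_norm)

text \<open>Every block is finite, so the block sums of the Fejer means converge at every point and
  Fatou's lemma bounds the square function of \<open>F\<close>. On the other side the Fejer means do
  not increase the norm.\<close>

theorem torus_upper:
 fixes F :: "real^'n::finite => complex" and D :: real
 assumes p: "1 <= p" and F: "F \<in> borel_measurable torus" and f: "pint p torus F < top"
  and R: "!!f :: real^'n => complex. f \<in> bm ==> pint p lborel f < top ==> sqR p f <= ennreal D * pint p lborel f"
 shows "sqT p F <= ennreal D * pint p torus F"
proof -
 have "sqT p F <= liminf (%n. sqT p (fmean (Suc n) F))"
  unfolding sqT_eq
 proof (rule fatou_epowr)
  show "AE x in utor. l2n int_dyadic_boxes (%R. trigp R (fourier_coeff F) x) <= liminf (%n. l2n int_dyadic_boxes (%R. trigp R (fourier_coeff (fmean (Suc n) F)) x))"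
  proof (intro AE_I2 l2n_liminf)
   fix x :: "real^'n" and R :: "(int^'n) set"
   have "(%n. trigp R (fourier_coeff (fmean (Suc n) F)) x) \<longlonglongrightarrow> (\<Sum>k\<in>R. cof 1 * fourier_coeff F k * character k x)"
    unfolding trigp_def fourier_coeff_fmean[OF zero_less_Suc]
    by (intro tendsto_sum tendsto_mult tendsto_const tendsto_of_real LIMSEQ_Suc FM_tendsto)
   then show "(%n. trigp R (fourier_coeff (fmean (Suc n) F)) x) \<longlonglongrightarrow> trigp R (fourier_coeff F) x" by (simp add: trigp_def)
  qed
 qed (use p in auto)
 also have "... <= liminf (%n. ennreal D * pint p torus F)"
 proof (intro Liminf_mono always_eventually allI)
  fix n
  have "sqT p (fmean (Suc n) F) <= ennreal D * pint p utor (fmean (Suc n) F)"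
   unfolding fmean_def by (rule trig_upper[OF finite_KN p R])
  also have "... <= ennreal D * pint p torus F" by (intro mult_left_mono pint_fmean_le F p f) auto
  finally show "sqT p (fmean (Suc n) F) <= ennreal D * pint p torus F" .
 qed
 finally show ?thesis by (simp add: Liminf_const)
qed

text \<open>The roles are exchanged: Fatou's lemma is applied to the norm, along a subsequence on
  which the Fejer means converge almost everywhere, and it is the square function that the Fejer
  means do not increase.\<close>

theorem torus_lower:
 fixes F :: "real^'n::finite => complex" and D :: real
 assumes p: "1 <= p" and F: "F \<in> borel_measurable torus" and f: "pint p torus F < top"
  and R: "!!f :: real^'n => complex. f \<in> bm ==> pint p lborel f < top ==> ennreal D * pint p lborel f <= sqR p f"
 shows "ennreal D * pint p torus F <= sqT p F"
proof -
 have [measurable]: "pex F \<in> bm" by (rule measurable_pex[OF F])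
 note i = integrable_pex[OF F p f]
 define u where "u n x = fmean (Suc n) F x - pex F x" for n x
 have fb: "integrable utor (fmean (Suc n) F)" for n
  unfolding fmean_def by (rule integrable_utor_bounded[OF measurable_trigp trigp_bound])
 have ui: "integrable utor (u n)" for n unfolding u_def using fb i(2) by (intro Bochner_Integration.integrable_diff) auto
 have "(%n. ennreal (BU x. norm (u n x))) \<longlonglongrightarrow> ennreal 0"
 proof -
  have "ennreal (BU x. norm (u n x)) = (NU x. enorm (u n x))" for n
   using ui[of n] by (intro nn_integral_eq_integral[symmetric]) auto
  then show ?thesis using fmean_L1[OF F i(2)] by (simp add: u_def)
 qed
 then have "(%n. (BU x. norm (u n x))) \<longlonglongrightarrow> 0" by (subst (asm) tendsto_ennreal_iff) auto
 from tendsto_L1_AE_subseq[OF ui this] obtain r where r: "strict_mono r" "AE x in utor. (%n. u (r n) x) \<longlonglongrightarrow> 0" by auto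
 have "pint p torus F <= liminf (%n. pint p utor (fmean (Suc (r n)) F))"
  unfolding i(1) unfolding pint_def
 proof (rule fatou_epowr)
  show "AE x in utor. enorm (pex F x) <= liminf (%n. enorm (fmean (Suc (r n)) F x))"
   using r(2)
  proof eventually_elim
   case (elim x)
   have "(%n. u (r n) x + pex F x) \<longlonglongrightarrow> 0 + pex F x" by (intro tendsto_intros elim)
   then show ?case by (simp add: u_def liminf_norm)
  qed
 qed (use p in auto)
 then have "ennreal D * pint p torus F <= ennreal D * liminf (%n. pint p utor (fmean (Suc (r n)) F))" by (rule mult_left_mono) simp
 also have "... = liminf (%n. ennreal D * pint p utor (fmean (Suc (r n)) F))" by (rule Limsup_cmult_ennreal(2)[symmetric])
 also have "... <= liminf (%n. sqT p F)"
 proof (intro Liminf_mono always_eventually allI)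
  fix n
  have "ennreal D * pint p utor (fmean (Suc (r n)) F) <= sqT p (fmean (Suc (r n)) F)"
   unfolding fmean_def by (rule trig_lower[OF finite_KN p R])
  also have "... <= sqT p F" by (rule sqT_fmean_le[OF _ p]) simp
  finally show "ennreal D * pint p utor (fmean (Suc (r n)) F) <= sqT p F" .
 qed
 finally show ?thesis by (simp add: Liminf_const)
qed

section \<open>Kernels with spectrum away from the dyadic hyperplanes\<close>

lemma conv_eq_integral: "conv k f x = (BI s. k (x - s) * f s)"
 unfolding conv_def using integral_translate(3)[of "%z. k z * f (x - z)" x] by simp

lemma norm_conv_le: "enorm (conv k f x) <= (NI z. enorm (k z) * enorm (f (x - z)))"
 unfolding conv_def by (rule order_trans[OF nn_norm_integral_le]) (simp add: norm_mult ennreal_mult')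

lemma nn_integral_convolution:
 fixes K V :: "'a::euclidean_space => ennreal"
 assumes [measurable]: "K \<in> bm" "V \<in> bm"
 shows "(NI x. (NI z. K z * V (x - z))) = (NI z. K z) * (NI x. V x)"
proof -
 have "(NI x. (NI z. K z * V (x - z))) = (NI z. (NI x. K z * V (x - z)))"
  by (rule lborel_pair.Fubini') measurable
 also have "... = (NI z. K z * (NI x. V x))"
 proof (rule nn_integral_cong)
  fix z
  have "(NI x. K z * V (x - z)) = K z * (NI x. V (x - z))" by (rule nn_integral_cmult) measurable
  then show "(NI x. K z * V (x - z)) = K z * (NI x. V x)" by (simp add: nn_integral_translate(2)[of V z])
 qed
 also have "... = (NI z. K z) * (NI x. V x)" by (rule nn_integral_multc) measurable
 finally show ?thesis .
qed

lemma conv_L1: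
 fixes k f :: "'a::euclidean_space => complex"
 assumes k: "integrable lborel k" and f: "integrable lborel f"
 shows "integrable lborel (conv k f)" "ft (conv k f) \<xi> = ft k \<xi> * ft f \<xi>"
  "(NI x. enorm (conv k f x)) <= (NI z. enorm (k z)) * (NI x. enorm (f x))"
proof -
 have [measurable]: "k \<in> bm" "f \<in> bm" using k f by auto
 have nn: "(NI x. (NI z. enorm (k z) * enorm (f (x - z)))) = (NI z. enorm (k z)) * (NI x. enorm (f x))"
  by (rule nn_integral_convolution[of "%z. enorm (k z)" "%x. enorm (f x)"]) measurable
 have fin0: "(NI z. enorm (k z)) * (NI x. enorm (f x)) < top"
  using k f by (simp add: integrable_iff_bounded ennreal_mult_less_top)
 have fin: "(NI x. (NI z. enorm (k z * f (x - z) * cis (- 2 * pi * (\<xi> \<bullet> x))))) < top"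
  using fin0 unfolding nn[symmetric] by (simp add: norm_mult ennreal_mult')
 have fin1: "(NI x. (NI z. enorm (k z * f (x - z)))) < top"
  using fin0 unfolding nn[symmetric] by (simp add: norm_mult ennreal_mult')
 show "integrable lborel (conv k f)"
  unfolding conv_def[abs_def] by (rule fubini_swap(2)[OF sigma_finite_lborel sigma_finite_lborel _ fin1]) measurable
 show "(NI x. enorm (conv k f x)) <= (NI z. enorm (k z)) * (NI x. enorm (f x))"
  unfolding nn[symmetric] by (intro nn_integral_mono norm_conv_le)
 have "ft (conv k f) \<xi> = (BI x. (BI z. k z * f (x - z) * cis (- 2 * pi * (\<xi> \<bullet> x))))"
  unfolding ft_def conv_def by (simp only: integral_mult_left_zero)
 also have "... = (BI z. (BI x. k z * f (x - z) * cis (- 2 * pi * (\<xi> \<bullet> x))))"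
  by (rule fubini_swap(1)[OF sigma_finite_lborel sigma_finite_lborel _ fin]) measurable
 also have "... = (BI z. k z * cis (- 2 * pi * (\<xi> \<bullet> z)) * ft f \<xi>)"
 proof (intro Bochner_Integration.integral_cong refl)
  fix z
  have "(BI x. k z * f (x - z) * cis (- 2 * pi * (\<xi> \<bullet> x))) = k z * ft (%x. f (x - z)) \<xi>"
   unfolding ft_def by (simp add: mult.assoc)
  then show "(BI x. k z * f (x - z) * cis (- 2 * pi * (\<xi> \<bullet> x))) = k z * cis (- 2 * pi * (\<xi> \<bullet> z)) * ft f \<xi>"
   by (simp only: ft_translate mult.assoc)
 qed
 also have "... = ft k \<xi> * ft f \<xi>" by (simp add: ft_def[of k])
 finally show "ft (conv k f) \<xi> = ft k \<xi> * ft f \<xi>" .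
qed

definition pk :: "(real => complex) => real^'n => complex" where
 "pk \<kappa> x = (\<Prod>i\<in>UNIV. \<kappa> (x $ i))"

lemma measurable_pk [measurable]:
 assumes [measurable]: "\<kappa> \<in> bm"
 shows "pk \<kappa> \<in> borel_measurable (borel :: (real^'n::finite) measure)"
 unfolding pk_def[abs_def] by measurable

lemma integrable_pk:
 assumes "integrable lborel \<kappa>" shows "integrable lborel (pk \<kappa> :: real^'n::finite => complex)"
 unfolding pk_def[abs_def] by (rule vec_prod_integral(1)) fact

lemma ft_pk:
 assumes "integrable lborel \<kappa>" shows "ft (pk \<kappa>) (\<xi> :: real^'n::finite) = (\<Prod>i\<in>UNIV. ft \<kappa> (\<xi> $ i))"
 unfolding pk_def[abs_def] by (rule ft_prod) fact

lemma norm_pk_le: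
 assumes "!!t. norm (\<kappa> t) <= B" shows "norm (pk \<kappa> (x::real^'n::finite)) <= B ^ CARD('n)"
proof -
 have "norm (pk \<kappa> x) <= (\<Prod>i\<in>(UNIV::'n set). B)" unfolding pk_def prod_norm[symmetric] by (intro prod_mono) (auto intro: assms)
 then show ?thesis by simp
qed

text \<open>Telescoping with one pure factor \<open>b\<close> in each summand. In the application
  \<open>b\<close> is the spread-out correction, and the other factors are only known to have
  bounded mass.\<close>

lemma norm_prod_diff_le:
 fixes a b :: "'b => complex"
 assumes "finite I"
 shows "norm ((\<Prod>i\<in>I. a i + b i) - (\<Prod>i\<in>I. a i)) <= (\<Sum>i\<in>I. \<Prod>j\<in>I. if j = i then norm (b j) else norm (a j) + norm (b j))"
 using assms
proof (induction I)
 case empty then show ?case by simp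
next
 case (insert x I)
 let ?P = "%i J. \<Prod>j\<in>J. if j = i then norm (b j) else norm (a j) + norm (b j)"
 have P'le: "norm (\<Prod>i\<in>I. a i + b i) <= (\<Prod>j\<in>I. norm (a j) + norm (b j))"
  unfolding prod_norm[symmetric] by (intro prod_mono) (auto intro: norm_triangle_ineq)
 have Px: "?P x (insert x I) = norm (b x) * (\<Prod>j\<in>I. norm (a j) + norm (b j))"
  using insert.hyps by (simp, intro disjI2 prod.cong) auto
 have Pi: "?P i (insert x I) = (norm (a x) + norm (b x)) * ?P i I" if "i \<in> I" for i
  using insert.hyps that by auto
 have P0: "0 <= ?P i I" for i by (intro prod_nonneg) auto
 have "(\<Prod>i\<in>insert x I. a i + b i) - (\<Prod>i\<in>insert x I. a i) = b x * (\<Prod>i\<in>I. a i + b i) + a x * ((\<Prod>i\<in>I. a i + b i) - (\<Prod>i\<in>I. a i))"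
  using insert.hyps by (simp add: algebra_simps)
 also have "norm ... <= norm (b x) * norm (\<Prod>i\<in>I. a i + b i) + norm (a x) * norm ((\<Prod>i\<in>I. a i + b i) - (\<Prod>i\<in>I. a i))"
  by (rule order_trans[OF norm_triangle_ineq]) (simp add: norm_mult)
 also have "... <= norm (b x) * (\<Prod>j\<in>I. norm (a j) + norm (b j)) + (norm (a x) + norm (b x)) * (\<Sum>i\<in>I. ?P i I)"
  by (intro add_mono mult_left_mono mult_mono P'le insert.IH) auto
 also have "... = ?P x (insert x I) + (\<Sum>i\<in>I. ?P i (insert x I))"
  unfolding Px sum_distrib_left by (intro arg_cong2[where f="(+)"] refl sum.cong Pi[symmetric])
 also have "... = (\<Sum>i\<in>insert x I. ?P i (insert x I))" by (rule sum.insert[OF insert.hyps, symmetric])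
 finally show ?case .
qed

lemma epowr_sum_le:
 fixes a :: "'b => ennreal"
 assumes p: "0 < p" and I: "finite I"
 shows "(\<Sum>i\<in>I. a i) epowr p <= ennreal (real (card I) powr p) * (\<Sum>i\<in>I. a i epowr p)"
proof -
 let ?S = "\<Sum>i\<in>I. a i epowr p"
 have "a i <= ?S epowr (1 / p)" if "i \<in> I" for i
 proof -
  have "a i epowr p <= ?S" using I that by (intro member_le_sum) auto
  then have "(a i epowr p) epowr (1 / p) <= ?S epowr (1 / p)" using p by (intro epowr_mono) auto
  then show ?thesis using p by simp
 qed
 then have "(\<Sum>i\<in>I. a i) <= (\<Sum>i\<in>I. ?S epowr (1 / p))" by (intro sum_mono)
 also have "... = ennreal (real (card I)) * ?S epowr (1 / p)" by (simp add: ennreal_of_nat_eq_real_of_nat)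
 finally have "(\<Sum>i\<in>I. a i) epowr p <= (ennreal (real (card I)) * ?S epowr (1 / p)) epowr p" using p by (intro epowr_mono) auto
 then show ?thesis using p by (simp add: epowr_mult)
qed

text \<open>This is where \<open>p > 1\<close> enters: a kernel of bounded mass that is spread out in one direction
 is small as a convolution operator on a fixed function.\<close>

lemma small_convolution:
 fixes U :: "real^'n::finite => ennreal"
 assumes p: "1 < p" and [measurable]: "U \<in> bm" and U: "(NI x. U x epowr p) < top"
  and B: "0 <= B" and e: "0 < e"
 obtains \<eta> :: real where "0 < \<eta>" "!!(g1::real => ennreal) g2 i. g1 \<in> bm ==> g2 \<in> bm ==>
  (!!t. g1 t <= ennreal \<eta>) ==> (NI t. g1 t) <= ennreal B ==> (NI t. g2 t) <= ennreal B ==>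
  (NI x. (NI z. (\<Prod>j\<in>UNIV. if j = i then g1 (z $ j) else g2 (z $ j)) * U (x - z)) epowr p) <= ennreal e"
proof -
 \<comment> \<open>On \<open>S n\<close> the function is bounded with bounded support. The rest
   \<open>U2 n\<close> is small in \<open>L_p\<close>, and Young's inequality keeps it small for
   every kernel of mass at most \<open>A\<close>. Hence \<open>n\<close> can be fixed before
   \<open>\<eta>\<close> is chosen.\<close>
 define S where "S n = {x. U x <= of_nat n \<and> norm x <= real n}" for n
 have [measurable]: "S n \<in> sets borel" for n unfolding S_def by measurable
 define A where "A = B ^ CARD('n)"
 have A0: "0 <= A" using B by (simp add: A_def)
 define U2 where "U2 n x = U x * indicator (- S n) x" for n x
 have [measurable]: "U2 n \<in> bm" for n unfolding U2_def by measurable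
 have "(%n. (NI x. U2 n x epowr p)) \<longlonglongrightarrow> (NI (x::real^'n). 0)"
 proof (rule nn_integral_dominated_convergence[where w="%x. U x epowr p"])
  show "AE x in lborel. U2 n x epowr p <= U x epowr p" for n
   using p by (intro AE_I2 epowr_mono) (auto simp: U2_def indicator_def)
  have "AE x in lborel. U x epowr p ~= \<infinity>" using U by (intro nn_integral_PInf_AE) auto
  then show "AE x in lborel. (%n. U2 n x epowr p) \<longlonglongrightarrow> 0"
  proof eventually_elim
   case (elim x)
   then obtain r where r: "U x = ennreal r" "0 <= r" by (cases "U x") auto
   obtain n0 :: nat where n0: "max r (norm x) <= real n0" using real_arch_simple by blast
   have "U2 n x epowr p = 0" if "n0 <= n" for n
   proof -
    have "r <= real n" "norm x <= real n" using n0 that by auto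
    then have "x \<in> S n" using r by (simp add: S_def ennreal_of_nat_eq_real_of_nat ennreal_leI)
    then show ?thesis by (simp add: U2_def)
   qed
   then show ?case by (intro tendsto_eventually) (auto simp: eventually_sequentially)
  qed
 qed (use U in auto)
 then have "(%n. ennreal (2 powr p * A powr p) * (NI x. U2 n x epowr p)) \<longlonglongrightarrow> ennreal (2 powr p * A powr p) * 0"
  by (intro ennreal_tendsto_cmult) auto
 then have "eventually (%n. ennreal (2 powr p * A powr p) * (NI x. U2 n x epowr p) < ennreal (e / 2)) sequentially"
  using e by (intro order_tendstoD(2)) auto
 then obtain n where n: "ennreal (2 powr p * A powr p) * (NI x. U2 n x epowr p) < ennreal (e / 2)"
  by (auto simp: eventually_sequentially)
 define U1 where "U1 x = U x * indicator (S n) x" for x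
 have [measurable]: "U1 \<in> bm" unfolding U1_def by measurable
 have U12: "U x = U1 x + U2 n x" for x by (simp add: U1_def U2_def indicator_def)
 define W where "W = A * (real n * measure lborel (cball (0::real^'n) (real n)))"
 have W0: "0 <= W" using A0 by (simp add: W_def)
 have iU1: "ennreal A * (NI x. U1 x) <= ennreal W"
 proof -
  have "(NI x. U1 x) <= (NI x. ennreal (real n) * indicator (cball (0::real^'n) (real n)) x)"
   by (intro nn_integral_mono) (auto simp: U1_def S_def indicator_def ennreal_of_nat_eq_real_of_nat)
  also have "... = ennreal (real n) * emeasure lborel (cball (0::real^'n) (real n))"
   by (rule nn_integral_cmult_indicator) simp
  also have "emeasure lborel (cball (0::real^'n) (real n)) = ennreal (measure lborel (cball (0::real^'n) (real n)))"
   by (rule emeasure_eq_ennreal_measure) (use emeasure_bounded_finite[OF bounded_cball, of "0::real^'n" "real n"] in auto)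
  finally have "ennreal A * (NI x. U1 x) <= ennreal A * (ennreal (real n) * ennreal (measure lborel (cball (0::real^'n) (real n))))"
   by (rule mult_left_mono) simp
  then show ?thesis using A0 by (simp add: W_def ennreal_mult)
 qed
 \<comment> \<open>A pointwise bound for the convolution with \<open>U1\<close> will be
   \<open>m * \<eta>\<close>: the function is at most \<open>n\<close>, the spread-out factor is at
   most \<open>\<eta>\<close> and is seen only on an interval of length \<open>2 * n\<close>, and
   each other factor has mass at most \<open>B\<close>.\<close>
 define m where "m = real n * (2 * real n * B ^ (CARD('n) - 1))"
 have m0: "0 <= m" using B by (simp add: m_def)
 \<comment> \<open>The upper bound wanted for \<open>(m * \<eta>) powr (p - 1)\<close>. The
   \<open>p\<close>-th power of \<open>Q\<close> is at most this number times \<open>Q\<close>, and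
   the integral of \<open>Q\<close> is at most \<open>W\<close>; making it small through
   \<open>\<eta>\<close> is possible because \<open>p - 1\<close> is positive.\<close>
 define \<tau> where "\<tau> = e / (2 * (2 powr p * (W + 1)))"
 have \<tau>0: "0 < \<tau>" using e W0 by (simp add: \<tau>_def)
 define \<eta> where "\<eta> = \<tau> powr (1 / (p - 1)) / (m + 1)"
 have \<eta>0: "0 < \<eta>" using \<tau>0 m0 by (simp add: \<eta>_def)
 have "m * \<eta> <= \<tau> powr (1 / (p - 1))" using m0 by (simp add: \<eta>_def field_simps)
 then have "(m * \<eta>) powr (p - 1) <= (\<tau> powr (1 / (p - 1))) powr (p - 1)" using m0 \<eta>0 p by (intro powr_mono2) auto
 then have m\<eta>: "(m * \<eta>) powr (p - 1) <= \<tau>" using p \<tau>0 by (simp add: powr_powr)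
 show ?thesis
 proof (rule that[OF \<eta>0])
  fix g1 g2 :: "real => ennreal" and i :: 'n
  assume [measurable]: "g1 \<in> bm" "g2 \<in> bm"
   and g1: "!!t. g1 t <= ennreal \<eta>" and ig: "(NI t. g1 t) <= ennreal B" "(NI t. g2 t) <= ennreal B"
  define h where "h z = (\<Prod>j\<in>UNIV. if j = i then g1 (z $ j) else g2 (z $ j))" for z :: "real^'n"
  have [measurable]: "h \<in> bm" unfolding h_def by measurable
  have ih: "(NI z. h z) <= ennreal A"
  proof -
   have "(NI z. h z) = (\<Prod>j\<in>(UNIV::'n set). (NI t. (if j = i then g1 t else g2 t)))"
    unfolding h_def by (rule vec_prod_nn_integral) measurable
   also have "... <= (\<Prod>j\<in>(UNIV::'n set). ennreal B)"
   proof (rule prod_mono_ennreal)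
    show "(NI t. (if j = i then g1 t else g2 t)) <= ennreal B" for j using ig by (cases "j = i") auto
   qed
   also have "... = ennreal A" using B by (simp add: A_def ennreal_power)
   finally show ?thesis .
  qed
  define Q where "Q x = (NI z. h z * U1 (x - z))" for x
  define Q2 where "Q2 x = (NI z. h z * U2 n (x - z))" for x
  have [measurable]: "Q \<in> bm" "Q2 \<in> bm" unfolding Q_def[abs_def] Q2_def[abs_def] by measurable
  have Qle: "Q x <= ennreal (m * \<eta>)" for x
  proof -
   define G where "G j t = (if j = i then ennreal \<eta> * indicator {x $ i - real n..x $ i + real n} t else g2 t)" for j :: 'n and t
   have [measurable]: "G j \<in> bm" for j unfolding G_def[abs_def] by measurable
   have "Q x <= (NI z. ennreal (real n) * (\<Prod>j\<in>UNIV. G j (z $ j)))"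
    unfolding Q_def
   proof (rule nn_integral_mono)
    fix z :: "real^'n"
    show "h z * U1 (x - z) <= ennreal (real n) * (\<Prod>j\<in>UNIV. G j (z $ j))"
    proof (cases "x - z \<in> S n")
     case True
     then have "U1 (x - z) <= ennreal (real n)" by (simp add: U1_def S_def ennreal_of_nat_eq_real_of_nat)
     moreover have "\<bar>x $ i - z $ i\<bar> <= real n" using True component_le_norm_cart[of "x - z" i] by (simp add: S_def)
     then have "h z <= (\<Prod>j\<in>UNIV. G j (z $ j))"
      unfolding h_def by (intro prod_mono_ennreal) (auto simp: G_def indicator_def g1 abs_le_iff)
     ultimately show ?thesis by (subst mult.commute) (rule mult_mono, auto)
    next
     case False then show ?thesis by (simp add: U1_def)
    qed
   qed
   also have "... = ennreal (real n) * (\<Prod>j\<in>(UNIV::'n set). (NI t. G j t))"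
    by (subst nn_integral_cmult) (measurable, simp add: vec_prod_nn_integral)
   also have "... <= ennreal (real n) * (\<Prod>j\<in>(UNIV::'n set). ennreal (if j = i then 2 * real n * \<eta> else B))"
   proof (intro mult_left_mono prod_mono_ennreal)
    fix j :: 'n
    have "(NI t. ennreal \<eta> * indicator {x $ i - real n..x $ i + real n} t) = ennreal (2 * real n * \<eta>)"
     by (subst nn_integral_cmult_indicator) (use \<eta>0 in \<open>auto simp: ennreal_mult[symmetric] mult.commute\<close>)
    then show "(NI t. G j t) <= ennreal (if j = i then 2 * real n * \<eta> else B)" using ig(2) by (simp add: G_def)
   qed simp
   also have "(\<Prod>j\<in>(UNIV::'n set). ennreal (if j = i then 2 * real n * \<eta> else B)) = ennreal (\<Prod>j\<in>(UNIV::'n set). if j = i then 2 * real n * \<eta> else B)"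
    using B \<eta>0 by (intro prod_ennreal) auto
   also have "(\<Prod>j\<in>(UNIV::'n set). if j = i then 2 * real n * \<eta> else B) = 2 * real n * \<eta> * B ^ (CARD('n) - 1)"
    by (subst prod.remove[of _ i]) (auto simp: card_Diff_singleton)
   also have "ennreal (real n) * ennreal (2 * real n * \<eta> * B ^ (CARD('n) - 1)) = ennreal (m * \<eta>)"
    using B \<eta>0 by (simp add: m_def ennreal_mult[symmetric] mult_ac)
   finally show ?thesis .
  qed
  have Qp: "(NI x. Q x epowr p) <= ennreal \<tau> * ennreal W"
  proof -
   have "Q x epowr p <= ennreal \<tau> * Q x" for x
   proof -
    have "Q x epowr p = Q x epowr (p - 1) * Q x" using p epowr_add[of "p - 1" 1 "Q x"] by simp
    also have "Q x epowr (p - 1) <= ennreal (m * \<eta>) epowr (p - 1)" using p Qle by (intro epowr_mono) auto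
    also have "... <= ennreal \<tau>" using m\<eta> m0 \<eta>0 by (simp add: ennreal_leI)
    finally show ?thesis by (simp add: mult_right_mono)
   qed
   then have "(NI x. Q x epowr p) <= (NI x. ennreal \<tau> * Q x)" by (intro nn_integral_mono)
   also have "... = ennreal \<tau> * (NI x. Q x)" by (rule nn_integral_cmult) simp
   also have "(NI x. Q x) = (NI z. h z) * (NI x. U1 x)"
    unfolding Q_def by (rule nn_integral_convolution) measurable
   also have "ennreal \<tau> * ((NI z. h z) * (NI x. U1 x)) <= ennreal \<tau> * ennreal W"
    by (rule mult_left_mono[OF order_trans[OF mult_right_mono[OF ih] iU1]]) auto
   finally show ?thesis .
  qed
  have Q2p: "(NI x. Q2 x epowr p) <= ennreal (A powr p) * (NI x. U2 n x epowr p)"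
  proof -
   have "(NI x. Q2 x epowr p) <= (NI z. h z) epowr p * (NI x. U2 n x epowr p)"
    unfolding Q2_def
    by (rule young_convolution[where s="%z. z"]) (use p ih in \<open>auto intro: sigma_finite_lborel le_less_trans\<close>)
   also have "... <= ennreal (A powr p) * (NI x. U2 n x epowr p)"
    using epowr_mono[OF ih, of p] p A0 by (intro mult_right_mono) auto
   finally show ?thesis .
  qed
  have "(NI x. (NI z. h z * U (x - z)) epowr p) = (NI x. (Q x + Q2 x) epowr p)"
   unfolding U12 Q_def Q2_def distrib_left
   by (intro nn_integral_cong arg_cong[where f="%x. x epowr p"] nn_integral_add) measurable
  also have "... <= (NI x. ennreal (2 powr p) * (Q x epowr p + Q2 x epowr p))"
   using p by (intro nn_integral_mono epowr_add_le2) auto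
  also have "... = ennreal (2 powr p) * ((NI x. Q x epowr p) + (NI x. Q2 x epowr p))"
   by (subst nn_integral_cmult) (measurable, simp add: nn_integral_add)
  also have "... <= ennreal (2 powr p) * (ennreal \<tau> * ennreal W + ennreal (A powr p) * (NI x. U2 n x epowr p))"
   by (intro mult_left_mono add_mono Qp Q2p) simp
  also have "... = ennreal (2 powr p * (\<tau> * W)) + ennreal (2 powr p * A powr p) * (NI x. U2 n x epowr p)"
   using \<tau>0 W0 by (simp add: distrib_left ennreal_mult mult.assoc)
  also have "... <= ennreal (e / 2) + ennreal (e / 2)"
  proof (intro add_mono ennreal_leI less_imp_le[OF n])
   have calc: "2 powr p * (\<tau> * W) <= 2 powr p * (\<tau> * (W + 1))" using \<tau>0 by (intro mult_left_mono) auto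
   have "q * (e / (2 * (q * w)) * w) = e / 2" if "q ~= 0" "w ~= 0" for q w :: real using that by (simp add: field_simps)
   from this[of "2 powr p" "W + 1"] have "2 powr p * (\<tau> * (W + 1)) = e / 2" unfolding \<tau>_def using W0 by simp
   with calc show "2 powr p * (\<tau> * W) <= e / 2" by simp
  qed
  also have "... = ennreal e" using e by (simp add: ennreal_plus[symmetric] del: ennreal_plus)
  finally show "(NI x. (NI z. (\<Prod>j\<in>UNIV. if j = i then g1 (z $ j) else g2 (z $ j)) * U (x - z)) epowr p) <= ennreal e"
   unfolding h_def .
 qed
qed

text \<open>The error made by exchanging one product kernel for another. The absolute value stands
  inside the convolution, so the same number controls all functions dominated by \<open>U\<close>,
  and square functions dominated by \<open>U\<close> as well.\<close>

definition kerr :: "real => (real^'n::finite => ennreal) => (real => complex) => (real => complex) => ennreal" where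
 "kerr p U \<kappa>' \<kappa> = (NI x. (NI z. enorm (pk \<kappa>' z - pk \<kappa> z) * U (x - z)) epowr p)"

lemma kerr_trans:
 fixes U :: "real^'n::finite => ennreal"
 assumes p: "1 <= p" and [measurable]: "U \<in> bm" "\<kappa> \<in> bm" "\<kappa>' \<in> bm" "\<kappa>'' \<in> bm"
 shows "kerr p U \<kappa>'' \<kappa> <= ennreal (2 powr p) * (kerr p U \<kappa>'' \<kappa>' + kerr p U \<kappa>' \<kappa>)"
proof -
 define q where "q \<alpha> \<beta> x = (NI z. enorm (pk \<alpha> z - pk \<beta> z) * U (x - z))" for \<alpha> \<beta> :: "real => complex" and x :: "real^'n"
 have [measurable]: "q \<kappa>'' \<kappa>' \<in> bm" "q \<kappa>' \<kappa> \<in> bm" unfolding q_def[abs_def] by measurable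
 have le: "q \<kappa>'' \<kappa> x <= q \<kappa>'' \<kappa>' x + q \<kappa>' \<kappa> x" for x
 proof -
  have "q \<kappa>'' \<kappa> x <= (NI z. enorm (pk \<kappa>'' z - pk \<kappa>' z) * U (x - z) + enorm (pk \<kappa>' z - pk \<kappa> z) * U (x - z))"
   unfolding q_def
  proof (rule nn_integral_mono)
   fix z :: "real^'n"
   have "norm (pk \<kappa>'' z - pk \<kappa> z) <= norm (pk \<kappa>'' z - pk \<kappa>' z) + norm (pk \<kappa>' z - pk \<kappa> z)"
    by norm
   then have "enorm (pk \<kappa>'' z - pk \<kappa> z) <= enorm (pk \<kappa>'' z - pk \<kappa>' z) + enorm (pk \<kappa>' z - pk \<kappa> z)"
    by (simp add: ennreal_plus[symmetric] ennreal_leI del: ennreal_plus)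
   then show "enorm (pk \<kappa>'' z - pk \<kappa> z) * U (x - z) <= enorm (pk \<kappa>'' z - pk \<kappa>' z) * U (x - z) + enorm (pk \<kappa>' z - pk \<kappa> z) * U (x - z)"
    by (simp add: distrib_right[symmetric] mult_right_mono)
  qed
  also have "... = q \<kappa>'' \<kappa>' x + q \<kappa>' \<kappa> x" unfolding q_def by (rule nn_integral_add) measurable
  finally show ?thesis .
 qed
 have "kerr p U \<kappa>'' \<kappa> <= (NI x. ennreal (2 powr p) * (q \<kappa>'' \<kappa>' x epowr p + q \<kappa>' \<kappa> x epowr p))"
  unfolding kerr_def q_def[symmetric]
  using p by (intro nn_integral_mono order_trans[OF epowr_mono[OF le] epowr_add_le2]) auto
 also have "... = ennreal (2 powr p) * (kerr p U \<kappa>'' \<kappa>' + kerr p U \<kappa>' \<kappa>)"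
  by (subst nn_integral_cmult) (measurable, simp add: nn_integral_add kerr_def q_def[symmetric])
 finally show ?thesis .
qed

text \<open>Subtract from \<open>\<kappa>\<close> its convolution with \<open>\<beta>\<close>, a
  modulated kernel whose transform is 1 near \<open>a\<close>. For narrow \<open>\<epsilon>\<close>
  the kernel \<open>\<beta>\<close> is flat, with values at most \<open>5 * \<epsilon>\<close>,
  while its mass stays at most 3; such corrections are what \<open>small_convolution\<close> makes
  negligible.\<close>

lemma notch_step:
 fixes U :: "real^'n::finite => ennreal" and \<kappa> :: "real => complex"
 assumes p: "1 < p" and [measurable]: "U \<in> bm" and U: "(NI x. U x epowr p) < top"
  and \<kappa>: "integrable lborel \<kappa>" "!!t. norm (\<kappa> t) <= M" and e: "0 < e"
 obtains \<kappa>' \<epsilon> M' where "0 < \<epsilon>" "integrable lborel \<kappa>'" "!!t. norm (\<kappa>' t) <= M'"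
  "!!\<xi>. ft \<kappa> \<xi> = 0 ==> ft \<kappa>' \<xi> = 0" "!!\<xi>. \<bar>\<xi> - a\<bar> <= \<epsilon> ==> ft \<kappa>' \<xi> = 0" "kerr p U \<kappa>' \<kappa> <= ennreal e"
proof -
 have [measurable]: "\<kappa> \<in> bm" using \<kappa> by auto
 define L where "L = (BI t. norm (\<kappa> t))"
 have L0: "0 <= L" by (simp add: L_def)
 have iL: "(NI t. enorm (\<kappa> t)) = ennreal L" unfolding L_def using \<kappa>(1) by (intro nn_integral_eq_integral) auto
 define c where "c = real CARD('n) powr p * real CARD('n)"
 have c0: "0 < c" by (simp add: c_def)
 \<comment> \<open>The correction will have mass at most \<open>3 * L\<close> and the kernel has
   mass \<open>L\<close>, so \<open>4 * L\<close> bounds the mass of both types of factors that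
   occur after telescoping.\<close>
 obtain \<eta> :: real where \<eta>: "0 < \<eta>" "!!(g1::real => ennreal) g2 i. g1 \<in> bm ==> g2 \<in> bm ==>
  (!!t. g1 t <= ennreal \<eta>) ==> (NI t. g1 t) <= ennreal (4 * L) ==> (NI t. g2 t) <= ennreal (4 * L) ==>
  (NI x. (NI z. (\<Prod>j\<in>UNIV. if j = i then g1 (z $ j) else g2 (z $ j)) * U (x - z)) epowr p) <= ennreal (e / c)"
  by (rule small_convolution[OF p _ U, of "4 * L" "e / c"]) (use e c0 L0 in auto)
 define \<epsilon> where "\<epsilon> = \<eta> / (5 * (L + 1))"
 have \<epsilon>: "0 < \<epsilon>" "5 * \<epsilon> * L <= \<eta>" using \<eta>(1) L0 by (auto simp: \<epsilon>_def field_simps)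
 \<comment> \<open>A de la Vallee Poussin kernel: twice the tent of half-width
   \<open>2 * \<epsilon>\<close> minus the tent of half-width \<open>\<epsilon>\<close> equals 1 on
   \<open>[- \<epsilon>, \<epsilon>]\<close>. Being a combination of two kernels of mass 1 it has
   mass at most 3.\<close>
 define b where "b t = 2 * cof (2 * \<epsilon> * fej (2 * \<epsilon> * t)) - cof (\<epsilon> * fej (\<epsilon> * t))" for t
 define \<beta> where "\<beta> t = b t * cis (2 * pi * (a \<bullet> t))" for t
 have e2: "0 < 2 * \<epsilon>" using \<epsilon> by simp
 have ib: "integrable lborel b" unfolding b_def
  by (intro Bochner_Integration.integrable_diff integrable_mult_right integrable_fej_scaled \<epsilon> e2)
 have i\<beta>: "integrable lborel \<beta>" unfolding \<beta>_def by (intro integrable_mult_cis ib) simp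
 have [measurable]: "\<beta> \<in> bm" using i\<beta> by auto
 have ftb: "ft b \<xi> = 2 * cof (tent (\<xi> / (2 * \<epsilon>))) - cof (tent (\<xi> / \<epsilon>))" for \<xi>
 proof -
  have 1: "integrable lborel (%t. 2 * (cof (2 * \<epsilon> * fej (2 * \<epsilon> * t)) * cis (- 2 * pi * (\<xi> \<bullet> t))))"
   by (rule integrable_mult_right, rule integrable_mult_cis[OF integrable_fej_scaled[OF e2]]) measurable
  have 2: "integrable lborel (%t. cof (\<epsilon> * fej (\<epsilon> * t)) * cis (- 2 * pi * (\<xi> \<bullet> t)))"
   by (rule integrable_mult_cis[OF integrable_fej_scaled[OF \<epsilon>(1)]]) measurable
  have "ft b \<xi> = 2 * ft (%t. cof (2 * \<epsilon> * fej (2 * \<epsilon> * t))) \<xi> - ft (%t. cof (\<epsilon> * fej (\<epsilon> * t))) \<xi>"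
   unfolding ft_def b_def left_diff_distrib mult.assoc[of "2::complex"] Bochner_Integration.integral_diff[OF 1 2]
   by (simp only: integral_mult_right_zero)
  then show ?thesis by (simp only: ft_fej_scaled[OF e2] ft_fej_scaled[OF \<epsilon>(1)])
 qed
 have ft\<beta>: "ft \<beta> \<xi> = 1" if "\<bar>\<xi> - a\<bar> <= \<epsilon>" for \<xi>
 proof -
  define s where "s = \<bar>\<xi> - a\<bar> / \<epsilon>"
  have s: "0 <= s" "s <= 1" using that \<epsilon>(1) by (auto simp: s_def)
  have "\<bar>(\<xi> - a) / (2 * \<epsilon>)\<bar> = s / 2" "\<bar>(\<xi> - a) / \<epsilon>\<bar> = s" using \<epsilon>(1) by (auto simp: s_def abs_divide)
  then have "tent ((\<xi> - a) / (2 * \<epsilon>)) = 1 - s / 2" "tent ((\<xi> - a) / \<epsilon>) = 1 - s" using s by (auto simp: tent_def)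
  moreover have "ft \<beta> \<xi> = ft b (\<xi> - a)" unfolding \<beta>_def[abs_def] by (rule ft_modulate)
  ultimately have "ft \<beta> \<xi> = 2 * cof (1 - s / 2) - cof (1 - s)" by (simp only: ftb)
  then show ?thesis by simp
 qed
 have nb: "norm (b t) <= 2 * (2 * \<epsilon> * fej (2 * \<epsilon> * t)) + \<epsilon> * fej (\<epsilon> * t)" for t
  unfolding b_def using \<epsilon> by (intro order_trans[OF norm_triangle_ineq4]) (simp add: norm_mult)
 have n\<beta>: "norm (\<beta> t) <= 5 * \<epsilon>" for t
 proof -
  have "2 * \<epsilon> * fej (2 * \<epsilon> * t) <= 2 * \<epsilon> * 1" "\<epsilon> * fej (\<epsilon> * t) <= \<epsilon> * 1" using \<epsilon>(1) by (intro mult_left_mono fej_le_1; simp)+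
  then show ?thesis using nb[of t] by (simp add: \<beta>_def norm_mult)
 qed
 have i\<beta>3: "(NI t. enorm (\<beta> t)) <= ennreal 3"
 proof -
  have "(NI t. enorm (\<beta> t)) <= (NI t. ennreal 2 * ennreal (2 * \<epsilon> * fej (2 * \<epsilon> * t)) + ennreal (\<epsilon> * fej (\<epsilon> * t)))"
  proof (rule nn_integral_mono)
   fix t
   have nn: "0 <= 2 * \<epsilon> * fej (2 * \<epsilon> * t)" "0 <= \<epsilon> * fej (\<epsilon> * t)" using \<epsilon>(1) by auto
   have "enorm (\<beta> t) <= ennreal (2 * (2 * \<epsilon> * fej (2 * \<epsilon> * t)) + \<epsilon> * fej (\<epsilon> * t))"
    using nb[of t] by (intro ennreal_leI) (simp add: \<beta>_def norm_mult)
   also have "... = ennreal 2 * ennreal (2 * \<epsilon> * fej (2 * \<epsilon> * t)) + ennreal (\<epsilon> * fej (\<epsilon> * t))"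
    by (simp only: ennreal_plus[OF mult_nonneg_nonneg[OF zero_le_numeral nn(1)] nn(2)] ennreal_mult[OF zero_le_numeral nn(1)])
   finally show "enorm (\<beta> t) <= ennreal 2 * ennreal (2 * \<epsilon> * fej (2 * \<epsilon> * t)) + ennreal (\<epsilon> * fej (\<epsilon> * t))" .
  qed
  also have "... = ennreal 2 * 1 + 1"
   by (subst nn_integral_add) (measurable, simp only: nn_integral_cmult[OF measurable_compose[OF _ measurable_ennreal]] nn_integral_fej_scaled[OF e2] nn_integral_fej_scaled[OF \<epsilon>(1)],
     subst nn_integral_cmult, measurable, simp only: nn_integral_fej_scaled[OF e2])
  also have "... = ennreal 3" by simp
  finally show ?thesis .
 qed
 define \<psi> where "\<psi> t = - conv \<kappa> \<beta> t" for t
 have i\<psi>: "integrable lborel \<psi>" unfolding \<psi>_def[abs_def] using conv_L1(1)[OF \<kappa>(1) i\<beta>] by simp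
 have [measurable]: "\<psi> \<in> bm" using i\<psi> by auto
 have n\<psi>: "norm (\<psi> t) <= \<eta>" for t
 proof -
  have "enorm (\<psi> t) <= (NI z. enorm (\<kappa> z) * enorm (\<beta> (t - z)))"
   unfolding \<psi>_def norm_minus_cancel by (rule norm_conv_le)
  also have "... <= (NI z. enorm (\<kappa> z) * ennreal (5 * \<epsilon>))"
   by (intro nn_integral_mono mult_left_mono ennreal_leI n\<beta>) simp
  also have "... = ennreal L * ennreal (5 * \<epsilon>)" unfolding iL[symmetric] by (rule nn_integral_multc) measurable
  also have "... <= ennreal \<eta>" using L0 \<epsilon> by (simp add: ennreal_mult[symmetric] ennreal_leI mult_ac)
  finally show ?thesis using \<eta>(1) by simp
 qed
 have i\<psi>3: "(NI t. enorm (\<psi> t)) <= ennreal (3 * L)"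
 proof -
  have "(NI t. enorm (\<psi> t)) <= ennreal L * (NI t. enorm (\<beta> t))"
   unfolding \<psi>_def norm_minus_cancel iL[symmetric] by (rule conv_L1(3)[OF \<kappa>(1) i\<beta>])
  also have "... <= ennreal L * ennreal 3" by (intro mult_left_mono i\<beta>3) simp
  also have "... = ennreal (3 * L)" using L0 by (subst ennreal_mult[symmetric]) (auto simp: mult.commute)
  finally show ?thesis .
 qed
 define \<kappa>' where "\<kappa>' t = \<kappa> t + \<psi> t" for t
 have i\<kappa>': "integrable lborel \<kappa>'" unfolding \<kappa>'_def[abs_def] by (intro Bochner_Integration.integrable_add \<kappa> i\<psi>)
 have ft\<kappa>': "ft \<kappa>' \<xi> = ft \<kappa> \<xi> * (1 - ft \<beta> \<xi>)" for \<xi>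
 proof -
  have "ft \<kappa>' \<xi> = ft \<kappa> \<xi> - ft (conv \<kappa> \<beta>) \<xi>"
   unfolding ft_def \<kappa>'_def \<psi>_def add_uminus_conv_diff left_diff_distrib
   by (intro Bochner_Integration.integral_diff integrable_mult_cis \<kappa> conv_L1(1) i\<beta>) measurable
  then show ?thesis by (simp add: conv_L1(2)[OF \<kappa>(1) i\<beta>] algebra_simps)
 qed
 define g1 g2 where "g1 t = enorm (\<psi> t)" and "g2 t = ennreal (norm (\<kappa> t) + norm (\<psi> t))" for t
 have [measurable]: "g1 \<in> bm" "g2 \<in> bm" unfolding g1_def[abs_def] g2_def[abs_def] by measurable
 have L4: "ennreal (3 * L) <= ennreal (4 * L)" "ennreal L + ennreal (3 * L) = ennreal (4 * L)"
  using L0 by (auto simp: ennreal_leI ennreal_plus[symmetric] simp del: ennreal_plus)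
 have ig1: "(NI t. g1 t) <= ennreal (4 * L)" unfolding g1_def using i\<psi>3 L4(1) by (rule order_trans)
 have ig2: "(NI t. g2 t) <= ennreal (4 * L)"
 proof -
  have "(NI t. g2 t) = ennreal L + (NI t. enorm (\<psi> t))"
   unfolding g2_def iL[symmetric] by (simp add: nn_integral_add)
  also have "... <= ennreal L + ennreal (3 * L)" by (intro add_left_mono i\<psi>3)
  finally show ?thesis using L4(2) by simp
 qed
 define H where "H i z = (\<Prod>j\<in>UNIV. if j = i then g1 (z $ j) else g2 (z $ j))" for i and z :: "real^'n"
 have [measurable]: "H i \<in> bm" for i unfolding H_def by measurable
 have H: "(NI x. (NI z. H i z * U (x - z)) epowr p) <= ennreal (e / c)" for i
  unfolding H_def by (rule \<eta>(2)[OF _ _ _ ig1 ig2]) (auto simp: g1_def intro!: ennreal_leI n\<psi>)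
 have diff: "enorm (pk \<kappa>' z - pk \<kappa> z) <= (\<Sum>i\<in>UNIV. H i z)" for z :: "real^'n"
 proof -
  have "enorm (pk \<kappa>' z - pk \<kappa> z) <= ennreal (\<Sum>i\<in>UNIV. \<Prod>j\<in>UNIV. if j = i then norm (\<psi> (z $ j)) else norm (\<kappa> (z $ j)) + norm (\<psi> (z $ j)))"
   unfolding pk_def \<kappa>'_def by (intro ennreal_leI norm_prod_diff_le) simp
  also have "... = (\<Sum>i\<in>UNIV. \<Prod>j\<in>UNIV. ennreal (if j = i then norm (\<psi> (z $ j)) else norm (\<kappa> (z $ j)) + norm (\<psi> (z $ j))))"
   by (subst sum_ennreal[symmetric]) (auto intro!: prod_nonneg sum.cong prod_ennreal[symmetric])
  also have "... = (\<Sum>i\<in>UNIV. H i z)" unfolding H_def g1_def g2_def by (intro sum.cong prod.cong refl) auto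
  finally show ?thesis .
 qed
 have "kerr p U \<kappa>' \<kappa> <= (NI x. (\<Sum>i\<in>UNIV. (NI z. H i z * U (x - z))) epowr p)"
  unfolding kerr_def
 proof (intro nn_integral_mono epowr_mono)
  fix x :: "real^'n"
  have "(NI z. enorm (pk \<kappa>' z - pk \<kappa> z) * U (x - z)) <= (NI z. (\<Sum>i\<in>UNIV. H i z * U (x - z)))"
   unfolding sum_distrib_right[symmetric] by (intro nn_integral_mono mult_right_mono diff) simp
  also have "... = (\<Sum>i\<in>UNIV. (NI z. H i z * U (x - z)))" by (rule nn_integral_sum) measurable
  finally show "(NI z. enorm (pk \<kappa>' z - pk \<kappa> z) * U (x - z)) <= (\<Sum>i\<in>UNIV. (NI z. H i z * U (x - z)))" .
 qed (use p in simp)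
 also have "... <= (NI x. ennreal (real CARD('n) powr p) * (\<Sum>i\<in>UNIV. (NI z. H i z * U (x - z)) epowr p))"
  using p by (intro nn_integral_mono epowr_sum_le) auto
 also have "... = ennreal (real CARD('n) powr p) * (\<Sum>i\<in>UNIV. (NI x. (NI z. H i z * U (x - z)) epowr p))"
  by (subst nn_integral_cmult) (measurable, subst nn_integral_sum, measurable)
 also have "... <= ennreal (real CARD('n) powr p) * (\<Sum>i\<in>(UNIV::'n set). ennreal (e / c))"
  by (intro mult_left_mono sum_mono H) simp
 also have "... = ennreal (real CARD('n) powr p * (real CARD('n) * (e / c)))"
 proof -
  have "0 <= e / c" using e c0 by simp
  then show ?thesis by (simp only: sum_constant ennreal_of_nat_eq_real_of_nat ennreal_mult[OF powr_ge_zero mult_nonneg_nonneg[OF of_nat_0_le_iff]] ennreal_mult[OF of_nat_0_le_iff])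
 qed
 also have "real CARD('n) powr p * (real CARD('n) * (e / c)) = e" using c0 by (simp add: c_def)
 finally have k: "kerr p U \<kappa>' \<kappa> <= ennreal e" .
 show ?thesis
 proof (rule that[of \<epsilon> \<kappa>' "M + \<eta>"])
  show "norm (\<kappa>' t) <= M + \<eta>" for t unfolding \<kappa>'_def by (rule norm_triangle_le) (intro add_mono \<kappa> n\<psi>)
 qed (use \<epsilon> i\<kappa>' k in \<open>auto simp: ft\<kappa>' ft\<beta>\<close>)
qed

text \<open>Each notch preserves the zeros of the transform, so notches made earlier survive. The
  error budget is divided by \<open>2 * 2 powr p\<close> at each step because
  \<open>kerr_trans\<close> is a triangle inequality with factor \<open>2 powr p\<close>.\<close>

lemma notches:
 fixes U :: "real^'n::finite => ennreal" and \<kappa> :: "real => complex" and as :: "real list"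
 assumes p: "1 < p" and [measurable]: "U \<in> bm" and U: "(NI x. U x epowr p) < top"
  and \<kappa>: "integrable lborel \<kappa>" "\<forall>t. norm (\<kappa> t) <= M" and e: "0 < e"
 shows "\<exists>\<kappa>' \<epsilon> M'. 0 < \<epsilon> \<and> integrable lborel \<kappa>' \<and> (\<forall>t. norm (\<kappa>' t) <= M') \<and>
  (\<forall>\<xi>. ft \<kappa> \<xi> = 0 \<longrightarrow> ft \<kappa>' \<xi> = 0) \<and> (\<forall>a\<in>set as. \<forall>\<xi>. \<bar>\<xi> - a\<bar> <= \<epsilon> \<longrightarrow> ft \<kappa>' \<xi> = 0) \<and> kerr p U \<kappa>' \<kappa> <= ennreal e"
 using \<kappa> e
proof (induction as arbitrary: \<kappa> M e)
 case Nil
 have "kerr p U \<kappa> \<kappa> = 0" by (simp add: kerr_def)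
 then show ?case using Nil by (intro exI[of _ \<kappa>] exI[of _ 1] exI[of _ M]) auto
next
 case (Cons a as)
 define e1 where "e1 = e / (2 * 2 powr p)"
 have e1: "0 < e1" using Cons.prems by (simp add: e1_def)
 obtain \<kappa>1 \<epsilon>1 M1 where 1: "0 < \<epsilon>1" "integrable lborel \<kappa>1" "!!t. norm (\<kappa>1 t) <= M1"
  "!!\<xi>. ft \<kappa> \<xi> = 0 ==> ft \<kappa>1 \<xi> = 0" "!!\<xi>. \<bar>\<xi> - a\<bar> <= \<epsilon>1 ==> ft \<kappa>1 \<xi> = 0" "kerr p U \<kappa>1 \<kappa> <= ennreal e1"
  by (rule notch_step[OF p _ U Cons.prems(1) _ e1, of M a]) (use Cons.prems in auto)
 obtain \<kappa>2 \<epsilon>2 M2 where 2: "0 < \<epsilon>2" "integrable lborel \<kappa>2" "\<forall>t. norm (\<kappa>2 t) <= M2"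
  "\<forall>\<xi>. ft \<kappa>1 \<xi> = 0 \<longrightarrow> ft \<kappa>2 \<xi> = 0" "\<forall>a\<in>set as. \<forall>\<xi>. \<bar>\<xi> - a\<bar> <= \<epsilon>2 \<longrightarrow> ft \<kappa>2 \<xi> = 0" "kerr p U \<kappa>2 \<kappa>1 <= ennreal e1"
  using Cons.IH[OF 1(2) _ e1, of M1] 1(3) by blast
 have [measurable]: "\<kappa> \<in> bm" "\<kappa>1 \<in> bm" "\<kappa>2 \<in> bm" using Cons.prems(1) 1(2) 2(2) by auto
 have "kerr p U \<kappa>2 \<kappa> <= ennreal (2 powr p) * (kerr p U \<kappa>2 \<kappa>1 + kerr p U \<kappa>1 \<kappa>)" using p by (intro kerr_trans) auto
 also have "... <= ennreal (2 powr p) * (ennreal e1 + ennreal e1)" by (intro mult_left_mono add_mono 1 2) simp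
 also have "... = ennreal e" using e1 by (simp add: ennreal_plus[symmetric] ennreal_mult[symmetric] e1_def del: ennreal_plus)
 finally have k: "kerr p U \<kappa>2 \<kappa> <= ennreal e" .
 have "ft \<kappa>2 \<xi> = 0" if "b \<in> set (a # as)" "\<bar>\<xi> - b\<bar> <= min \<epsilon>1 \<epsilon>2" for b \<xi>
  using that 1(5)[of \<xi>] 2(4,5) by auto
 then show ?case using k 1(1,4) 2 by (intro exI[of _ \<kappa>2] exI[of _ "min \<epsilon>1 \<epsilon>2"] exI[of _ M2]) auto
qed

definition \<kappa>0 :: "real => real => complex" where
 "\<kappa>0 N t = cof (N * fej (N * t))"

text \<open>The Fejer kernel confines the spectrum to modulus below \<open>N\<close>, and a first
  notch at 0 keeps it above some \<open>\<epsilon>1\<close>. Between these bounds there are only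
  finitely many dyadic end points, and the width of the notches cut there is the gap.\<close>

theorem kernel_exists:
 fixes U :: "real^'n::finite => ennreal"
 assumes p: "1 < p" and [measurable]: "U \<in> bm" and U: "(NI x. U x epowr p) < top"
  and N: "0 < N" and e: "0 < e"
 obtains \<kappa> \<gamma> M where "0 < \<gamma>" "\<gamma> <= 1" "integrable lborel \<kappa>" "!!t. norm (\<kappa> t) <= M"
  "!!\<xi> \<eta>. ft \<kappa> \<xi> ~= 0 ==> \<bar>\<eta> - \<xi>\<bar> < \<gamma> ==> \<eta> \<in> dint \<xi>" "!!\<xi>. ft \<kappa> \<xi> ~= 0 ==> \<bar>\<xi>\<bar> <= N \<and> \<xi> ~= 0"
  "finite (dint ` {\<xi>. ft \<kappa> \<xi> ~= 0})" "kerr p U \<kappa> (\<kappa>0 N) <= ennreal e"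
proof -
 have i0: "integrable lborel (\<kappa>0 N)" unfolding \<kappa>0_def[abs_def] using N by (rule integrable_fej_scaled)
 have ft0: "ft (\<kappa>0 N) \<xi> = cof (tent (\<xi> / N))" for \<xi> unfolding \<kappa>0_def[abs_def] using N by (rule ft_fej_scaled)
 have b0: "norm (\<kappa>0 N t) <= N" for t using N mult_left_mono[OF fej_le_1, of N "N * t"] by (simp add: \<kappa>0_def norm_mult)
 define e1 where "e1 = e / (2 * 2 powr p)"
 have e1: "0 < e1" using e by (simp add: e1_def)
 obtain \<kappa>1 \<epsilon>1 M1 where 1: "0 < \<epsilon>1" "integrable lborel \<kappa>1" "!!t. norm (\<kappa>1 t) <= M1"
  "!!\<xi>. ft (\<kappa>0 N) \<xi> = 0 ==> ft \<kappa>1 \<xi> = 0" "!!\<xi>. \<bar>\<xi> - 0\<bar> <= \<epsilon>1 ==> ft \<kappa>1 \<xi> = 0" "kerr p U \<kappa>1 (\<kappa>0 N) <= ennreal e1"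
  by (rule notch_step[OF p _ U i0 b0 e1, of 0]) auto
 define m0 where "m0 = max 0 \<lceil>max (log 2 N) (- log 2 \<epsilon>1)\<rceil>"
 have m0: "log 2 N <= real_of_int m0" "- log 2 \<epsilon>1 <= real_of_int m0" unfolding m0_def by linarith+
 \<comment> \<open>The binary orders of the remaining frequencies lie in \<open>[- m0, m0]\<close>;
   one more exponent is listed for the upper end of the last interval.\<close>
 define as :: "real list" where "as = map (%m. 2 powi m) [- m0..m0 + 1] @ map (%m. - (2 powi m)) [- m0..m0 + 1]"
 obtain \<kappa>2 \<epsilon>2 M2 where 2: "0 < \<epsilon>2" "integrable lborel \<kappa>2" "\<forall>t. norm (\<kappa>2 t) <= M2"
  "\<forall>\<xi>. ft \<kappa>1 \<xi> = 0 \<longrightarrow> ft \<kappa>2 \<xi> = 0" "\<forall>a\<in>set as. \<forall>\<xi>. \<bar>\<xi> - a\<bar> <= \<epsilon>2 \<longrightarrow> ft \<kappa>2 \<xi> = 0" "kerr p U \<kappa>2 \<kappa>1 <= ennreal e1"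
  using notches[OF p _ U 1(2) _ e1, of M1 as] 1(3) by auto
 have [measurable]: "\<kappa>0 N \<in> bm" "\<kappa>1 \<in> bm" "\<kappa>2 \<in> bm" using i0 1(2) 2(2) by auto
 have "kerr p U \<kappa>2 (\<kappa>0 N) <= ennreal (2 powr p) * (kerr p U \<kappa>2 \<kappa>1 + kerr p U \<kappa>1 (\<kappa>0 N))" using p by (intro kerr_trans) auto
 also have "... <= ennreal (2 powr p) * (ennreal e1 + ennreal e1)" by (intro mult_left_mono add_mono 1 2) simp
 also have "... = ennreal e" using e1 by (simp add: ennreal_plus[symmetric] ennreal_mult[symmetric] e1_def del: ennreal_plus)
 finally have k: "kerr p U \<kappa>2 (\<kappa>0 N) <= ennreal e" .
 have range: "\<epsilon>1 < \<bar>\<xi>\<bar> \<and> \<bar>\<xi>\<bar> < N" if "ft \<kappa>2 \<xi> ~= 0" for \<xi>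
 proof -
  have "ft \<kappa>1 \<xi> ~= 0" "ft (\<kappa>0 N) \<xi> ~= 0" using that 1(4) 2(4) by auto
  moreover have "\<bar>\<xi>\<bar> < N" if "tent (\<xi> / N) ~= 0" using tent_eq_0[of "\<xi> / N"] that N by (cases "\<bar>\<xi>\<bar> < N") (auto simp: abs_divide)
  ultimately show ?thesis using 1(5)[of \<xi>] unfolding ft0 by fastforce
 qed
 have fl: "\<lfloor>log 2 \<bar>\<xi>\<bar>\<rfloor> \<in> {- m0..m0}" if "ft \<kappa>2 \<xi> ~= 0" for \<xi>
 proof -
  have r: "\<epsilon>1 < \<bar>\<xi>\<bar>" "\<bar>\<xi>\<bar> < N" using range[OF that] by auto
  have "log 2 \<epsilon>1 <= log 2 \<bar>\<xi>\<bar>" "log 2 \<bar>\<xi>\<bar> <= log 2 N" using r 1(1) N by auto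
  then have "real_of_int (- m0) <= log 2 \<bar>\<xi>\<bar>" "log 2 \<bar>\<xi>\<bar> <= real_of_int m0" using m0 by auto
  then show ?thesis by (auto simp: le_floor_iff) linarith
 qed
 have away: "\<epsilon>2 < \<bar>\<xi> - a\<bar>" if "ft \<kappa>2 \<xi> ~= 0" "a \<in> set as" for \<xi> a using 2(5) that by force
 have dp: "dint \<xi> = {2 powi \<lfloor>log 2 \<bar>\<xi>\<bar>\<rfloor>..<2 powi (\<lfloor>log 2 \<bar>\<xi>\<bar>\<rfloor> + 1)}" if "0 < \<xi>" for \<xi> using dint_pos[OF that] that by simp
 have dn: "dint \<xi> = {- (2 powi (\<lfloor>log 2 \<bar>\<xi>\<bar>\<rfloor> + 1))<..- (2 powi \<lfloor>log 2 \<bar>\<xi>\<bar>\<rfloor>)}" if "\<xi> < 0" for \<xi> using dint_neg[OF that] that by simp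
 show ?thesis
 proof (rule that[of "min 1 \<epsilon>2" \<kappa>2 M2])
  fix \<xi> \<eta> assume nz: "ft \<kappa>2 \<xi> ~= 0" and d: "\<bar>\<eta> - \<xi>\<bar> < min 1 \<epsilon>2"
  define m where "m = \<lfloor>log 2 \<bar>\<xi>\<bar>\<rfloor>"
  define l u :: real where "l = 2 powi m" and "u = 2 powi (m + 1)"
  have "m \<in> set [- m0..m0 + 1]" "m + 1 \<in> set [- m0..m0 + 1]" using fl[OF nz] by (auto simp: m_def)
  then have "l \<in> set as" "u \<in> set as" "- l \<in> set as" "- u \<in> set as" unfolding as_def l_def u_def set_append set_map by blast+
  note aw = this[THEN away[OF nz]]
  have d': "\<bar>\<eta> - \<xi>\<bar> < \<epsilon>2" using d by simp
  consider "0 < \<xi>" | "\<xi> < 0" using range[OF nz] 1(1) by (cases \<xi> "0::real" rule: linorder_cases) auto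
  then show "\<eta> \<in> dint \<xi>"
  proof cases
   case 1
   have D: "dint \<xi> = {l..<u}" using dp[OF 1] by (simp only: l_def u_def m_def)
   have "l <= \<xi>" "\<xi> < u" using dint_refl[of \<xi>] unfolding D by auto
   then show ?thesis unfolding D using aw d' by (simp add: abs_less_iff abs_if split: if_splits)
  next
   case 2
   have D: "dint \<xi> = {- u<..- l}" using dn[OF 2] by (simp only: l_def u_def m_def)
   have "- u < \<xi>" "\<xi> <= - l" using dint_refl[of \<xi>] unfolding D by auto
   then show ?thesis unfolding D using aw d' by (simp add: abs_less_iff abs_if split: if_splits)
  qed
 next
  have "dint ` {\<xi>. ft \<kappa>2 \<xi> ~= 0} \<subseteq> (%m. {2 powi m..<2 powi (m + 1)}) ` {- m0..m0} \<union> (%m. {- (2 powi (m + 1))<..- (2 powi m)}) ` {- m0..m0}"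
  proof
   fix I assume "I \<in> dint ` {\<xi>. ft \<kappa>2 \<xi> ~= 0}"
   then obtain \<xi> where \<xi>: "I = dint \<xi>" "ft \<kappa>2 \<xi> ~= 0" by auto
   consider "0 < \<xi>" | "\<xi> < 0" using range[OF \<xi>(2)] 1(1) by (cases \<xi> "0::real" rule: linorder_cases) auto
   then show "I \<in> (%m. {2 powi m..<2 powi (m + 1)}) ` {- m0..m0} \<union> (%m. {- (2 powi (m + 1))<..- (2 powi m)}) ` {- m0..m0}"
    unfolding \<xi>(1) by cases (use dp dn fl[OF \<xi>(2)] in blast)+
  qed
  then show "finite (dint ` {\<xi>. ft \<kappa>2 \<xi> ~= 0})" by (rule finite_subset) simp
 next
  show "\<bar>\<xi>\<bar> <= N \<and> \<xi> ~= 0" if "ft \<kappa>2 \<xi> ~= 0" for \<xi> using range[OF that] 1(1) by auto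
 qed (use 2 k in auto)
qed

section \<open>Periodization\<close>

lemma integral_cell:
 fixes x :: "real^'n::finite" and a :: complex
 shows "(\<integral>j. indicator ucube (x - iv j) *\<^sub>R a \<partial>count_space UNIV) = a"
proof -
 let ?k = "\<chi> i. \<lfloor>x $ i\<rfloor>"
 have e: "(%j. indicator ucube (x - iv j) *\<^sub>R a) = (%j. if j = ?k then a else 0)" by (auto simp: indicator_def ex1_cell)
 have s: "{j \<in> UNIV. (if j = ?k then a else 0) ~= 0} \<subseteq> {?k}" by auto
 have "(\<integral>j. (if j = ?k then a else 0) \<partial>count_space UNIV) = (\<Sum>j | j \<in> UNIV \<and> (if j = ?k then a else 0) ~= 0. if j = ?k then a else 0)"
  by (rule lebesgue_integral_count_space_finite_support[OF finite_subset[OF s]]) simp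
 also have "... = (\<Sum>j\<in>{?k}. if j = ?k then a else 0)" by (rule sum.mono_neutral_left) auto
 finally show ?thesis unfolding e by simp
qed

lemma integral_unfold:
 fixes g :: "real^'n::finite => complex"
 assumes g: "integrable lborel g"
 shows "(BU x. (\<integral>j. g (x + iv j) \<partial>count_space UNIV)) = (BI x. g x)"
  "integrable utor (%x. \<integral>j. g (x + iv j) \<partial>count_space UNIV)"
proof -
 have [measurable]: "g \<in> bm" using g by auto
 have sf: "sigma_finite_measure (count_space (UNIV :: (int^'n) set))" by (rule sigma_finite_measure_count_space)
 have gfin: "(NI x. enorm (g x)) < top" using g by (simp add: integrable_iff_bounded)
 have m: "(%x. \<integral>j. g (x + iv j) \<partial>count_space UNIV) \<in> bm"
  by (intro sigma_finite_measure.borel_measurable_lebesgue_integral[OF sf]) measurable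
 have mn: "(%x. \<integral>\<^sup>+j. enorm (g (x + iv j)) \<partial>count_space UNIV) \<in> bm"
  by (intro sigma_finite_measure.borel_measurable_nn_integral[OF sf]) measurable
 have fin1: "(NI x. \<integral>\<^sup>+j. enorm (indicator ucube (x - iv j) *\<^sub>R g x) \<partial>count_space UNIV) < top"
 proof -
  have "(\<integral>\<^sup>+j. enorm (indicator ucube (x - iv j) *\<^sub>R g x) \<partial>count_space UNIV) = (\<integral>\<^sup>+j. indicator ucube (x - iv j) * enorm (g x) \<partial>count_space UNIV)" for x :: "real^'n"
   by (intro nn_integral_cong) (simp add: indicator_def)
  then have "(\<integral>\<^sup>+j. enorm (indicator ucube (x - iv j) *\<^sub>R g x) \<partial>count_space UNIV) = enorm (g x)" for x :: "real^'n"
   by (simp add: nn_integral_multc nn_integral_cell)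
  then show ?thesis using gfin by simp
 qed
 have fin2: "(NI x. \<integral>\<^sup>+j. enorm (indicator ucube x *\<^sub>R g (x + iv j)) \<partial>count_space UNIV) < top"
 proof -
  have "(\<integral>\<^sup>+j. enorm (indicator ucube x *\<^sub>R g (x + iv j)) \<partial>count_space UNIV) = (\<integral>\<^sup>+j. enorm (g (x + iv j)) \<partial>count_space UNIV) * indicator ucube x" for x :: "real^'n"
   by (simp add: indicator_def)
  then have "(NI x. \<integral>\<^sup>+j. enorm (indicator ucube x *\<^sub>R g (x + iv j)) \<partial>count_space UNIV) = (NI x. enorm (g x))"
   by (simp add: nn_integral_utor[OF mn, symmetric] nn_integral_unfold)
  then show ?thesis using gfin by simp
 qed
 have "integrable lborel (%x. \<integral>j. indicator ucube x *\<^sub>R g (x + iv j) \<partial>count_space UNIV)"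
  by (rule fubini_swap(2)[OF sigma_finite_lborel sf _ fin2]) measurable
 then have i: "integrable lborel (%x. indicator ucube x *\<^sub>R (\<integral>j. g (x + iv j) \<partial>count_space UNIV))" by (simp only: integral_scaleR_right)
 show "integrable utor (%x. \<integral>j. g (x + iv j) \<partial>count_space UNIV)"
  unfolding utor_def using i m by (subst integrable_density) auto
 have "(BU x. (\<integral>j. g (x + iv j) \<partial>count_space UNIV)) = (BI x. indicator ucube x *\<^sub>R (\<integral>j. g (x + iv j) \<partial>count_space UNIV))"
  unfolding utor_def using m by (subst integral_density) auto
 also have "... = (BI x. (\<integral>j. indicator ucube x *\<^sub>R g (x + iv j) \<partial>count_space UNIV))" by (simp only: integral_scaleR_right)
 also have "... = (\<integral>j. (BI x. indicator ucube x *\<^sub>R g (x + iv j)) \<partial>count_space UNIV)"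
  by (rule fubini_swap(1)[OF sigma_finite_lborel sf _ fin2]) measurable
 also have "... = (\<integral>j. (BI x. indicator ucube (x - iv j) *\<^sub>R g x) \<partial>count_space UNIV)"
 proof (rule Bochner_Integration.integral_cong[OF refl])
  fix j :: "int^'n"
  show "(BI x. indicator ucube x *\<^sub>R g (x + iv j)) = (BI x. indicator ucube (x - iv j) *\<^sub>R g x)"
   using integral_translate(2)[of "%x. indicator ucube x *\<^sub>R g (x + iv j)" "iv j"] by simp
 qed
 also have "... = (BI x. (\<integral>j. indicator ucube (x - iv j) *\<^sub>R g x \<partial>count_space UNIV))"
  by (rule fubini_swap(1)[OF sigma_finite_lborel sf _ fin1, symmetric]) measurable
 also have "... = (BI x. g x)" by (simp only: integral_cell)
 finally show "(BU x. (\<integral>j. g (x + iv j) \<partial>count_space UNIV)) = (BI x. g x)" .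
qed

text \<open>Periodization with period \<open>N\<close>, rescaled to the unit torus. The function is
  dilated before it is summed, so all periods live on the same measure.\<close>

definition per :: "real => (real^'n => complex) => real^'n => complex" where
 "per N h x = (\<integral>j. h (N *\<^sub>R (x + iv j)) \<partial>count_space UNIV)"

lemma measurable_per [measurable]:
 assumes [measurable]: "h \<in> bm"
 shows "per N h \<in> borel_measurable (borel :: (real^'n::finite) measure)"
 unfolding per_def[abs_def] by (intro sigma_finite_measure.borel_measurable_lebesgue_integral[OF sigma_finite_measure_count_space]) measurable

lemma iv_add: "iv (j + k) = iv j + iv k"
 by (simp add: vec_eq_iff)

lemma per_periodic: "per N h (x + iv k) = per N h x"
proof -
 have b: "bij_betw (%j. k + j) UNIV (UNIV :: (int^'a) set)" by (rule bij_plus)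
 show ?thesis
  unfolding per_def using integral_bij_count_space[OF b, of "%j. h (N *\<^sub>R (x + iv j))"] by (simp add: iv_add add.assoc)
qed

lemma pex_eq:
 assumes "!!x j. G (x + iv j) = G x" shows "pex G x = G x"
proof -
 have "x = (\<chi> i. frac (x $ i)) + iv (\<chi> i. \<lfloor>x $ i\<rfloor>)" by (simp add: vec_eq_iff frac_def)
 then show ?thesis unfolding pex_def using assms[of "\<chi> i. frac (x $ i)" "\<chi> i. \<lfloor>x $ i\<rfloor>"] by simp
qed

text \<open>Characters are periodic, so the sum over the lattice and the integral over a cell unfold
  to one integral over the space: the coefficients are samples of the transform, and the factor is
  the Jacobian of the dilation.\<close>

lemma fourier_coeff_per:
 fixes u :: "real^'n::finite => complex"
 assumes u: "integrable lborel u" and N: "0 < N"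
 shows "fourier_coeff (per N u) k = cof (1 / N ^ CARD('n)) * ft u ((1 / N) *\<^sub>R iv k)"
  "integrable utor (per N u)"
proof -
 have [measurable]: "u \<in> bm" using u by auto
 have uN: "integrable lborel (%y. u (N *\<^sub>R y))" using integrable_affine[OF u, of N 0] N by simp
 show "integrable utor (per N u)" unfolding per_def[abs_def] using integral_unfold(2)[OF uN] .
 define g where "g y = u (N *\<^sub>R y) * cnj (character k y)" for y
 have g: "integrable lborel g"
  unfolding g_def cnj_character mult.commute[of "u _"] by (rule integrable_mult_bounded[OF uN, where B=1]) auto
 have "fourier_coeff (per N u) k = (BU x. per N u x * cnj (character k x))"
  by (subst fourier_coeff_utor) (auto intro!: borel_imp_torus simp: pex_eq[of "per N u", OF per_periodic])
 also have "... = (BU x. (\<integral>j. g (x + iv j) \<partial>count_space UNIV))"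
  unfolding per_def g_def by (simp add: character_add)
 also have "... = (BI y. g y)" by (rule integral_unfold(1)[OF g])
 also have "... = ft (%y. u (N *\<^sub>R y)) (iv k)"
  unfolding ft_def g_def character_inner by (simp add: cis_cnj)
 also have "... = cof (1 / N ^ CARD('n)) * ft u ((1 / N) *\<^sub>R iv k)"
 proof -
  have "ft u ((1 / N) *\<^sub>R iv k) = N ^ CARD('n) *\<^sub>R ft (%y. u (N *\<^sub>R y)) (iv k)"
   using ft_scale[of N u "(1 / N) *\<^sub>R iv k"] N by simp
  then have "cof (1 / N ^ CARD('n)) * ft u ((1 / N) *\<^sub>R iv k) = ((1 / N ^ CARD('n)) * N ^ CARD('n)) *\<^sub>R ft (%y. u (N *\<^sub>R y)) (iv k)"
   by (simp only: scaleR_conv_of_real of_real_mult mult.assoc)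
  then show ?thesis using N by simp
 qed
 finally show "fourier_coeff (per N u) k = cof (1 / N ^ CARD('n)) * ft u ((1 / N) *\<^sub>R iv k)" .
qed

text \<open>The difference \<open>H\<close> has only zero coefficients, so its Fejer means vanish,
  and their convergence in \<open>L_1\<close> forces \<open>H\<close> to vanish almost
  everywhere.\<close>

lemma torus_coeff_unique:
 fixes G :: "real^'n::finite => complex"
 assumes [measurable]: "G \<in> bm" and per: "!!x j. G (x + iv j) = G x" and G: "integrable utor G"
  and K: "finite K" "!!k. k \<notin> K ==> fourier_coeff G k = 0"
 shows "AE x in utor. G x = trigp K (fourier_coeff G) x"
proof -
 define T where "T = trigp K (fourier_coeff G)"
 have [measurable]: "T \<in> bm" unfolding T_def by measurable
 have T: "integrable utor T" unfolding T_def by (rule integrable_utor_bounded[OF measurable_trigp trigp_bound])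
 have Tper: "T (x + iv j) = T x" for x j unfolding T_def by (rule trigp_periodic)
 define H where "H x = G x - T x" for x
 have [measurable]: "H \<in> bm" unfolding H_def[abs_def] by measurable
 have pH: "pex H x = H x" for x by (rule pex_eq) (simp add: H_def per Tper)
 have Hi: "integrable utor H" unfolding H_def[abs_def] using G T by simp
 have c: "fourier_coeff L k = (BU x. L x * cnj (character k x))"
  if [measurable]: "L \<in> bm" and "!!x j. L (x + iv j) = L x" for L :: "real^'n => complex" and k
  by (subst fourier_coeff_utor) (auto intro!: borel_imp_torus simp: pex_eq[of L, OF that(2)])
 have i: "integrable utor (%x. L x * cnj (character k x))" if "integrable utor L" for L :: "real^'n => complex" and k
  unfolding cnj_character mult.commute[of "L _"] by (rule integrable_mult_bounded[OF that, where B=1]) auto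
 have H0: "fourier_coeff H k = 0" for k
 proof -
  have "fourier_coeff H k = (BU x. G x * cnj (character k x) - T x * cnj (character k x))"
   by (subst c) (auto simp: H_def per Tper left_diff_distrib)
  also have "... = fourier_coeff G k - fourier_coeff T k"
   unfolding c[of G, OF _ per, simplified] c[of T, OF _ Tper, simplified] by (rule Bochner_Integration.integral_diff[OF i[OF G] i[OF T]])
  also have "... = 0" unfolding T_def fourier_coeff_trigp[OF K(1)] using K(2) by simp
  finally show ?thesis .
 qed
 have "(%n. (NU x. enorm (fmean (Suc n) H x - pex H x))) \<longlonglongrightarrow> 0"
  by (rule fmean_L1) (auto intro!: borel_imp_torus simp: pH[abs_def] Hi)
 then have "(NU x. enorm (H x)) = 0"
  by (simp add: fmean_def trigp_def H0 pH LIMSEQ_const_iff)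
 then have "AE x in utor. enorm (H x) = 0" by (subst (asm) nn_integral_0_iff_AE) auto
 then show ?thesis unfolding T_def[symmetric] by eventually_elim (simp add: H_def)
qed

section \<open>Lattice sums of decaying functions\<close>

lemma wt_le_1: "wt x <= 1"
 unfolding wt_def by (intro prod_le_1) (auto simp: divide_le_eq_1 add_pos_nonneg)

text \<open>Unfolding the integral of \<open>wt\<close> shows that the lattice sum based at almost
  every point is finite. One such point \<open>x\<close> suffices, because \<open>wt (iv j)\<close>
  and \<open>wt (x + iv j)\<close> are comparable uniformly in \<open>j\<close>.\<close>

lemma integrable_wt_iv: "integrable (count_space UNIV) (%j. wt (iv j :: real^'n::finite))"
proof -
 interpret prob_space "utor :: (real^'n) measure" by (rule prob_space_utor)
 have "(NU x. (\<integral>\<^sup>+j. ennreal (wt (x + iv j :: real^'n)) \<partial>count_space UNIV)) = (NI x. ennreal (wt (x::real^'n)))"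
  by (rule nn_integral_unfold[symmetric]) measurable
 also have "... ~= \<infinity>" using integrable_wt[where 'a="real^'n"] by (simp add: integrable_iff_bounded less_top)
 finally have "AE x::real^'n in utor. (\<integral>\<^sup>+j. ennreal (wt (x + iv j)) \<partial>count_space UNIV) ~= \<infinity>"
  by (intro nn_integral_PInf_AE sigma_finite_measure.borel_measurable_nn_integral[OF sigma_finite_measure_count_space]) measurable
 then have "\<exists>x::real^'n. (\<integral>\<^sup>+j. ennreal (wt (x + iv j)) \<partial>count_space UNIV) ~= \<infinity>"
 proof (rule contrapos_pp)
  assume "\<not> (\<exists>x::real^'n. (\<integral>\<^sup>+j. ennreal (wt (x + iv j)) \<partial>count_space UNIV) ~= \<infinity>)"
  then show "\<not> (AE x::real^'n in utor. (\<integral>\<^sup>+j. ennreal (wt (x + iv j)) \<partial>count_space UNIV) ~= \<infinity>)"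
   by (simp add: AE_False)
 qed
 then obtain x :: "real^'n" where x: "(\<integral>\<^sup>+j. ennreal (wt (x + iv j)) \<partial>count_space UNIV) ~= \<infinity>" by blast
 define c where "c = 2 ^ CARD('n) / wt x"
 have c0: "0 <= c" using wt_pos[of x] by (simp add: c_def less_imp_le)
 have le: "wt (iv j) <= c * wt (x + iv j)" for j
 proof -
  have "wt (iv j) * wt x <= (\<Prod>i\<in>(UNIV::'n set). 2 * (1 / (1 + (x $ i + real_of_int (j $ i))\<^sup>2)))"
   unfolding wt_vec prod.distrib[symmetric]
  proof (intro prod_mono conjI)
   fix i :: 'n
   define a b where "a = x $ i" and "b = real_of_int (j $ i)"
   \<comment> \<open>This is Peetre's inequality
     \<open>1 + (a + b)^2 \<le> 2 * (1 + a^2) * (1 + b^2)\<close>, with the difference of the two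
     sides written out.\<close>
   have "0 <= (a - b)\<^sup>2 + 1 + 2 * (a * b)\<^sup>2" by simp
   then have "1 + (a + b)\<^sup>2 <= 2 * ((1 + b\<^sup>2) * (1 + a\<^sup>2))" by (simp add: power2_eq_square algebra_simps)
   moreover have "0 < 1 + (a + b)\<^sup>2" "0 < 1 + a\<^sup>2" "0 < 1 + b\<^sup>2" by (auto intro!: add_pos_nonneg)
   ultimately have "1 / (1 + b\<^sup>2) * (1 / (1 + a\<^sup>2)) <= 2 * (1 / (1 + (a + b)\<^sup>2))" by (simp add: divide_simps)
   then show "1 / (1 + (iv j $ i)\<^sup>2) * (1 / (1 + (x $ i)\<^sup>2)) <= 2 * (1 / (1 + (x $ i + real_of_int (j $ i))\<^sup>2))"
    by (simp add: a_def b_def)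
  qed simp
  also have "... = 2 ^ CARD('n) * wt (x + iv j)" by (simp add: wt_vec prod.distrib prod_dividef)
  finally show ?thesis using wt_pos[of x] by (simp add: c_def pos_le_divide_eq)
 qed
 have "(\<integral>\<^sup>+j. enorm (wt (iv j :: real^'n)) \<partial>count_space UNIV) <= (\<integral>\<^sup>+j. ennreal c * ennreal (wt (x + iv j)) \<partial>count_space UNIV)"
  using le c0 by (intro nn_integral_mono) (simp add: ennreal_mult'[symmetric] ennreal_leI)
 also have "... < \<infinity>" using x by (simp add: nn_integral_cmult ennreal_mult_less_top less_top)
 finally show ?thesis by (simp add: integrable_iff_bounded)
qed

text \<open>The cell is centred at 0 so that it exhausts the space as \<open>N\<close> grows;
  multiples of the unit cube would fill only one orthant.\<close>

definition cbox0 :: "real => (real^'n) set" where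
 "cbox0 N = cbx (%_. {- N / 2..<N / 2})"

lemma mem_cbox0: "y \<in> cbox0 N \<longleftrightarrow> (\<forall>i. - N / 2 <= y $ i \<and> y $ i < N / 2)"
 by (simp add: cbox0_def cbx_def)

lemma measurable_cbox0 [measurable]: "(cbox0 N :: (real^'n::finite) set) \<in> sets borel"
 unfolding cbox0_def by (intro measurable_cbx) simp

text \<open>In the centred cell a coordinate is at most \<open>N / 2\<close> in modulus, so a
  translation by \<open>N * m\<close> with \<open>m\<close> nonzero leaves it of modulus at least
  \<open>N * |m| / 2\<close>. The result is a majorant that is summable in \<open>j\<close>,
  integrable in \<open>y\<close> and independent of \<open>N\<close>.\<close>

lemma wt_lattice_le:
 fixes y :: "real^'n::finite"
 assumes N: "1 <= N" and y: "y \<in> cbox0 N"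
 shows "wt (y + N *\<^sub>R iv j) <= 16 ^ CARD('n) * wt (iv j :: real^'n) * wt y"
  "j ~= 0 ==> wt (y + N *\<^sub>R iv j) <= 4 / N\<^sup>2"
proof -
 have far: "N\<^sup>2 * m\<^sup>2 / 4 <= (t + N * m)\<^sup>2" if "\<bar>t\<bar> <= N / 2" "1 <= \<bar>m\<bar>" for t m :: real
 proof -
  have "N / 2 * 1 <= N / 2 * \<bar>m\<bar>" using that N by (intro mult_left_mono) auto
  then have "\<bar>t\<bar> <= N / 2 * \<bar>m\<bar>" using that by linarith
  then have "N * \<bar>m\<bar> / 2 <= \<bar>t + N * m\<bar>" using N abs_triangle_ineq2[of "N * m" "- t"] by (simp add: abs_mult add.commute)
  then have "(N * \<bar>m\<bar> / 2)\<^sup>2 <= \<bar>t + N * m\<bar>\<^sup>2" using N by (intro power_mono) auto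
  then show ?thesis by (simp add: power_mult_distrib power_divide)
 qed
 have yb: "\<bar>y $ i\<bar> <= N / 2" for i using y[unfolded mem_cbox0, rule_format, of i] by linarith
 have one: "1 <= \<bar>real_of_int m\<bar>" if "m ~= 0" for m using that by linarith
 show "wt (y + N *\<^sub>R iv j) <= 16 ^ CARD('n) * wt (iv j :: real^'n) * wt y"
 proof -
  have "wt (y + N *\<^sub>R iv j) <= (\<Prod>i\<in>(UNIV::'n set). 16 * (1 / (1 + (iv j $ i)\<^sup>2)) * (1 / (1 + (y $ i)\<^sup>2)))"
   unfolding wt_vec
  proof (intro prod_mono conjI)
   fix i :: 'n
   define m t where "m = real_of_int (j $ i)" and "t = y $ i"
   have "(1 + m\<^sup>2) * (1 + t\<^sup>2) <= 16 * (1 + (t + N * m)\<^sup>2)"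
   proof (cases "j $ i = 0")
    case True
    then show ?thesis by (simp add: m_def)
   next
    case False
    then have m1: "1 <= \<bar>m\<bar>" using one by (simp add: m_def)
    have tt: "t\<^sup>2 <= N\<^sup>2 / 4" using power_mono[OF yb[of i], of 2] by (simp add: t_def power_divide)
    have mm: "1 <= m\<^sup>2" using power_mono[OF m1, of 2] by simp
    have NN: "1 <= N\<^sup>2" using power_mono[OF N, of 2] by simp
    have "(1 + m\<^sup>2) * (1 + t\<^sup>2) <= (2 * m\<^sup>2) * (2 * N\<^sup>2)" using tt mm NN by (intro mult_mono) auto
    also have "... = 16 * (N\<^sup>2 * m\<^sup>2 / 4)" by simp
    also have "... <= 16 * (t + N * m)\<^sup>2" using far[OF yb[of i] m1] by (simp add: t_def)
    finally show ?thesis by simp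
   qed
   moreover have "0 < 1 + (t + N * m)\<^sup>2" "0 < 1 + m\<^sup>2" "0 < 1 + t\<^sup>2" by (auto intro!: add_pos_nonneg)
   ultimately have "1 / (1 + (t + N * m)\<^sup>2) <= 16 * (1 / (1 + m\<^sup>2)) * (1 / (1 + t\<^sup>2))" by (simp add: divide_simps)
   then show "1 / (1 + ((y + N *\<^sub>R iv j) $ i)\<^sup>2) <= 16 * (1 / (1 + (iv j $ i)\<^sup>2)) * (1 / (1 + (y $ i)\<^sup>2))"
    by (simp add: m_def t_def)
  qed simp
  then show ?thesis by (simp add: wt_vec prod.distrib prod_dividef)
 qed
 show "wt (y + N *\<^sub>R iv j) <= 4 / N\<^sup>2" if j0: "j ~= 0"
 proof -
  obtain i where i: "j $ i ~= 0" using j0 by (auto simp: vec_eq_iff)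
  define m t where "m = real_of_int (j $ i)" and "t = y $ i"
  have m1: "1 <= \<bar>m\<bar>" using one[OF i] by (simp add: m_def)
  have "N\<^sup>2 / 4 * 1 <= N\<^sup>2 / 4 * m\<^sup>2" using power_mono[OF m1, of 2] by (intro mult_left_mono) auto
  then have far': "N\<^sup>2 / 4 <= (t + N * m)\<^sup>2" using far[OF yb[of i] m1] by (simp add: t_def)
  have "wt (y + N *\<^sub>R iv j) = 1 / (1 + (t + N * m)\<^sup>2) * (\<Prod>i\<in>UNIV - {i}. 1 / (1 + ((y + N *\<^sub>R iv j) $ i)\<^sup>2))"
   unfolding wt_vec by (subst prod.remove[of _ i]) (auto simp: m_def t_def)
  also have "... <= 1 / (1 + (t + N * m)\<^sup>2) * 1"
   by (intro mult_left_mono prod_le_1) (auto simp: divide_le_eq_1 add_pos_nonneg)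
  also have "... <= 1 / (N\<^sup>2 / 4)" unfolding mult_1_right
   by (intro divide_left_mono) (use far' N in \<open>auto intro!: mult_pos_pos add_pos_nonneg\<close>)
  finally show ?thesis by simp
 qed
qed

definition lsum :: "real => (real^'n => complex) => real^'n => complex" where
 "lsum N h y = (\<integral>j. h (y + N *\<^sub>R iv j) \<partial>count_space UNIV)"

lemma per_lsum: "per N h x = lsum N h (N *\<^sub>R x)"
 by (simp add: per_def lsum_def scaleR_right_distrib)

lemma lsum_bound:
 fixes h :: "real^'n::finite => complex"
 assumes N: "1 <= N" and y: "y \<in> cbox0 N" and h: "!!x. norm (h x) <= C * wt x" and C: "0 <= C"
 shows "norm (lsum N h y) <= C * 16 ^ CARD('n) * (\<integral>j. wt (iv j :: real^'n) \<partial>count_space UNIV) * wt y"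
proof -
 have b: "norm (h (y + N *\<^sub>R iv j)) <= C * 16 ^ CARD('n) * wt y * wt (iv j :: real^'n)" for j
  using order_trans[OF h mult_left_mono[OF wt_lattice_le(1)[OF N y] C]] by (simp add: mult_ac)
 have "norm (lsum N h y) <= (\<integral>j. C * 16 ^ CARD('n) * wt y * wt (iv j :: real^'n) \<partial>count_space UNIV)"
  unfolding lsum_def
  by (rule order_trans[OF integral_norm_bound], rule integral_mono'[OF integrable_mult_right[OF integrable_wt_iv]])
   (use C b in \<open>auto simp: wt_pos less_imp_le\<close>)
 then show ?thesis by (simp add: mult_ac)
qed

text \<open>Eventually \<open>y\<close> belongs to the cell. Then the term \<open>j = 0\<close> is
  \<open>h y\<close>, each other term is of order \<open>N powr - 2\<close>, and
  \<open>wt_lattice_le\<close> gives the summable majorant for dominated convergence over the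
  lattice.\<close>

lemma lsum_tendsto:
 fixes h :: "real^'n::finite => complex"
 assumes h: "!!x. norm (h x) <= C * wt x" and C: "0 <= C"
 shows "(%m. indicator (cbox0 (2 ^ m)) y *\<^sub>R lsum (2 ^ m) h y) \<longlonglongrightarrow> h y"
proof -
 have b: "norm (indicator (cbox0 (2 ^ m)) y *\<^sub>R h (y + 2 ^ m *\<^sub>R iv j)) <= C * 16 ^ CARD('n) * wt y * wt (iv j :: real^'n)" for j m
 proof (cases "y \<in> cbox0 (2 ^ m)")
  case True
  then show ?thesis using order_trans[OF h mult_left_mono[OF wt_lattice_le(1)[OF one_le_power[of "2::real" m] True, of j] C]] by (simp add: mult_ac)
 next
  case False
  then show ?thesis using C by (simp add: wt_pos less_imp_le)
 qed
 obtain i0 where "!!i. \<bar>y $ i\<bar> <= \<bar>y $ i0\<bar>"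
  using Max_in[of "range (%i. \<bar>y $ i\<bar>)"] Max_ge[of "range (%i. \<bar>y $ i\<bar>)"] by fastforce
 moreover obtain m0 where m0: "2 * \<bar>y $ i0\<bar> < 2 ^ m0" using real_arch_pow[of 2 "2 * \<bar>y $ i0\<bar>"] by auto
 ultimately have m0': "2 * \<bar>y $ i\<bar> < 2 ^ m0" for i by (meson le_less_trans mult_left_mono zero_le_numeral)
 have inb: "y \<in> cbox0 (2 ^ m)" if "m0 <= m" for m
  unfolding mem_cbox0
 proof
  fix i
  have "2 * \<bar>y $ i\<bar> < 2 ^ m" using m0'[of i] power_increasing[OF that, of "2::real"] by linarith
  then show "- (2 ^ m) / 2 <= y $ i \<and> y $ i < 2 ^ m / 2" by linarith
 qed
 have "(%m. \<integral>j. indicator (cbox0 (2 ^ m)) y *\<^sub>R h (y + 2 ^ m *\<^sub>R iv j) \<partial>count_space UNIV) \<longlonglongrightarrow> (\<integral>j. (if j = 0 then h y else 0) \<partial>count_space (UNIV :: (int^'n) set))"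
 proof (rule integral_dominated_convergence[where w="%j. C * 16 ^ CARD('n) * wt y * wt (iv j :: real^'n)"])
  show "AE j in count_space UNIV. (%m. indicator (cbox0 (2 ^ m)) y *\<^sub>R h (y + 2 ^ m *\<^sub>R iv j)) \<longlonglongrightarrow> (if j = 0 then h y else 0)"
  proof (intro AE_I2)
   fix j :: "int^'n"
   show "(%m. indicator (cbox0 (2 ^ m)) y *\<^sub>R h (y + 2 ^ m *\<^sub>R iv j)) \<longlonglongrightarrow> (if j = 0 then h y else 0)"
   proof (cases "j = 0")
    case True
    have "iv (0 :: int^'n) = 0" by (simp add: vec_eq_iff)
    then show ?thesis using True inb by (intro tendsto_eventually) (auto simp: eventually_sequentially intro!: exI[of _ m0])
   next
    case False
    have nb: "norm (indicator (cbox0 (2 ^ m)) y *\<^sub>R h (y + 2 ^ m *\<^sub>R iv j)) <= C * (4 / (2 ^ m)\<^sup>2)" for m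
    proof (cases "y \<in> cbox0 (2 ^ m)")
     case True
     then show ?thesis using order_trans[OF h mult_left_mono[OF wt_lattice_le(2)[OF one_le_power[of "2::real" m] True False] C]] by simp
    qed (use C in simp)
    have lim: "(%m. C * (4 / (2 ^ m)\<^sup>2)) \<longlonglongrightarrow> 0"
    proof -
     have "(%m. C * (4 / (2 ^ m)\<^sup>2)) = (%m. C * 4 * (1 / 4) ^ m)"
      by (auto simp: power_one_over power2_eq_square power_mult_distrib[symmetric])
     then show ?thesis by (simp only:) (intro tendsto_mult_right_zero LIMSEQ_realpow_zero; simp)
    qed
    have "(%m. indicator (cbox0 (2 ^ m)) y *\<^sub>R h (y + 2 ^ m *\<^sub>R iv j)) \<longlonglongrightarrow> 0"
     by (rule Lim_null_comparison[OF always_eventually[OF allI[OF nb]] lim])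
    then show ?thesis using False by simp
   qed
  qed
 next
  show "integrable (count_space UNIV) (%j. C * 16 ^ CARD('n) * wt y * wt (iv j :: real^'n))" by (intro integrable_mult_right integrable_wt_iv)
  show "AE j in count_space UNIV. norm (indicator (cbox0 (2 ^ m)) y *\<^sub>R h (y + 2 ^ m *\<^sub>R iv j)) <= C * 16 ^ CARD('n) * wt y * wt (iv j :: real^'n)" for m
   by (rule AE_I2) (rule b)
 qed simp_all
 moreover have "(\<integral>j. (if j = 0 then h y else 0) \<partial>count_space (UNIV :: (int^'n) set)) = h y"
 proof -
  have s: "{j \<in> UNIV. (if j = 0 then h y else 0) ~= 0} \<subseteq> {0 :: int^'n}" by auto
  have "(\<integral>j. (if j = 0 then h y else 0) \<partial>count_space (UNIV :: (int^'n) set)) = (\<Sum>j | j \<in> UNIV \<and> (if j = 0 then h y else 0) ~= 0. if j = (0 :: int^'n) then h y else 0)"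
   by (rule lebesgue_integral_count_space_finite_support[OF finite_subset[OF s]]) simp
  also have "... = (\<Sum>j\<in>{0::int^'n}. if j = 0 then h y else 0)" by (rule sum.mono_neutral_left) auto
  finally show ?thesis by simp
 qed
 ultimately show ?thesis unfolding lsum_def by simp
qed

lemma nn_integral_utor_centered:
 fixes \<Phi> :: "real^'n::finite => ennreal"
 assumes [measurable]: "\<Phi> \<in> bm" and per: "!!x j. \<Phi> (x + iv j) = \<Phi> x" and N: "0 < N"
 shows "ennreal (N ^ CARD('n)) * (NU x. \<Phi> x) = (NI y. \<Phi> ((1 / N) *\<^sub>R y) * indicator (cbox0 N) y)"
proof -
 have "(NU x. \<Phi> x) = (NU x. \<Phi> (x + (- halfv)))" by (rule nn_integral_periodic_shift[symmetric]) (auto simp: per)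
 also have "... = (NI x. \<Phi> (x - halfv) * indicator ucube x)" by (subst nn_integral_utor) auto
 also have "... = ennreal (\<bar>1 / N\<bar> ^ DIM(real^'n)) * (NI y. \<Phi> (halfv + (1 / N) *\<^sub>R y - halfv) * indicator ucube (halfv + (1 / N) *\<^sub>R y))"
  using N by (intro nn_integral_affine) auto
 also have "(NI y. \<Phi> (halfv + (1 / N) *\<^sub>R y - halfv) * indicator ucube (halfv + (1 / N) *\<^sub>R y)) = (NI y. \<Phi> ((1 / N) *\<^sub>R y) * indicator (cbox0 N) y)"
 proof (rule nn_integral_cong)
  fix y :: "real^'n"
  have "halfv + (1 / N) *\<^sub>R y \<in> ucube \<longleftrightarrow> y \<in> cbox0 N"
   unfolding mem_ucube mem_cbox0
   by (intro all_cong1) (use N in \<open>auto simp: halfv_def field_simps\<close>)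
  then show "\<Phi> (halfv + (1 / N) *\<^sub>R y - halfv) * indicator ucube (halfv + (1 / N) *\<^sub>R y) = \<Phi> ((1 / N) *\<^sub>R y) * indicator (cbox0 N) y"
   by (simp add: indicator_def)
 qed
 finally have "(NU x. \<Phi> x) = ennreal (1 / N ^ CARD('n)) * (NI y. \<Phi> ((1 / N) *\<^sub>R y) * indicator (cbox0 N) y)"
  using N by (simp add: power_one_over)
 moreover have "ennreal (N ^ CARD('n)) * ennreal (1 / N ^ CARD('n)) = 1" using N by (simp add: ennreal_mult[symmetric])
 ultimately show ?thesis by (simp add: mult.assoc[symmetric])
qed

text \<open>Multiplied by the volume of the cell, the torus integral becomes an integral over the
  centred cell in the original coordinates. There the lattice sums converge pointwise and stay below
  a fixed multiple of \<open>wt\<close>.\<close>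

lemma period_limit:
 fixes v :: "'b => real^'n::finite => complex"
 assumes p: "1 <= p" and F: "finite F" and C: "0 <= C"
  and v: "!!R. R \<in> F ==> v R \<in> bm" "!!R x. R \<in> F ==> norm (v R x) <= C * wt x"
 shows "(%m. ennreal ((2 ^ m) ^ CARD('n)) * (NU x. ennreal (L2_set (%R. norm (per (2 ^ m) (v R) x)) F) epowr p))
  \<longlonglongrightarrow> (NI x. ennreal (L2_set (%R. norm (v R x)) F) epowr p)"
proof -
 define a where "a m R y = indicator (cbox0 (2 ^ m)) y *\<^sub>R lsum (2 ^ m) (v R) y" for m R and y :: "real^'n"
 have [measurable]: "lsum (2 ^ m) (v R) \<in> bm" if "R \<in> F" for m R
 proof -
  have [measurable]: "v R \<in> bm" by (rule v) fact
  show ?thesis unfolding lsum_def[abs_def]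
   by (intro sigma_finite_measure.borel_measurable_lebesgue_integral[OF sigma_finite_measure_count_space]) measurable
 qed
 have am: "a m R \<in> bm" if "R \<in> F" for m R unfolding a_def[abs_def] using that by measurable
 have pm: "per (2 ^ m) (v R) \<in> bm" if "R \<in> F" for m R using v(1)[OF that] by measurable
 have lm: "(%x. ennreal (L2_set (%R. norm (b R x)) F) epowr p) \<in> borel_measurable M"
  if "!!R. R \<in> F ==> b R \<in> borel_measurable M" for b :: "'b => 'c => complex" and M
  unfolding L2_set_def using that by measurable
 define B where "B = C * 16 ^ CARD('n) * (\<integral>j. wt (iv j :: real^'n) \<partial>count_space UNIV)"
 have B0: "0 <= B" unfolding B_def using C by (intro mult_nonneg_nonneg Bochner_Integration.integral_nonneg) (auto simp: wt_pos less_imp_le)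
 have ab: "norm (a m R y) <= B * wt y" if "R \<in> F" for m R y
 proof (cases "y \<in> cbox0 (2 ^ m)")
  case True
  then show ?thesis unfolding a_def B_def using lsum_bound[OF one_le_power[of "2::real" m] True v(2)[OF that] C] by simp
 next
  case False
  then show ?thesis using B0 by (simp add: a_def wt_pos less_imp_le)
 qed
 define c where "c = real (card F) * B"
 have c0: "0 <= c" using B0 by (simp add: c_def)
 have Lb: "L2_set (%R. norm (a m R y)) F <= c * wt y" for m y
 proof -
  have "L2_set (%R. norm (a m R y)) F <= (\<Sum>R\<in>F. norm (a m R y))" by (rule L2_set_le_sum) simp
  also have "... <= (\<Sum>R\<in>F. B * wt y)" by (intro sum_mono ab)
  finally show ?thesis by (simp add: c_def)
 qed
 have e: "ennreal ((2 ^ m) ^ CARD('n)) * (NU x. ennreal (L2_set (%R. norm (per (2 ^ m) (v R) x)) F) epowr p) = (NI y. ennreal (L2_set (%R. norm (a m R y)) F) epowr p)" for m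
 proof -
  have "(%x. ennreal (L2_set (%R. norm (per (2 ^ m) (v R) x)) F) epowr p) \<in> bm" by (intro lm pm)
  then have "ennreal ((2 ^ m) ^ CARD('n)) * (NU x. ennreal (L2_set (%R. norm (per (2 ^ m) (v R) x)) F) epowr p)
   = (NI y. ennreal (L2_set (%R. norm (per (2 ^ m) (v R) ((1 / 2 ^ m) *\<^sub>R y))) F) epowr p * indicator (cbox0 (2 ^ m)) y)"
   by (rule nn_integral_utor_centered) (simp_all add: per_periodic del: epowr_ennreal)
  also have "... = (NI y. ennreal (L2_set (%R. norm (a m R y)) F) epowr p)"
  proof (rule nn_integral_cong)
   fix y :: "real^'n"
   show "ennreal (L2_set (%R. norm (per (2 ^ m) (v R) ((1 / 2 ^ m) *\<^sub>R y))) F) epowr p * indicator (cbox0 (2 ^ m)) y = ennreal (L2_set (%R. norm (a m R y)) F) epowr p"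
    by (cases "y \<in> cbox0 (2 ^ m)") (simp_all add: a_def per_lsum L2_set_def)
  qed
  finally show ?thesis .
 qed
 show ?thesis
  unfolding e
 proof (rule nn_integral_dominated_convergence[where w="%y. ennreal (c powr p) * ennreal (wt y)"])
  show "AE y in lborel. ennreal (L2_set (%R. norm (a m R y)) F) epowr p <= ennreal (c powr p) * ennreal (wt y)" for m
  proof (intro AE_I2)
   fix y :: "real^'n"
   have "ennreal (L2_set (%R. norm (a m R y)) F) epowr p = ennreal (L2_set (%R. norm (a m R y)) F powr p)" by (simp add: L2_set_nonneg)
   also have "... <= ennreal ((c * wt y) powr p)" using Lb p by (intro ennreal_leI powr_mono2) (auto simp: L2_set_nonneg)
   also have "... = ennreal (c powr p * wt y powr p)" using c0 wt_pos[of y] by (simp add: powr_mult)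
   also have "... <= ennreal (c powr p * wt y)"
    using powr_mono'[of 1 p "wt y"] p wt_pos[of y] wt_le_1[of y] by (intro ennreal_leI mult_left_mono) auto
   finally show "ennreal (L2_set (%R. norm (a m R y)) F) epowr p <= ennreal (c powr p) * ennreal (wt y)"
    by (simp add: ennreal_mult')
  qed
  show "(NI (y::real^'n). ennreal (c powr p) * ennreal (wt y)) < \<infinity>"
   using integrable_wt[where 'a="real^'n"] by (subst nn_integral_cmult) (auto simp: ennreal_mult_less_top integrable_iff_bounded)
  show "AE y in lborel. (%m. ennreal (L2_set (%R. norm (a m R y)) F) epowr p) \<longlonglongrightarrow> ennreal (L2_set (%R. norm (v R y)) F) epowr p"
  proof (intro AE_I2)
   fix y :: "real^'n"
   have "(%m. L2_set (%R. norm (a m R y)) F) \<longlonglongrightarrow> L2_set (%R. norm (v R y)) F"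
    unfolding L2_set_def a_def by (intro tendsto_real_sqrt tendsto_sum tendsto_power tendsto_norm lsum_tendsto[OF v(2) C])
   then have "(%m. L2_set (%R. norm (a m R y)) F powr p) \<longlonglongrightarrow> L2_set (%R. norm (v R y)) F powr p"
    using p by (intro tendsto_powr2) (auto simp: L2_set_nonneg)
   then show "(%m. ennreal (L2_set (%R. norm (a m R y)) F) epowr p) \<longlonglongrightarrow> ennreal (L2_set (%R. norm (v R y)) F) epowr p"
    by (simp add: L2_set_nonneg tendsto_ennrealI)
  qed
 next
  show "(%y. ennreal (L2_set (%R. norm (a m R y)) F) epowr p) \<in> borel_measurable lborel" for m
   by (intro lm) (simp add: am)
  show "(%y. ennreal (L2_set (%R. norm (v R y)) F) epowr p) \<in> borel_measurable lborel"
   by (intro lm) (simp add: v)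
 qed measurable
qed

lemma mem_dyadic_box:
 assumes R: "R \<in> dyadic_boxes" shows "y \<in> R \<longleftrightarrow> bx y = R"
proof -
 obtain x where "R = bx x" using R unfolding dyadic_boxes_eq by (rule imageE)
 then show ?thesis by (simp only: bx_eq_iff)
qed

text \<open>The bounded spectrum of \<open>u\<close> makes its periodization a trigonometric
  polynomial with coefficients sampled from \<open>ft u\<close>. Its block sums are the
  periodizations of the pieces \<open>v R\<close>, since both have the same coefficients.
  Frequencies with a zero coordinate carry no mass, so the torus blocks without counterpart on the
  line contribute nothing.\<close>

theorem transfer_period:
 fixes u :: "real^'n::finite => complex" and v :: "(real^'n) set => real^'n => complex"
 assumes p: "1 <= p" and F: "finite F" "F \<subseteq> dyadic_boxes" and C: "0 <= C"
  and u: "u \<in> bm" "!!x. norm (u x) <= C * wt x"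
  and v: "!!R. R \<in> F ==> v R \<in> bm" "!!R x. R \<in> F ==> norm (v R x) <= C * wt x"
  and spec: "!!R \<xi>. R \<in> F ==> ft (v R) \<xi> = indicator R \<xi> * ft u \<xi>"
  and supp: "!!\<xi> i. ft u \<xi> ~= 0 ==> \<xi> $ i ~= 0 \<and> \<bar>\<xi> $ i\<bar> <= B" "!!\<xi>. ft u \<xi> ~= 0 ==> bx \<xi> \<in> F"
 shows "(%m. ennreal ((2 ^ m) ^ CARD('n)) * pint p torus (per (2 ^ m) u)) \<longlonglongrightarrow> pint p lborel u"
  "(%m. ennreal ((2 ^ m) ^ CARD('n)) * sqT p (per (2 ^ m) u)) \<longlonglongrightarrow> (NI x. ennreal (L2_set (%R. norm (v R x)) F) epowr p)"
proof -
 note [measurable] = u(1)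
 \<comment> \<open>The norm is treated as the square function of a family with one member, so that
   one limit theorem serves for both sides.\<close>
 have "pint p torus (per (2 ^ m) u) = (NU x. ennreal (L2_set (%_. norm (per (2 ^ m) u x)) {()}) epowr p)" for m
  unfolding pint_def by (subst nn_integral_torus[OF refl]) (auto simp: L2_set_def)
 moreover have "pint p lborel u = (NI x. ennreal (L2_set (%_. norm (u x)) {()}) epowr p)"
  by (simp add: pint_def L2_set_def)
 ultimately show "(%m. ennreal ((2 ^ m) ^ CARD('n)) * pint p torus (per (2 ^ m) u)) \<longlonglongrightarrow> pint p lborel u"
  using period_limit[OF p _ C, of "{()}" "%_. u"] u by simp
 have iwt: "integrable lborel h" if "h \<in> bm" "!!x. norm (h x) <= C * wt x" for h :: "real^'n => complex"
  by (rule Bochner_Integration.integrable_bound[OF integrable_mult_right[OF integrable_wt, of C]])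
   (use that C in \<open>auto simp: abs_mult\<close>)
 have iu: "integrable lborel u" by (rule iwt[OF u])
 have iv': "integrable lborel (v R)" if "R \<in> F" for R by (rule iwt[OF v[OF that]])
 have "sqT p (per (2 ^ m) u) = (NU x. ennreal (L2_set (%R. norm (per (2 ^ m) (v R) x)) F) epowr p)" for m
 proof -
  define N :: real where "N = 2 ^ m"
  have N0: "0 < N" by (simp add: N_def)
  define sc where "sc k = (1 / N) *\<^sub>R (iv k :: real^'n)" for k
  define cf where "cf = cof (1 / N ^ CARD('n))"
  define a where "a = fourier_coeff (per N u)"
  have a: "a k = cf * ft u (sc k)" for k unfolding a_def cf_def sc_def by (rule fourier_coeff_per(1)[OF iu N0])
  define K where "K = {k. ft u (sc k) ~= 0}"
  have Ksub: "K \<subseteq> {k. \<forall>i. k $ i \<in> {- \<lceil>N * B\<rceil>..\<lceil>N * B\<rceil>}}"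
  proof safe
   fix k i assume "k \<in> K"
   then have "\<bar>sc k $ i\<bar> <= B" using supp(1)[of "sc k" i] by (simp add: K_def)
   then have "\<bar>real_of_int (k $ i)\<bar> <= N * B" using N0 by (simp add: sc_def abs_divide pos_divide_le_eq mult.commute)
   then have "\<bar>k $ i\<bar> <= \<lceil>N * B\<rceil>" by linarith
   then show "k $ i \<in> {- \<lceil>N * B\<rceil>..\<lceil>N * B\<rceil>}" by auto
  qed
  have K: "finite K" by (rule finite_subset[OF Ksub]) (rule finite_vec, simp)
  have bxF: "bx (sc k) \<in> F" if "k \<in> K" for k using that supp(2) by (simp add: K_def)
  have ibx_mem: "k \<in> R \<longleftrightarrow> ibx k = R" if R: "R \<in> int_dyadic_boxes" for k :: "int^'n" and R
  proof -
   obtain l where "R = ibx l" using R unfolding int_dyadic_boxes_eq by (rule rangeE)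
   then show ?thesis by (simp only: mem_ibx ibx_eq_iff bx_eq_iff)
  qed
  have bx_mem: "y \<in> R \<longleftrightarrow> bx y = R" if R: "R \<in> dyadic_boxes" for y :: "real^'n" and R
   by (rule mem_dyadic_box[OF R])
  \<comment> \<open>This equivalence is what asks for a period that is a power of 2: the sample
    points share a box exactly when their integer indices share a block.\<close>
  have part: "ibx k = ibx l \<longleftrightarrow> bx (sc k) = bx (sc l)" for k l
  proof -
   have "real_of_int (k $ i) \<in> dint (real_of_int (l $ i)) \<longleftrightarrow> sc k $ i \<in> dint (sc l $ i)" for i
    using dint_scale[of m "sc k $ i" "sc l $ i"] by (simp add: sc_def N_def)
   then show ?thesis by (simp only: ibx_eq_iff bx_eq_iff mem_bx iv_nth)
  qed
  have l2: "l2n int_dyadic_boxes (%R. trigp R a x) = ennreal (L2_set (%R. norm (\<Sum>k\<in>{k\<in>K. bx (sc k) = R}. a k * character k x)) F)" for x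
  proof -
   have "l2n int_dyadic_boxes (%R. trigp R a x) = l2n int_dyadic_boxes (%R. \<Sum>k\<in>{k\<in>K. ibx k = R}. a k * character k x)"
   proof (intro l2n_cong arg_cong[where f=norm])
    fix R :: "(int^'n) set" assume R: "R \<in> int_dyadic_boxes"
    have "finite R" using R finite_ibx by (auto simp: int_dyadic_boxes_eq)
    then show "trigp R a x = (\<Sum>k\<in>{k\<in>K. ibx k = R}. a k * character k x)"
     unfolding trigp_def using ibx_mem[OF R] by (intro sum.mono_neutral_right) (auto simp: K_def a)
   qed
   also have "... = l2n dyadic_boxes (%R. \<Sum>k\<in>{k\<in>K. bx (sc k) = R}. a k * character k x)"
    using bxF F(2) by (intro l2n_partition_eq[OF K _ _ part]) (auto simp: int_dyadic_boxes_eq)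
   also have "... = ennreal (L2_set (%R. norm (\<Sum>k\<in>{k\<in>K. bx (sc k) = R}. a k * character k x)) F)"
    using bxF by (intro l2n_finite_support F sum.neutral) auto
   finally show ?thesis .
  qed
  have "AE x in utor. \<forall>R\<in>F. per N (v R) x = (\<Sum>k\<in>{k\<in>K. bx (sc k) = R}. a k * character k x)"
  proof (rule AE_finite_allI[OF F(1)])
   fix R assume R: "R \<in> F"
   let ?K = "{k\<in>K. bx (sc k) = R}"
   have [measurable]: "v R \<in> bm" by (rule v) fact
   have fc: "fourier_coeff (per N (v R)) k = (if k \<in> ?K then a k else 0)" for k
    unfolding fourier_coeff_per(1)[OF iv'[OF R] N0] a spec[OF R] sc_def[symmetric] cf_def[symmetric]
    using bx_mem[of R "sc k"] R F(2) by (auto simp: K_def indicator_def)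
   have "AE x in utor. per N (v R) x = trigp ?K (fourier_coeff (per N (v R))) x"
    using K by (intro torus_coeff_unique fourier_coeff_per(2)[OF iv'[OF R] N0]) (auto simp: per_periodic fc)
   then show "AE x in utor. per N (v R) x = (\<Sum>k\<in>?K. a k * character k x)"
    by eventually_elim (simp add: trigp_def fc)
  qed
  then have ae: "AE x in utor. l2n int_dyadic_boxes (%R. trigp R a x) epowr p = ennreal (L2_set (%R. norm (per N (v R) x)) F) epowr p"
   unfolding l2
  proof eventually_elim
   case (elim x)
   have "L2_set (%R. norm (\<Sum>k\<in>{k\<in>K. bx (sc k) = R}. a k * character k x)) F = L2_set (%R. norm (per N (v R) x)) F"
    using elim by (intro L2_set_cong) auto
   then show ?case by (simp only:)
  qed
  show ?thesis unfolding sqT_eq N_def[symmetric] a_def[symmetric] by (rule nn_integral_cong_AE[OF ae])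
 qed
 then show "(%m. ennreal ((2 ^ m) ^ CARD('n)) * sqT p (per (2 ^ m) u)) \<longlonglongrightarrow> (NI x. ennreal (L2_set (%R. norm (v R x)) F) epowr p)"
  using period_limit[OF p F(1) C v] by simp
qed

section \<open>From the torus to Euclidean space\<close>

lemma dyadic_box_cases:
 fixes R :: "(real^'n::finite) set"
 assumes "R \<in> dyadic_boxes"
 obtains I where "R = cbx I" "\<forall>i. short_interval (I i)" "R \<in> sets borel" "emeasure lborel R < top"
proof -
 obtain x where x: "R = bx x" "!!i. x $ i ~= 0" using assms by (auto simp: dyadic_boxes_eq)
 let ?I = "%i. dint (x $ i)"
 have s: "short_interval (?I i)" for i by (rule short_interval_dint[OF x(2)])
 have m: "?I i \<in> sets borel" for i using s[of i] by (simp add: short_interval_def)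
 have e: "emeasure lborel (?I i) < top" for i by (rule short_interval_ft[OF s[of i]])
 show ?thesis
  by (rule that[of ?I]) (use s measurable_cbx[of ?I, OF m] emeasure_cbx_less_top[of ?I, OF m e] in \<open>simp_all add: x(1) bx_def\<close>)
qed

text \<open>A bounded integrable kernel lies in \<open>L_q\<close> for the conjugate exponent
  \<open>q\<close>, since \<open>|k| powr q\<close> is at most
  \<open>B powr (q - 1) * |k|\<close>.\<close>

lemma conv_bounded_L1_bounded:
 fixes k f :: "'a::euclidean_space => complex"
 assumes p: "1 < p" and k: "integrable lborel k" "!!x. norm (k x) <= B" and [measurable]: "f \<in> bm"
  and f: "pint p lborel f < top"
 obtains M where "0 <= M" "conv_bounded k f M"
proof -
 have [measurable]: "k \<in> bm" using k by auto
 define q where "q = p / (p - 1)"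
 have q: "1 < q" using p by (simp add: q_def)
 have B0: "0 <= B" using k(2)[of 0] norm_ge_zero[of "k 0"] by linarith
 have "pint q lborel k <= (NI x. ennreal (B powr (q - 1)) * enorm (k x))"
  unfolding pint_def
 proof (rule nn_integral_mono)
  fix x
  have "norm (k x) powr q = norm (k x) powr (q - 1) * norm (k x)" using powr_add[of "norm (k x)" "q - 1" 1] by simp
  also have "... <= B powr (q - 1) * norm (k x)" using q k(2) by (intro mult_right_mono powr_mono2) auto
  finally show "enorm (k x) epowr q <= ennreal (B powr (q - 1)) * enorm (k x)"
   by (simp add: ennreal_mult'[symmetric] ennreal_leI)
 qed
 also have "... < top" using k(1) by (subst nn_integral_cmult) (auto simp: ennreal_mult_less_top integrable_iff_bounded)
 finally have kq: "pint q lborel k < top" .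
 define Z where "Z = pint q lborel k + pint p lborel f"
 have Z: "Z < top" using kq f by (simp add: Z_def)
 have le: "(NI z. ennreal (norm (k z) * norm (f (x - z)))) <= Z" for x
  using conv_young[OF p zero_less_one q_def, of k f x] by (simp add: Z_def)
 show ?thesis by (rule that[of "enn2real Z"]) (use le Z in \<open>auto simp: conv_bounded_def\<close>)
qed

lemma conv_bounded_L1_sup:
 fixes k g :: "'a::euclidean_space => complex"
 assumes k: "integrable lborel k" and g: "!!x. norm (g x) <= B"
 obtains M where "0 <= M" "conv_bounded k g M"
proof -
 have [measurable]: "k \<in> bm" using k by auto
 have B0: "0 <= B" using g[of 0] norm_ge_zero[of "g 0"] by linarith
 define L where "L = (BI z. norm (k z))"
 have L: "(NI z. enorm (k z)) = ennreal L" unfolding L_def using k by (intro nn_integral_eq_integral) auto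
 have "(NI z. ennreal (norm (k z) * norm (g (x - z)))) <= ennreal (L * B)" for x
 proof -
  have "(NI z. ennreal (norm (k z) * norm (g (x - z)))) <= (NI z. enorm (k z) * ennreal B)"
   by (intro nn_integral_mono) (auto simp: ennreal_mult'[symmetric] intro!: ennreal_leI mult_left_mono g)
  also have "... = ennreal L * ennreal B" unfolding L[symmetric] by (rule nn_integral_multc) measurable
  also have "... = ennreal (L * B)" using B0 by (simp add: ennreal_mult'')
  finally show ?thesis .
 qed
 then show ?thesis using B0 by (intro that[of "L * B"]) (auto simp: conv_bounded_def L_def intro!: mult_nonneg_nonneg Bochner_Integration.integral_nonneg)
qed

text \<open>The convolution is transposed onto the integrable factor \<open>W\<close>. With a
  modulated window for \<open>W\<close>, a single value of the transform of a windowed convolution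
  becomes a pairing of \<open>g\<close> with a function of known spectrum.\<close>

lemma conv_pairing:
 fixes k g W :: "'a::euclidean_space => complex"
 assumes k: "integrable lborel k" and [measurable]: "g \<in> bm" and M: "conv_bounded k g M" and W: "integrable lborel W"
 shows "(BI x. conv k g x * W x) = (BI s. g s * conv W (%y. k (- y)) s)"
  "integrable lborel (conv W (%y. k (- y)))"
  "ft (conv W (%y. k (- y))) (- \<eta>) = ft W (- \<eta>) * ft k \<eta>"
proof -
 have [measurable]: "k \<in> bm" "W \<in> bm" using k W by auto
 have k': "integrable lborel (%y. k (- y))" using integrable_translate(3)[OF k, of 0] by simp
 show "integrable lborel (conv W (%y. k (- y)))" by (rule conv_L1(1)[OF W k'])
 have "ft (%y. k (- y)) (- \<eta>) = ft k \<eta>"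
  using integral_translate(3)[of "%x. k x * cis (- 2 * pi * (\<eta> \<bullet> x))" 0] by (simp add: ft_def)
 then show "ft (conv W (%y. k (- y))) (- \<eta>) = ft W (- \<eta>) * ft k \<eta>" by (simp add: conv_L1(2)[OF W k'])
 have fin: "(NI x. (NI s. enorm (k (x - s) * g s * W x))) < top"
 proof -
  have "(NI s. enorm (k (x - s) * g s * W x)) <= ennreal M * enorm (W x)" for x
  proof -
   have "(NI s. enorm (k (x - s) * g s * W x)) = (NI s. ennreal (norm (k (x - s)) * norm (g (x - (x - s))))) * enorm (W x)"
    by (subst nn_integral_multc[symmetric]) (auto simp: norm_mult ennreal_mult')
   also have "(NI s. ennreal (norm (k (x - s)) * norm (g (x - (x - s))))) = (NI z. ennreal (norm (k z) * norm (g (x - z))))"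
    by (rule nn_integral_translate(3)[where f="%z. ennreal (norm (k z) * norm (g (x - z)))"]) measurable
   also have "... <= ennreal M" using M by (simp add: conv_bounded_def)
   finally show ?thesis by (simp add: mult_right_mono)
  qed
  then have "(NI x. (NI s. enorm (k (x - s) * g s * W x))) <= (NI x. ennreal M * enorm (W x))"
   by (intro nn_integral_mono)
  also have "... < top" using W by (simp add: nn_integral_cmult ennreal_mult_less_top integrable_iff_bounded)
  finally show ?thesis .
 qed
 have "(BI x. conv k g x * W x) = (BI x. (BI s. k (x - s) * g s * W x))"
  unfolding conv_eq_integral by (simp only: integral_mult_left_zero)
 also have "... = (BI s. (BI x. k (x - s) * g s * W x))"
  by (rule fubini_swap(1)[OF sigma_finite_lborel sigma_finite_lborel _ fin]) measurable
 also have "... = (BI s. g s * conv W (%y. k (- y)) s)"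
  unfolding conv_def
  by (rule Bochner_Integration.integral_cong[OF refl], subst integral_mult_right_zero[symmetric], rule Bochner_Integration.integral_cong[OF refl]) (simp add: mult_ac)
 finally show "(BI x. conv k g x * W x) = (BI s. g s * conv W (%y. k (- y)) s)" .
qed

section \<open>Windowed functions and their dyadic pieces\<close>

lemma ft_reflect: "ft (%x. f (- x)) \<xi> = ft f (- \<xi>)"
 using integral_translate(3)[of "%x. f x * cis (- 2 * pi * (- \<xi> \<bullet> x))" 0] by (simp add: ft_def)

lemma integrable_ft_window:
 assumes "0 < \<delta>"
 shows "integrable lborel (ft (%x::real^'n::finite. cof (window \<delta> x)))"
proof -
 have "integrable lborel (%t::real. cof (tent (0 + (1 / \<delta>) *\<^sub>R t)))"
  using assms by (intro integrable_affine[OF integrable_tent]) auto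
 then have "integrable lborel (%t::real. cof (1 / \<delta>) * cof (tent (0 + (1 / \<delta>) *\<^sub>R t)))"
  by (rule integrable_mult_right)
 moreover have "(%t. cof (1 / \<delta>) * cof (tent (0 + (1 / \<delta>) *\<^sub>R t))) = (%t. cof (tent (t / \<delta>) / \<delta>))"
  by (rule ext) simp
 ultimately have "integrable lborel (%t::real. cof (tent (t / \<delta>) / \<delta>))" by (simp only:)
 then have "integrable lborel (%\<xi>::real^'n. \<Prod>i\<in>UNIV. cof (tent (\<xi> $ i / \<delta>) / \<delta>))" by (intro vec_prod_integral(1))
 moreover have "ft (%x::real^'n. cof (window \<delta> x)) = (%\<xi>. \<Prod>i\<in>UNIV. cof (tent (\<xi> $ i / \<delta>) / \<delta>))"
  by (rule ext) (rule ft_window[OF assms])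
 ultimately show ?thesis by simp
qed

text \<open>What is kept of \<open>kernel_exists\<close>: the spectrum meets finitely many dyadic
  intervals, is bounded, avoids 0, and has distance at least \<open>\<gamma>\<close> from the
  complement of each interval that it meets.\<close>

definition admissible :: "(real => complex) => bool" where
 "admissible \<kappa> \<longleftrightarrow> integrable lborel \<kappa> \<and> (\<exists>M. \<forall>t. norm (\<kappa> t) <= M) \<and>
  (\<exists>\<gamma>>0. \<gamma> <= 1 \<and> (\<forall>\<xi> \<eta>. ft \<kappa> \<xi> ~= 0 \<longrightarrow> \<bar>\<eta> - \<xi>\<bar> < \<gamma> \<longrightarrow> \<eta> \<in> dint \<xi>)) \<and>
  (\<exists>B. \<forall>\<xi>. ft \<kappa> \<xi> ~= 0 \<longrightarrow> \<bar>\<xi>\<bar> <= B \<and> \<xi> ~= 0) \<and> finite (dint ` {\<xi>. ft \<kappa> \<xi> ~= 0})"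

text \<open>The window moves frequencies by less than the gap \<open>\<gamma>\<close>, hence never across the boundary of a
 dyadic box; so multiplication by it commutes with the partial sums.\<close>

lemma windowed_spectrum:
 fixes f :: "real^'n::finite => complex" and \<kappa> :: "real => complex"
 assumes p: "1 < p" and [measurable]: "f \<in> bm" and f: "pint p lborel f < top"
  and \<kappa>: "integrable lborel \<kappa>" "!!t. norm (\<kappa> t) <= B"
  and gap: "!!\<xi> \<eta>. ft \<kappa> \<xi> ~= 0 ==> \<bar>\<eta> - \<xi>\<bar> < \<gamma> ==> \<eta> \<in> dint \<xi>"
  and \<delta>: "0 < \<delta>" "\<delta> <= \<gamma>" "\<delta> <= 1"
 shows "R \<in> dyadic_boxes ==> ft (%x. conv (pk \<kappa>) (conv (ker R) f) x * cof (window \<delta> x)) \<xi> =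
   indicator R \<xi> * ft (%x. conv (pk \<kappa>) f x * cof (window \<delta> x)) \<xi>"
  "ft (%x. conv (pk \<kappa>) f x * cof (window \<delta> x)) \<xi> ~= 0 ==>
   \<exists>\<eta>. (\<forall>i. ft \<kappa> (\<eta> $ i) ~= 0 \<and> \<bar>\<xi> $ i - \<eta> $ i\<bar> < \<delta>)"
proof -
 define k where "k = (pk \<kappa> :: real^'n => complex)"
 have k: "integrable lborel k" unfolding k_def by (rule integrable_pk) fact
 have kb: "norm (k x) <= B ^ CARD('n)" for x unfolding k_def by (rule norm_pk_le) fact
 have ftk: "ft k \<eta> = (\<Prod>i\<in>UNIV. ft \<kappa> (\<eta> $ i))" for \<eta> unfolding k_def by (rule ft_pk) fact
 define w where "w x = cof (window \<delta> x)" for x :: "real^'n"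
 have w: "integrable lborel w" unfolding w_def using \<delta> by (intro integrable_window)
 have [measurable]: "k \<in> bm" "w \<in> bm" using k w by auto
 define W where "W x = w x * cis (2 * pi * ((- \<xi>) \<bullet> x))" for x
 have W: "integrable lborel W" unfolding W_def by (intro integrable_mult_cis w) measurable
 have ftW: "ft W (- \<eta>) = ft w (\<xi> - \<eta>)" for \<eta>
  using ft_modulate[of w "- \<xi>" "- \<eta>"] by (simp add: W_def[abs_def])
 have ft_W: "ft (%x. h x * w x) \<xi> = (BI x. h x * W x)" for h
  by (simp add: ft_def W_def mult.assoc)
 define \<theta> where "\<theta> = conv W (%y. k (- y))"
 obtain Mf where Mf: "0 <= Mf" "conv_bounded k f Mf" by (rule conv_bounded_L1_bounded[OF p k kb _ f]) auto
 have \<theta>: "integrable lborel \<theta>" unfolding \<theta>_def by (rule conv_pairing(2)[OF k _ Mf(2) W]) simp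
 have ft\<theta>: "ft \<theta> (- \<eta>) = ft w (\<xi> - \<eta>) * ft k \<eta>" for \<eta>
  unfolding \<theta>_def ftW[symmetric] by (rule conv_pairing(3)[OF k _ Mf(2) W]) simp
 have [measurable]: "\<theta> \<in> bm" using \<theta> by auto
 have u: "ft (%x. conv k f x * w x) \<xi> = (BI s. f s * \<theta> s)"
  unfolding ft_W \<theta>_def by (rule conv_pairing(1)[OF k _ Mf(2) W]) simp
 have near: "ft \<kappa> (\<eta> $ i) ~= 0 \<and> \<bar>\<xi> $ i - \<eta> $ i\<bar> < \<delta>" if "ft \<theta> (- \<eta>) ~= 0" for \<eta> i
 proof -
  have "ft w (\<xi> - \<eta>) ~= 0" "ft k \<eta> ~= 0" using that unfolding ft\<theta> by auto
  then show ?thesis using ft_window_eq_0[OF \<delta>(1), of "\<xi> - \<eta>" i] unfolding w_def[abs_def] ftk by fastforce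
 qed
 have wi: "integrable lborel (ft w)" unfolding w_def[abs_def] by (rule integrable_ft_window[OF \<delta>(1)])
 have ift: "integrable lborel (ft \<theta>)"
 proof -
  have "ft \<theta> = (%\<zeta>. ft k (- \<zeta>) * ft w (\<zeta> + \<xi>))"
  proof
   fix \<zeta> show "ft \<theta> \<zeta> = ft k (- \<zeta>) * ft w (\<zeta> + \<xi>)" using ft\<theta>[of "- \<zeta>"] by (simp add: add.commute mult.commute)
  qed
  moreover have "integrable lborel (%\<zeta>. ft k (- \<zeta>) * ft w (\<zeta> + \<xi>))"
   by (rule integrable_mult_bounded[OF integrable_translate(1)[OF wi] _ norm_ft_le]) measurable
  ultimately show ?thesis by simp
 qed
 have inv: "AE t in lborel. ft (%\<eta>. ft \<theta> (- \<eta>)) t = \<theta> t"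
  using fourier_inversion[OF \<theta> ift] by eventually_elim (simp add: ft_reflect)
 show "\<exists>\<eta>. (\<forall>i. ft \<kappa> (\<eta> $ i) ~= 0 \<and> \<bar>\<xi> $ i - \<eta> $ i\<bar> < \<delta>)" if nz: "ft (%x. conv (pk \<kappa>) f x * cof (window \<delta> x)) \<xi> ~= 0"
 proof (rule ccontr)
  assume "\<not> ?thesis"
  then have "ft \<theta> (- \<eta>) = 0" for \<eta> using near by blast
  from this[of "- \<eta>" for \<eta>] have "ft \<theta> \<eta> = 0" for \<eta> by simp
  then have "AE s in lborel. \<theta> s = 0" by (rule ft_zero_imp_AE_zero[OF \<theta>])
  then have "AE s in lborel. f s * \<theta> s = 0" by eventually_elim simp
  then have "(BI s. f s * \<theta> s) = 0" by (subst integral_cong_AE[where g="%_. 0"]) auto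
  then show False using nz u by (simp add: k_def w_def)
 qed
 show "ft (%x. conv (pk \<kappa>) (conv (ker R) f) x * cof (window \<delta> x)) \<xi> =
   indicator R \<xi> * ft (%x. conv (pk \<kappa>) f x * cof (window \<delta> x)) \<xi>" if R: "R \<in> dyadic_boxes"
 proof -
  obtain I where I: "R = cbx I" "\<forall>i. short_interval (I i)" and [measurable]: "R \<in> sets borel" and Rfin: "emeasure lborel R < top"
   by (rule dyadic_box_cases[OF R])
  obtain MR where MR: "0 <= MR" "conv_bounded (ker R) f MR" unfolding I(1) by (rule conv_bounded_ker_cbx[OF p _ f I(2)[rule_format]]) auto
  have [measurable]: "conv (ker R) f \<in> bm" by measurable
  obtain M' where M': "0 <= M'" "conv_bounded k (conv (ker R) f) M'"
   by (rule conv_bounded_L1_sup[OF k conv_boundedD[OF MR(2,1)]])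
  have "ft (%x. conv k (conv (ker R) f) x * w x) \<xi> = (BI s. conv (ker R) f s * \<theta> s)"
   unfolding ft_W \<theta>_def by (rule conv_pairing(1)[OF k _ M'(2) W]) simp
  also have "... = (BI t. f t * ft (%\<eta>. indicator R \<eta> * ft \<theta> (- \<eta>)) t)"
   by (rule conv_ker_pairing[OF _ Rfin _ MR(2) \<theta>]) measurable
  \<comment> \<open>Here the gap enters: every \<open>\<eta>\<close> contributing to
    \<open>\<theta>\<close> lies in the same box as \<open>\<xi>\<close>, so the indicator is
    constant on the spectrum of \<open>\<theta>\<close> and can be taken out.\<close>
  also have "(%\<eta>. indicator R \<eta> * ft \<theta> (- \<eta>)) = (%\<eta>. indicator R \<xi> * ft \<theta> (- \<eta>))"
  proof
   fix \<eta>
   show "indicator R \<eta> * ft \<theta> (- \<eta>) = indicator R \<xi> * ft \<theta> (- \<eta>)"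
   proof (cases "ft \<theta> (- \<eta>) = 0")
    case False
    have "\<xi> \<in> bx \<eta>" unfolding mem_bx
    proof
     fix i show "\<xi> $ i \<in> dint (\<eta> $ i)" using near[OF False, of i] \<delta>(2) by (intro gap) auto
    qed
    then have "bx \<xi> = bx \<eta>" by (simp add: bx_eq_iff)
    then show ?thesis using mem_dyadic_box[OF R, of \<xi>] mem_dyadic_box[OF R, of \<eta>] by (simp add: indicator_def)
   qed simp
  qed
  also have "(BI t. f t * ft (%\<eta>. indicator R \<xi> * ft \<theta> (- \<eta>)) t) = indicator R \<xi> * (BI t. f t * ft (%\<eta>. ft \<theta> (- \<eta>)) t)"
   by (simp add: ft_def[of "%\<eta>. indicator R \<xi> * ft \<theta> (- \<eta>)"] ft_def[of "%\<eta>. ft \<theta> (- \<eta>)"] mult.assoc mult.left_commute[of _ "indicator R \<xi>"])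
  also have "(BI t. f t * ft (%\<eta>. ft \<theta> (- \<eta>)) t) = (BI t. f t * \<theta> t)"
   by (rule integral_cong_AE) (measurable, use inv in eventually_elim, simp)
  finally show ?thesis using u by (simp add: k_def w_def)
 qed
qed

text \<open>The kernel bounds the convolutions and the window adds decay like \<open>wt\<close>,
  while the gap confines the spectrum to the finitely many boxes in \<open>F\<close>. These are the
  conditions for \<open>transfer_period\<close>. The order of quantifiers matters: \<open>m\<close>
  tends to infinity for fixed \<open>\<delta>\<close>.\<close>

lemma window_transfer:
 fixes f :: "real^'n::finite => complex" and \<kappa> :: "real => complex"
 assumes p: "1 < p" and [measurable]: "f \<in> bm" and f: "pint p lborel f < top"
  and \<kappa>: "admissible \<kappa>"
 obtains \<gamma> where "0 < \<gamma>" "!!\<delta>. 0 < \<delta> ==> \<delta> <= \<gamma> ==> \<exists>F.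
  (\<forall>m. F m \<in> borel_measurable torus) \<and> eventually (%m. pint p torus (F m :: real^'n => complex) < top) sequentially \<and>
  (%m. ennreal ((2 ^ m) ^ CARD('n)) * pint p torus (F m)) \<longlonglongrightarrow> pint p lborel (%x. conv (pk \<kappa>) f x * cof (window \<delta> x)) \<and>
  (%m. ennreal ((2 ^ m) ^ CARD('n)) * sqT p (F m)) \<longlonglongrightarrow>
   (NI x. l2n dyadic_boxes (%R. conv (pk \<kappa>) (conv (ker R) f) x * cof (window \<delta> x)) epowr p)"
proof -
 obtain B0 \<gamma> B1 where \<kappa>i: "integrable lborel \<kappa>" and B0: "!!t. norm (\<kappa> t) <= B0" and \<gamma>: "0 < \<gamma>" "\<gamma> <= 1"
  and gap: "!!\<xi> \<eta>. ft \<kappa> \<xi> ~= 0 ==> \<bar>\<eta> - \<xi>\<bar> < \<gamma> ==> \<eta> \<in> dint \<xi>"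
  and B1: "!!\<xi>. ft \<kappa> \<xi> ~= 0 ==> \<bar>\<xi>\<bar> <= B1 \<and> \<xi> ~= 0" and fin: "finite (dint ` {\<xi>. ft \<kappa> \<xi> ~= 0})"
  using \<kappa> unfolding admissible_def by blast
 define k where "k = (pk \<kappa> :: real^'n => complex)"
 have k: "integrable lborel k" unfolding k_def by (rule integrable_pk) fact
 have kb: "norm (k x) <= B0 ^ CARD('n)" for x unfolding k_def by (rule norm_pk_le) fact
 have [measurable]: "k \<in> bm" using k by auto
 define F where "F = bx ` {\<eta> :: real^'n. \<forall>i. ft \<kappa> (\<eta> $ i) ~= 0}"
 have "F \<subseteq> cbx ` PiE UNIV (%_. dint ` {\<xi>. ft \<kappa> \<xi> ~= 0})"
  unfolding F_def bx_def by auto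
 then have Ffin: "finite F" by (rule finite_subset) (intro finite_imageI finite_PiE fin; simp)
 have FD: "F \<subseteq> dyadic_boxes" unfolding F_def dyadic_boxes_eq using B1 by auto
 obtain Mf where Mf: "0 <= Mf" "conv_bounded k f Mf" by (rule conv_bounded_L1_bounded[OF p k kb _ f]) auto
 have "\<exists>M. 0 <= M \<and> conv_bounded k (conv (ker R) f) M" if R: "R \<in> dyadic_boxes" for R
 proof -
  obtain I where I: "R = cbx I" "\<forall>i. short_interval (I i)" "R \<in> sets borel" "emeasure lborel R < top" by (rule dyadic_box_cases[OF R])
  obtain MR where MR: "0 <= MR" "conv_bounded (ker R) f MR" unfolding I(1) by (rule conv_bounded_ker_cbx[OF p _ f I(2)[rule_format]]) auto
  have gb: "norm (conv (ker R) f x) <= MR" for x by (rule conv_boundedD[OF MR(2,1)])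
  obtain M where "0 <= M" "conv_bounded k (conv (ker R) f) M" by (rule conv_bounded_L1_sup[OF k gb])
  then show ?thesis by blast
 qed
 then obtain MR where MR: "!!R. R \<in> dyadic_boxes ==> 0 <= MR R" "!!R. R \<in> dyadic_boxes ==> conv_bounded k (conv (ker R) f) (MR R)" by metis
 show ?thesis
 proof (rule that[OF \<gamma>(1)])
  fix \<delta> :: real assume \<delta>: "0 < \<delta>" "\<delta> <= \<gamma>"
  have \<delta>1: "\<delta> <= 1" using \<delta> \<gamma> by simp
  define u where "u x = conv k f x * cof (window \<delta> x)" for x
  define v where "v R x = conv k (conv (ker R) f) x * cof (window \<delta> x)" for R x
  have [measurable]: "u \<in> bm" unfolding u_def[abs_def] by measurable
  have vm: "v R \<in> bm" if R: "R \<in> dyadic_boxes" for R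
  proof -
   have [measurable]: "R \<in> sets borel" by (rule dyadic_box_cases[OF R])
   show ?thesis unfolding v_def[abs_def] by measurable
  qed
  define w0 where "w0 = (2 / \<delta>\<^sup>2) ^ CARD('n)"
  have w0: "0 <= w0" by (simp add: w0_def)
  have wb: "norm (h x * cof (window \<delta> x)) <= M * w0 * wt x" if "norm (h x) <= M" "0 <= M" for h M and x :: "real^'n"
  proof -
   have "norm (h x * cof (window \<delta> x)) = norm (h x) * window \<delta> x" by (simp add: norm_mult)
   also have "... <= M * (w0 * wt x)" unfolding w0_def using that \<delta> \<delta>1 by (intro mult_mono window_le_wt) auto
   finally show ?thesis by (simp add: mult.assoc)
  qed
  \<comment> \<open>One constant for \<open>u\<close> and for the finitely many pieces, as the limit
    theorem asks for a common majorant.\<close>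
  define C where "C = (Mf + (\<Sum>R\<in>F. MR R)) * w0"
  have S0: "0 <= (\<Sum>R\<in>F. MR R)" using MR(1) FD by (intro sum_nonneg) auto
  have C0: "0 <= C" unfolding C_def using Mf S0 w0 by simp
  have ub: "norm (u x) <= C * wt x" for x
  proof -
   have "norm (u x) <= Mf * w0 * wt x" unfolding u_def by (rule wb[OF conv_boundedD[OF Mf(2,1)] Mf(1)])
   also have "... <= C * wt x" unfolding C_def using S0 w0 by (intro mult_right_mono) (auto simp: wt_pos less_imp_le)
   finally show ?thesis .
  qed
  have vb0: "norm (v R x) <= MR R * w0 * wt x" if "R \<in> dyadic_boxes" for R x
   unfolding v_def by (rule wb[OF conv_boundedD[OF MR(2,1)[OF that]] MR(1)[OF that]])
  have vb: "norm (v R x) <= C * wt x" if R: "R \<in> F" for R x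
  proof -
   have "MR R <= (\<Sum>R\<in>F. MR R)" using R FD MR(1) Ffin by (intro member_le_sum) auto
   then have "MR R * w0 * wt x <= C * wt x" unfolding C_def using Mf(1) w0 by (intro mult_right_mono) (auto simp: wt_pos less_imp_le)
   then show ?thesis using vb0[of R x] R FD by (auto intro: order_trans)
  qed
  note sp = windowed_spectrum[OF p _ f \<kappa>i B0 gap \<delta> \<delta>1, simplified, folded k_def]
  have spec: "ft (v R) \<xi> = indicator R \<xi> * ft u \<xi>" if "R \<in> dyadic_boxes" for R \<xi>
   unfolding v_def[abs_def] u_def[abs_def] by (rule sp(1)[OF that])
  have supp: "\<exists>\<eta>. bx \<xi> = bx \<eta> \<and> (\<forall>i. ft \<kappa> (\<eta> $ i) ~= 0 \<and> \<bar>\<xi> $ i - \<eta> $ i\<bar> < \<delta>)" if nz0: "ft u \<xi> ~= 0" for \<xi>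
  proof -
   obtain \<eta> where \<eta>: "!!i. ft \<kappa> (\<eta> $ i) ~= 0 \<and> \<bar>\<xi> $ i - \<eta> $ i\<bar> < \<delta>" using sp(2)[of \<xi>] nz0 unfolding u_def[abs_def] by blast
   have "\<xi> \<in> bx \<eta>" unfolding mem_bx
   proof
    fix i show "\<xi> $ i \<in> dint (\<eta> $ i)" using \<eta>[of i] \<delta>(2) by (intro gap) auto
   qed
   then show ?thesis using \<eta> by (auto simp: bx_eq_iff)
  qed
  have supp1: "\<xi> $ i ~= 0 \<and> \<bar>\<xi> $ i\<bar> <= B1 + 1" if nz: "ft u \<xi> ~= 0" for \<xi> i
  proof -
   obtain \<eta> where \<eta>: "\<xi> \<in> bx \<eta>" "!!i. ft \<kappa> (\<eta> $ i) ~= 0 \<and> \<bar>\<xi> $ i - \<eta> $ i\<bar> < \<delta>" using supp[OF nz] by (auto simp: bx_eq_iff)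
   have "\<xi> $ i \<in> dint (\<eta> $ i)" using \<eta>(1) by (simp add: mem_bx)
   then show ?thesis using dint_nonzero[of "\<xi> $ i" "\<eta> $ i"] B1[of "\<eta> $ i"] \<eta>(2)[of i] \<delta>1 by auto
  qed
  have supp2: "bx \<xi> \<in> F" if "ft u \<xi> ~= 0" for \<xi> using supp[OF that] by (auto simp: F_def)
  \<comment> \<open>Pieces for boxes outside \<open>F\<close> have vanishing transform and so are
    zero almost everywhere; this reduces the full square function to the finite family
    \<open>F\<close>.\<close>
  have "AE x in lborel. \<forall>R\<in>dyadic_boxes. R \<notin> F \<longrightarrow> v R x = 0"
   unfolding AE_ball_countable[OF countable_dyadic_boxes]
  proof
   fix R :: "(real^'n) set" assume R: "R \<in> dyadic_boxes"
   show "AE x in lborel. R \<notin> F \<longrightarrow> v R x = 0"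
   proof (cases "R \<in> F")
    case False
    have "ft (v R) \<xi> = 0" for \<xi>
     using spec[OF R, of \<xi>] supp2[of \<xi>] mem_dyadic_box[OF R, of \<xi>] False by (cases "ft u \<xi> = 0") (auto simp: indicator_def)
    moreover have "integrable lborel (v R)"
     by (rule Bochner_Integration.integrable_bound[OF integrable_mult_right[OF integrable_wt, of "MR R * w0"]])
      (use vm[OF R] vb0[OF R] MR(1)[OF R] w0 in \<open>auto simp: abs_mult\<close>)
    ultimately have "AE x in lborel. v R x = 0" by (intro ft_zero_imp_AE_zero)
    then show ?thesis by eventually_elim simp
   qed simp
  qed
  then have "AE x in lborel. l2n dyadic_boxes (%R. v R x) epowr p = ennreal (L2_set (%R. norm (v R x)) F) epowr p"
   by eventually_elim (subst l2n_finite_support[OF Ffin FD], auto)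
  then have l2: "(NI x. l2n dyadic_boxes (%R. v R x) epowr p) = (NI x. ennreal (L2_set (%R. norm (v R x)) F) epowr p)"
   by (rule nn_integral_cong_AE)
  have vmF: "v R \<in> bm" and specF: "ft (v R) \<xi> = indicator R \<xi> * ft u \<xi>" if "R \<in> F" for R \<xi>
   using vm spec FD that by auto
  have p1: "1 <= p" using p by simp
  have um: "u \<in> bm" by measurable
  have tp1: "(%m. ennreal ((2 ^ m) ^ CARD('n)) * pint p torus (per (2 ^ m) u)) \<longlonglongrightarrow> pint p lborel u"
   by (rule transfer_period(1)[where v=v and F=F and u=u and C=C and B="B1 + 1"]) (fact p1 Ffin FD C0 um ub vmF vb specF supp1 supp2)+
  have tp2: "(%m. ennreal ((2 ^ m) ^ CARD('n)) * sqT p (per (2 ^ m) u)) \<longlonglongrightarrow> (NI x. ennreal (L2_set (%R. norm (v R x)) F) epowr p)"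
   by (rule transfer_period(2)[where v=v and F=F and u=u and C=C and B="B1 + 1"]) (fact p1 Ffin FD C0 um ub vmF vb specF supp1 supp2)+
  have "pint p lborel u < top"
  proof -
   have "pint p lborel u <= (NI (x::real^'n). ennreal (C powr p) * ennreal (wt x))"
    unfolding pint_def
   proof (rule nn_integral_mono)
    fix x
    have "norm (u x) powr p <= (C * wt x) powr p" using ub p by (intro powr_mono2) auto
    also have "... = C powr p * wt x powr p" using C0 wt_pos[of x] by (simp add: powr_mult)
    also have "... <= C powr p * wt x" using powr_mono'[of 1 p "wt x"] p wt_pos[of x] wt_le_1[of x] by (intro mult_left_mono) auto
    finally show "enorm (u x) epowr p <= ennreal (C powr p) * ennreal (wt x)" by (simp add: ennreal_mult'[symmetric] ennreal_leI)
   qed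
   also have "... < top" using integrable_wt[where 'a="real^'n"] by (subst nn_integral_cmult) (auto simp: ennreal_mult_less_top integrable_iff_bounded)
   finally show ?thesis .
  qed
  with tp1 have "eventually (%m. ennreal ((2 ^ m) ^ CARD('n)) * pint p torus (per (2 ^ m) u) < top) sequentially"
   by (rule order_tendstoD(2))
  then have ev: "eventually (%m. pint p torus (per (2 ^ m) u) < top) sequentially"
  proof eventually_elim
   case (elim m)
   have "\<not> ((2::real) ^ m) ^ CARD('n) <= 0" by (simp add: not_le)
   then show ?case using elim by (auto simp: ennreal_mult_less_top ennreal_eq_0_iff)
  qed
  show "\<exists>F. (\<forall>m. F m \<in> borel_measurable torus) \<and> eventually (%m. pint p torus (F m :: real^'n => complex) < top) sequentially \<and>
   (%m. ennreal ((2 ^ m) ^ CARD('n)) * pint p torus (F m)) \<longlonglongrightarrow> pint p lborel (%x. conv (pk \<kappa>) f x * cof (window \<delta> x)) \<and>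
   (%m. ennreal ((2 ^ m) ^ CARD('n)) * sqT p (F m)) \<longlonglongrightarrow>
    (NI x. l2n dyadic_boxes (%R. conv (pk \<kappa>) (conv (ker R) f) x * cof (window \<delta> x)) epowr p)"
   unfolding k_def[symmetric] u_def[symmetric] v_def[symmetric] l2
   by (intro exI[of _ "%m. per (2 ^ m) u"] conjI allI ev tp1 tp2 borel_imp_torus measurable_per um)
 qed
qed

section \<open>Removing the window\<close>

lemma tendsto_0_le_ennreal:
 fixes f g :: "nat => ennreal"
 assumes le: "!!n. f n <= g n" and g: "g \<longlonglongrightarrow> 0"
 shows "f \<longlonglongrightarrow> 0"
proof (rule tendsto_sandwich[OF _ _ tendsto_const g])
 show "\<forall>\<^sub>F n in sequentially. f n <= g n" by (rule always_eventually[OF allI[OF le]])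
qed simp

lemma conv_ker_measurable:
 assumes "R \<in> dyadic_boxes" "f \<in> bm"
 shows "conv (ker R) f \<in> borel_measurable (borel :: (real^'n::finite) measure)"
proof -
 have [measurable]: "R \<in> sets borel" by (rule dyadic_box_cases[OF assms(1)])
 show ?thesis using assms(2) by measurable
qed

lemma conv_conv_ker_measurable:
 assumes "R \<in> dyadic_boxes" "f \<in> bm" "k \<in> bm"
 shows "conv k (conv (ker R) f) \<in> borel_measurable (borel :: (real^'n::finite) measure)"
 by (intro measurable_conv conv_ker_measurable assms)

lemma scaled_limit_le:
 fixes A B :: "nat => ennreal" and D :: real
 assumes "A \<longlonglongrightarrow> a" "B \<longlonglongrightarrow> b"
 shows "eventually (%n. A n <= ennreal D * B n) sequentially ==> a <= ennreal D * b"
  "eventually (%n. ennreal D * B n <= A n) sequentially ==> ennreal D * b <= a"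
proof -
 have l: "(%n. ennreal D * B n) \<longlonglongrightarrow> ennreal D * b" by (intro ennreal_tendsto_cmult assms) simp
 show "eventually (%n. A n <= ennreal D * B n) sequentially ==> a <= ennreal D * b"
  by (rule tendsto_le[OF sequentially_bot l assms(1)])
 show "eventually (%n. ennreal D * B n <= A n) sequentially ==> ennreal D * b <= a"
  by (rule tendsto_le[OF sequentially_bot assms(1) l])
qed

lemma pint_window_le: "pint p lborel (%x. h x * cof (window \<delta> x)) <= pint p lborel h" if "0 <= p"
 unfolding pint_def
proof (intro nn_integral_mono epowr_mono that ennreal_leI)
 fix x
 show "norm (h x * cof (window \<delta> x)) <= norm (h x)"
  using mult_left_mono[OF window_le_1, of "norm (h x)" \<delta> x] by (simp add: norm_mult)
qed

lemma shrink_tendsto_0: "(%n. \<gamma> / real (Suc n)) \<longlonglongrightarrow> 0"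
 by (rule LIMSEQ_Suc[OF lim_const_over_n])

text \<open>As the window widens, Fatou's lemma recovers the square function from below, while on
  the side of the norm the window is simply dropped because it is at most 1.\<close>

lemma admissible_upper:
 fixes f :: "real^'n::finite => complex"
 assumes p: "1 < p" and [measurable]: "f \<in> bm" and f: "pint p lborel f < top" and \<kappa>: "admissible \<kappa>"
  and T: "!!F :: real^'n => complex. F \<in> borel_measurable torus ==> pint p torus F < top ==> sqT p F <= ennreal D * pint p torus F"
 shows "(NI x. l2n dyadic_boxes (%R. conv (pk \<kappa>) (conv (ker R) f) x) epowr p) <= ennreal D * pint p lborel (conv (pk \<kappa>) f)"
proof -
 have \<kappa>m: "\<kappa> \<in> bm" using \<kappa> by (auto simp: admissible_def)
 have km: "(pk \<kappa> :: real^'n => complex) \<in> bm" by (rule measurable_pk[OF \<kappa>m])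
 obtain \<gamma> where \<gamma>: "0 < \<gamma>" and tr: "!!\<delta>. 0 < \<delta> ==> \<delta> <= \<gamma> ==> \<exists>F.
  (\<forall>m. F m \<in> borel_measurable torus) \<and> eventually (%m. pint p torus (F m :: real^'n => complex) < top) sequentially \<and>
  (%m. ennreal ((2 ^ m) ^ CARD('n)) * pint p torus (F m)) \<longlonglongrightarrow> pint p lborel (%x. conv (pk \<kappa>) f x * cof (window \<delta> x)) \<and>
  (%m. ennreal ((2 ^ m) ^ CARD('n)) * sqT p (F m)) \<longlonglongrightarrow>
   (NI x. l2n dyadic_boxes (%R. conv (pk \<kappa>) (conv (ker R) f) x * cof (window \<delta> x)) epowr p)"
  by (rule window_transfer[OF p _ f \<kappa>]) auto
 define \<delta> where "\<delta> n = \<gamma> / real (Suc n)" for n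
 have \<delta>: "0 < \<delta> n" "\<delta> n <= \<gamma>" for n using \<gamma> by (auto simp: \<delta>_def divide_le_eq algebra_simps)
 have \<delta>0: "\<delta> \<longlonglongrightarrow> 0" unfolding \<delta>_def[abs_def] by (rule shrink_tendsto_0)
 define c where "c R = conv (pk \<kappa>) (conv (ker R) f)" for R
 have cm: "c R \<in> bm" if "R \<in> dyadic_boxes" for R unfolding c_def by (rule conv_conv_ker_measurable[OF that _ km]) simp
 have "(NI x. l2n dyadic_boxes (%R. c R x) epowr p) <= liminf (%n. (NI x. l2n dyadic_boxes (%R. c R x * cof (window (\<delta> n) x)) epowr p))"
 proof (rule fatou_epowr)
  show "0 < p" using p by simp
  show "(%x. l2n dyadic_boxes (%R. c R x * cof (window (\<delta> n) x))) \<in> borel_measurable lborel" for n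
  proof (rule measurable_l2n[OF countable_dyadic_boxes])
   fix R :: "(real^'n) set" assume "R \<in> dyadic_boxes"
   then have [measurable]: "c R \<in> bm" by (rule cm)
   show "(%x. c R x * cof (window (\<delta> n) x)) \<in> borel_measurable lborel" by measurable
  qed
  show "AE x in lborel. l2n dyadic_boxes (%R. c R x) <= liminf (%n. l2n dyadic_boxes (%R. c R x * cof (window (\<delta> n) x)))"
  proof (intro AE_I2 l2n_liminf)
   fix x R
   have "(%n. c R x * cof (window (\<delta> n) x)) \<longlonglongrightarrow> c R x * cof 1"
    by (intro tendsto_mult tendsto_const tendsto_of_real window_tendsto_1 \<delta>0)
   then show "(%n. c R x * cof (window (\<delta> n) x)) \<longlonglongrightarrow> c R x" by simp
  qed
 qed
 also have "... <= liminf (%n. ennreal D * pint p lborel (conv (pk \<kappa>) f))"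
 proof (intro Liminf_mono always_eventually allI)
  fix n
  obtain F where F: "!!m. F m \<in> borel_measurable torus" "eventually (%m. pint p torus (F m :: real^'n => complex) < top) sequentially"
   "(%m. ennreal ((2 ^ m) ^ CARD('n)) * pint p torus (F m)) \<longlonglongrightarrow> pint p lborel (%x. conv (pk \<kappa>) f x * cof (window (\<delta> n) x))"
   "(%m. ennreal ((2 ^ m) ^ CARD('n)) * sqT p (F m)) \<longlonglongrightarrow>
    (NI x. l2n dyadic_boxes (%R. c R x * cof (window (\<delta> n) x)) epowr p)"
   using tr[OF \<delta>[of n]] unfolding c_def by blast
  have "(NI x. l2n dyadic_boxes (%R. c R x * cof (window (\<delta> n) x)) epowr p) <= ennreal D * pint p lborel (%x. conv (pk \<kappa>) f x * cof (window (\<delta> n) x))"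
  proof (rule scaled_limit_le(1)[OF F(4,3)])
   show "\<forall>\<^sub>F m in sequentially. ennreal ((2 ^ m) ^ CARD('n)) * sqT p (F m) <= ennreal D * (ennreal ((2 ^ m) ^ CARD('n)) * pint p torus (F m))"
    using F(2) by eventually_elim (subst mult.left_commute, intro mult_left_mono T F, auto)
  qed
  also have "... <= ennreal D * pint p lborel (conv (pk \<kappa>) f)" using p by (intro mult_left_mono pint_window_le) auto
  finally show "(NI x. l2n dyadic_boxes (%R. c R x * cof (window (\<delta> n) x)) epowr p) <= ennreal D * pint p lborel (conv (pk \<kappa>) f)" .
 qed
 finally show ?thesis by (simp add: Liminf_const c_def)
qed

text \<open>Now Fatou's lemma recovers the norm, and the window is dropped from the square function,
  where it only decreases every piece.\<close>

lemma admissible_lower: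
 fixes f :: "real^'n::finite => complex"
 assumes p: "1 < p" and [measurable]: "f \<in> bm" and f: "pint p lborel f < top" and \<kappa>: "admissible \<kappa>"
  and T: "!!F :: real^'n => complex. F \<in> borel_measurable torus ==> pint p torus F < top ==> ennreal D * pint p torus F <= sqT p F"
 shows "ennreal D * pint p lborel (conv (pk \<kappa>) f) <= (NI x. l2n dyadic_boxes (%R. conv (pk \<kappa>) (conv (ker R) f) x) epowr p)"
proof -
 have \<kappa>m: "\<kappa> \<in> bm" using \<kappa> by (auto simp: admissible_def)
 have km [measurable]: "(pk \<kappa> :: real^'n => complex) \<in> bm" by (rule measurable_pk[OF \<kappa>m])
 obtain \<gamma> where \<gamma>: "0 < \<gamma>" and tr: "!!\<delta>. 0 < \<delta> ==> \<delta> <= \<gamma> ==> \<exists>F.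
  (\<forall>m. F m \<in> borel_measurable torus) \<and> eventually (%m. pint p torus (F m :: real^'n => complex) < top) sequentially \<and>
  (%m. ennreal ((2 ^ m) ^ CARD('n)) * pint p torus (F m)) \<longlonglongrightarrow> pint p lborel (%x. conv (pk \<kappa>) f x * cof (window \<delta> x)) \<and>
  (%m. ennreal ((2 ^ m) ^ CARD('n)) * sqT p (F m)) \<longlonglongrightarrow>
   (NI x. l2n dyadic_boxes (%R. conv (pk \<kappa>) (conv (ker R) f) x * cof (window \<delta> x)) epowr p)"
  by (rule window_transfer[OF p _ f \<kappa>]) auto
 define \<delta> where "\<delta> n = \<gamma> / real (Suc n)" for n
 have \<delta>: "0 < \<delta> n" "\<delta> n <= \<gamma>" for n using \<gamma> by (auto simp: \<delta>_def divide_le_eq algebra_simps)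
 have \<delta>0: "\<delta> \<longlonglongrightarrow> 0" unfolding \<delta>_def[abs_def] by (rule shrink_tendsto_0)
 define c where "c R = conv (pk \<kappa>) (conv (ker R) f)" for R
 define h where "h = conv (pk \<kappa>) f"
 have [measurable]: "h \<in> bm" unfolding h_def by measurable
 have "pint p lborel h <= liminf (%n. pint p lborel (%x. h x * cof (window (\<delta> n) x)))"
  unfolding pint_def
 proof (rule fatou_epowr)
  show "0 < p" using p by simp
  show "AE x in lborel. enorm (h x) <= liminf (%n. enorm (h x * cof (window (\<delta> n) x)))"
  proof (intro AE_I2)
   fix x
   have "(%n. h x * cof (window (\<delta> n) x)) \<longlonglongrightarrow> h x * cof 1"
    by (intro tendsto_mult tendsto_const tendsto_of_real window_tendsto_1 \<delta>0)
   then show "enorm (h x) <= liminf (%n. enorm (h x * cof (window (\<delta> n) x)))" by (simp only: liminf_norm) simp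
  qed
 qed measurable
 then have "ennreal D * pint p lborel h <= ennreal D * liminf (%n. pint p lborel (%x. h x * cof (window (\<delta> n) x)))"
  by (rule mult_left_mono) simp
 also have "... = liminf (%n. ennreal D * pint p lborel (%x. h x * cof (window (\<delta> n) x)))"
  by (rule Limsup_cmult_ennreal(2)[symmetric])
 also have "... <= liminf (%n. (NI x. l2n dyadic_boxes (%R. c R x) epowr p))"
 proof (intro Liminf_mono always_eventually allI)
  fix n
  obtain F where F: "!!m. F m \<in> borel_measurable torus" "eventually (%m. pint p torus (F m :: real^'n => complex) < top) sequentially"
   "(%m. ennreal ((2 ^ m) ^ CARD('n)) * pint p torus (F m)) \<longlonglongrightarrow> pint p lborel (%x. h x * cof (window (\<delta> n) x))"
   "(%m. ennreal ((2 ^ m) ^ CARD('n)) * sqT p (F m)) \<longlonglongrightarrow>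
    (NI x. l2n dyadic_boxes (%R. c R x * cof (window (\<delta> n) x)) epowr p)"
   using tr[OF \<delta>[of n]] unfolding c_def h_def by blast
  have "ennreal D * pint p lborel (%x. h x * cof (window (\<delta> n) x)) <= (NI x. l2n dyadic_boxes (%R. c R x * cof (window (\<delta> n) x)) epowr p)"
  proof (rule scaled_limit_le(2)[OF F(4,3)])
   show "\<forall>\<^sub>F m in sequentially. ennreal D * (ennreal ((2 ^ m) ^ CARD('n)) * pint p torus (F m)) <= ennreal ((2 ^ m) ^ CARD('n)) * sqT p (F m)"
    using F(2) by eventually_elim (subst mult.left_commute, intro mult_left_mono T F, auto)
  qed
  also have "... <= (NI x. l2n dyadic_boxes (%R. c R x) epowr p)"
  proof (intro nn_integral_mono epowr_mono l2n_mono)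
   fix x R
   show "norm (c R x * cof (window (\<delta> n) x)) <= norm (c R x)"
    using mult_left_mono[OF window_le_1, of "norm (c R x)" "\<delta> n" x] by (simp add: norm_mult)
  qed (use p in simp)
  finally show "ennreal D * pint p lborel (%x. h x * cof (window (\<delta> n) x)) <= (NI x. l2n dyadic_boxes (%R. c R x) epowr p)" .
 qed
 finally show ?thesis by (simp add: Liminf_const c_def h_def)
qed

section \<open>Removing the notched kernel\<close>

lemma admissible_exists:
 fixes U :: "real^'n::finite => ennreal"
 assumes p: "1 < p" and Um: "U \<in> bm" and U: "(NI x. U x epowr p) < top"
 obtains \<kappa> :: "nat => real => complex" where "\<forall>n. admissible (\<kappa> n)" "(%n. kerr p U (\<kappa> n) (\<kappa>0 (real (Suc n)))) \<longlonglongrightarrow> 0"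
proof -
 \<comment> \<open>The bandwidth grows and the notching error shrinks with the same
   \<open>n\<close>. The widths of the notches depend on \<open>U\<close>, so the kernels are chosen
   for a given \<open>U\<close>.\<close>
 have "\<exists>\<kappa>. admissible \<kappa> \<and> kerr p U \<kappa> (\<kappa>0 (real (Suc n))) <= ennreal (1 / real (Suc n))" for n
 proof -
  obtain \<kappa> \<gamma> M where k: "0 < \<gamma>" "\<gamma> <= 1" "integrable lborel \<kappa>" "!!t. norm (\<kappa> t) <= M"
   "!!\<xi> \<eta>. ft \<kappa> \<xi> ~= 0 ==> \<bar>\<eta> - \<xi>\<bar> < \<gamma> ==> \<eta> \<in> dint \<xi>" "!!\<xi>. ft \<kappa> \<xi> ~= 0 ==> \<bar>\<xi>\<bar> <= real (Suc n) \<and> \<xi> ~= 0"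
   "finite (dint ` {\<xi>. ft \<kappa> \<xi> ~= 0})" "kerr p U \<kappa> (\<kappa>0 (real (Suc n))) <= ennreal (1 / real (Suc n))"
   by (rule kernel_exists[OF p Um U, of "real (Suc n)" "1 / real (Suc n)"]) auto
  have "admissible \<kappa>" unfolding admissible_def
   using k(3) k(4) k(1,2) k(5) k(6) k(7) by blast
  then show ?thesis using k(8) by blast
 qed
 then obtain \<kappa> where \<kappa>: "!!n. admissible (\<kappa> n) \<and> kerr p U (\<kappa> n) (\<kappa>0 (real (Suc n))) <= ennreal (1 / real (Suc n))" by metis
 have "(%n. ennreal (1 / real (Suc n))) \<longlonglongrightarrow> ennreal 0" by (intro tendsto_ennrealI shrink_tendsto_0)
 then have lim: "(%n. ennreal (1 / real (Suc n))) \<longlonglongrightarrow> 0" by (simp only: ennreal_0)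
 have "(%n. kerr p U (\<kappa> n) (\<kappa>0 (real (Suc n)))) \<longlonglongrightarrow> 0"
  by (rule tendsto_0_le_ennreal[OF conjunct2[OF \<kappa>] lim])
 then show ?thesis by (rule that[OF allI[OF conjunct1[OF \<kappa>]]])
qed

lemma integrable_\<kappa>0: "0 < N ==> integrable lborel (\<kappa>0 N)"
 unfolding \<kappa>0_def[abs_def] by (rule integrable_fej_scaled)

lemma norm_\<kappa>0_le: "0 < N ==> norm (\<kappa>0 N t) <= N"
 using mult_left_mono[OF fej_le_1, of N "N * t"] by (simp add: \<kappa>0_def norm_mult)

lemma nn_integral_pk_\<kappa>0:
 assumes N: "0 < N" shows "(NI (z::real^'n::finite). enorm (pk (\<kappa>0 N) z)) = 1"
proof -
 have "enorm (pk (\<kappa>0 N) z) = (\<Prod>i\<in>UNIV. ennreal (N * fej (N * z $ i)))" for z :: "real^'n"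
  using N by (simp add: pk_def \<kappa>0_def prod_norm[symmetric] norm_mult prod_ennreal)
 moreover have "(NI (z::real^'n). (\<Prod>i\<in>UNIV. ennreal (N * fej (N * z $ i)))) = (\<Prod>i\<in>(UNIV::'n set). (NI t. ennreal (N * fej (N * t))))"
  by (rule vec_prod_nn_integral) measurable
 ultimately show ?thesis by (simp add: nn_integral_fej_scaled[OF N])
qed

lemma conv_pk_\<kappa>0:
 fixes f :: "real^'n::finite => complex"
 assumes N: "0 < N"
 shows "conv (pk (\<kappa>0 N)) f x = (BI z. cof (window 1 z) * f (x - (1 / N) *\<^sub>R z))"
proof -
 have e: "pk (\<kappa>0 N) ((1 / N) *\<^sub>R z) = cof (N ^ CARD('n)) * cof (window 1 z)" for z :: "real^'n"
  using N by (simp add: pk_def \<kappa>0_def window_def prod.distrib)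
 have "conv (pk (\<kappa>0 N)) f x = (\<bar>1 / N\<bar> ^ DIM(real^'n)) *\<^sub>R (BI z. pk (\<kappa>0 N) (0 + (1 / N) *\<^sub>R z) * f (x - (0 + (1 / N) *\<^sub>R z)))"
  unfolding conv_def using N by (intro integral_affine) auto
 also have "... = (1 / N ^ CARD('n)) *\<^sub>R (cof (N ^ CARD('n)) * (BI z. cof (window 1 z) * f (x - (1 / N) *\<^sub>R z)))"
  using N by (simp only: add_0_left e mult.assoc integral_mult_right_zero) (simp add: power_one_over)
 also have "... = (BI z. cof (window 1 z) * f (x - (1 / N) *\<^sub>R z))"
  using N by (simp add: scaleR_conv_of_real)
 finally show ?thesis .
qed

text \<open>Two errors occur: the distance of the Fejer kernel from the identity, which vanishes for
  every \<open>f\<close> in \<open>L_p\<close>, and the effect of the notches, which is bounded by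
  \<open>kerr\<close> because \<open>f\<close> is dominated by \<open>U\<close>.\<close>

lemma kernel_convergence:
 fixes f :: "real^'n::finite => complex" and U :: "real^'n => ennreal"
 assumes p: "1 < p" and [measurable]: "f \<in> bm" "U \<in> bm" and f: "pint p lborel f < top"
  and fU: "!!x. enorm (f x) <= U x"
  and \<kappa>: "!!n. admissible (\<kappa> n)" and ke: "(%n. kerr p U (\<kappa> n) (\<kappa>0 (real (Suc n)))) \<longlonglongrightarrow> 0"
 shows "(%n. pint p lborel (%x. conv (pk (\<kappa> n)) f x - f x)) \<longlonglongrightarrow> 0"
proof -
 define a where "a n = pint p lborel (%x. conv (pk (\<kappa>0 (real (Suc n)))) f x - f x)" for n
 have a0: "a \<longlonglongrightarrow> 0"
 proof -
  have e: "ennreal (window 1 z) = (\<Prod>i\<in>UNIV. ennreal (fej (z $ i)))" for z :: "real^'n" by (simp add: window_def prod_ennreal)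
  have "(NI (z::real^'n). ennreal (window 1 z)) = (\<Prod>i\<in>(UNIV::'n set). (NI t. ennreal (fej t)))"
   unfolding e by (rule vec_prod_nn_integral) measurable
  then have "(NI (z::real^'n). ennreal (window 1 z)) = 1" by (simp add: integral_fej)
  then show ?thesis
   unfolding a_def conv_pk_\<kappa>0[OF of_nat_0_less_iff[THEN iffD2, OF zero_less_Suc]]
   using p by (intro approximate_identity_Lp f) auto
 qed
 have le: "pint p lborel (%x. conv (pk (\<kappa> n)) f x - f x) <= ennreal (2 powr p) * (a n + kerr p U (\<kappa> n) (\<kappa>0 (real (Suc n))))" for n
 proof -
  define K where "K = (pk (\<kappa> n) :: real^'n => complex)"
  define k where "k = (pk (\<kappa>0 (real (Suc n))) :: real^'n => complex)"
  have N: "0 < real (Suc n)" by simp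
  obtain B where Ki: "integrable lborel (\<kappa> n)" and B: "!!t. norm (\<kappa> n t) <= B" using \<kappa>[of n] unfolding admissible_def by blast
  have K: "integrable lborel K" unfolding K_def by (rule integrable_pk[OF Ki])
  have k: "integrable lborel k" unfolding k_def by (rule integrable_pk[OF integrable_\<kappa>0[OF N]])
  have [measurable]: "K \<in> bm" "k \<in> bm" using K k by auto
  have KB: "norm (K x) <= B ^ CARD('n)" for x unfolding K_def by (rule norm_pk_le[OF B])
  have kB: "norm (k x) <= real (Suc n) ^ CARD('n)" for x unfolding k_def by (rule norm_pk_le[OF norm_\<kappa>0_le[OF N]])
  obtain M1 where M1: "0 <= M1" "conv_bounded K f M1"
   by (rule conv_bounded_L1_bounded[OF p K KB _ f]) auto
  obtain M2 where M2: "0 <= M2" "conv_bounded k f M2"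
   by (rule conv_bounded_L1_bounded[OF p k kB _ f]) auto
  define b where "b x = (NI z. enorm (K z - k z) * U (x - z))" for x
  have [measurable]: "b \<in> bm" unfolding b_def[abs_def] by measurable
  have pt: "enorm (conv K f x - f x) <= enorm (conv k f x - f x) + b x" for x
  proof -
   have "conv K f x - conv k f x = (BI z. (K z - k z) * f (x - z))"
    unfolding conv_def left_diff_distrib
    by (rule Bochner_Integration.integral_diff[symmetric]; rule conv_bounded_integrable[OF M1(2)] conv_bounded_integrable[OF M2(2)]; simp)
   then have "enorm (conv K f x - conv k f x) <= (NI z. enorm (K z - k z) * enorm (f (x - z)))"
    using nn_norm_integral_le[of lborel "%z. (K z - k z) * f (x - z)"] by (simp add: norm_mult ennreal_mult')
   also have "... <= b x" unfolding b_def by (intro nn_integral_mono mult_left_mono fU) simp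
   finally have 1: "enorm (conv K f x - conv k f x) <= b x" .
   have "norm (conv K f x - f x) <= norm (conv k f x - f x) + norm (conv K f x - conv k f x)" by norm
   then have "enorm (conv K f x - f x) <= enorm (conv k f x - f x) + enorm (conv K f x - conv k f x)"
    by (simp add: ennreal_plus[symmetric] ennreal_leI del: ennreal_plus)
   also have "... <= enorm (conv k f x - f x) + b x" by (rule add_left_mono[OF 1])
   finally show ?thesis .
  qed
  have "pint p lborel (%x. conv K f x - f x) <= (NI x. ennreal (2 powr p) * (enorm (conv k f x - f x) epowr p + b x epowr p))"
   unfolding pint_def using p by (intro nn_integral_mono order_trans[OF epowr_mono[OF pt] epowr_add_le2]) auto
  also have "... = ennreal (2 powr p) * (NI x. (enorm (conv k f x - f x) epowr p + b x epowr p))"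
   by (rule nn_integral_cmult) measurable
  also have "(NI x. (enorm (conv k f x - f x) epowr p + b x epowr p)) = a n + kerr p U (\<kappa> n) (\<kappa>0 (real (Suc n)))"
   unfolding a_def pint_def kerr_def K_def[symmetric] k_def[symmetric] b_def[symmetric] by (rule nn_integral_add) measurable
  finally show ?thesis unfolding K_def .
 qed
 have "(%n. ennreal (2 powr p) * (a n + kerr p U (\<kappa> n) (\<kappa>0 (real (Suc n))))) \<longlonglongrightarrow> ennreal (2 powr p) * (0 + 0)"
  by (intro ennreal_tendsto_cmult tendsto_add a0 ke) simp
 then have "(%n. ennreal (2 powr p) * (a n + kerr p U (\<kappa> n) (\<kappa>0 (real (Suc n))))) \<longlonglongrightarrow> 0" by (simp only: add_0_left mult_zero_right)
 then show ?thesis by (rule tendsto_0_le_ennreal[OF le])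
qed

text \<open>Partial sums commute with the smoothing, so that the pieces of the smoothed function can
  be read in two ways: as smoothed pieces of \<open>f\<close>, or as pieces of a function close to
  \<open>f\<close> in \<open>L_p\<close>.\<close>

lemma conv_commute:
 fixes k h f :: "'a::euclidean_space => complex"
 assumes k: "integrable lborel k" and [measurable]: "h \<in> bm" "f \<in> bm" and M: "conv_bounded h f M"
 shows "conv k (conv h f) x = conv h (conv k f) x"
proof -
 have [measurable]: "k \<in> bm" using k by auto
 have fin: "(NI z. (NI y. enorm (k z * (h y * f (x - z - y))))) < top"
 proof -
  have "(NI y. enorm (k z * (h y * f (x - z - y)))) <= enorm (k z) * ennreal M" for z
  proof -
   have "(NI y. enorm (k z * (h y * f (x - z - y)))) = (NI y. enorm (k z) * ennreal (norm (h y) * norm (f (x - z - y))))"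
    by (intro nn_integral_cong) (simp add: norm_mult ennreal_mult')
   also have "... = enorm (k z) * (NI y. ennreal (norm (h y) * norm (f (x - z - y))))" by (rule nn_integral_cmult) measurable
   also have "... <= enorm (k z) * ennreal M" using M by (intro mult_left_mono) (auto simp: conv_bounded_def)
   finally show ?thesis .
  qed
  then have "(NI z. (NI y. enorm (k z * (h y * f (x - z - y))))) <= (NI z. enorm (k z) * ennreal M)"
   by (rule nn_integral_mono)
  also have "... < top" using k by (subst nn_integral_multc) (auto simp: ennreal_mult_less_top integrable_iff_bounded)
  finally show ?thesis .
 qed
 have "conv k (conv h f) x = (BI z. (BI y. k z * (h y * f (x - z - y))))"
  unfolding conv_def by (simp only: integral_mult_right_zero)
 also have "... = (BI y. (BI z. k z * (h y * f (x - z - y))))"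
  by (rule fubini_swap(1)[OF sigma_finite_lborel sigma_finite_lborel _ fin]) measurable
 also have "... = (BI y. (BI z. h y * (k z * f (x - y - z))))"
  by (intro Bochner_Integration.integral_cong refl) (simp add: mult.left_commute diff_diff_eq add.commute)
 also have "... = conv h (conv k f) x" unfolding conv_def by (simp only: integral_mult_right_zero)
 finally show ?thesis .
qed

lemma sqR_conv_ker:
 fixes f :: "real^'n::finite => complex"
 assumes p: "1 < p" and [measurable]: "f \<in> bm" and f: "pint p lborel f < top"
 shows "sqR p f = (NI x. l2n dyadic_boxes (%R. conv (ker R) f x) epowr p)"
  and "R \<in> dyadic_boxes ==> \<exists>M\<ge>0. conv_bounded (ker R) f M"
proof -
 show b: "\<exists>M\<ge>0. conv_bounded (ker R) f M" if R: "R \<in> dyadic_boxes" for R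
 proof -
  obtain I where I: "R = cbx I" "\<forall>i. short_interval (I i)" "R \<in> sets borel" "emeasure lborel R < top" by (rule dyadic_box_cases[OF R])
  obtain MR where MR: "0 <= MR" "conv_bounded (ker R) f MR" unfolding I(1) by (rule conv_bounded_ker_cbx[OF p _ f I(2)[rule_format]]) auto
  then show ?thesis by blast
 qed
 show "sqR p f = (NI x. l2n dyadic_boxes (%R. conv (ker R) f x) epowr p)"
 proof (rule sqR_eq)
  fix R :: "(real^'n) set" assume R: "R \<in> dyadic_boxes"
  obtain I where I: "R = cbx I" "\<forall>i. short_interval (I i)" "R \<in> sets borel" "emeasure lborel R < top" by (rule dyadic_box_cases[OF R])
  obtain M where "0 <= M" "conv_bounded (ker R) f M" using b[OF R] by blast
  then show "fourier_restriction R f (conv (ker R) f)" by (intro fourier_restriction_conv_ker I) auto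
 qed
qed

lemma pint_conv_less_top:
 fixes f :: "real^'n::finite => complex"
 assumes p: "1 < p" and k: "integrable lborel k" and [measurable]: "f \<in> bm" and f: "pint p lborel f < top"
 shows "pint p lborel (conv k f) < top"
proof -
 have [measurable]: "k \<in> bm" using k by auto
 have kf: "(NI z. enorm (k z)) < top" using k by (simp add: integrable_iff_bounded)
 have "pint p lborel (conv k f) <= (NI x. (NI z. enorm (k z) * enorm (f (x - z))) epowr p)"
  unfolding pint_def using p by (intro nn_integral_mono epowr_mono norm_conv_le) auto
 also have "... <= (NI z. enorm (k z)) epowr p * (NI x. enorm (f x) epowr p)"
  by (rule young_convolution[where s="%z. z" and V="%x. enorm (f x)"]) (use p kf in \<open>auto intro: sigma_finite_lborel\<close>)
 also have "... < top" using kf f unfolding pint_def[symmetric] by (simp add: ennreal_mult_less_top)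
 finally show ?thesis .
qed

text \<open>Kernels are chosen for \<open>U = |f|\<close>. The pieces of the smoothed functions
  converge at every point, so Fatou's lemma bounds the square function of \<open>f\<close>; the
  norms of the smoothed functions have lower limit at most the norm of \<open>f\<close>, since they
  converge in \<open>L_p\<close>.\<close>

theorem euclid_upper:
 fixes f :: "real^'n::finite => complex"
 assumes p: "1 < p" and [measurable]: "f \<in> bm" and f: "pint p lborel f < top"
  and T: "!!F :: real^'n => complex. F \<in> borel_measurable torus ==> pint p torus F < top ==> sqT p F <= ennreal D * pint p torus F"
 shows "sqR p f <= ennreal D * pint p lborel f"
proof -
 define U where "U x = enorm (f x)" for x
 have Um [measurable]: "U \<in> bm" unfolding U_def[abs_def] by measurable
 have U: "(NI x. U x epowr p) < top" using f unfolding pint_def U_def .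
 obtain \<kappa> :: "nat => real => complex" where \<kappa>: "\<forall>n. admissible (\<kappa> n)" and ke: "(%n. kerr p U (\<kappa> n) (\<kappa>0 (real (Suc n)))) \<longlonglongrightarrow> 0"
  by (rule admissible_exists[OF p Um U])
 define h where "h n = conv (pk (\<kappa> n)) f" for n
 have Ki: "integrable lborel (pk (\<kappa> n) :: real^'n => complex)" for n using \<kappa> by (intro integrable_pk) (auto simp: admissible_def)
 have Km [measurable]: "(pk (\<kappa> n) :: real^'n => complex) \<in> bm" for n using Ki[of n] by auto
 have hm [measurable]: "h n \<in> bm" for n unfolding h_def by measurable
 have conv: "(%n. pint p lborel (%x. h n x - f x)) \<longlonglongrightarrow> 0"
  unfolding h_def by (rule kernel_convergence[OF p _ _ f _ _ ke]) (use \<kappa> in \<open>auto simp: U_def\<close>)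
 have hf: "pint p lborel (h n) < top" for n unfolding h_def by (rule pint_conv_less_top[OF p Ki _ f]) simp
 have "sqR p f <= liminf (%n. (NI x. l2n dyadic_boxes (%R. conv (pk (\<kappa> n)) (conv (ker R) f) x) epowr p))"
  unfolding sqR_conv_ker(1)[OF p \<open>f \<in> borel_measurable borel\<close> f]
 proof (rule fatou_epowr)
  show "0 < p" using p by simp
  show "(%x. l2n dyadic_boxes (%R. conv (pk (\<kappa> n)) (conv (ker R) f) x)) \<in> borel_measurable lborel" for n
   by (rule measurable_l2n[OF countable_dyadic_boxes]) (use conv_conv_ker_measurable[OF _ \<open>f \<in> borel_measurable borel\<close> Km] in simp)
  show "AE x in lborel. l2n dyadic_boxes (%R. conv (ker R) f x) <= liminf (%n. l2n dyadic_boxes (%R. conv (pk (\<kappa> n)) (conv (ker R) f) x))"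
  proof (intro AE_I2 l2n_liminf)
   fix x :: "real^'n" and R :: "(real^'n) set" assume R: "R \<in> dyadic_boxes"
   obtain I where I: "R = cbx I" "\<forall>i. short_interval (I i)" "R \<in> sets borel" "emeasure lborel R < top" by (rule dyadic_box_cases[OF R])
   obtain M where M: "conv_bounded (ker R) f M" using sqR_conv_ker(2)[OF p _ f R] by auto
   have "conv (pk (\<kappa> n)) (conv (ker R) f) x = conv (ker R) (h n) x" for n
    unfolding h_def by (rule conv_commute[OF Ki measurable_ker[OF I(3)] _ M]) simp
   moreover have "(%n. conv (ker R) (h n) x) \<longlonglongrightarrow> conv (ker R) f x"
    unfolding I(1) by (rule conv_ker_tendsto[OF p _ hm f hf I(2)[rule_format] conv]) simp
   ultimately show "(%n. conv (pk (\<kappa> n)) (conv (ker R) f) x) \<longlonglongrightarrow> conv (ker R) f x" by (simp only:)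
  qed
 qed
 also have "... <= liminf (%n. ennreal D * pint p lborel (h n))"
  unfolding h_def by (intro Liminf_mono always_eventually allI admissible_upper[OF p _ f _ T]) (use \<kappa> in auto)
 also have "... = ennreal D * liminf (%n. pint p lborel (h n))" by (rule Limsup_cmult_ennreal(2))
 also have "... <= ennreal D * pint p lborel f"
 proof (rule mult_left_mono)
  have "liminf (%n. (NI x. enorm (h n x) epowr p)) <= liminf (%n. (NI x. enorm (f x) epowr p))"
  proof (rule perturb_power_integral(2)[OF p])
   show "AE x in lborel. enorm (h n x) <= enorm (f x) + enorm (h n x - f x)" for n
   proof (intro AE_I2)
    fix x
    have "norm (h n x) <= norm (f x) + norm (h n x - f x)" by norm
    then show "enorm (h n x) <= enorm (f x) + enorm (h n x - f x)"
     by (simp add: ennreal_plus[symmetric] ennreal_leI del: ennreal_plus)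
   qed
   show "(%n. (NI x. enorm (h n x - f x) epowr p)) \<longlonglongrightarrow> 0" using conv unfolding pint_def .
  qed measurable
  then show "liminf (%n. pint p lborel (h n)) <= pint p lborel f" unfolding pint_def by (simp add: Liminf_const)
 qed simp
 finally show ?thesis .
qed

text \<open>The square function after smoothing has to be bounded by \<open>V\<close>, the square
  function of \<open>f\<close>, with constant 1 in the limit, although notched kernels need not be
  positive of mass 1. It is compared with the average of \<open>V\<close> by the Fejer kernel, which
  is a contraction. The rest is a kernel error acting on \<open>V\<close>, small because the kernels
  are chosen for \<open>U = |f| + V\<close>. This choice needs \<open>V\<close> in
  \<open>L_p\<close>; otherwise nothing is to be shown.\<close>

theorem euclid_lower:
 fixes f :: "real^'n::finite => complex"
 assumes p: "1 < p" and fm [measurable]: "f \<in> bm" and f: "pint p lborel f < top"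
  and T: "!!F :: real^'n => complex. F \<in> borel_measurable torus ==> pint p torus F < top ==> ennreal D * pint p torus F <= sqT p F"
 shows "ennreal D * pint p lborel f <= sqR p f"
proof -
 define V where "V x = l2n dyadic_boxes (%R. conv (ker R) f x)" for x
 have Vm [measurable]: "V \<in> bm" unfolding V_def[abs_def]
  by (rule measurable_l2n[OF countable_dyadic_boxes conv_ker_measurable[OF _ fm]])
 have sq: "sqR p f = (NI x. V x epowr p)" unfolding V_def by (rule sqR_conv_ker(1)[OF p fm f])
 show ?thesis
 proof (cases "sqR p f = top")
  case False
  then have Vf: "(NI x. V x epowr p) < top" unfolding sq by (simp add: less_top)
  define U where "U x = enorm (f x) + V x" for x
  have Um [measurable]: "U \<in> bm" unfolding U_def[abs_def] by measurable
  have "(NI x. U x epowr p) <= (NI x. ennreal (2 powr p) * (enorm (f x) epowr p + V x epowr p))"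
   unfolding U_def using p by (intro nn_integral_mono epowr_add_le2) auto
  also have "... = ennreal (2 powr p) * (NI x. (enorm (f x) epowr p + V x epowr p))" by (rule nn_integral_cmult) measurable
  also have "(NI x. (enorm (f x) epowr p + V x epowr p)) = pint p lborel f + (NI x. V x epowr p)"
   unfolding pint_def by (rule nn_integral_add) measurable
  also have "ennreal (2 powr p) * (pint p lborel f + (NI x. V x epowr p)) < top"
   using f Vf by (simp add: ennreal_mult_less_top)
  finally have U: "(NI x. U x epowr p) < top" .
  obtain \<kappa> :: "nat => real => complex" where \<kappa>: "\<forall>n. admissible (\<kappa> n)" and ke: "(%n. kerr p U (\<kappa> n) (\<kappa>0 (real (Suc n)))) \<longlonglongrightarrow> 0"
   by (rule admissible_exists[OF p Um U])
  define h where "h n = conv (pk (\<kappa> n)) f" for n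
  define K where "K n = (pk (\<kappa> n) :: real^'n => complex)" for n
  define k where "k n = (pk (\<kappa>0 (real (Suc n))) :: real^'n => complex)" for n
  have Ki: "integrable lborel (K n)" for n unfolding K_def using \<kappa> by (intro integrable_pk) (auto simp: admissible_def)
  have Km [measurable]: "K n \<in> bm" for n using Ki[of n] by auto
  have km [measurable]: "k n \<in> bm" for n
   using integrable_pk[OF integrable_\<kappa>0[of "real (Suc n)"], where 'n='n] unfolding k_def by auto
  have hm [measurable]: "h n \<in> bm" for n unfolding h_def K_def[symmetric] by measurable
  have conv: "(%n. pint p lborel (%x. h n x - f x)) \<longlonglongrightarrow> 0"
   unfolding h_def by (rule kernel_convergence[OF p _ _ f _ _ ke]) (use \<kappa> in \<open>auto simp: U_def\<close>)
  have "liminf (%n. (NI x. enorm (f x) epowr p)) <= liminf (%n. (NI x. enorm (h n x) epowr p))"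
  proof (rule perturb_power_integral(2)[OF p])
   show "AE x in lborel. enorm (f x) <= enorm (h n x) + enorm (h n x - f x)" for n
   proof (intro AE_I2)
    fix x
    have "norm (f x) <= norm (h n x) + norm (h n x - f x)" by norm
    then show "enorm (f x) <= enorm (h n x) + enorm (h n x - f x)"
     by (simp add: ennreal_plus[symmetric] ennreal_leI del: ennreal_plus)
   qed
   show "(%n. (NI x. enorm (h n x - f x) epowr p)) \<longlonglongrightarrow> 0" using conv unfolding pint_def .
  qed measurable
  then have "pint p lborel f <= liminf (%n. pint p lborel (h n))" unfolding pint_def by (simp add: Liminf_const)
  then have "ennreal D * pint p lborel f <= ennreal D * liminf (%n. pint p lborel (h n))" by (rule mult_left_mono) simp
  also have "... = liminf (%n. ennreal D * pint p lborel (h n))" by (rule Limsup_cmult_ennreal(2)[symmetric])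
  also have "... <= liminf (%n. (NI x. l2n dyadic_boxes (%R. conv (K n) (conv (ker R) f) x) epowr p))"
   unfolding h_def K_def by (intro Liminf_mono always_eventually allI admissible_lower[OF p _ f _ T]) (use \<kappa> in auto)
  also have "... <= liminf (%n. (NI x. (NI z. enorm (k n z) * V (x - z)) epowr p))"
  proof (rule perturb_power_integral(2)[OF p, where b="%n x. (NI z. enorm (K n z - k n z) * V (x - z))"])
   show "AE x in lborel. l2n dyadic_boxes (%R. conv (K n) (conv (ker R) f) x) <= (NI z. enorm (k n z) * V (x - z)) + (NI z. enorm (K n z - k n z) * V (x - z))" for n
   proof (intro AE_I2)
    fix x :: "real^'n"
    have "l2n dyadic_boxes (%R. conv (K n) (conv (ker R) f) x) = l2n dyadic_boxes (%R. (BI z. conv (ker R) f (x - z) * K n z))"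
     by (rule l2n_cong) (simp only: conv_def[of "K n"] mult.commute)
    also have "... <= (NI z. l2n dyadic_boxes (%R. conv (ker R) f (x - z) * K n z))"
    proof (rule l2n_integral_le)
     fix R :: "(real^'n) set" assume R: "R \<in> dyadic_boxes"
     have [measurable]: "conv (ker R) f \<in> bm" by (rule conv_ker_measurable[OF R fm])
     obtain M where M: "0 <= M" "conv_bounded (ker R) f M" using sqR_conv_ker(2)[OF p fm f R] by blast
     show "integrable lborel (%z. conv (ker R) f (x - z) * K n z)"
      by (rule integrable_mult_bounded[OF Ki _ conv_boundedD[OF M(2,1)]]) measurable
    qed
    also have "... = (NI z. enorm (K n z) * V (x - z))" unfolding l2n_mult V_def by (simp only: mult.commute)
    also have "... <= (NI z. enorm (k n z) * V (x - z) + enorm (K n z - k n z) * V (x - z))"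
    proof (rule nn_integral_mono)
     fix z
     have "norm (K n z) <= norm (k n z) + norm (K n z - k n z)" by norm
     then have "enorm (K n z) <= enorm (k n z) + enorm (K n z - k n z)"
      by (simp add: ennreal_plus[symmetric] ennreal_leI del: ennreal_plus)
     then show "enorm (K n z) * V (x - z) <= enorm (k n z) * V (x - z) + enorm (K n z - k n z) * V (x - z)"
      by (simp add: distrib_right[symmetric] mult_right_mono)
    qed
    also have "... = (NI z. enorm (k n z) * V (x - z)) + (NI z. enorm (K n z - k n z) * V (x - z))"
     by (rule nn_integral_add) measurable
    finally show "l2n dyadic_boxes (%R. conv (K n) (conv (ker R) f) x) <= (NI z. enorm (k n z) * V (x - z)) + (NI z. enorm (K n z - k n z) * V (x - z))" .
   qed
   have "(NI x. (NI z. enorm (K n z - k n z) * V (x - z)) epowr p) <= kerr p U (\<kappa> n) (\<kappa>0 (real (Suc n)))" for n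
    unfolding kerr_def K_def[symmetric] k_def[symmetric] using p
    by (intro nn_integral_mono epowr_mono mult_left_mono) (auto simp: U_def)
   then show "(%n. (NI x. (NI z. enorm (K n z - k n z) * V (x - z)) epowr p)) \<longlonglongrightarrow> 0"
    by (rule tendsto_0_le_ennreal[OF _ ke])
  qed measurable
  also have "... <= liminf (%n. sqR p f)"
  proof (intro Liminf_mono always_eventually allI)
   fix n
   have one: "(NI z. enorm (k n z)) = 1" unfolding k_def by (rule nn_integral_pk_\<kappa>0) simp
   have "(NI x. (NI z. enorm (k n z) * V (x - z)) epowr p) <= 1 epowr p * (NI x. V x epowr p)"
    by (rule young_convolution[where s="%z. z", OF _ _ _ sigma_finite_lborel one]) (use p in auto)
   then show "(NI x. (NI z. enorm (k n z) * V (x - z)) epowr p) <= sqR p f" by (simp add: sq)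
  qed
  finally show ?thesis by (simp add: Liminf_const)
 qed simp
qed

section \<open>Best constants\<close>

lemma Lp_space_eq: "Lp_space p M = {f \<in> borel_measurable M. pint p M f < top}"
 by (simp add: Lp_space_def Lp_norm_def Lp_enorm_def pint_def)

lemma Lp_ineq_iff:
 assumes p: "0 < p"
 shows "Lp_enorm p M h <= C * Lp_norm p M f \<longleftrightarrow> (\<integral>\<^sup>+x. h x epowr p \<partial>M) <= C epowr p * pint p M f"
  "C * Lp_norm p M f <= Lp_enorm p M h \<longleftrightarrow> C epowr p * pint p M f <= (\<integral>\<^sup>+x. h x epowr p \<partial>M)"
proof -
 have e: "Lp_enorm p M h epowr p = (\<integral>\<^sup>+x. h x epowr p \<partial>M)" using p by (simp add: Lp_enorm_def)
 have n: "(C * Lp_norm p M f) epowr p = C epowr p * pint p M f"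
  using p by (simp add: epowr_mult Lp_norm_def Lp_enorm_def pint_def)
 show "Lp_enorm p M h <= C * Lp_norm p M f \<longleftrightarrow> (\<integral>\<^sup>+x. h x epowr p \<partial>M) <= C epowr p * pint p M f"
  unfolding e[symmetric] n[symmetric] by (rule epowr_le_iff[OF p, symmetric])
 show "C * Lp_norm p M f <= Lp_enorm p M h \<longleftrightarrow> C epowr p * pint p M f <= (\<integral>\<^sup>+x. h x epowr p \<partial>M)"
  unfolding e[symmetric] n[symmetric] by (rule epowr_le_iff[OF p, symmetric])
qed

text \<open>Adding \<open>top\<close> to a set or removing it from there does not change an infimum,
  so only finite constants have to be compared.\<close>

lemma Inf_Collect_cong_top:
 fixes P Q :: "ennreal => bool"
 assumes "!!C. C ~= top ==> P C \<longleftrightarrow> Q C"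
 shows "Inf {C. P C} = Inf {C. Q C}"
proof (rule antisym)
 show "Inf {C. P C} <= Inf {C. Q C}"
 proof (rule Inf_greatest)
  fix C assume "C \<in> {C. Q C}"
  then show "Inf {C. P C} <= C" using assms[of C] by (cases "C = top") (auto intro: Inf_lower)
 qed
 show "Inf {C. Q C} <= Inf {C. P C}"
 proof (rule Inf_greatest)
  fix C assume "C \<in> {C. P C}"
  then show "Inf {C. Q C} <= C" using assms[of C] by (cases "C = top") (auto intro: Inf_lower)
 qed
qed

text \<open>For the lower constant the candidate \<open>C = 0\<close> leads to the factor
  \<open>inverse C = top\<close>. This reduces it to all finite factors, for which the transfer is
  available.\<close>

lemma top_mult_le_iff: "top * x <= (y::ennreal) \<longleftrightarrow> (\<forall>d::real. ennreal d * x <= y)"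
proof
 assume "top * x <= y"
 then show "\<forall>d::real. ennreal d * x <= y" by (meson mult_right_mono order_trans top_greatest zero_le)
next
 assume d: "\<forall>d::real. ennreal d * x <= y"
 have "top * x = (SUP n. of_nat n * x)" by (simp add: SUP_mult_right_ennreal[symmetric] ennreal_SUP_of_nat_eq_top)
 also have "... <= y" using d by (intro SUP_least) (simp add: ennreal_of_nat_eq_real_of_nat)
 finally show "top * x <= y" .
qed

theorem theorem9:
  fixes p :: real
  assumes "1 < p"
  shows "LP_upper_Rd TYPE('n::finite) p = LP_upper_torus TYPE('n) p \<and>
         LP_lower_Rd TYPE('n) p = LP_lower_torus TYPE('n) p"
proof
 have p0: "0 < p" and p1: "1 <= p" using assms by auto
 have lb: "borel_measurable lborel = (bm :: (real^'n => complex) set)" by simp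
 let ?R = "%D::real. \<forall>f\<in>bm. pint p lborel f < top \<longrightarrow> sqR p (f :: real^'n => complex) <= ennreal D * pint p lborel f"
 let ?T = "%D::real. \<forall>F\<in>borel_measurable torus. pint p torus F < top \<longrightarrow> sqT p (F :: real^'n => complex) <= ennreal D * pint p torus F"
 have u: "?R D \<longleftrightarrow> ?T D" for D
  using torus_upper[OF p1, where D=D and 'n='n] euclid_upper[OF assms, where D=D and 'n='n] by blast
 let ?R' = "%D::real. \<forall>f\<in>bm. pint p lborel f < top \<longrightarrow> ennreal D * pint p lborel f <= sqR p (f :: real^'n => complex)"
 let ?T' = "%D::real. \<forall>F\<in>borel_measurable torus. pint p torus F < top \<longrightarrow> ennreal D * pint p torus F <= sqT p (F :: real^'n => complex)"
 have l: "?R' D \<longleftrightarrow> ?T' D" for D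
  using torus_lower[OF p1, where D=D and 'n='n] euclid_lower[OF assms, where D=D and 'n='n] by blast
 show "LP_upper_Rd TYPE('n) p = LP_upper_torus TYPE('n) p"
  unfolding LP_upper_Rd_def LP_upper_torus_def best_upper_const_def
 proof (rule Inf_Collect_cong_top)
  fix C :: ennreal assume "C ~= top"
  then obtain c where c: "C = ennreal c" "0 <= c" by (cases C) auto
  show "(\<forall>f\<in>Lp_space p (lborel :: (real^'n) measure). Lp_enorm p lborel (square_function dyadic_boxes partial_sum f) <= C * Lp_norm p lborel f) \<longleftrightarrow>
   (\<forall>f\<in>Lp_space p (torus :: (real^'n) measure). Lp_enorm p torus (square_function int_dyadic_boxes torus_partial_sum f) <= C * Lp_norm p torus f)"
   unfolding Lp_ineq_iff[OF p0] sqR_def[symmetric] sqT_def[symmetric] Lp_space_eq lb c(1) epowr_ennreal[OF c(2)]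
   using u[of "c powr p"] by blast
 qed
 show "LP_lower_Rd TYPE('n) p = LP_lower_torus TYPE('n) p"
  unfolding LP_lower_Rd_def LP_lower_torus_def best_lower_const_def
 proof (rule Inf_Collect_cong_top)
  fix C :: ennreal assume "C ~= top"
  show "(\<forall>f\<in>Lp_space p (lborel :: (real^'n) measure). inverse C * Lp_norm p lborel f <= Lp_enorm p lborel (square_function dyadic_boxes partial_sum f)) \<longleftrightarrow>
   (\<forall>f\<in>Lp_space p (torus :: (real^'n) measure). inverse C * Lp_norm p torus f <= Lp_enorm p torus (square_function int_dyadic_boxes torus_partial_sum f))"
  \<comment> \<open>Transfer theorems speak of real factors \<open>D\<close>; an infinite factor is
    replaced by the family of all real ones.\<close>
  proof (cases "inverse C = top")
   case True
   show ?thesis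
    unfolding Lp_ineq_iff[OF p0] sqR_def[symmetric] sqT_def[symmetric] Lp_space_eq lb True epowr_top top_mult_le_iff
    using l by blast
  next
   case False
   then obtain c where c: "inverse C = ennreal c" "0 <= c" by (cases "inverse C") auto
   show ?thesis
    unfolding Lp_ineq_iff[OF p0] sqR_def[symmetric] sqT_def[symmetric] Lp_space_eq lb c(1) epowr_ennreal[OF c(2)]
    using l[of "c powr p"] by blast
  qed
 qed
qed

end
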